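(* Let $T>0$ and let $H$, $G$, $H^0$, $G^0$ satisfy the standing assumptions listed in the context (for some integer $n\ge4$). Let $(U^{0,1},U^1)$ and $(U^{0,2},U^2)$ be two classical solutions, defined on the time interval $[0,T]$, of the system of master equations $$ \left\{\begin{array}{l} -\partial_t U^{0}-\Delta_{x_0} U^0+ H^0(x_0,D_{x_0}U^{0}(t,x_0,m), m) -\int_{\mathbb R^d} \mathrm{div}_yD_m U^0(t,x_0,m,y)\,m(dy)\\ \quad + \int_{\mathbb R^d} D_mU^0(t,x_0,m,y)\cdot H_p(x_0,y, D_{x}U(t,x_0,y,m), m)\,m(dy)=0 \quad \text{in } (0,T)\times \mathbb R^{d_0}\times \mathcal P_2,\\ -\partial_t U- \Delta_{x} U-\Delta_{x_0}U + H(x_0,x,D_{x}U(t,x_0,x,m), m) -\int_{\mathbb R^d} \mathrm{div}_y D_mU(t,x_0,x,m,y)\,m(dy)\\ \quad + D_{x_0}U(t,x_0,x,m) \cdot H^0_p(x_0,D_{x_0}U^0(t,x_0,m), m)\\ \quad + \int_{\mathbb R^d} D_m U(t,x_0,x,m,y)\cdot H_p(x_0,y, D_{x}U(t,x_0,y,m), m)\,m(dy)=0 \quad \text{in } (0,T)\times \mathbb R^{d_0}\times \mathbb R^d\times \mathcal P_2,\\ U^{0}(T,x_0,m)= G^0(x_0,m),\qquad U(T,x_0, x,m)= G(x_0,x,m), \end{array}\right. $$ and assume that $D_{x_0}U^{0,1}$ and $(D_{x_0}U^1,D_xU^1)$ are uniformly Lipschitz continuous in the space and measure variables. Then $(U^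{0,1},U^1)=(U^{0,2},U^2)$.
   Context: A pair $U^0:[0,T]\times\mathbb R^{d_0}\times\mathcal P_2\to\mathbb R$, $U:[0,T]\times\mathbb R^{d_0}\times\mathbb R^d\times\mathcal P_2\to\mathbb R$ is a **classical solution** if $U^0$, $U$ and their derivatives involved in the system exist, are continuous in all variables and bounded, and the system holds. **Spaces.** $\mathcal P_2$ is the set of Borel probability measures on $\mathbb R^d$ with finite second moment, with the 2-Wasserstein distance $\mathbf d_2$. For a function $\phi$ of several Euclidean variables, $\|\phi\|_{n_1,\dots,n_j}=\sum_{l_1\le n_1,\dots,l_j\le n_j}\|D^{l_1}_{x_1}\cdots D^{l_j}_{x_j}\phi\|_\infty$ (derivatives continuous and bounded). For a map $V$ depending also on $m\in\mathcal P_2$, $\mathrm{Lip}_{n_1,\dots,n_j}(V)=\sup_{m_1\ne m_2}\|V(\cdot,m_1)-V(\cdot,m_2)\|_{n_1,\dots,n_j}/\mathbf d_2(m_1,m_2)$. **Derivatives in measure.** $U:\mathcal P_2\to\mathbb R$ is $C^1$ if there is a continuous bounded $\frac{\delta U}{\delta m}:\mathcal P_2\times\mathbb R^d\to\mathbb R$ with $U(m')-U(m)=\int_0^1\int\frac{\delta U}{\delta m}((1-s)m+sm',y)(m'-m)(dy)ds$ for all $m,m'$, normalized by $\int\frac{\delta U}{\delta m}(m,y)m(dy)=0$. $D_mU(m,y):=D_y\frac{\delta U}{\delta m}(m,y)$. $U$ is $C^2$ if $\frac{\delta U}{\delta m}$ is $C^1$ in $m$ with $\frac{\delta^2U}{\delta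 m^2}(m,y,y')$ continuous and bounded. $H_p$, $H^0_p$ are gradients in $p$. **Standing assumptions** (for some integer $n\ge4$, and for every $k\in\{2,\dots,n-1\}$; $C_0>0$, $\gamma>1$ are constants): - $H=H(x_0,x,p,m):\mathbb R^{d_0}\times\mathbb R^d\times\mathbb R^d\times\mathcal P_2\to\mathbb R$ satisfies $\sup_{x_0,x,m}|D_xH(x_0,x,p,m)|\le C_0(1+|p|^\gamma)$ for all $p$; for every $R>0$ the quantities $\|H(\cdot_{x_0},\cdot_x,\cdot_p,m)\|_{3,n,n+1}$, $\|\frac{\delta H}{\delta m}(\cdot_{x_0},\cdot_x,\cdot_p,m,\cdot_y)\|_{2,n-1,n,k}$, $\|\frac{\delta^2H}{\delta m^2}(\cdot_{x_0},\cdot_x,\cdot_p,m,\cdot_y,\cdot_{y'})\|_{1,n-2,n-1,k-1,k-1}$ and $\mathrm{Lip}_{1,n-3,n-2,k-1,k-1}(\frac{\delta^2H}{\delta m^2})$ are bounded for $|p|\le R$, uniformly in $m$. - $G=G(x_0,x,m)$ is of class $C^2$ in all variables and $\|G(\cdot_{x_0},\cdot_x,m)\|_{3,n}$, $\|\frac{\delta G}{\delta m}(\cdot_{x_0},\cdot_x,m,\cdot_y)\|_{2,n-1,k}$, $\|\frac{\delta^2G}{\delta m^2}\|_{1,n-2,k-1,k-1}$, $\mathrm{Lip}_{1,n-3,k-2,k-2}(\frac{\delta^2G}{\delta m^2})$ are bounded uniformly in $m$. - $H^0=H^0(x_0,p,m):\mathbb R^{d_0}\times\mathbb R^{d_0}\times\mathcal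 P_2\to\mathbb R$ satisfies $\sup_{x_0,m}\big(|D_{(x_0,p)}H^0|+|D^2_{(x_0,p)}H^0|\big)(x_0,p,m)\le C_0(|p|^\gamma+1)$; for every $R>0$ the quantities $\|H^0(\cdot_{x_0},\cdot_p,m)\|_{3,4}$, $\|\frac{\delta H^0}{\delta m}(\cdot_{x_0},\cdot_p,m,\cdot_y)\|_{2,3,k}$, $\|\frac{\delta^2H^0}{\delta m^2}\|_{1,2,k-1,k-1}$ and $\mathrm{Lip}_{0,1,k-2,k-2}(\frac{\delta^2H^0}{\delta m^2})$ are bounded for $|p|\le R$, uniformly in $m$. - $G^0=G^0(x_0,m):\mathbb R^{d_0}\times\mathcal P_2\to\mathbb R$ is of class $C^2$ in $m$ and $\|G^0(\cdot,m)\|_3$, $\|\frac{\delta G^0}{\delta m}(\cdot_{x_0},m,\cdot_y)\|_{2,k}$, $\|\frac{\delta^2G^0}{\delta m^2}\|_{1,k-1,k-1}$, $\mathrm{Lip}_{0,k-2,k-2}(\frac{\delta^2G^0}{\delta m^2})$ are bounded uniformly in $m$. *)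

theory Defs
  imports "HOL-Probability.Probability"
begin

section \<open>The Wasserstein space\<close>

definition P2 :: "'b::euclidean_space measure set" where
  "P2 = {m. prob_space m \<and> sets m = sets borel \<and> integrable m (\<lambda>x. (norm x)\<^sup>2)}"

definition couplings :: "'b::euclidean_space measure \<Rightarrow> 'b measure \<Rightarrow> ('b \<times> 'b) measure set" where
  "couplings m m' = {\<pi>. prob_space \<pi> \<and> sets \<pi> = sets (borel \<Otimes>\<^sub>M borel) \<and>
     distr \<pi> borel fst = m \<and> distr \<pi> borel snd = m'}"

definition d2 :: "'b::euclidean_space measure \<Rightarrow> 'b measure \<Rightarrow> real" where
  "d2 m m' = sqrt (INF \<pi>\<in>couplings m m'. (\<integral>z. (dist (fst z) (snd z))\<^sup>2 \<partial>\<pi>))"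

text \<open>Joint continuity, respectively boundedness, on \<open>A \<times> P2\<close>, where \<open>P2\<close> carries the
  distance \<open>d2\<close>. Several Euclidean variables are collected in a tuple ranging over \<open>A\<close>.\<close>

definition continuous_P2 ::
  "'e::metric_space set \<Rightarrow> ('e \<Rightarrow> 'b::euclidean_space measure \<Rightarrow> 'g::metric_space) \<Rightarrow> bool" where
  "continuous_P2 A f \<longleftrightarrow> (\<forall>z\<in>A. \<forall>m\<in>P2. \<forall>\<epsilon>>0. \<exists>\<delta>>0. \<forall>z'\<in>A. \<forall>m'\<in>P2.
     dist z' z < \<delta> \<and> d2 m' m < \<delta> \<longrightarrow> dist (f z' m') (f z m) < \<epsilon>)"

definition bounded_P2 ::
  "'e set \<Rightarrow> ('e \<Rightarrow> 'b::euclidean_space measure \<Rightarrow> 'g::real_normed_vector) \<Rightarrow> bool" where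
  "bounded_P2 A f \<longleftrightarrow> (\<exists>C. \<forall>z\<in>A. \<forall>m\<in>P2. norm (f z m) \<le> C)"

section \<open>Derivatives in the Euclidean variables\<close>

definition grad :: "('e::euclidean_space \<Rightarrow> real) \<Rightarrow> 'e \<Rightarrow> 'e" where
  "grad f x = (THE D. GDERIV f x :> D)"

definition jac :: "('e::euclidean_space \<Rightarrow> 'e) \<Rightarrow> 'e \<Rightarrow> ('e \<Rightarrow>\<^sub>L 'e)" where
  "jac F x = Blinfun (frechet_derivative F (at x))"

definition divergence :: "('e::euclidean_space \<Rightarrow> 'e) \<Rightarrow> 'e \<Rightarrow> real" where
  "divergence F x = (\<Sum>i\<in>Basis. frechet_derivative F (at x) i \<bullet> i)"

definition laplacian :: "('e::euclidean_space \<Rightarrow> real) \<Rightarrow> 'e \<Rightarrow> real" where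
  "laplacian f = divergence (grad f)"

section \<open>Norms of several Euclidean variables\<close>

text \<open>A function of the variables \<open>x\<^sub>1, \<dots>, x\<^sub>j\<close> is regarded as a function of one variable in the
  product space; the list of blocks records which basis vectors of the product belong to which
  \<open>x\<^sub>i\<close>.\<close>

definition add_block :: "'f::euclidean_space set list \<Rightarrow> ('e::euclidean_space \<times> 'f) set list" where
  "add_block Bs = (\<lambda>i. (i, 0)) ` Basis # map (\<lambda>B. (\<lambda>v. (0, v)) ` B) Bs"

definition blocks1 :: "'a::euclidean_space set list" where
  "blocks1 = [Basis]"

definition blocks2 :: "('a::euclidean_space \<times> 'b::euclidean_space) set list" where
  "blocks2 = add_block blocks1"

definition blocks3 ::
  "('a::euclidean_space \<times> 'b::euclidean_space \<times> 'c::euclidean_space) set list" where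
  "blocks3 = add_block blocks2"

definition blocks4 ::
  "('a::euclidean_space \<times> 'b::euclidean_space \<times> 'c::euclidean_space \<times> 'd::euclidean_space) set list"
  where
  "blocks4 = add_block blocks3"

definition blocks5 ::
  "('a::euclidean_space \<times> 'b::euclidean_space \<times> 'c::euclidean_space \<times> 'd::euclidean_space
     \<times> 'e::euclidean_space) set list" where
  "blocks5 = add_block blocks4"

definition dir_deriv :: "'e::euclidean_space \<Rightarrow> ('e \<Rightarrow> real) \<Rightarrow> 'e \<Rightarrow> real" where
  "dir_deriv v f z = deriv (\<lambda>s. f (z + s *\<^sub>R v)) 0"

fun iter_deriv :: "'e::euclidean_space list \<Rightarrow> ('e \<Rightarrow> real) \<Rightarrow> 'e \<Rightarrow> real" where
  "iter_deriv [] f = f"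
| "iter_deriv (v # vs) f = dir_deriv v (iter_deriv vs f)"

text \<open>The index lists of the entries of the tensor \<open>D\<^sup>l\<^sup>1\<^sub>x\<^sub>1 \<cdots> D\<^sup>l\<^sup>j\<^sub>x\<^sub>j f\<close>, for \<open>ls = [l1, \<dots>, lj]\<close>.\<close>

definition directions :: "'e::euclidean_space set list \<Rightarrow> nat list \<Rightarrow> 'e list set" where
  "directions Bs ls =
     {concat vss | vss. length vss = length Bs \<and> length ls = length Bs \<and>
        (\<forall>i<length Bs. set (vss ! i) \<subseteq> Bs ! i \<and> length (vss ! i) = ls ! i)}"

lemma finite_directions:
  assumes "\<And>B. B \<in> set Bs \<Longrightarrow> finite B"
  shows "finite (directions Bs ls)"
proof (cases "length ls = length Bs")
  case True
  have "finite {xs. set xs \<subseteq> \<Union>(set Bs) \<and> length xs = sum_list ls}"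
    using assms by (intro finite_lists_length_eq) auto
  moreover have "directions Bs ls \<subseteq> {xs. set xs \<subseteq> \<Union>(set Bs) \<and> length xs = sum_list ls}"
  proof
    fix xs assume "xs \<in> directions Bs ls"
    then obtain vss where v: "xs = concat vss" "length vss = length Bs"
      "\<forall>i<length Bs. set (vss ! i) \<subseteq> Bs ! i \<and> length (vss ! i) = ls ! i"
      unfolding directions_def by blast
    have "map length vss = ls" using v True by (intro nth_equalityI) auto
    moreover have "set xs \<subseteq> \<Union>(set Bs)"
    proof
      fix x assume "x \<in> set xs"
      then obtain i where "i < length vss" "x \<in> set (vss ! i)"
        unfolding v(1) by (auto simp: in_set_conv_nth[of _ vss])
      then have "x \<in> Bs ! i" "Bs ! i \<in> set Bs" using v(2,3) by auto
      then show "x \<in> \<Union>(set Bs)" by blast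
    qed
    ultimately show "xs \<in> {xs. set xs \<subseteq> \<Union>(set Bs) \<and> length xs = sum_list ls}"
      using v(1) by (auto simp: length_concat)
  qed
  ultimately show ?thesis by (rule rev_finite_subset)
next
  case False
  then show ?thesis by (simp add: directions_def)
qed

definition tensor_norm ::
  "'e::euclidean_space set list \<Rightarrow> nat list \<Rightarrow> ('e \<Rightarrow> real) \<Rightarrow> 'e \<Rightarrow> real" where
  "tensor_norm Bs ls f z = sqrt (\<Sum>vs\<in>directions Bs ls. (iter_deriv vs f z)\<^sup>2)"

definition multi_indices :: "nat list \<Rightarrow> nat list set" where
  "multi_indices ns = {ls. list_all2 (\<le>) ls ns}"

lemma finite_multi_indices: "finite (multi_indices ns)"
proof (rule finite_subset)
  show "multi_indices ns \<subseteq> {ls. set ls \<subseteq> {..sum_list ns} \<and> length ls = length ns}"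
  proof safe
    fix ls x assume ls: "ls \<in> multi_indices ns"
    then show "length ls = length ns" by (simp add: multi_indices_def list_all2_lengthD)
    assume "x \<in> set ls"
    then obtain i where "i < length ls" "x = ls ! i" by (auto simp: in_set_conv_nth)
    with ls have "x \<le> ns ! i" "i < length ns"
      by (auto simp: multi_indices_def list_all2_conv_all_nth)
    with elem_le_sum_list[of i ns] show "x \<le> sum_list ns" by linarith
  qed
qed (simp add: finite_lists_length_eq)

definition C_multi ::
  "'e::euclidean_space set list \<Rightarrow> nat list \<Rightarrow> ('e \<Rightarrow> real) \<Rightarrow> bool" where
  "C_multi Bs ns f \<longleftrightarrow> (\<forall>ls\<in>multi_indices ns.
     (\<forall>vs\<in>directions Bs ls. continuous_on UNIV (iter_deriv vs f)) \<and>
     (\<forall>v vs. v # vs \<in> directions Bs ls \<longrightarrow>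
        (\<forall>z. (\<lambda>s. iter_deriv vs f (z + s *\<^sub>R v)) field_differentiable (at 0))))"

text \<open>The norm \<open>\<parallel>f\<parallel>\<^sub>n\<^sub>1\<^sub>,\<^sub>\<dots>\<^sub>,\<^sub>n\<^sub>j\<close> with suprema over \<open>S\<close> only, where \<open>ns = [n1, \<dots>, nj]\<close>.\<close>

definition multi_norm ::
  "'e::euclidean_space set \<Rightarrow> 'e set list \<Rightarrow> nat list \<Rightarrow> ('e \<Rightarrow> real) \<Rightarrow> ennreal" where
  "multi_norm S Bs ns f = (\<Sum>ls\<in>multi_indices ns. SUP z\<in>S. ennreal (tensor_norm Bs ls f z))"

definition bounded_multi_norm ::
  "'e::euclidean_space set \<Rightarrow> 'e set list \<Rightarrow> nat list \<Rightarrow>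
     ('b::euclidean_space measure \<Rightarrow> 'e \<Rightarrow> real) \<Rightarrow> bool" where
  "bounded_multi_norm S Bs ns V \<longleftrightarrow> (\<forall>m\<in>P2. C_multi Bs ns (V m)) \<and>
     (\<exists>C::real. \<forall>m\<in>P2. multi_norm S Bs ns (V m) \<le> ennreal C)"

definition Lip ::
  "'e::euclidean_space set \<Rightarrow> 'e set list \<Rightarrow> nat list \<Rightarrow>
     ('b::euclidean_space measure \<Rightarrow> 'e \<Rightarrow> real) \<Rightarrow> ennreal" where
  "Lip S Bs ns V = (SUP (m1, m2)\<in>{(m1, m2). m1 \<in> P2 \<and> m2 \<in> P2 \<and> m1 \<noteq> m2}.
     multi_norm S Bs ns (\<lambda>z. V m1 z - V m2 z) / ennreal (d2 m1 m2))"

section \<open>Derivatives in the measure variable\<close>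

text \<open>The convex combination \<open>(1 - s) m + s m'\<close>.\<close>

definition mix :: "real \<Rightarrow> 'b::euclidean_space measure \<Rightarrow> 'b measure \<Rightarrow> 'b measure" where
  "mix s m m' = measure_of UNIV (sets borel)
     (\<lambda>A. ennreal (1 - s) * emeasure m A + ennreal s * emeasure m' A)"

lemma mix_sets: "sets (mix s m m') = sets borel" "space (mix s m m') = UNIV"
  unfolding mix_def
  using sets.sigma_sets_eq[of borel] by (simp_all add: sets_measure_of space_measure_of)

lemma emeasure_mix:
  assumes "m \<in> P2" "m' \<in> P2" "A \<in> sets borel"
  shows "emeasure (mix s m m') A = ennreal (1 - s) * emeasure m A + ennreal s * emeasure m' A"
proof (rule emeasure_measure_of[OF mix_def])
  show "sets borel \<subseteq> Pow UNIV" by auto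
  show "A \<in> sets (mix s m m')" using assms mix_sets by auto
  show "positive (sets (mix s m m')) (\<lambda>A. ennreal (1 - s) * emeasure m A + ennreal s * emeasure m' A)"
    by (auto simp: positive_def)
  show "countably_additive (sets (mix s m m')) (\<lambda>A. ennreal (1 - s) * emeasure m A + ennreal s * emeasure m' A)"
    unfolding countably_additive_def mix_sets
  proof safe
    fix F :: "nat \<Rightarrow> 'a set" assume F: "range F \<subseteq> sets borel" "disjoint_family F"
    have "(\<Sum>i. emeasure m (F i)) = emeasure m (\<Union>(range F))" "(\<Sum>i. emeasure m' (F i)) = emeasure m' (\<Union>(range F))"
      using F assms by (auto intro!: suminf_emeasure simp: P2_def)
    then show "(\<Sum>i. ennreal (1 - s) * emeasure m (F i) + ennreal s * emeasure m' (F i)) =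
      ennreal (1 - s) * emeasure m (\<Union>(range F)) + ennreal s * emeasure m' (\<Union>(range F))"
      by (subst suminf_add[symmetric]) (auto simp: ennreal_suminf_cmult)
  qed
qed

definition has_lin_deriv ::
  "('b::euclidean_space measure \<Rightarrow> real) \<Rightarrow> ('b measure \<Rightarrow> 'b \<Rightarrow> real) \<Rightarrow> bool" where
  "has_lin_deriv U D \<longleftrightarrow>
     continuous_P2 UNIV (\<lambda>y m. D m y) \<and> bounded_P2 UNIV (\<lambda>y m. D m y) \<and>
     (\<forall>m\<in>P2. \<forall>m'\<in>P2. U m' - U m =
        (LINT s:{0..1}|lborel. (\<integral>y. D (mix s m m') y \<partial>m') - (\<integral>y. D (mix s m m') y \<partial>m))) \<and>
     (\<forall>m\<in>P2. (\<integral>y. D m y \<partial>m) = 0)"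

definition lin_deriv ::
  "('b::euclidean_space measure \<Rightarrow> real) \<Rightarrow> 'b measure \<Rightarrow> 'b \<Rightarrow> real" where
  "lin_deriv U = (SOME D. has_lin_deriv U D)"

definition lin_deriv2 ::
  "('b::euclidean_space measure \<Rightarrow> real) \<Rightarrow> 'b measure \<Rightarrow> 'b \<Rightarrow> 'b \<Rightarrow> real" where
  "lin_deriv2 U m y y' = lin_deriv (\<lambda>m. lin_deriv U m y) m y'"

definition m_C1 :: "('b::euclidean_space measure \<Rightarrow> real) \<Rightarrow> bool" where
  "m_C1 U \<longleftrightarrow> (\<exists>D. has_lin_deriv U D)"

definition m_C2 :: "('b::euclidean_space measure \<Rightarrow> real) \<Rightarrow> bool" where
  "m_C2 U \<longleftrightarrow> m_C1 U \<and> (\<forall>y. m_C1 (\<lambda>m. lin_deriv U m y)) \<and>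
     continuous_P2 UNIV (\<lambda>(y, y') m. lin_deriv2 U m y y') \<and>
     bounded_P2 UNIV (\<lambda>(y, y') m. lin_deriv2 U m y y')"

definition Dm :: "('b::euclidean_space measure \<Rightarrow> real) \<Rightarrow> 'b measure \<Rightarrow> 'b \<Rightarrow> 'b" where
  "Dm U m y = grad (lin_deriv U m) y"

text \<open>Class \<open>C\<^sup>2\<close> jointly in a Euclidean variable and the measure: all pure and mixed derivatives
  of order at most two exist and are jointly continuous.\<close>

definition joint_C2 ::
  "('e::euclidean_space \<Rightarrow> 'b::euclidean_space measure \<Rightarrow> real) \<Rightarrow> bool" where
  "joint_C2 F \<longleftrightarrow>
     continuous_P2 UNIV F \<and>
     (\<forall>z. \<forall>m\<in>P2. (\<lambda>z. F z m) differentiable (at z)) \<and>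
     continuous_P2 UNIV (\<lambda>z m. grad (\<lambda>z. F z m) z) \<and>
     (\<forall>z. \<forall>m\<in>P2. grad (\<lambda>z. F z m) differentiable (at z)) \<and>
     continuous_P2 UNIV (\<lambda>z m. jac (grad (\<lambda>z. F z m)) z) \<and>
     (\<forall>z. m_C2 (F z)) \<and>
     continuous_P2 UNIV (\<lambda>(z, y) m. lin_deriv (F z) m y) \<and>
     (\<forall>z y. \<forall>m\<in>P2. (\<lambda>z. lin_deriv (F z) m y) differentiable (at z)) \<and>
     continuous_P2 UNIV (\<lambda>(z, y) m. grad (\<lambda>z. lin_deriv (F z) m y) z) \<and>
     continuous_P2 UNIV (\<lambda>(z, y, y') m. lin_deriv2 (F z) m y y')"

section \<open>Standing assumptions\<close>

definition assumption_H ::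
  "nat \<Rightarrow> real \<Rightarrow> real \<Rightarrow>
   ('a::euclidean_space \<Rightarrow> 'b::euclidean_space \<Rightarrow> 'b \<Rightarrow> 'b measure \<Rightarrow> real) \<Rightarrow> bool" where
  "assumption_H n C0 \<gamma> H \<longleftrightarrow>
     (\<forall>x0 x p. m_C2 (H x0 x p)) \<and>
     (\<forall>x0 x p. \<forall>m\<in>P2. norm (grad (\<lambda>x. H x0 x p m) x) \<le> C0 * (1 + norm p powr \<gamma>)) \<and>
     (\<forall>R>0.
        bounded_multi_norm {(x0, x, p). norm p \<le> R} blocks3 [3, n, n + 1]
          (\<lambda>m (x0, x, p). H x0 x p m) \<and>
        (\<forall>k\<in>{2..n - 1}.
          bounded_multi_norm {(x0, x, p, y). norm p \<le> R} blocks4 [2, n - 1, n, k]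
            (\<lambda>m (x0, x, p, y). lin_deriv (H x0 x p) m y) \<and>
          bounded_multi_norm {(x0, x, p, y, y'). norm p \<le> R} blocks5
            [1, n - 2, n - 1, k - 1, k - 1]
            (\<lambda>m (x0, x, p, y, y'). lin_deriv2 (H x0 x p) m y y') \<and>
          Lip {(x0, x, p, y, y'). norm p \<le> R} blocks5 [1, n - 3, n - 2, k - 1, k - 1]
            (\<lambda>m (x0, x, p, y, y'). lin_deriv2 (H x0 x p) m y y') < \<infinity>))"

definition assumption_G ::
  "nat \<Rightarrow> ('a::euclidean_space \<Rightarrow> 'b::euclidean_space \<Rightarrow> 'b measure \<Rightarrow> real) \<Rightarrow> bool" where
  "assumption_G n G \<longleftrightarrow>
     joint_C2 (\<lambda>(x0, x). G x0 x) \<and>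
     bounded_multi_norm UNIV blocks2 [3, n] (\<lambda>m (x0, x). G x0 x m) \<and>
     (\<forall>k\<in>{2..n - 1}.
        bounded_multi_norm UNIV blocks3 [2, n - 1, k]
          (\<lambda>m (x0, x, y). lin_deriv (G x0 x) m y) \<and>
        bounded_multi_norm UNIV blocks4 [1, n - 2, k - 1, k - 1]
          (\<lambda>m (x0, x, y, y'). lin_deriv2 (G x0 x) m y y') \<and>
        Lip UNIV blocks4 [1, n - 3, k - 2, k - 2]
          (\<lambda>m (x0, x, y, y'). lin_deriv2 (G x0 x) m y y') < \<infinity>)"

definition assumption_H0 ::
  "nat \<Rightarrow> real \<Rightarrow> real \<Rightarrow>
   ('a::euclidean_space \<Rightarrow> 'a \<Rightarrow> 'b::euclidean_space measure \<Rightarrow> real) \<Rightarrow> bool" where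
  "assumption_H0 n C0 \<gamma> H0 \<longleftrightarrow>
     (\<forall>x0 p. m_C2 (H0 x0 p)) \<and>
     (\<forall>x0 p. \<forall>m\<in>P2.
        norm (grad (\<lambda>(x0, p). H0 x0 p m) (x0, p)) + norm (jac (grad (\<lambda>(x0, p). H0 x0 p m)) (x0, p))
          \<le> C0 * (norm p powr \<gamma> + 1)) \<and>
     (\<forall>R>0.
        bounded_multi_norm {(x0, p). norm p \<le> R} blocks2 [3, 4] (\<lambda>m (x0, p). H0 x0 p m) \<and>
        (\<forall>k\<in>{2..n - 1}.
          bounded_multi_norm {(x0, p, y). norm p \<le> R} blocks3 [2, 3, k]
            (\<lambda>m (x0, p, y). lin_deriv (H0 x0 p) m y) \<and>
          bounded_multi_norm {(x0, p, y, y'). norm p \<le> R} blocks4 [1, 2, k - 1, k - 1]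
            (\<lambda>m (x0, p, y, y'). lin_deriv2 (H0 x0 p) m y y') \<and>
          Lip {(x0, p, y, y'). norm p \<le> R} blocks4 [0, 1, k - 2, k - 2]
            (\<lambda>m (x0, p, y, y'). lin_deriv2 (H0 x0 p) m y y') < \<infinity>))"

definition assumption_G0 ::
  "nat \<Rightarrow> ('a::euclidean_space \<Rightarrow> 'b::euclidean_space measure \<Rightarrow> real) \<Rightarrow> bool" where
  "assumption_G0 n G0 \<longleftrightarrow>
     (\<forall>x0. m_C2 (G0 x0)) \<and>
     bounded_multi_norm UNIV blocks1 [3] (\<lambda>m x0. G0 x0 m) \<and>
     (\<forall>k\<in>{2..n - 1}.
        bounded_multi_norm UNIV blocks2 [2, k] (\<lambda>m (x0, y). lin_deriv (G0 x0) m y) \<and>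
        bounded_multi_norm UNIV blocks3 [1, k - 1, k - 1]
          (\<lambda>m (x0, y, y'). lin_deriv2 (G0 x0) m y y') \<and>
        Lip UNIV blocks3 [0, k - 2, k - 2]
          (\<lambda>m (x0, y, y'). lin_deriv2 (G0 x0) m y y') < \<infinity>)"

section \<open>Classical solutions of the system of master equations\<close>

text \<open>The derivatives involved in the system are required where the system is posed, on the open
  time interval; \<open>U0\<close> and \<open>U\<close> themselves are continuous up to the times \<open>0\<close> and \<open>T\<close>.
  The Hessians and the \<open>y\<close>-Jacobian of \<open>Dm\<close> appear through their traces.\<close>

definition regular_U0 ::
  "real \<Rightarrow> (real \<Rightarrow> 'a::euclidean_space \<Rightarrow> 'b::euclidean_space measure \<Rightarrow> real) \<Rightarrow> bool" where
  "regular_U0 T U0 \<longleftrightarrow>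
     (let clos = {0..T} \<times> UNIV; dom = {0<..<T} \<times> UNIV; domy = {0<..<T} \<times> UNIV \<times> UNIV in
     continuous_P2 clos (\<lambda>(t, x0) m. U0 t x0 m) \<and>
     bounded_P2 clos (\<lambda>(t, x0) m. U0 t x0 m) \<and>
     (\<forall>t\<in>{0<..<T}. \<forall>x0. m_C1 (U0 t x0)) \<and>
     (\<forall>t\<in>{0<..<T}. \<forall>x0. \<forall>m\<in>P2.
        (\<lambda>s. U0 s x0 m) field_differentiable (at t) \<and>
        (\<lambda>x0. U0 t x0 m) differentiable (at x0) \<and>
        grad (\<lambda>x0. U0 t x0 m) differentiable (at x0) \<and>
        (\<forall>y. lin_deriv (U0 t x0) m differentiable (at y) \<and>
             Dm (U0 t x0) m differentiable (at y))) \<and>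
     continuous_P2 dom (\<lambda>(t, x0) m. deriv (\<lambda>s. U0 s x0 m) t) \<and>
     bounded_P2 dom (\<lambda>(t, x0) m. deriv (\<lambda>s. U0 s x0 m) t) \<and>
     continuous_P2 dom (\<lambda>(t, x0) m. grad (\<lambda>x0. U0 t x0 m) x0) \<and>
     bounded_P2 dom (\<lambda>(t, x0) m. grad (\<lambda>x0. U0 t x0 m) x0) \<and>
     continuous_P2 dom (\<lambda>(t, x0) m. jac (grad (\<lambda>x0. U0 t x0 m)) x0) \<and>
     bounded_P2 dom (\<lambda>(t, x0) m. jac (grad (\<lambda>x0. U0 t x0 m)) x0) \<and>
     continuous_P2 domy (\<lambda>(t, x0, y) m. Dm (U0 t x0) m y) \<and>
     bounded_P2 domy (\<lambda>(t, x0, y) m. Dm (U0 t x0) m y) \<and>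
     continuous_P2 domy (\<lambda>(t, x0, y) m. jac (Dm (U0 t x0) m) y) \<and>
     bounded_P2 domy (\<lambda>(t, x0, y) m. jac (Dm (U0 t x0) m) y))"

definition regular_U ::
  "real \<Rightarrow> (real \<Rightarrow> 'a::euclidean_space \<Rightarrow> 'b::euclidean_space \<Rightarrow> 'b measure \<Rightarrow> real) \<Rightarrow> bool" where
  "regular_U T U \<longleftrightarrow>
     (let clos = {0..T} \<times> UNIV \<times> UNIV; dom = {0<..<T} \<times> UNIV \<times> UNIV;
          domy = {0<..<T} \<times> UNIV \<times> UNIV \<times> UNIV in
     continuous_P2 clos (\<lambda>(t, x0, x) m. U t x0 x m) \<and>
     bounded_P2 clos (\<lambda>(t, x0, x) m. U t x0 x m) \<and>
     (\<forall>t\<in>{0<..<T}. \<forall>x0 x. m_C1 (U t x0 x)) \<and>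
     (\<forall>t\<in>{0<..<T}. \<forall>x0 x. \<forall>m\<in>P2.
        (\<lambda>s. U s x0 x m) field_differentiable (at t) \<and>
        (\<lambda>x0. U t x0 x m) differentiable (at x0) \<and>
        grad (\<lambda>x0. U t x0 x m) differentiable (at x0) \<and>
        (\<lambda>x. U t x0 x m) differentiable (at x) \<and>
        grad (\<lambda>x. U t x0 x m) differentiable (at x) \<and>
        (\<forall>y. lin_deriv (U t x0 x) m differentiable (at y) \<and>
             Dm (U t x0 x) m differentiable (at y))) \<and>
     continuous_P2 dom (\<lambda>(t, x0, x) m. deriv (\<lambda>s. U s x0 x m) t) \<and>
     bounded_P2 dom (\<lambda>(t, x0, x) m. deriv (\<lambda>s. U s x0 x m) t) \<and>
     continuous_P2 dom (\<lambda>(t, x0, x) m. grad (\<lambda>x0. U t x0 x m) x0) \<and>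
     bounded_P2 dom (\<lambda>(t, x0, x) m. grad (\<lambda>x0. U t x0 x m) x0) \<and>
     continuous_P2 dom (\<lambda>(t, x0, x) m. jac (grad (\<lambda>x0. U t x0 x m)) x0) \<and>
     bounded_P2 dom (\<lambda>(t, x0, x) m. jac (grad (\<lambda>x0. U t x0 x m)) x0) \<and>
     continuous_P2 dom (\<lambda>(t, x0, x) m. grad (\<lambda>x. U t x0 x m) x) \<and>
     bounded_P2 dom (\<lambda>(t, x0, x) m. grad (\<lambda>x. U t x0 x m) x) \<and>
     continuous_P2 dom (\<lambda>(t, x0, x) m. jac (grad (\<lambda>x. U t x0 x m)) x) \<and>
     bounded_P2 dom (\<lambda>(t, x0, x) m. jac (grad (\<lambda>x. U t x0 x m)) x) \<and>
     continuous_P2 domy (\<lambda>(t, x0, x, y) m. Dm (U t x0 x) m y) \<and>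
     bounded_P2 domy (\<lambda>(t, x0, x, y) m. Dm (U t x0 x) m y) \<and>
     continuous_P2 domy (\<lambda>(t, x0, x, y) m. jac (Dm (U t x0 x) m) y) \<and>
     bounded_P2 domy (\<lambda>(t, x0, x, y) m. jac (Dm (U t x0 x) m) y))"

definition master_equations ::
  "real \<Rightarrow>
   ('a::euclidean_space \<Rightarrow> 'b::euclidean_space \<Rightarrow> 'b \<Rightarrow> 'b measure \<Rightarrow> real) \<Rightarrow>
   ('a \<Rightarrow> 'b \<Rightarrow> 'b measure \<Rightarrow> real) \<Rightarrow>
   ('a \<Rightarrow> 'a \<Rightarrow> 'b measure \<Rightarrow> real) \<Rightarrow>
   ('a \<Rightarrow> 'b measure \<Rightarrow> real) \<Rightarrow>
   (real \<Rightarrow> 'a \<Rightarrow> 'b measure \<Rightarrow> real) \<Rightarrow>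
   (real \<Rightarrow> 'a \<Rightarrow> 'b \<Rightarrow> 'b measure \<Rightarrow> real) \<Rightarrow> bool" where
  "master_equations T H G H0 G0 U0 U \<longleftrightarrow>
     (\<forall>t\<in>{0<..<T}. \<forall>x0. \<forall>m\<in>P2.
        - deriv (\<lambda>s. U0 s x0 m) t
        - laplacian (\<lambda>x0. U0 t x0 m) x0
        + H0 x0 (grad (\<lambda>x0. U0 t x0 m) x0) m
        - (\<integral>y. divergence (Dm (U0 t x0) m) y \<partial>m)
        + (\<integral>y. Dm (U0 t x0) m y \<bullet> grad (\<lambda>p. H x0 y p m) (grad (\<lambda>x. U t x0 x m) y) \<partial>m)
        = 0) \<and>
     (\<forall>t\<in>{0<..<T}. \<forall>x0 x. \<forall>m\<in>P2.
        - deriv (\<lambda>s. U s x0 x m) t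
        - laplacian (\<lambda>x. U t x0 x m) x
        - laplacian (\<lambda>x0. U t x0 x m) x0
        + H x0 x (grad (\<lambda>x. U t x0 x m) x) m
        - (\<integral>y. divergence (Dm (U t x0 x) m) y \<partial>m)
        + grad (\<lambda>x0. U t x0 x m) x0 \<bullet> grad (\<lambda>p. H0 x0 p m) (grad (\<lambda>x0. U0 t x0 m) x0)
        + (\<integral>y. Dm (U t x0 x) m y \<bullet> grad (\<lambda>p. H x0 y p m) (grad (\<lambda>x. U t x0 x m) y) \<partial>m)
        = 0) \<and>
     (\<forall>x0. \<forall>m\<in>P2. U0 T x0 m = G0 x0 m) \<and>
     (\<forall>x0 x. \<forall>m\<in>P2. U T x0 x m = G x0 x m)"

definition classical_solution ::
  "real \<Rightarrow>
   ('a::euclidean_space \<Rightarrow> 'b::euclidean_space \<Rightarrow> 'b \<Rightarrow> 'b measure \<Rightarrow> real) \<Rightarrow>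
   ('a \<Rightarrow> 'b \<Rightarrow> 'b measure \<Rightarrow> real) \<Rightarrow>
   ('a \<Rightarrow> 'a \<Rightarrow> 'b measure \<Rightarrow> real) \<Rightarrow>
   ('a \<Rightarrow> 'b measure \<Rightarrow> real) \<Rightarrow>
   (real \<Rightarrow> 'a \<Rightarrow> 'b measure \<Rightarrow> real) \<Rightarrow>
   (real \<Rightarrow> 'a \<Rightarrow> 'b \<Rightarrow> 'b measure \<Rightarrow> real) \<Rightarrow> bool" where
  "classical_solution T H G H0 G0 U0 U \<longleftrightarrow>
     regular_U0 T U0 \<and> regular_U T U \<and> master_equations T H G H0 G0 U0 U"

text \<open>Lipschitz continuity in all variables but the time, uniformly in the time.\<close>

definition lipschitz_space_measure ::
  "real \<Rightarrow> (real \<Rightarrow> 'e::metric_space \<Rightarrow> 'b::euclidean_space measure \<Rightarrow> 'g::metric_space) \<Rightarrow> bool" where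
  "lipschitz_space_measure T f \<longleftrightarrow>
     (\<exists>L. \<forall>t\<in>{0<..<T}. \<forall>z z'. \<forall>m\<in>P2. \<forall>m'\<in>P2.
        dist (f t z m) (f t z' m') \<le> L * (dist z z' + d2 m m'))"

end

theory Submission
  imports Defs
begin

text \<open>
  Let \<open>V0 = U01 - U02\<close>, \<open>V = U1 - U2\<close>, and \<open>W(t,x0,m) = V0(t,x0,m)\<^sup>2 + \<integral> V(t,x0,z,m)\<^sup>2 m(dz)\<close>. The individual
  noise acts on \<open>W\<close> through first derivatives in \<open>m\<close> only, so \<open>W\<close> satisfies a linear degenerate parabolic
  inequality: the terms of the equation for \<open>(V0, V)\<close> that involve \<open>D\<^sub>x\<^sub>0V0\<close> and the nonlocal quantity
  \<open>\<integral> |D\<^sub>xV(t,x0,y,m)| m(dy)\<close> are absorbed by the squared gradients that the two Laplacians and the heat flow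
  of \<open>m\<close> produce on squares. Hence \<open>W = 0\<close> by a maximum principle on the Wasserstein space: one maximizes
  \<open>exp(\<theta>t) W\<close> minus a small multiple of \<open>exp(\<kappa>(T-t)) (1 + |x0|\<^sup>2 + \<integral> psi dm) + 1/t\<close>, where the maximum
  exists because bounds on \<open>\<integral> psi dm\<close> give compactness, and tests it against small time steps, shifts of
  \<open>x0\<close>, transport of \<open>m\<close> along the drift \<open>-H\<^sub>p\<close>, and one step of a symmetric random walk on \<open>m\<close>.
  Finally \<open>V(t,x0,z,m) = 0\<close> for every \<open>z\<close>, because measures with an atom at \<open>z\<close> are dense.
\<close>

section \<open>Couplings and mixtures\<close>

text \<open>The nonlocal coupling dictates the choice of \<open>W\<close>. Subtracting the two
  equations leaves integrals of \<open>Dm\<close> of the first solution against the difference of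
  \<open>H_p\<close> at the two momenta, which involve the gradient of \<open>V\<close> at all
  points \<open>y\<close> at once; a pointwise maximum of \<open>V\<close> gives no control of them.
  Moving \<open>m\<close> by a random walk moves the integrating measure in \<open>W\<close> as
  well, and so yields the \<open>m\<close>-integral of the squared \<open>z\<close>-gradient, which
  dominates the square of the nonlocal term by Jensen. The test drifts are frozen at the maximum and
  taken from the second solution: the first measure derivatives of \<open>V\<close> then cancel, and
  those of the first solution enter only through a bound. Since classical solutions carry no second
  derivative in \<open>m\<close>, the maximum is tested along explicit one-parameter perturbations,
  by difference quotients over a fixed sequence of steps. Young's inequality fixes
  \<open>\<theta>\<close>, the growth of the penalty under the perturbations fixes
  \<open>\<kappa>\<close>, and \<open>\<epsilon>\<close> is small enough for a positive maximum,
  which excludes the final time because the terminal data agree; the term in \<open>1/t\<close>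
  excludes the initial time.\<close>

lemma P2_D:
  assumes "m \<in> P2"
  shows "prob_space m" "sets m = sets borel" "space m = UNIV" "integrable m (\<lambda>x. (norm x)\<^sup>2)"
  using assms sets_eq_imp_space_eq[of m borel] by (auto simp: P2_def)

lemma P2_distr:
  assumes "prob_space M" "X \<in> borel_measurable M" "integrable M (\<lambda>w. (norm (X w))\<^sup>2)"
  shows "distr M borel X \<in> P2"
  using assms unfolding P2_def
  by (auto simp: integrable_distr_eq intro!: prob_space.prob_space_distr)

text \<open>The joint law of \<open>X\<close> and \<open>Y\<close> is one admissible coupling, so
  its cost bounds the infimum. All upper bounds on \<open>d2\<close> below arise in this way, by
  realising both measures on one probability space.\<close>

lemma d2_distr_le:
  fixes X Y :: "'c \<Rightarrow> 'b::euclidean_space"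
  assumes M: "prob_space M" and X: "X \<in> borel_measurable M" and Y: "Y \<in> borel_measurable M"
    and c: "0 \<le> c" "(\<integral>\<^sup>+ w. ennreal ((dist (X w) (Y w))\<^sup>2) \<partial>M) \<le> ennreal c"
  shows "d2 (distr M borel X) (distr M borel Y) \<le> sqrt c"
proof -
  let ?p = "distr M (borel \<Otimes>\<^sub>M borel) (\<lambda>w. (X w, Y w))"
  let ?I = "\<lambda>\<pi>. \<integral>z. (dist (fst z) (snd z))\<^sup>2 \<partial>\<pi>"
  have XY: "(\<lambda>w. (X w, Y w)) \<in> M \<rightarrow>\<^sub>M (borel \<Otimes>\<^sub>M borel)" using X Y by measurable
  have p: "?p \<in> couplings (distr M borel X) (distr M borel Y)"
    unfolding couplings_def using XY M
    by (auto simp: distr_distr comp_def intro!: prob_space.prob_space_distr)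
  have b: "bdd_below (?I ` couplings (distr M borel X) (distr M borel Y))"
    by (rule bdd_belowI2[where m=0]) auto
  have m: "(\<lambda>z::'b\<times>'b. (dist (fst z) (snd z))\<^sup>2) \<in> borel_measurable (borel \<Otimes>\<^sub>M borel)"
    unfolding borel_prod by (intro borel_measurable_continuous_onI continuous_intros)
  have "?I ?p = (\<integral>w. (dist (X w) (Y w))\<^sup>2 \<partial>M)"
    using integral_distr[OF XY m] by simp
  also have "\<dots> = enn2real (\<integral>\<^sup>+ w. ennreal ((dist (X w) (Y w))\<^sup>2) \<partial>M)"
    using X Y by (intro integral_eq_nn_integral) auto
  also have "\<dots> \<le> c" using c
    by (metis enn2real_ennreal enn2real_mono ennreal_less_top)
  finally have "?I ?p \<le> c" .
  with cINF_lower[OF b p] have "(INF \<pi>\<in>couplings (distr M borel X) (distr M borel Y). ?I \<pi>) \<le> c"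
    by linarith
  then show ?thesis unfolding d2_def by (rule real_sqrt_le_mono)
qed

text \<open>The infimum of an empty set of reals carries no information, hence the premise. Lower
  bounds of this kind are what squeezes \<open>d2\<close> to 0 in the limits below.\<close>

lemma d2_nonneg: "0 \<le> d2 (m::'b::euclidean_space measure) m'" if "couplings m m' \<noteq> {}"
  unfolding d2_def using that by (auto intro!: cINF_greatest)

lemma d2_distr_nonneg:
  fixes X Y :: "'c \<Rightarrow> 'b::euclidean_space"
  assumes M: "prob_space M" and X: "X \<in> borel_measurable M" and Y: "Y \<in> borel_measurable M"
  shows "0 \<le> d2 (distr M borel X) (distr M borel Y)"
proof (rule d2_nonneg)
  have XY: "(\<lambda>w. (X w, Y w)) \<in> M \<rightarrow>\<^sub>M (borel \<Otimes>\<^sub>M borel)" using X Y by measurable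
  have "distr M (borel \<Otimes>\<^sub>M borel) (\<lambda>w. (X w, Y w)) \<in> couplings (distr M borel X) (distr M borel Y)"
    unfolding couplings_def using XY M
    by (auto simp: distr_distr comp_def intro!: prob_space.prob_space_distr)
  then show "couplings (distr M borel X) (distr M borel Y) \<noteq> {}" by auto
qed

lemma P2_distr_id: "m \<in> P2 \<Longrightarrow> distr m borel (\<lambda>y. y) = m"
  by (rule distr_id2) (simp add: P2_D(2))

lemma d2_self:
  assumes m: "m \<in> P2" shows "d2 m m = 0"
proof -
  have id: "(\<lambda>y. y) \<in> borel_measurable m" using P2_D(2)[OF m] by (rule measurable_ident_sets)
  have "d2 m m \<le> sqrt 0"
    using d2_distr_le[OF P2_D(1)[OF m] id id, of 0] unfolding P2_distr_id[OF m] by simp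
  moreover have "0 \<le> d2 m m"
    using d2_distr_nonneg[OF P2_D(1)[OF m] id id] unfolding P2_distr_id[OF m] .
  ultimately show ?thesis by simp
qed

text \<open>\<open>mix\<close> is given only by its values on sets, so the formula spreads from
  indicators to nonnegative measurable functions through sums and monotone limits. It holds for
  every real \<open>s\<close>, because \<open>ennreal\<close> truncates a negative weight on both
  sides alike.\<close>

lemma nn_integral_mix:
  assumes m: "m \<in> P2" "m' \<in> P2" and f: "f \<in> borel_measurable borel"
  shows "(\<integral>\<^sup>+y. f y \<partial>mix s m m') = ennreal (1 - s) * (\<integral>\<^sup>+y. f y \<partial>m) + ennreal s * (\<integral>\<^sup>+y. f y \<partial>m')"
  using f
proof (induction rule: borel_measurable_induct)
  note [measurable_cong] = mix_sets(1)[of s m m'] P2_D(2)[OF m(1)] P2_D(2)[OF m(2)]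
  {
    case (cong f g)
    then have "f = g" by auto
    with cong show ?case by simp
  next
    case (set A)
    then show ?case using emeasure_mix[OF m set] P2_D[OF m(1)] P2_D[OF m(2)] mix_sets[of s m m']
      by (simp)
  next
    case (mult u c)
    then show ?case by (simp add: nn_integral_cmult distrib_left mult.left_commute)
  next
    case (add u v)
    then show ?case by (simp add: nn_integral_add distrib_left ac_simps)
  next
    case (seq U)
    have U: "(SUP i. U i) = (\<lambda>y. SUP i. U i y)" by (rule ext) (simp add: image_comp)
    have *: "integral\<^sup>N M (SUP i. U i) = (SUP i. \<integral>\<^sup>+y. U i y \<partial>M)" if "sets M = sets borel" for M
      unfolding U using seq(1,3) that
      by (intro nn_integral_monotone_convergence_SUP) (auto simp: measurable_cong_sets[OF that refl])
    have inc: "incseq (\<lambda>i. c * (\<integral>\<^sup>+y. U i y \<partial>M))" for M c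
      using seq(3) by (intro incseq_SucI mult_left_mono nn_integral_mono) (auto simp: incseq_Suc_iff le_fun_def)
    have "integral\<^sup>N (mix s m m') (SUP i. U i) =
      (SUP i. ennreal (1 - s) * (\<integral>\<^sup>+y. U i y \<partial>m) + ennreal s * (\<integral>\<^sup>+y. U i y \<partial>m'))"
      unfolding *[OF mix_sets(1)] seq.IH ..
    also have "\<dots> = (SUP i. ennreal (1 - s) * (\<integral>\<^sup>+y. U i y \<partial>m)) + (SUP i. ennreal s * (\<integral>\<^sup>+y. U i y \<partial>m'))"
      by (rule ennreal_SUP_add[OF inc inc])
    also have "\<dots> = ennreal (1 - s) * integral\<^sup>N m (SUP i. U i) + ennreal s * integral\<^sup>N m' (SUP i. U i)"
      unfolding *[OF P2_D(2)[OF m(1)]] *[OF P2_D(2)[OF m(2)]] SUP_mult_left_ennreal ..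
    finally show ?case unfolding seq(4) .
  }
qed

lemma mix_prob_space:
  assumes "m \<in> P2" "m' \<in> P2" "s \<in> {0..1}"
  shows "prob_space (mix s m m')"
proof (rule prob_spaceI)
  interpret m: prob_space m using assms P2_D by auto
  interpret m': prob_space m' using assms P2_D by auto
  have "emeasure (mix s m m') UNIV = ennreal (1-s) + ennreal s"
    using emeasure_mix[OF assms(1,2), of UNIV s] m.emeasure_space_1 m'.emeasure_space_1
    by (simp add: P2_D(3)[OF assms(1)] P2_D(3)[OF assms(2)])
  also have "\<dots> = 1" using assms by (simp flip: ennreal_plus)
  finally show "emeasure (mix s m m') (space (mix s m m')) = 1" by (simp add: mix_sets)
qed

text \<open>\<open>nn_integral_mix\<close> is applied to the positive parts of \<open>f\<close> and
  of \<open>- f\<close>; integrability keeps all integrals finite, which \<open>enn2real\<close>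
  needs in order to be additive.\<close>

lemma integral_mix:
  fixes f :: "'b::euclidean_space \<Rightarrow> real"
  assumes m: "m \<in> P2" "m' \<in> P2" and s: "s \<in> {0..1}" and f: "integrable m f" "integrable m' f"
  shows "integrable (mix s m m') f"
    "(\<integral>y. f y \<partial>mix s m m') = (1 - s) * (\<integral>y. f y \<partial>m) + s * (\<integral>y. f y \<partial>m')"
proof -
  have fb: "f \<in> borel_measurable borel"
    using borel_measurable_integrable[OF f(1)] P2_D(2)[OF m(1)] by (simp cong: measurable_cong_sets)
  note [measurable_cong] = mix_sets(1)[of s m m']
  have fin: "(\<integral>\<^sup>+y. ennreal (norm (f y)) \<partial>m) < \<infinity>" "(\<integral>\<^sup>+y. ennreal (norm (f y)) \<partial>m') < \<infinity>"
    using f by (auto simp: integrable_iff_bounded)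
  have "(\<integral>\<^sup>+y. ennreal (norm (f y)) \<partial>mix s m m') < \<infinity>"
    using fin fb by (subst nn_integral_mix[OF m]) (auto simp: ennreal_mult_less_top)
  then show i: "integrable (mix s m m') f"
    using fb by (auto simp: integrable_iff_bounded)
  have le: "(\<integral>\<^sup>+y. ennreal (g y) \<partial>M) < \<infinity>" if "integrable M g" for g :: "'b \<Rightarrow> real" and M
  proof -
    have "(\<integral>\<^sup>+y. ennreal (g y) \<partial>M) \<le> (\<integral>\<^sup>+y. ennreal (norm (g y)) \<partial>M)"
      by (intro nn_integral_mono ennreal_leI) auto
    also have "\<dots> < \<infinity>" using that by (auto simp: integrable_iff_bounded)
    finally show ?thesis .
  qed
  have e: "enn2real (\<integral>\<^sup>+y. ennreal (g y) \<partial>mix s m m') =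
      (1 - s) * enn2real (\<integral>\<^sup>+y. ennreal (g y) \<partial>m) + s * enn2real (\<integral>\<^sup>+y. ennreal (g y) \<partial>m')"
    if "integrable m g" "integrable m' g" "g \<in> borel_measurable borel" for g
    using le[OF that(1)] le[OF that(2)] s that(3)
    by (subst nn_integral_mix[OF m]) (auto simp: enn2real_plus enn2real_mult ennreal_mult_less_top)
  show "(\<integral>y. f y \<partial>mix s m m') = (1 - s) * (\<integral>y. f y \<partial>m) + s * (\<integral>y. f y \<partial>m')"
    using e[OF f fb] e[of "\<lambda>y. - f y"] f fb
    by (simp add: real_lebesgue_integral_def i algebra_simps)
qed

lemma mix_P2:
  assumes m: "m \<in> P2" "m' \<in> P2" and s: "s \<in> {0..1}" shows "mix s m m' \<in> P2"
  using mix_prob_space[OF m s] integral_mix(1)[OF m s P2_D(4)[OF m(1)] P2_D(4)[OF m(2)]]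
  unfolding P2_def by (simp add: mix_sets)

lemma mix_0:
  assumes m: "m \<in> P2" "m' \<in> P2" shows "mix 0 m m' = m"
  by (rule measure_eqI) (simp_all add: mix_sets P2_D[OF m(1)] emeasure_mix[OF m])

lemma ennreal_div_one: "(x::ennreal) / 1 = x"
  by (simp add: divide_ennreal_def)

text \<open>An independent uniform variable acts as a coin: up to \<open>s\<close> it selects
  \<open>Y\<close>, above \<open>s\<close> it selects \<open>X\<close>. The same variable serves all
  \<open>s\<close> at once and thereby couples different mixtures.\<close>

lemma distr_mix_coin:
  fixes X Y :: "'c \<Rightarrow> 'b::euclidean_space"
  assumes M: "prob_space M" and X: "X \<in> borel_measurable M" and Y: "Y \<in> borel_measurable M"
    and P: "distr M borel X \<in> P2" "distr M borel Y \<in> P2" and s: "s \<in> {0..1}"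
  shows "distr (M \<Otimes>\<^sub>M uniform_measure lborel {0..1::real}) borel (\<lambda>z. if snd z \<le> s then Y (fst z) else X (fst z))
    = mix s (distr M borel X) (distr M borel Y)" (is "distr ?N _ ?Z = ?m")
proof (rule measure_eqI)
  interpret M: prob_space M by fact
  let ?u = "uniform_measure lborel {0..1::real}"
  interpret u: prob_space ?u by (rule prob_space_uniform_measure) auto
  have Z: "?Z \<in> borel_measurable ?N" using X Y by measurable
  show "sets (distr ?N borel ?Z) = sets ?m" by (simp add: mix_sets)
  fix A assume "A \<in> sets (distr ?N borel ?Z)"
  then have A: "A \<in> sets borel" by simp
  have u1: "emeasure ?u {..s} = ennreal s" "emeasure ?u {s<..} = ennreal (1 - s)"
  proof -
    have "{0..1} \<inter> {..s} = {0..s}" "{0..1} \<inter> {s<..} = {s<..1}" using s by auto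
    then show "emeasure ?u {..s} = ennreal s" "emeasure ?u {s<..} = ennreal (1 - s)"
      using s by (simp_all add: ennreal_div_one)
  qed
  have XA: "X -` A \<inter> space M \<in> sets M" "Y -` A \<inter> space M \<in> sets M" using X Y A by auto
  have "?Z -` A \<inter> space ?N = (X -` A \<inter> space M) \<times> {s<..} \<union> (Y -` A \<inter> space M) \<times> {..s}"
    by (auto simp: space_pair_measure split: if_splits)
  then have "emeasure (distr ?N borel ?Z) A = emeasure ?N ((X -` A \<inter> space M) \<times> {s<..} \<union> (Y -` A \<inter> space M) \<times> {..s})"
    by (simp only: emeasure_distr[OF Z A])
  also have "\<dots> = emeasure ?N ((X -` A \<inter> space M) \<times> {s<..}) + emeasure ?N ((Y -` A \<inter> space M) \<times> {..s})"
    by (rule plus_emeasure[symmetric], rule pair_measureI[OF XA(1)], simp, rule pair_measureI[OF XA(2)], simp) auto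
  also have "\<dots> = emeasure M (X -` A \<inter> space M) * ennreal (1 - s) + emeasure M (Y -` A \<inter> space M) * ennreal s"
    by (subst (1 2) u.emeasure_pair_measure_Times) (simp_all add: XA u1 del: emeasure_uniform_measure)
  also have "\<dots> = emeasure ?m A"
    by (simp only: emeasure_mix[OF P A] emeasure_distr[OF X A] emeasure_distr[OF Y A] mult.commute)
  finally show "emeasure (distr ?N borel ?Z) A = emeasure ?m A" .
qed

text \<open>With a common coin the two mixtures differ only if the uniform variable falls between
  \<open>s\<close> and \<open>s'\<close>. This event has probability
  \<open>\<bar>s - s'\<bar>\<close> and is independent of the pair \<open>X\<close>,
  \<open>Y\<close>, so the cost is the product.\<close>

lemma d2_mix_distr_le:
  fixes X Y :: "'c \<Rightarrow> 'b::euclidean_space"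
  assumes M: "prob_space M" and X: "X \<in> borel_measurable M" and Y: "Y \<in> borel_measurable M"
    and P: "distr M borel X \<in> P2" "distr M borel Y \<in> P2" and s: "s \<in> {0..1}" "s' \<in> {0..1}"
    and c: "0 \<le> c" "(\<integral>\<^sup>+ w. ennreal ((dist (X w) (Y w))\<^sup>2) \<partial>M) \<le> ennreal c"
  shows "d2 (mix s (distr M borel X) (distr M borel Y)) (mix s' (distr M borel X) (distr M borel Y))
     \<le> sqrt (\<bar>s - s'\<bar> * c)"
proof -
  interpret M: prob_space M by fact
  let ?u = "uniform_measure lborel {0..1::real}"
  interpret u: prob_space ?u by (rule prob_space_uniform_measure) auto
  interpret N: pair_prob_space M ?u ..
  let ?N = "M \<Otimes>\<^sub>M ?u"
  let ?Z = "\<lambda>s z. if snd z \<le> s then Y (fst z) else X (fst z)"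
  have Z[measurable]: "?Z s \<in> borel_measurable ?N" for s using X Y by measurable
  note [measurable] = X Y
  have uI: "emeasure ?u {min s s'<..max s s'} = ennreal \<bar>s - s'\<bar>"
  proof -
    have "{0..1} \<inter> {min s s'<..max s s'} = {min s s'<..max s s'}" using s by auto
    moreover have "max s s' - min s s' = \<bar>s - s'\<bar>" by auto
    ultimately show ?thesis by (simp add: ennreal_div_one)
  qed
  have "(\<integral>\<^sup>+ z. ennreal ((dist (?Z s z) (?Z s' z))\<^sup>2) \<partial>?N) =
     (\<integral>\<^sup>+ z. ennreal ((dist (X (fst z)) (Y (fst z)))\<^sup>2) * indicator {min s s'<..max s s'} (snd z) \<partial>?N)"
    by (intro nn_integral_cong) (auto simp: indicator_def dist_commute min_def max_def split: if_splits)
  also have "\<dots> = (\<integral>\<^sup>+ w. \<integral>\<^sup>+ u. ennreal ((dist (X w) (Y w))\<^sup>2) * indicator {min s s'<..max s s'} u \<partial>?u \<partial>M)"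
    by (subst u.nn_integral_fst[symmetric]) (auto intro!: measurable_compose[OF measurable_snd])
  also have "\<dots> = (\<integral>\<^sup>+ w. ennreal ((dist (X w) (Y w))\<^sup>2) * ennreal \<bar>s - s'\<bar> \<partial>M)"
    by (intro nn_integral_cong) (simp add: nn_integral_cmult uI)
  also have "\<dots> = (\<integral>\<^sup>+ w. ennreal ((dist (X w) (Y w))\<^sup>2) \<partial>M) * ennreal \<bar>s - s'\<bar>"
    by (rule nn_integral_multc) measurable
  also have "\<dots> \<le> ennreal c * ennreal \<bar>s - s'\<bar>" by (intro mult_right_mono c) auto
  also have "\<dots> = ennreal (\<bar>s - s'\<bar> * c)" using c by (simp add: ennreal_mult mult.commute)
  finally have le: "(\<integral>\<^sup>+ z. ennreal ((dist (?Z s z) (?Z s' z))\<^sup>2) \<partial>?N) \<le> ennreal (\<bar>s - s'\<bar> * c)" .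
  show ?thesis
    using d2_distr_le[OF N.prob_space_axioms Z[of s] Z[of s'] _ le] c
    by (simp add: distr_mix_coin[OF M X Y P s(1)] distr_mix_coin[OF M X Y P s(2)])
qed

section \<open>Sequential limits, and quotients of a functional along a perturbed measure\<close>

lemma bounded_convergence:
  fixes f :: "nat \<Rightarrow> 'c \<Rightarrow> real"
  assumes M: "prob_space M" and f: "\<And>n. f n \<in> borel_measurable M"
    and lim: "\<And>x. x \<in> space M \<Longrightarrow> (\<lambda>n. f n x) \<longlonglongrightarrow> g x"
    and le: "\<And>n x. x \<in> space M \<Longrightarrow> \<bar>f n x\<bar> \<le> C"
  shows "(\<lambda>n. \<integral>x. f n x \<partial>M) \<longlonglongrightarrow> (\<integral>x. g x \<partial>M)"
proof -
  interpret prob_space M by fact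
  have g: "g \<in> borel_measurable M" by (rule borel_measurable_LIMSEQ_real[OF lim f])
  show ?thesis
    by (rule integral_dominated_convergence[OF g f, of "\<lambda>_. C"]) (use lim le in auto)
qed

lemma bounded_integrable:
  fixes f :: "'c \<Rightarrow> 'd::{banach, second_countable_topology}"
  assumes M: "prob_space M" and f: "f \<in> borel_measurable M"
    and le: "\<And>x. x \<in> space M \<Longrightarrow> norm (f x) \<le> C"
  shows "integrable M f"
proof -
  interpret prob_space M by fact
  show ?thesis by (rule integrable_const_bound[of _ C]) (use f le in auto)
qed

text \<open>Integrability is not among the premises: where it fails the Bochner integral is 0, and
  \<open>C\<close> is nonnegative because a probability space is nonempty.\<close>

lemma integral_abs_le:
  fixes f :: "'c \<Rightarrow> real"
  assumes M: "prob_space M" and le: "\<And>x. x \<in> space M \<Longrightarrow> \<bar>f x\<bar> \<le> C"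
  shows "\<bar>\<integral>x. f x \<partial>M\<bar> \<le> C"
proof -
  interpret prob_space M by fact
  have C: "0 \<le> C" using le not_empty by (metis abs_ge_zero all_not_in_conv order_trans)
  show ?thesis
  proof (cases "integrable M f")
    case True
    have "\<bar>\<integral>x. f x \<partial>M\<bar> \<le> (\<integral>x. \<bar>f x\<bar> \<partial>M)" by (rule integral_abs_bound)
    also have "\<dots> \<le> (\<integral>x. C \<partial>M)" using True le by (intro integral_mono) auto
    finally show ?thesis by (simp add: prob_space)
  qed (simp add: C not_integrable_integral_eq)
qed

lemma continuous_P2_seq:
  assumes f: "continuous_P2 A f" and z: "\<And>n. z n \<in> A" "z0 \<in> A" "z \<longlonglongrightarrow> z0"
    and m: "\<And>n. m n \<in> P2" "m0 \<in> P2" "(\<lambda>n. d2 (m n) m0) \<longlonglongrightarrow> 0"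
  shows "(\<lambda>n. f (z n) (m n)) \<longlonglongrightarrow> f z0 m0"
proof (rule metric_LIMSEQ_I)
  fix e :: real assume "e > 0"
  then obtain d where d: "d > 0"
    "\<And>z' m'. z' \<in> A \<Longrightarrow> m' \<in> P2 \<Longrightarrow> dist z' z0 < d \<Longrightarrow> d2 m' m0 < d \<Longrightarrow> dist (f z' m') (f z0 m0) < e"
    using f z(2) m(2) unfolding continuous_P2_def by blast
  have "\<forall>\<^sub>F n in sequentially. dist (z n) z0 < d" using z(3) d(1) by (rule tendstoD)
  moreover have "\<forall>\<^sub>F n in sequentially. d2 (m n) m0 < d" using m(3) d(1) by (rule order_tendstoD)
  ultimately have "\<forall>\<^sub>F n in sequentially. dist (f (z n) (m n)) (f z0 m0) < e"
    by eventually_elim (use d(2) z(1) m(1) in auto)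
  then show "\<exists>no. \<forall>n\<ge>no. dist (f (z n) (m n)) (f z0 m0) < e"
    by (simp add: eventually_sequentially)
qed

lemma continuous_P2_continuous_on:
  assumes f: "continuous_P2 A f" and m: "m \<in> P2"
  shows "continuous_on A (\<lambda>z. f z m)"
  unfolding continuous_on_iff
proof (intro ballI allI impI)
  fix z and e :: real assume "z \<in> A" "0 < e"
  then obtain d where "d > 0"
    "\<And>z' m'. z' \<in> A \<Longrightarrow> m' \<in> P2 \<Longrightarrow> dist z' z < d \<Longrightarrow> d2 m' m < d \<Longrightarrow> dist (f z' m') (f z m) < e"
    using f m unfolding continuous_P2_def by blast
  then show "\<exists>d>0. \<forall>x'\<in>A. dist x' z < d \<longrightarrow> dist (f x' m) (f z m) < e"
    using m d2_self[OF m] by auto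
qed

lemma measurable_P2:
  assumes "m \<in> P2" "f \<in> borel_measurable borel" shows "f \<in> borel_measurable m"
  using assms(2) P2_D(2)[OF assms(1)] by (simp cong: measurable_cong_sets)

text \<open>The two measures become the coordinates of their product; \<open>c\<close> is the cost
  of this independent coupling, finite by the second moments. The coin of
  \<open>distr_mix_coin\<close> then provides a coupling of any two mixtures, which gives both the
  bound and the nonnegativity.\<close>

lemma d2_mix_le:
  fixes m m' :: "'b::euclidean_space measure"
  assumes m: "m \<in> P2" "m' \<in> P2"
  obtains c where "c \<ge> 0"
    "\<And>s s'. s \<in> {0..1} \<Longrightarrow> s' \<in> {0..1} \<Longrightarrow> d2 (mix s m m') (mix s' m m') \<le> sqrt (\<bar>s - s'\<bar> * c)"
    "\<And>s s'. s \<in> {0..1} \<Longrightarrow> s' \<in> {0..1} \<Longrightarrow> 0 \<le> d2 (mix s m m') (mix s' m m')"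
proof -
  interpret m: prob_space m using P2_D(1)[OF m(1)] .
  interpret m': prob_space m' using P2_D(1)[OF m(2)] .
  interpret N: pair_prob_space m m' ..
  let ?M = "m \<Otimes>\<^sub>M m'"
  note [measurable_cong] = P2_D(2)[OF m(1)] P2_D(2)[OF m(2)]
  have X: "fst \<in> borel_measurable ?M" and Y: "snd \<in> borel_measurable ?M" by measurable
  have dX: "distr ?M borel fst = m"
    using m'.distr_pair_fst[of m] by (simp add: P2_D(2)[OF m(1)] cong: distr_cong)
  have dY: "distr ?M borel snd = m'"
  proof (rule measure_eqI)
    fix A assume "A \<in> sets (distr ?M borel snd)"
    then have A: "A \<in> sets borel" by simp
    have "snd -` A \<inter> space ?M = UNIV \<times> A"
      by (auto simp: space_pair_measure P2_D(3)[OF m(1)] P2_D(3)[OF m(2)])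
    then have "emeasure (distr ?M borel snd) A = emeasure m UNIV * emeasure m' A"
      using A by (simp add: emeasure_distr[OF Y A] P2_D(2)[OF m(1)] P2_D(2)[OF m(2)] m'.emeasure_pair_measure_Times)
    then show "emeasure (distr ?M borel snd) A = emeasure m' A"
      using m.emeasure_space_1 by (simp add: P2_D(3)[OF m(1)])
  qed (simp add: P2_D(2)[OF m(2)])
  let ?J = "\<integral>\<^sup>+ w. ennreal ((dist (fst w) (snd w))\<^sup>2) \<partial>?M"
  have "?J \<le> (\<integral>\<^sup>+ w. ennreal (2 * (norm (fst w))\<^sup>2) + ennreal (2 * (norm (snd w))\<^sup>2) \<partial>?M)"
  proof (rule nn_integral_mono)
    fix w :: "'b \<times> 'b"
    have "dist (fst w) (snd w) \<le> norm (fst w) + norm (snd w)"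
      by (simp add: dist_norm norm_triangle_ineq4)
    then have "(dist (fst w) (snd w))\<^sup>2 \<le> (norm (fst w) + norm (snd w))\<^sup>2" by (rule power_mono) simp
    also have "\<dots> \<le> 2 * (norm (fst w))\<^sup>2 + 2 * (norm (snd w))\<^sup>2"
      using sum_squares_bound[of "norm (fst w)" "norm (snd w)"] by (simp add: power2_sum)
    finally show "ennreal ((dist (fst w) (snd w))\<^sup>2) \<le> ennreal (2 * (norm (fst w))\<^sup>2) + ennreal (2 * (norm (snd w))\<^sup>2)"
      by (simp flip: ennreal_plus)
  qed
  also have "\<dots> = (\<integral>\<^sup>+ w. ennreal (2 * (norm (fst w))\<^sup>2) \<partial>?M) + (\<integral>\<^sup>+ w. ennreal (2 * (norm (snd w))\<^sup>2) \<partial>?M)"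
    by (rule nn_integral_add) measurable
  also have "\<dots> = (\<integral>\<^sup>+ x. ennreal (2 * (norm x)\<^sup>2) \<partial>m) + (\<integral>\<^sup>+ x. ennreal (2 * (norm x)\<^sup>2) \<partial>m')"
    using nn_integral_distr[OF X, of "\<lambda>x. ennreal (2 * (norm x)\<^sup>2)"] nn_integral_distr[OF Y, of "\<lambda>x. ennreal (2 * (norm x)\<^sup>2)"]
    unfolding dX dY by simp
  also have "\<dots> < \<infinity>"
  proof -
    have "(\<integral>\<^sup>+ x. ennreal (2 * (norm x)\<^sup>2) \<partial>\<mu>) < \<infinity>" if "\<mu> \<in> P2" for \<mu> :: "'b measure"
    proof -
      have "integrable \<mu> (\<lambda>x. 2 * (norm x)\<^sup>2)" using P2_D(4)[OF that] by simp
      then show ?thesis unfolding integrable_iff_bounded by simp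
    qed
    from this[OF m(1)] this[OF m(2)] show ?thesis by simp
  qed
  finally have fin: "?J < \<infinity>" .
  define c where "c = enn2real ?J"
  have c: "0 \<le> c" "?J \<le> ennreal c" using fin by (auto simp: c_def)
  show thesis
  proof (rule that[OF c(1)])
    fix s s' :: real assume s: "s \<in> {0..1}" "s' \<in> {0..1}"
    show "d2 (mix s m m') (mix s' m m') \<le> sqrt (\<bar>s - s'\<bar> * c)"
      using d2_mix_distr_le[OF N.prob_space_axioms X Y _ _ s c] m unfolding dX dY by auto
    let ?u = "uniform_measure lborel {0..1::real}"
    interpret u: prob_space ?u by (rule prob_space_uniform_measure) auto
    interpret NN: pair_prob_space ?M ?u ..
    have Z: "(\<lambda>z. if snd z \<le> s then snd (fst z) else fst (fst z)) \<in> borel_measurable (?M \<Otimes>\<^sub>M ?u)" for s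
      using X Y by measurable
    show "0 \<le> d2 (mix s m m') (mix s' m m')"
      using d2_distr_nonneg[OF NN.prob_space_axioms Z[of s] Z[of s']]
        distr_mix_coin[OF N.prob_space_axioms X Y _ _ s(1)] distr_mix_coin[OF N.prob_space_axioms X Y _ _ s(2)] m
      unfolding dX dY by auto
  qed
qed

lemma mix_seq:
  assumes m: "m \<in> P2" "m' \<in> P2" and s: "\<And>n. s n \<in> {0..1}" "s0 \<in> {0..1}" "s \<longlonglongrightarrow> s0"
  shows "(\<lambda>n. d2 (mix (s n) m m') (mix s0 m m')) \<longlonglongrightarrow> 0"
proof -
  obtain c where c: "c \<ge> 0"
    "\<And>s s'. s \<in> {0..1} \<Longrightarrow> s' \<in> {0..1} \<Longrightarrow> d2 (mix s m m') (mix s' m m') \<le> sqrt (\<bar>s - s'\<bar> * c)"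
    "\<And>s s'. s \<in> {0..1} \<Longrightarrow> s' \<in> {0..1} \<Longrightarrow> 0 \<le> d2 (mix s m m') (mix s' m m')"
    by (rule d2_mix_le[OF m], rule that)
  have "(\<lambda>n. sqrt (\<bar>s n - s0\<bar> * c)) \<longlonglongrightarrow> sqrt (\<bar>s0 - s0\<bar> * c)"
    by (intro tendsto_intros s)
  then have "(\<lambda>n. sqrt (\<bar>s n - s0\<bar> * c)) \<longlonglongrightarrow> 0" by simp
  then show ?thesis
    by (rule tendsto_sandwich[OF _ _ tendsto_const, rotated 2]) (use c s in auto)
qed

text \<open>Continuity in the mixing parameter follows from \<open>mix_seq\<close> by bounded
  convergence. It makes the integrand in \<open>has_lin_deriv\<close> integrable over the unit
  interval, so that the formula there can be subtracted and passed to the limit.\<close>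

lemma lin_deriv_integrable:
  assumes D: "has_lin_deriv U D" and \<nu>: "\<nu> \<in> P2"
  shows "m \<in> P2 \<Longrightarrow> integrable \<nu> (D m)"
    and "m \<in> P2 \<Longrightarrow> m' \<in> P2 \<Longrightarrow> continuous_on {0..1} (\<lambda>r. \<integral>y. D (mix r m m') y \<partial>\<nu>)"
proof -
  have cD: "continuous_P2 UNIV (\<lambda>y m. D m y)" and bD: "bounded_P2 UNIV (\<lambda>y m. D m y)"
    using D unfolding has_lin_deriv_def by auto
  obtain K where K: "\<And>m y. m \<in> P2 \<Longrightarrow> \<bar>D m y\<bar> \<le> K" using bD unfolding bounded_P2_def by auto
  have Dm: "D m \<in> borel_measurable \<nu>" if "m \<in> P2" for m
    using continuous_P2_continuous_on[OF cD that] by (intro measurable_P2[OF \<nu>] borel_measurable_continuous_onI) simp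
  show "integrable \<nu> (D m)" if "m \<in> P2"
    by (rule bounded_integrable[OF P2_D(1)[OF \<nu>] Dm[OF that], of K]) (use K[OF that] in simp)
  assume m: "m \<in> P2" "m' \<in> P2"
  show "continuous_on {0..1} (\<lambda>r. \<integral>y. D (mix r m m') y \<partial>\<nu>)"
  proof (rule continuous_on_sequentiallyI)
    fix u :: "nat \<Rightarrow> real" and r assume u: "\<forall>k. u k \<in> {0..1}" "r \<in> {0..1}" "u \<longlonglongrightarrow> r"
    show "(\<lambda>k. \<integral>y. D (mix (u k) m m') y \<partial>\<nu>) \<longlonglongrightarrow> (\<integral>y. D (mix r m m') y \<partial>\<nu>)"
    proof (rule bounded_convergence[where C=K])
      fix y show "(\<lambda>k. D (mix (u k) m m') y) \<longlonglongrightarrow> D (mix r m m') y"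
        using u by (intro continuous_P2_seq[OF cD, of "\<lambda>_. y"] mix_P2 mix_seq m) auto
    qed (use u K P2_D(1)[OF \<nu>] Dm[OF mix_P2[OF m]] mix_P2[OF m] in auto)
  qed
qed

text \<open>\<open>\<mu> n\<close> is a perturbation of \<open>m\<close> of size \<open>a n\<close>.
  The defining formula writes the increment of \<open>U\<close> as an average over the segment from
  \<open>m\<close> to \<open>\<mu> n\<close>, and \<open>R\<close> turns the difference of two
  integrals of \<open>D\<close> into one integral against the fixed measure \<open>m\<close>. Two
  dominated limits follow, in \<open>y\<close> and then in the segment parameter. \<open>lim\<close>
  has to hold along every sequence tending to \<open>m\<close>, since \<open>D\<close> is evaluated
  at mixtures that move with \<open>n\<close>.\<close>

lemma lin_deriv_quotient:
  fixes m :: "'b::euclidean_space measure"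
  assumes D: "has_lin_deriv U D" and m: "m \<in> P2" and \<mu>: "\<And>n. \<mu> n \<in> P2" and a: "\<And>n. a n > 0"
    and d: "\<And>s. s \<in> {0..1} \<Longrightarrow> (\<lambda>n. d2 (mix s m (\<mu> n)) m) \<longlonglongrightarrow> 0"
    and R: "\<And>\<nu> n. \<nu> \<in> P2 \<Longrightarrow> (\<integral>y. D \<nu> y \<partial>\<mu> n) - (\<integral>y. D \<nu> y \<partial>m) = a n * (\<integral>y. R n \<nu> y \<partial>m)"
    and Rm: "\<And>\<nu> n. \<nu> \<in> P2 \<Longrightarrow> R n \<nu> \<in> borel_measurable borel"
    and RC: "\<And>\<nu> n y. \<nu> \<in> P2 \<Longrightarrow> \<bar>R n \<nu> y\<bar> \<le> C"
    and lim: "\<And>\<nu> y. (\<And>n. \<nu> n \<in> P2) \<Longrightarrow> (\<lambda>n. d2 (\<nu> n) m) \<longlonglongrightarrow> 0 \<Longrightarrow> (\<lambda>n. R n (\<nu> n) y) \<longlonglongrightarrow> \<rho> y"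
  shows "(\<lambda>n. (U (\<mu> n) - U m) / a n) \<longlonglongrightarrow> (\<integral>y. \<rho> y \<partial>m)"
    and "\<And>n. \<bar>(U (\<mu> n) - U m) / a n\<bar> \<le> C"
proof -
  interpret m: prob_space m using P2_D(1)[OF m] .
  let ?I = "{0..1::real}"
  define q where "q n r = (\<integral>y. R n (mix r m (\<mu> n)) y \<partial>m)" for n r
  have C: "0 \<le> C" using RC[OF m, of 0] abs_ge_zero order_trans by blast
  have UD: "\<And>m m'. m \<in> P2 \<Longrightarrow> m' \<in> P2 \<Longrightarrow> U m' - U m =
        (LINT s:{0..1}|lborel. (\<integral>y. D (mix s m m') y \<partial>m') - (\<integral>y. D (mix s m m') y \<partial>m))"
    using D unfolding has_lin_deriv_def by auto
  have mixP: "mix r m (\<mu> n) \<in> P2" if "r \<in> ?I" for r n using mix_P2[OF m \<mu> that] .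
  have eq: "(\<integral>y. D (mix r m (\<mu> n)) y \<partial>\<mu> n) - (\<integral>y. D (mix r m (\<mu> n)) y \<partial>m) = a n * q n r"
    if "r \<in> ?I" for r n using R[OF mixP[OF that]] by (simp add: q_def)
  have c: "continuous_on ?I (\<lambda>r. ((\<integral>y. D (mix r m (\<mu> n)) y \<partial>\<mu> n) - (\<integral>y. D (mix r m (\<mu> n)) y \<partial>m)) / a n)" for n
    using a[of n] by (intro continuous_on_divide continuous_on_diff lin_deriv_integrable(2)[OF D] \<mu> m continuous_on_const) auto
  have e: "((\<integral>y. D (mix r m (\<mu> n)) y \<partial>\<mu> n) - (\<integral>y. D (mix r m (\<mu> n)) y \<partial>m)) / a n = q n r"
    if "r \<in> ?I" for r n using eq[OF that, of n] a[of n] by simp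
  have qc: "continuous_on ?I (q n)" for n by (rule continuous_on_eq[OF c e])
  have qm: "(\<lambda>r. indicator ?I r *\<^sub>R q n r) \<in> borel_measurable lborel" for n
    using borel_measurable_continuous_on_indicator[OF _ qc[of n]] by simp
  have qC: "\<bar>q n r\<bar> \<le> C" if "r \<in> ?I" for n r
    unfolding q_def using RC[OF mixP[OF that]] by (intro integral_abs_le) (auto intro: m.prob_space_axioms)
  have qI: "set_integrable lborel ?I (q n)" for n
    using qc by (intro borel_integrable_atLeastAtMost') auto
  have U1: "(U (\<mu> n) - U m) / a n = (LINT r:?I|lborel. q n r)" for n
  proof -
    have "U (\<mu> n) - U m = (LINT r:?I|lborel. a n * q n r)"
      unfolding UD[OF m \<mu>] by (rule set_lebesgue_integral_cong) (auto simp: eq)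
    then show ?thesis using a[of n] by simp
  qed
  have qlim: "(\<lambda>n. q n r) \<longlonglongrightarrow> (\<integral>y. \<rho> y \<partial>m)" if r: "r \<in> ?I" for r
    unfolding q_def
    by (rule bounded_convergence[where C=C])
      (use m.prob_space_axioms measurable_P2[OF m Rm[OF mixP[OF r]]] lim[OF mixP[OF r] d[OF r]] RC[OF mixP[OF r]] in auto)
  have "(\<lambda>n. LINT r:?I|lborel. q n r) \<longlonglongrightarrow> (LINT r:?I|lborel. (\<integral>y. \<rho> y \<partial>m))"
    unfolding set_lebesgue_integral_def
  proof (rule integral_dominated_convergence[where w="\<lambda>r. indicator ?I r * C"])
    show "(\<lambda>r. indicator ?I r *\<^sub>R (\<integral>y. \<rho> y \<partial>m)) \<in> borel_measurable lborel" by simp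
    show "integrable lborel (\<lambda>r. indicator ?I r * C)"
      by (intro integrable_mult_left integrable_real_indicator) auto
    show "AE r in lborel. (\<lambda>n. indicator ?I r *\<^sub>R q n r) \<longlonglongrightarrow> indicator ?I r *\<^sub>R (\<integral>y. \<rho> y \<partial>m)"
      using qlim by (auto simp: indicator_def)
    show "AE r in lborel. norm (indicator ?I r *\<^sub>R q n r) \<le> indicator ?I r * C" for n
      using qC by (auto simp: indicator_def)
  qed (rule qm)
  moreover have "(LINT r:?I|lborel. (\<integral>y. \<rho> y \<partial>m)) = (\<integral>y. \<rho> y \<partial>m)"
    by (simp add: set_lebesgue_integral_def)
  ultimately show "(\<lambda>n. (U (\<mu> n) - U m) / a n) \<longlonglongrightarrow> (\<integral>y. \<rho> y \<partial>m)" unfolding U1 by simp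
  fix n
  have "\<bar>LINT r:?I|lborel. q n r\<bar> \<le> (LINT r:?I|lborel. C)"
  proof -
    have "\<bar>LINT r:?I|lborel. q n r\<bar> \<le> (\<integral>r. \<bar>indicator ?I r *\<^sub>R q n r\<bar> \<partial>lborel)"
      unfolding set_lebesgue_integral_def by (rule integral_abs_bound)
    also have "\<dots> \<le> (\<integral>r. indicator ?I r *\<^sub>R C \<partial>lborel)"
    proof (rule integral_mono)
      show "integrable lborel (\<lambda>r. \<bar>indicator ?I r *\<^sub>R q n r\<bar>)"
        using qI[of n] unfolding set_integrable_def by (rule integrable_abs)
      show "integrable lborel (\<lambda>r. indicator ?I r *\<^sub>R C)"
        by (intro integrable_scaleR_left integrable_real_indicator) auto
    qed (use qC in \<open>auto simp: indicator_def\<close>)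
    finally show ?thesis unfolding set_lebesgue_integral_def .
  qed
  also have "\<dots> = C" by (simp add: set_lebesgue_integral_def)
  finally show "\<bar>(U (\<mu> n) - U m) / a n\<bar> \<le> C" unfolding U1 .
qed

section \<open>Compactness in the Wasserstein space\<close>

text \<open>The digits are 0 and 1 in base 3, as in a Cantor set: the first differing digit
  contributes \<open>(1/3)^k\<close>, while all later ones together change the sum by at most half
  of that. In base 2 the tail could cancel the digit.\<close>

lemma ternary_separation:
  fixes b c :: "nat \<Rightarrow> bool"
  assumes ne: "b k \<noteq> c k" and eq: "\<And>j. j < k \<Longrightarrow> b j = c j"
  shows "(1/3)^k / 2 \<le> \<bar>(\<Sum>j. of_bool (b j) * (1/3::real)^j) - (\<Sum>j. of_bool (c j) * (1/3)^j)\<bar>"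
proof -
  define d where "d j = (of_bool (b j) - of_bool (c j)) * (1/3::real)^j" for j
  have sb: "summable (\<lambda>j. of_bool (a j) * (1/3::real)^j)" for a
    by (rule summable_comparison_test'[of "\<lambda>j. (1/3::real)^j" 0]) auto
  have dle: "\<bar>d j\<bar> \<le> (1/3)^j" for j by (auto simp: d_def of_bool_def abs_mult)
  have dle': "\<bar>d (j + Suc k)\<bar> \<le> (1/3)^j * (1/3)^Suc k" for j by (simp only: power_add[symmetric] dle)
  have sd: "summable d" by (rule summable_comparison_test'[of "\<lambda>j. (1/3::real)^j" 0]) (auto simp: dle)
  have "(\<Sum>j. of_bool (b j) * (1/3::real)^j) - (\<Sum>j. of_bool (c j) * (1/3)^j) = suminf d"
    unfolding d_def by (subst suminf_diff[OF sb sb]) (simp add: left_diff_distrib)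
  also have "suminf d = (\<Sum>j. d (j + Suc k)) + sum d {..<Suc k}"
    by (rule suminf_split_initial_segment[OF sd])
  also have "sum d {..<Suc k} = d k" using eq by (simp add: d_def)
  finally have e: "(\<Sum>j. of_bool (b j) * (1/3::real)^j) - (\<Sum>j. of_bool (c j) * (1/3)^j) = (\<Sum>j. d (j + Suc k)) + d k" .
  have s3: "(\<lambda>j. (1/3::real)^j * (1/3)^Suc k) sums (1 / (1 - 1/3) * (1/3)^Suc k)"
    by (intro sums_mult2 geometric_sums) simp
  have "\<bar>\<Sum>j. d (j + Suc k)\<bar> \<le> (\<Sum>j. (1/3::real)^j * (1/3)^Suc k)"
  proof (rule order_trans[OF summable_rabs])
    show "summable (\<lambda>j. \<bar>d (j + Suc k)\<bar>)"
      by (rule summable_comparison_test'[OF sums_summable[OF s3], of 0])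
        (use dle' in simp)
    then show "(\<Sum>j. \<bar>d (j + Suc k)\<bar>) \<le> (\<Sum>j. (1/3::real)^j * (1/3)^Suc k)"
      by (intro suminf_le sums_summable[OF s3] dle')
  qed
  also have "\<dots> = (1/3)^k / 2" using sums_unique[OF s3] by simp
  finally have t: "\<bar>\<Sum>j. d (j + Suc k)\<bar> \<le> (1/3)^k / 2" .
  have "\<bar>d k\<bar> = (1/3)^k" using ne by (auto simp: d_def)
  with t show ?thesis unfolding e by linarith
qed

lemma ternary_bounds:
  fixes b :: "nat \<Rightarrow> bool"
  shows "0 \<le> (\<Sum>j. of_bool (b j) * (1/3::real)^j)" "(\<Sum>j. of_bool (b j) * (1/3::real)^j) \<le> 3/2"
proof -
  have s: "summable (\<lambda>j. of_bool (b j) * (1/3::real)^j)"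
    by (rule summable_comparison_test'[of "\<lambda>j. (1/3::real)^j" 0]) auto
  show "0 \<le> (\<Sum>j. of_bool (b j) * (1/3::real)^j)" by (rule suminf_nonneg[OF s]) simp
  have "(\<Sum>j. of_bool (b j) * (1/3::real)^j) \<le> (\<Sum>j. (1/3::real)^j)"
    by (rule suminf_le[OF _ s]) (auto simp: of_bool_def)
  also have "\<dots> = 3/2" by (subst suminf_geometric) auto
  finally show "(\<Sum>j. of_bool (b j) * (1/3::real)^j) \<le> 3/2" .
qed

text \<open>The ternary digits record the members of a countable basis containing \<open>y\<close>; the integer part
  keeps bounded sets apart from infinity.\<close>

lemma real_code:
  obtains s :: "'b::euclidean_space \<Rightarrow> real" where "s \<in> borel_measurable borel"
    "\<And>y M. norm y \<le> M \<Longrightarrow> \<bar>s y\<bar> \<le> 10 * M + 12"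
    "\<And>M e. e > 0 \<Longrightarrow> \<exists>d>0. \<forall>y y'. \<bar>s y\<bar> \<le> M \<longrightarrow> \<bar>s y - s y'\<bar> < d \<longrightarrow> dist y y' < e"
proof -
  obtain B :: "'b set set" where B: "countable B" "topological_basis B"
    using ex_countable_basis by blast
  then have Bne: "B \<noteq> {}"
    unfolding topological_basis_def by (metis UNIV_not_empty Union_empty open_UNIV subset_empty)
  define A where "A = from_nat_into B"
  have Ar: "range A = B" unfolding A_def by (rule range_from_nat_into[OF Bne B(1)])
  have Ao: "open (A k)" for k using B(2) Ar by (auto simp: topological_basis_open)
  define f :: "'b \<Rightarrow> real" where "f y = (\<Sum>j. of_bool (y \<in> A j) * (1/3)^j)" for y
  \<comment> \<open>The factor 10 lets a change of the integer part outweigh the variation of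
    \<open>f\<close>, which is at most 3/2; the summand 1 makes \<open>s\<close> dominate the
    norm.\<close>
  define s where "s y = 10 * (of_int \<lfloor>norm y\<rfloor> + 1) + f y" for y
  have f: "0 \<le> f y" "f y \<le> 3/2" for y unfolding f_def by (rule ternary_bounds)+
  have fm[measurable]: "f \<in> borel_measurable borel"
  proof -
    have [measurable]: "A j \<in> sets borel" for j using Ao[of j] by auto
    show ?thesis unfolding f_def by measurable
  qed
  have sm: "s \<in> borel_measurable borel" unfolding s_def by measurable
  have s1: "norm y \<le> s y" for y
    using f(1)[of y] norm_ge_zero[of y] real_of_int_floor_add_one_gt[of "norm y"] unfolding s_def by argo
  have s2: "\<bar>s y\<bar> \<le> 10 * M + 12" if "norm y \<le> M" for y M
  proof -
    have "0 \<le> s y" using s1[of y] norm_ge_zero[of y] by linarith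
    then show ?thesis using f(2)[of y] that of_int_floor_le[of "norm y"] unfolding s_def by argo
  qed
  have s3: "\<exists>d>0. \<forall>y y'. \<bar>s y\<bar> \<le> M \<longrightarrow> \<bar>s y - s y'\<bar> < d \<longrightarrow> dist y y' < e" if "e > 0" for M e
  proof -
    \<comment> \<open>Finitely many basic sets of diameter below \<open>e\<close> cover the ball. If
      their indices are at most \<open>N\<close>, two points whose first digits agree up to
      \<open>N\<close> lie in a common one of them.\<close>
    let ?S = "{Q \<in> B. \<exists>x. Q \<subseteq> ball x (e/2)}"
    have sub: "cball 0 M \<subseteq> \<Union>?S"
    proof
      fix x :: 'b
      obtain Q where "Q \<in> B" "x \<in> Q" "Q \<subseteq> ball x (e/2)"
        using topological_basisE[OF B(2), of "ball x (e/2)" x] \<open>e > 0\<close> open_ball centre_in_ball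
        by (metis half_gt_zero)
      then show "x \<in> \<Union>?S" by blast
    qed
    have op: "\<And>Q. Q \<in> ?S \<Longrightarrow> open Q" using topological_basis_open[OF B(2)] by simp
    obtain F where F: "F \<subseteq> ?S" "finite F" "cball 0 M \<subseteq> \<Union>F"
      by (rule compactE[OF compact_cball sub op], assumption, rule that)
    have "\<forall>Q\<in>F. \<exists>k. A k = Q" using F(1) Ar by (metis (no_types, lifting) imageE mem_Collect_eq subsetD)
    then obtain ix where ix: "\<And>Q. Q \<in> F \<Longrightarrow> A (ix Q) = Q" by metis
    obtain N where N: "\<And>Q. Q \<in> F \<Longrightarrow> ix Q \<le> N"
      using finite_nat_set_iff_bounded_le[of "ix ` F"] F(2) by auto
    show ?thesis
    proof (intro exI[of _ "(1/3)^N/2"] conjI allI impI)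
      fix y y' assume y: "\<bar>s y\<bar> \<le> M" "\<bar>s y - s y'\<bar> < (1/3)^N/2"
      have p1: "(1/3::real)^N \<le> 1" by (rule power_le_one) auto
      have fl: "\<lfloor>norm y\<rfloor> = \<lfloor>norm y'\<rfloor>"
      proof (rule ccontr)
        assume "\<lfloor>norm y\<rfloor> \<noteq> \<lfloor>norm y'\<rfloor>"
        then have "1 \<le> \<bar>\<lfloor>norm y\<rfloor> - \<lfloor>norm y'\<rfloor>\<bar>" by linarith
        then have "1 \<le> \<bar>real_of_int \<lfloor>norm y\<rfloor> - of_int \<lfloor>norm y'\<rfloor>\<bar>" by linarith
        moreover have "10 * \<bar>real_of_int \<lfloor>norm y\<rfloor> - of_int \<lfloor>norm y'\<rfloor>\<bar> = \<bar>(s y - s y') - (f y - f y')\<bar>"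
        proof -
          have "10 * (real_of_int \<lfloor>norm y\<rfloor> - of_int \<lfloor>norm y'\<rfloor>) = (s y - s y') - (f y - f y')"
            unfolding s_def by (simp add: algebra_simps)
          then show ?thesis by (metis abs_mult abs_numeral)
        qed
        moreover have "\<bar>(s y - s y') - (f y - f y')\<bar> \<le> \<bar>s y - s y'\<bar> + \<bar>f y - f y'\<bar>"
          by (rule abs_triangle_ineq4)
        moreover have "\<bar>f y - f y'\<bar> \<le> 3/2" using f[of y] f[of y'] by linarith
        ultimately show False using y(2) p1 by argo
      qed
      then have ff: "\<bar>f y - f y'\<bar> < (1/3)^N/2" using y(2) by (simp add: s_def)
      have agree: "y \<in> A k \<longleftrightarrow> y' \<in> A k" if k: "k \<le> N" for k
      proof (rule ccontr)
        assume n: "\<not> (y \<in> A k \<longleftrightarrow> y' \<in> A k)"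
        \<comment> \<open>\<open>ternary_separation\<close> needs the first index at which the
          digits differ; it is at most \<open>N\<close>, so the codes would be at least
          \<open>(1/3)^N/2\<close> apart.\<close>
        define j where "j = (LEAST j. (y \<in> A j) \<noteq> (y' \<in> A j))"
        have j: "(y \<in> A j) \<noteq> (y' \<in> A j)" unfolding j_def using n by (rule LeastI)
        have jk: "j \<le> k" unfolding j_def using n by (rule Least_le)
        have jl: "(y \<in> A i) = (y' \<in> A i)" if "i < j" for i
          using not_less_Least[OF that[unfolded j_def]] by blast
        have "(1/3)^j / 2 \<le> \<bar>f y - f y'\<bar>" unfolding f_def 
          by (rule ternary_separation[where b="\<lambda>j. y \<in> A j" and c="\<lambda>j. y' \<in> A j", OF j jl])
        moreover have "(1/3::real)^N \<le> (1/3)^j" using jk k by (intro power_decreasing) auto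
        ultimately show False using ff by linarith
      qed
      have "norm y \<le> M" using s1[of y] y(1) by linarith
      then obtain Q where Q: "Q \<in> F" "y \<in> Q" using F(3) by (auto simp: subset_iff)
      then obtain x where x: "Q \<subseteq> ball x (e/2)" using F(1) by blast
      have "y' \<in> Q" using agree[OF N[OF Q(1)]] Q ix by auto
      with Q(2) x have "dist x y < e/2" "dist x y' < e/2" by auto
      then show "dist y y' < e" using dist_triangle_half_r[of x y e y'] by simp
    qed simp
  qed
  show thesis by (rule that[of s, OF sm s2 s3])
qed

text \<open>Convergent codes are bounded, so the last clause of \<open>real_code\<close> makes the
  coded points a Cauchy sequence; the inverse of the code therefore extends continuously to the
  closure of its range. The closure is required because limits of random codes may leave the range
  itself.\<close>

lemma real_decode:
  obtains s :: "'b::euclidean_space \<Rightarrow> real" and \<Phi> :: "real \<Rightarrow> 'b" and K :: "real set"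
  where "s \<in> borel_measurable borel" "\<And>y M. norm y \<le> M \<Longrightarrow> \<bar>s y\<bar> \<le> 10 * M + 12"
    "closed K" "range s \<subseteq> K" "continuous_on K \<Phi>" "\<And>y. \<Phi> (s y) = y"
proof -
  obtain s :: "'b \<Rightarrow> real" where s: "s \<in> borel_measurable borel"
    "\<And>y M. norm y \<le> M \<Longrightarrow> \<bar>s y\<bar> \<le> 10 * M + 12"
    "\<And>M e. e > 0 \<Longrightarrow> \<exists>d>0. \<forall>y y'. \<bar>s y\<bar> \<le> M \<longrightarrow> \<bar>s y - s y'\<bar> < d \<longrightarrow> dist y y' < e"
    by (rule real_code) blast
  define K where "K = closure (range s)"
  \<comment> \<open>\<open>P k L\<close> says that \<open>L\<close> is a possible value of the
    extension at \<open>k\<close>.\<close>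
  define P where "P k L \<longleftrightarrow> (\<exists>u. (\<lambda>n. s (u n)) \<longlonglongrightarrow> k \<and> u \<longlonglongrightarrow> L)" for k L
  have ex: "\<exists>L. P k L" if "k \<in> K" for k
  proof -
    from that obtain v where v: "\<And>n. v n \<in> range s" "v \<longlonglongrightarrow> k"
      unfolding K_def closure_sequential by blast
    have "\<forall>n. \<exists>y. v n = s y" using v(1) by blast
    then obtain u where u: "\<And>n. v n = s (u n)" by (auto dest: choice)
    have veq: "v = (\<lambda>n. s (u n))" using u by (rule ext)
    have lim: "(\<lambda>n. s (u n)) \<longlonglongrightarrow> k" using v(2) unfolding veq .
    then have C: "Cauchy (\<lambda>n. s (u n))" by (rule LIMSEQ_imp_Cauchy)
    obtain M where M: "\<And>n. \<bar>s (u n)\<bar> \<le> M"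
      using Cauchy_Bseq[OF C] unfolding Bseq_def by auto
    have "Cauchy u"
    proof (rule metric_CauchyI)
      fix e :: real assume "e > 0"
      then obtain d where d: "d > 0" "\<And>y y'. \<bar>s y\<bar> \<le> M \<Longrightarrow> \<bar>s y - s y'\<bar> < d \<Longrightarrow> dist y y' < e"
        using s(3) by metis
      then obtain n0 where "\<And>m n. m \<ge> n0 \<Longrightarrow> n \<ge> n0 \<Longrightarrow> dist (s (u m)) (s (u n)) < d"
        using metric_CauchyD[OF C d(1)] by blast
      then show "\<exists>n0. \<forall>m\<ge>n0. \<forall>n\<ge>n0. dist (u m) (u n) < e"
        using d(2)[OF M] by (metis dist_real_def)
    qed
    then obtain L where "u \<longlonglongrightarrow> L" using Cauchy_convergent convergent_def by blast
    with lim show ?thesis unfolding P_def by blast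
  qed
  \<comment> \<open>One estimate does two jobs: with \<open>k' = k\<close> it shows that the value
    is unique, hence that \<open>\<Phi>\<close> inverts \<open>s\<close>, and with \<open>k'\<close>
    near \<open>k\<close> it is the continuity of \<open>\<Phi>\<close>.\<close>
  have P: "\<exists>d>0. \<forall>k' L L'. P k L \<longrightarrow> P k' L' \<longrightarrow> \<bar>k - k'\<bar> < d \<longrightarrow> dist L L' \<le> e" if e: "e > 0" for k e
  proof -
    obtain d where d: "d > 0" "\<And>y y'. \<bar>s y\<bar> \<le> \<bar>k\<bar> + 1 \<Longrightarrow> \<bar>s y - s y'\<bar> < d \<Longrightarrow> dist y y' < e"
      using s(3)[OF e] by metis
    show ?thesis
    proof (intro exI conjI allI impI)
      fix k' L L' assume "P k L" "P k' L'" and k: "\<bar>k - k'\<bar> < d"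
      then obtain u v where u: "(\<lambda>n. s (u n)) \<longlonglongrightarrow> k" "u \<longlonglongrightarrow> L" and v: "(\<lambda>n. s (v n)) \<longlonglongrightarrow> k'" "v \<longlonglongrightarrow> L'"
        unfolding P_def by blast
      have "(\<lambda>n. \<bar>s (u n)\<bar>) \<longlonglongrightarrow> \<bar>k\<bar>" "(\<lambda>n. \<bar>s (u n) - s (v n)\<bar>) \<longlonglongrightarrow> \<bar>k - k'\<bar>"
        by (intro tendsto_intros u v)+
      then have "\<forall>\<^sub>F n in sequentially. \<bar>s (u n)\<bar> < \<bar>k\<bar> + 1" "\<forall>\<^sub>F n in sequentially. \<bar>s (u n) - s (v n)\<bar> < d"
        using k by (auto intro: order_tendstoD)
      then have "\<forall>\<^sub>F n in sequentially. dist (u n) (v n) \<le> e"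
        by eventually_elim (use d(2) in \<open>auto intro!: less_imp_le\<close>)
      then show "dist L L' \<le> e"
        by (intro tendsto_upperbound[OF tendsto_dist[OF u(2) v(2)]]) auto
    qed (rule d(1))
  qed
  define \<Phi> where "\<Phi> k = (SOME L. P k L)" for k
  have P\<Phi>: "P k (\<Phi> k)" if "k \<in> K" for k unfolding \<Phi>_def using ex[OF that] by (rule someI_ex)
  have sK: "range s \<subseteq> K" unfolding K_def by (rule closure_subset)
  have "continuous_on K \<Phi>"
    unfolding continuous_on_iff
  proof (intro ballI allI impI)
    fix k and e :: real assume k: "k \<in> K" and "0 < e"
    then have "0 < e/2" by simp
    from P[OF this, of k] obtain d where "d > 0"
      "\<And>k' L L'. P k L \<Longrightarrow> P k' L' \<Longrightarrow> \<bar>k - k'\<bar> < d \<Longrightarrow> dist L L' \<le> e/2" by blast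
    then show "\<exists>d>0. \<forall>x'\<in>K. dist x' k < d \<longrightarrow> dist (\<Phi> x') (\<Phi> k) < e"
      using P\<Phi> k \<open>0 < e\<close> by (intro exI[of _ d]) (force simp: dist_real_def dist_commute abs_minus_commute)
  qed
  moreover have "\<Phi> (s y) = y" for y
  proof -
    have 1: "P (s y) y" unfolding P_def by (rule exI[of _ "\<lambda>_. y"]) simp
    have 2: "P (s y) (\<Phi> (s y))" using P\<Phi> sK by blast
    have "dist (\<Phi> (s y)) y \<le> 0"
    proof (rule field_le_epsilon)
      fix e :: real assume "e > 0"
      then show "dist (\<Phi> (s y)) y \<le> 0 + e" using P[of e "s y"] 1 2 by force
    qed
    then show ?thesis by simp
  qed
  ultimately show thesis using that s(1,2) sK closed_closure unfolding K_def by blast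
qed

text \<open>A weight of superquadratic growth, so that a bound on its integral gives \<open>d2\<close>-compactness.\<close>

definition psi :: "'b::euclidean_space \<Rightarrow> real" where
  "psi y = (1 + (norm y)\<^sup>2)\<^sup>2"

lemma psi_ge: "1 \<le> psi y" "(norm y)^4 \<le> psi y" "(norm y)\<^sup>2 \<le> psi y" "1 + (norm y)\<^sup>2 \<le> psi y" "0 \<le> psi y"
proof -
  have 0: "0 \<le> (norm y)\<^sup>2" by simp
  have e: "psi y = 1 + 2 * (norm y)\<^sup>2 + (norm y)^4"
    by (simp add: psi_def power2_sum flip: power_mult)
  have 4: "0 \<le> (norm y)^4" by simp
  show "1 \<le> psi y" "(norm y)^4 \<le> psi y" "(norm y)\<^sup>2 \<le> psi y" "1 + (norm y)\<^sup>2 \<le> psi y" "0 \<le> psi y"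
    using 0 4 unfolding e by linarith+
qed

lemma psi_measurable[measurable]: "psi \<in> borel_measurable borel"
  unfolding psi_def by measurable

lemma P2_psi:
  assumes "prob_space m" "sets m = sets borel" "(\<integral>\<^sup>+y. ennreal (psi y) \<partial>m) < \<infinity>"
  shows "m \<in> P2" "integrable m psi"
proof -
  have [measurable_cong]: "sets m = sets borel" by fact
  show i: "integrable m psi" using assms(3) by (auto simp: integrable_iff_bounded psi_ge)
  have "integrable m (\<lambda>y. (norm y)\<^sup>2)"
    by (rule Bochner_Integration.integrable_bound[OF i]) (auto intro!: order_trans[OF psi_ge(3) abs_ge_self])
  with assms show "m \<in> P2" by (simp add: P2_def)
qed

text \<open>Prokhorov's theorem in the form of Skorohod: the coding by real numbers reduces both to the
  real line.\<close>

lemma P2_Skorohod: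
  fixes m :: "nat \<Rightarrow> 'b::euclidean_space measure"
  assumes m: "\<And>n. m n \<in> P2" and C: "\<And>n. (\<integral>\<^sup>+y. ennreal (psi y) \<partial>m n) \<le> ennreal C" "0 \<le> C"
  obtains r :: "nat \<Rightarrow> nat" and \<Omega> :: "real measure" and X X0
  where "strict_mono r" "prob_space \<Omega>" "\<And>n. X n \<in> borel_measurable \<Omega>"
    "\<And>n. distr \<Omega> borel (X n) = m (r n)" "X0 \<in> borel_measurable \<Omega>"
    "AE w in \<Omega>. (\<lambda>n. X n w) \<longlonglongrightarrow> X0 w"
proof -
  obtain s :: "'b \<Rightarrow> real" and \<Phi> :: "real \<Rightarrow> 'b" and K :: "real set"
    where s[measurable]: "s \<in> borel_measurable borel"
    and sM: "\<And>y M. norm y \<le> M \<Longrightarrow> \<bar>s y\<bar> \<le> 10 * M + 12"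
    and K: "closed K" "range s \<subseteq> K" and \<Phi>: "continuous_on K \<Phi>" "\<And>y. \<Phi> (s y) = y"
    by (rule real_decode) blast
  note pm = P2_D(1)[OF m] and sets_m = P2_D(2)[OF m] and space_m = P2_D(3)[OF m]
  have sm: "s \<in> borel_measurable (m n)" for n using measurable_P2[OF m s] .
  define \<mu> where "\<mu> n = distr (m n) borel s" for n
  have rd: "real_distribution (\<mu> n)" for n
    unfolding \<mu>_def using prob_space.real_distribution_distr[OF pm sm] .
  have "tight \<mu>"
    unfolding tight_def
  proof (intro conjI allI impI rd)
    fix e :: real assume e: "e > 0"
    \<comment> \<open>Chosen so that \<open>C / M\<^sup>2\<close>, the Markov bound for the event
      that \<open>psi\<close> is at least \<open>M\<^sup>2\<close>, falls below
      \<open>e\<close>.\<close>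
    define M where "M = 1 + C / e"
    have M: "1 \<le> M" "C < e * M\<^sup>2"
    proof -
      show "1 \<le> M" using C(2) e by (simp add: M_def)
      have "C < e * M" using e by (simp add: M_def field_simps)
      also have "e * M \<le> e * M\<^sup>2" using e \<open>1 \<le> M\<close> by (intro mult_left_mono) (auto simp: power2_eq_square)
      finally show "C < e * M\<^sup>2" .
    qed
    show "\<exists>a b. a < b \<and> (\<forall>n. 1 - e < measure (\<mu> n) {a<..b})"
    \<comment> \<open>The code of a point of norm at most \<open>M\<close> is bounded by
      \<open>10 * M + 12\<close>; one unit more keeps it off the excluded left end of the half-open
      interval.\<close>
    proof (rule exI[of _ "- (10 * M + 13)"], rule exI[of _ "10 * M + 13"], intro conjI allI)
      show "- (10 * M + 13) < 10 * M + 13" using M by linarith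
      fix n
      interpret m: prob_space "m n" by (rule pm)
      let ?I = "{- (10 * M + 13)<..10 * M + 13}"
      let ?B = "{y \<in> space (m n). M\<^sup>2 \<le> psi y}"
      have psm: "psi \<in> borel_measurable (m n)" using measurable_P2[OF m psi_measurable] .
      have i: "integrable (m n) psi"
      proof (rule P2_psi(2)[OF pm sets_m])
        show "(\<integral>\<^sup>+y. ennreal (psi y) \<partial>m n) < \<infinity>" using C(1)[of n] by (rule le_less_trans) simp
      qed
      have ile: "(\<integral>y. psi y \<partial>m n) \<le> C"
      proof -
        have "ennreal (\<integral>y. psi y \<partial>m n) = (\<integral>\<^sup>+y. ennreal (psi y) \<partial>m n)"
          using nn_integral_eq_integral[OF i AE_I2[OF psi_ge(5)]] by simp
        then show ?thesis using C(1)[of n] C(2) by (metis ennreal_le_iff)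
      qed
      have "measure (m n) ?B \<le> (\<integral>y. psi y \<partial>m n) / M\<^sup>2"
      proof -
        have "AE y in m n. 0 \<le> psi y" by (rule AE_I2) (rule psi_ge(5))
        then show ?thesis using integral_Markov_inequality_measure[OF i, of "{}" "M\<^sup>2"] M by simp
      qed
      also have "\<dots> \<le> C / M\<^sup>2" using ile by (intro divide_right_mono) auto
      also have "\<dots> < e" using M by (simp add: divide_less_eq)
      finally have Be: "measure (m n) ?B < e" .
      have Bm: "?B \<in> sets (m n)" using psm by measurable
      have "1 - e < measure (m n) (space (m n) - ?B)" using Be m.prob_compl[OF Bm] by simp
      also have "\<dots> \<le> measure (m n) (s -` ?I \<inter> space (m n))"
      proof (rule m.finite_measure_mono)
        show "s -` ?I \<inter> space (m n) \<in> sets (m n)" using sm by measurable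
        show "space (m n) - ?B \<subseteq> s -` ?I \<inter> space (m n)"
        proof
          fix y assume y: "y \<in> space (m n) - ?B"
          then have "(norm y)\<^sup>2 < M\<^sup>2" using psi_ge(3)[of y] by auto
          then have "norm y \<le> M" using M(1) power2_less_imp_less[of "norm y" M] by simp
          from sM[OF this] have "s y \<in> ?I" by auto
          with y show "y \<in> s -` ?I \<inter> space (m n)" by simp
        qed
      qed
      also have "\<dots> = measure (\<mu> n) ?I" unfolding \<mu>_def by (rule measure_distr[OF sm, symmetric]) simp
      finally show "1 - e < measure (\<mu> n) ?I" .
    qed
  qed
  from tight_imp_convergent_subsubsequence[OF this strict_mono_id]
  obtain r L where r: "strict_mono r" and L: "real_distribution L" "weak_conv_m (\<mu> \<circ> r) L"
    by auto
  have rd': "real_distribution ((\<mu> \<circ> r) n)" for n by (simp add: rd)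
  from Skorohod[OF rd' L] obtain \<Omega> :: "real measure" and Y Y0 where Om: "prob_space \<Omega>"
    and Y': "\<forall>n. Y n \<in> borel_measurable \<Omega>" "\<forall>n. distr \<Omega> borel (Y n) = \<mu> (r n)"
    and Y0': "Y0 \<in> measurable \<Omega> lborel" and lim': "\<forall>w\<in>space \<Omega>. (\<lambda>n. Y n w) \<longlonglongrightarrow> Y0 w"
    unfolding comp_apply by blast
  have Y: "Y n \<in> borel_measurable \<Omega>" "distr \<Omega> borel (Y n) = \<mu> (r n)" for n using Y' by auto
  have Y0: "Y0 \<in> borel_measurable \<Omega>" using Y0' by simp
  have lim: "(\<lambda>n. Y n w) \<longlonglongrightarrow> Y0 w" if "w \<in> space \<Omega>" for w using lim' that by blast
  interpret Om: prob_space \<Omega> by (rule Om)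
  \<comment> \<open>Extension of \<open>\<Phi>\<close> by 0 outside the closed set \<open>K\<close>:
    Borel on the whole line, though continuous only on \<open>K\<close>.\<close>
  define \<Psi> where "\<Psi> k = indicator K k *\<^sub>R \<Phi> k" for k
  have \<Psi>[measurable]: "\<Psi> \<in> borel_measurable borel"
    unfolding \<Psi>_def using K(1) \<Phi>(1) by (intro borel_measurable_continuous_on_indicator) auto
  have \<Psi>s: "\<Psi> (s y) = y" for y using K(2) \<Phi>(2) by (auto simp: \<Psi>_def image_subset_iff)
  \<comment> \<open>Only the law of \<open>Y n\<close> is known, so its values are codes up to a
    null set; this is why the convergence obtained at the end is almost sure.\<close>
  have YK: "AE w in \<Omega>. Y n w \<in> K" for n
  proof -
    have "AE y in m (r n). s y \<in> K" using K(2) by auto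
    then have "AE k in \<mu> (r n). k \<in> K"
      unfolding \<mu>_def using K(1) by (subst AE_distr_iff[OF sm]) auto
    then show ?thesis unfolding Y(2)[symmetric] using K(1) by (subst (asm) AE_distr_iff[OF Y(1)]) auto
  qed
  show thesis
  proof (rule that[OF r Om])
    show "(\<lambda>w. \<Psi> (Y n w)) \<in> borel_measurable \<Omega>" for n using Y(1) by measurable
    show "(\<lambda>w. \<Psi> (Y0 w)) \<in> borel_measurable \<Omega>" using Y0 by measurable
    show "distr \<Omega> borel (\<lambda>w. \<Psi> (Y n w)) = m (r n)" for n
    proof -
      have "distr \<Omega> borel (\<lambda>w. \<Psi> (Y n w)) = distr (\<mu> (r n)) borel \<Psi>"
        unfolding Y(2)[symmetric] by (subst distr_distr[OF \<Psi> Y(1)]) (simp add: comp_def)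
      also have "\<dots> = distr (m (r n)) borel (\<lambda>y. y)"
        unfolding \<mu>_def by (subst distr_distr[OF \<Psi> sm]) (simp add: comp_def \<Psi>s)
      finally show ?thesis using P2_distr_id[OF m] by simp
    qed
    have "AE w in \<Omega>. \<forall>n. Y n w \<in> K" using YK by (simp add: AE_all_countable)
    then show "AE w in \<Omega>. (\<lambda>n. \<Psi> (Y n w)) \<longlonglongrightarrow> \<Psi> (Y0 w)"
    proof (rule AE_mp[OF _ AE_I2], intro impI)
      fix w assume w: "w \<in> space \<Omega>" "\<forall>n. Y n w \<in> K"
      have "Y0 w \<in> K" using closed_sequentially[OF K(1) _ lim[OF w(1)]] w(2) by auto
      then have "(\<lambda>n. \<Phi> (Y n w)) \<longlonglongrightarrow> \<Phi> (Y0 w)"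
        using \<Phi>(1) lim[OF w(1)] w(2) unfolding continuous_on_sequentially by (auto simp: comp_def)
      then show "(\<lambda>n. \<Psi> (Y n w)) \<longlonglongrightarrow> \<Psi> (Y0 w)"
        using w(2) \<open>Y0 w \<in> K\<close> by (simp add: \<Psi>_def)
    qed
  qed
qed

text \<open>Almost sure convergence gives the last clause by Fatou, and the bound on fourth moments
  contained in that on \<open>psi\<close> makes the squared distances uniformly integrable, which
  yields convergence in \<open>d2\<close>. The integral of \<open>psi\<close> may drop in the limit;
  this is harmless for a penalty that enters with a negative sign.\<close>

lemma P2_compact:
  fixes m :: "nat \<Rightarrow> 'b::euclidean_space measure"
  assumes m: "\<And>n. m n \<in> P2" and C: "\<And>n. (\<integral>\<^sup>+y. ennreal (psi y) \<partial>m n) \<le> ennreal C" "0 \<le> C"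
  obtains r :: "nat \<Rightarrow> nat" and \<Omega> :: "real measure" and X X0
  where "strict_mono r" "prob_space \<Omega>" "\<And>n. X n \<in> borel_measurable \<Omega>"
    "\<And>n. distr \<Omega> borel (X n) = m (r n)" "X0 \<in> borel_measurable \<Omega>"
    "AE w in \<Omega>. (\<lambda>n. X n w) \<longlonglongrightarrow> X0 w"
    "distr \<Omega> borel X0 \<in> P2" "(\<lambda>n. d2 (m (r n)) (distr \<Omega> borel X0)) \<longlonglongrightarrow> 0"
    "(\<integral>\<^sup>+y. ennreal (psi y) \<partial>distr \<Omega> borel X0) \<le> liminf (\<lambda>n. \<integral>\<^sup>+y. ennreal (psi y) \<partial>m (r n))"
proof -
  obtain r :: "nat \<Rightarrow> nat" and \<Omega> :: "real measure" and X X0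
    where r: "strict_mono r" and Om: "prob_space \<Omega>" and X[measurable]: "\<And>n. X n \<in> borel_measurable \<Omega>"
    and dX: "\<And>n. distr \<Omega> borel (X n) = m (r n)" and X0[measurable]: "X0 \<in> borel_measurable \<Omega>"
    and lim: "AE w in \<Omega>. (\<lambda>n. X n w) \<longlonglongrightarrow> X0 w"
    by (rule P2_Skorohod[OF assms], rule that)
  interpret Om: prob_space \<Omega> by (rule Om)
  have eX: "(\<integral>\<^sup>+y. ennreal (psi y) \<partial>m (r n)) = (\<integral>\<^sup>+w. ennreal (psi (X n w)) \<partial>\<Omega>)" for n
    unfolding dX[symmetric] by (subst nn_integral_distr[OF X]) auto
  have eX0: "(\<integral>\<^sup>+y. ennreal (psi y) \<partial>distr \<Omega> borel X0) = (\<integral>\<^sup>+w. ennreal (psi (X0 w)) \<partial>\<Omega>)"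
    by (subst nn_integral_distr[OF X0]) auto
  have pc: "continuous_on UNIV (psi :: 'b \<Rightarrow> real)" unfolding psi_def by (intro continuous_intros)
  have "(\<integral>\<^sup>+w. ennreal (psi (X0 w)) \<partial>\<Omega>) = (\<integral>\<^sup>+w. liminf (\<lambda>n. ennreal (psi (X n w))) \<partial>\<Omega>)"
  proof (rule nn_integral_cong_AE, use lim in eventually_elim)
    fix w assume "(\<lambda>n. X n w) \<longlonglongrightarrow> X0 w"
    then have "(\<lambda>n. psi (X n w)) \<longlonglongrightarrow> psi (X0 w)"
      using continuous_on_tendsto_compose[OF pc] by auto
    then have "(\<lambda>n. ennreal (psi (X n w))) \<longlonglongrightarrow> ennreal (psi (X0 w))" by (rule tendsto_ennrealI)
    then show "ennreal (psi (X0 w)) = liminf (\<lambda>n. ennreal (psi (X n w)))"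
      by (rule lim_imp_Liminf[OF sequentially_bot, symmetric])
  qed
  also have "\<dots> \<le> liminf (\<lambda>n. \<integral>\<^sup>+w. ennreal (psi (X n w)) \<partial>\<Omega>)"
    by (rule nn_integral_liminf) measurable
  finally have F: "(\<integral>\<^sup>+y. ennreal (psi y) \<partial>distr \<Omega> borel X0) \<le> liminf (\<lambda>n. \<integral>\<^sup>+y. ennreal (psi y) \<partial>m (r n))"
    unfolding eX eX0 .
  also have "\<dots> \<le> liminf (\<lambda>n::nat. ennreal C)" by (rule Liminf_mono) (simp add: C)
  also have "\<dots> = ennreal C" by (simp add: Liminf_const)
  finally have FC: "(\<integral>\<^sup>+y. ennreal (psi y) \<partial>distr \<Omega> borel X0) \<le> ennreal C" .
  have P0: "distr \<Omega> borel X0 \<in> P2"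
    by (rule P2_psi) (use FC in \<open>auto intro: Om.prob_space_distr le_less_trans\<close>)
  have dlim: "(\<lambda>n. d2 (m (r n)) (distr \<Omega> borel X0)) \<longlonglongrightarrow> 0"
  proof (rule LIMSEQ_I)
    fix e :: real assume e: "0 < e"
    \<comment> \<open>Uniform integrability by hand: \<open>g\<close> is at most
      \<open>min g A\<close> plus \<open>g\<^sup>2 / A\<close>. The first part tends to 0 by
      dominated convergence, the second is controlled by \<open>psi\<close> since
      \<open>g\<^sup>2\<close> is of fourth order.\<close>
    define g where "g n w = (dist (X n w) (X0 w))\<^sup>2" for n w
    have [measurable]: "g n \<in> borel_measurable \<Omega>" for n unfolding g_def by measurable
    have g4: "(g n w)\<^sup>2 \<le> 8 * psi (X n w) + 8 * psi (X0 w)" for n w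
    proof -
      let ?a = "norm (X n w)" and ?b = "norm (X0 w)"
      have "dist (X n w) (X0 w) \<le> ?a + ?b" by (simp add: dist_norm norm_triangle_ineq4)
      then have "g n w \<le> (?a + ?b)\<^sup>2" unfolding g_def by (rule power_mono) simp
      also have "\<dots> \<le> 2 * ?a\<^sup>2 + 2 * ?b\<^sup>2" using sum_squares_bound[of ?a ?b] by (simp add: power2_sum)
      finally have "(g n w)\<^sup>2 \<le> (2 * ?a\<^sup>2 + 2 * ?b\<^sup>2)\<^sup>2" by (rule power_mono) (simp add: g_def)
      also have "\<dots> \<le> 8 * ?a^4 + 8 * ?b^4"
        using sum_squares_bound[of "?a\<^sup>2" "?b\<^sup>2"] by (simp add: power2_sum power_mult_distrib flip: power_mult)
      finally show ?thesis using psi_ge(2)[of "X n w"] psi_ge(2)[of "X0 w"] by linarith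
    qed
    \<comment> \<open>Both parts of the cost will be at most \<open>h\<close>, and
      \<open>sqrt (2 * h)\<close> is below \<open>e\<close>.\<close>
    define h where "h = e\<^sup>2 / 4"
    have h: "0 < h" "sqrt (h + h) < e"
    proof -
      show "0 < h" using e by (simp add: h_def)
      have "sqrt (h + h) < sqrt (e\<^sup>2)" using e unfolding h_def by (intro real_sqrt_less_mono) simp
      then show "sqrt (h + h) < e" using e by simp
    qed
    \<comment> \<open>The fourth order part costs \<open>8 / A\<close> times two integrals of
      \<open>psi\<close>, each at most \<open>C\<close>; the choice makes \<open>16 * C / A\<close>
      at most \<open>h\<close>.\<close>
    define A where "A = 16 * C / h + 1"
    have A: "0 < A" "16 * C / A \<le> h"
    proof -
      show "0 < A" unfolding A_def using C(2) h by (simp add: add_nonneg_pos)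
      then show "16 * C / A \<le> h" unfolding A_def using C(2) h by (simp add: field_simps)
    qed
    have gm: "g n w \<le> min (g n w) A + (g n w)\<^sup>2 / A" for n w
    proof (cases "g n w \<le> A")
      case False
      then have "g n w * A \<le> g n w * g n w" using A by (intro mult_left_mono) auto
      then have "g n w \<le> (g n w)\<^sup>2 / A" using A by (simp add: le_divide_eq power2_eq_square)
      then show ?thesis using A False by simp
    qed (use A in simp)
    have "(\<lambda>n. \<integral>w. min (g n w) A \<partial>\<Omega>) \<longlonglongrightarrow> (\<integral>w. 0 \<partial>\<Omega>)"
    proof (rule integral_dominated_convergence[where w="\<lambda>_. A"])
      show "AE w in \<Omega>. (\<lambda>n. min (g n w) A) \<longlonglongrightarrow> 0"
        using lim
      proof eventually_elim
        fix w assume "(\<lambda>n. X n w) \<longlonglongrightarrow> X0 w"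
        then have "(\<lambda>n. min (g n w) A) \<longlonglongrightarrow> min ((dist (X0 w) (X0 w))\<^sup>2) A"
          unfolding g_def by (intro tendsto_intros)
        then show "(\<lambda>n. min (g n w) A) \<longlonglongrightarrow> 0" using A by simp
      qed
      show "AE w in \<Omega>. norm (min (g n w) A) \<le> A" for n using A by (auto simp: g_def)
    qed auto
    then have "\<forall>\<^sub>F n in sequentially. (\<integral>w. min (g n w) A \<partial>\<Omega>) < h" using h by (auto intro: order_tendstoD)
    then obtain N where N: "\<And>n. n \<ge> N \<Longrightarrow> (\<integral>w. min (g n w) A \<partial>\<Omega>) < h"
      unfolding eventually_sequentially by blast
    show "\<exists>no. \<forall>n\<ge>no. norm (d2 (m (r n)) (distr \<Omega> borel X0) - 0) < e"
    proof (intro exI[of _ N] allI impI)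
      fix n assume n: "n \<ge> N"
      have im: "integrable \<Omega> (\<lambda>w. min (g n w) A)"
        by (rule bounded_integrable[OF Om, of _ A]) (use A in \<open>auto simp: g_def\<close>)
      have "(\<integral>\<^sup>+w. ennreal ((dist (X n w) (X0 w))\<^sup>2) \<partial>\<Omega>)
         \<le> (\<integral>\<^sup>+w. ennreal (min (g n w) A) + ennreal (8/A) * (ennreal (psi (X n w)) + ennreal (psi (X0 w))) \<partial>\<Omega>)"
      proof (rule nn_integral_mono)
        fix w
        have "g n w \<le> min (g n w) A + 8/A * (psi (X n w) + psi (X0 w))"
        proof -
          have "(g n w)\<^sup>2 / A \<le> (8 * psi (X n w) + 8 * psi (X0 w)) / A"
            using g4 A by (intro divide_right_mono) auto
          then show ?thesis using gm[of n w] by (simp add: field_simps)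
        qed
        then have "ennreal (g n w) \<le> ennreal (min (g n w) A + 8/A * (psi (X n w) + psi (X0 w)))"
          by (rule ennreal_leI)
        also have "\<dots> = ennreal (min (g n w) A) + ennreal (8/A) * (ennreal (psi (X n w)) + ennreal (psi (X0 w)))"
        proof -
          have "0 \<le> min (g n w) A" using A by (simp add: g_def)
          moreover have "ennreal (a + b * (c + d)) = ennreal a + ennreal b * (ennreal c + ennreal d)"
            if "0 \<le> a" "0 \<le> b" "0 \<le> c" "0 \<le> d" for a b c d
            using that by (simp add: ennreal_mult)
          moreover have "0 \<le> 8 / A" using A by simp
          ultimately show ?thesis using psi_ge(5) by blast
        qed
        finally show "ennreal ((dist (X n w) (X0 w))\<^sup>2) \<le> ennreal (min (g n w) A) + ennreal (8/A) * (ennreal (psi (X n w)) + ennreal (psi (X0 w)))"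
          unfolding g_def .
      qed
      also have "\<dots> = (\<integral>\<^sup>+w. ennreal (min (g n w) A) \<partial>\<Omega>) + ennreal (8/A) * ((\<integral>\<^sup>+w. ennreal (psi (X n w)) \<partial>\<Omega>) + (\<integral>\<^sup>+w. ennreal (psi (X0 w)) \<partial>\<Omega>))"
        by (simp add: nn_integral_add nn_integral_cmult)
      also have "\<dots> \<le> ennreal h + ennreal (8/A) * (ennreal C + ennreal C)"
      proof (intro add_mono mult_left_mono)
        have "(\<integral>\<^sup>+w. ennreal (min (g n w) A) \<partial>\<Omega>) = ennreal (\<integral>w. min (g n w) A \<partial>\<Omega>)"
          using A by (intro nn_integral_eq_integral[OF im]) (auto simp: g_def)
        then show "(\<integral>\<^sup>+w. ennreal (min (g n w) A) \<partial>\<Omega>) \<le> ennreal h" using N[OF n] by (simp add: ennreal_leI)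
        show "(\<integral>\<^sup>+w. ennreal (psi (X n w)) \<partial>\<Omega>) \<le> ennreal C" using C(1)[of "r n"] unfolding eX .
        show "(\<integral>\<^sup>+w. ennreal (psi (X0 w)) \<partial>\<Omega>) \<le> ennreal C" using FC unfolding eX0 .
      qed auto
      also have "\<dots> = ennreal (h + 16 * C / A)"
        using A C(2) h by (simp add: ennreal_plus[symmetric] ennreal_mult[symmetric] field_simps del: ennreal_plus)
      also have "\<dots> \<le> ennreal (h + h)" using A by (intro ennreal_leI) simp
      finally have "(\<integral>\<^sup>+w. ennreal ((dist (X n w) (X0 w))\<^sup>2) \<partial>\<Omega>) \<le> ennreal (h + h)" .
      from d2_distr_le[OF Om X X0 _ this] h have "d2 (m (r n)) (distr \<Omega> borel X0) \<le> sqrt (h + h)"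
        unfolding dX by simp
      moreover have "0 \<le> d2 (m (r n)) (distr \<Omega> borel X0)"
        using d2_distr_nonneg[OF Om X X0] unfolding dX .
      ultimately show "norm (d2 (m (r n)) (distr \<Omega> borel X0) - 0) < e" using h by simp
    qed
  qed
  show thesis by (rule that[OF r Om X dX X0 lim P0 dlim F])
qed

section \<open>Regularity of the Hamiltonians\<close>

lemma mvt_real:
  fixes \<phi> :: "real \<Rightarrow> real"
  assumes "\<And>s. (\<phi> has_real_derivative \<phi>' s) (at s)"
  obtains z where "\<bar>z\<bar> \<le> \<bar>t\<bar>" "\<phi> t - \<phi> 0 = t * \<phi>' z"
proof -
  consider "t > 0" | "t = 0" | "t < 0" by linarith
  then show thesis
  proof cases
    case 1
    from MVT2[of 0 t \<phi> \<phi>', OF 1 assms] obtain z where "0 < z" "z < t" "\<phi> t - \<phi> 0 = (t - 0) * \<phi>' z" by blast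
    then show thesis by (intro that[of z]) auto
  next
    case 2
    then show thesis by (intro that[of 0]) auto
  next
    case 3
    from MVT2[of t 0 \<phi> \<phi>', OF 3 assms] obtain z where "t < z" "z < 0" "\<phi> 0 - \<phi> t = (0 - t) * \<phi>' z" by blast
    then show thesis by (intro that[of z]) (auto simp: algebra_simps)
  qed
qed

text \<open>The norms in the standing assumptions speak of directional derivatives along basis
  vectors only. Continuity of these gives a total derivative, by changing the coordinates one at a
  time and applying the mean value theorem to each change.\<close>

lemma GDERIV_partials:
  fixes f :: "'e::euclidean_space \<Rightarrow> real"
  assumes d: "\<And>e x. e \<in> Basis \<Longrightarrow> ((\<lambda>s. f (x + s *\<^sub>R e)) has_real_derivative g e x) (at 0)"
    and c: "\<And>e. e \<in> Basis \<Longrightarrow> continuous_on UNIV (g e)"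
  shows "GDERIV f x :> (\<Sum>e\<in>Basis. g e x *\<^sub>R e)"
proof -
  have d': "((\<lambda>s. f (x + s *\<^sub>R e)) has_real_derivative g e (x + s *\<^sub>R e)) (at s)" if "e \<in> Basis" for e x s
  proof -
    have "((\<lambda>r. f ((x + s *\<^sub>R e) + r *\<^sub>R e)) has_real_derivative g e (x + s *\<^sub>R e)) (at (s - s))"
      using d[OF that, of "x + s *\<^sub>R e"] by simp
    then have "((\<lambda>r. f (x + s *\<^sub>R e + (r - s) *\<^sub>R e)) has_real_derivative g e (x + s *\<^sub>R e) * 1) (at s)"
      by (rule DERIV_chain'[rotated]) (auto intro!: derivative_eq_intros)
    then show ?thesis by (simp add: algebra_simps)
  qed
  define k where "k B h = (\<Sum>e\<in>B. (h \<bullet> e) *\<^sub>R e)" for B and h :: 'e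
  \<comment> \<open>Induction over the set \<open>B\<close> of coordinates already changed. The next
    one starts from \<open>x + k B h\<close>, so its intermediate point is at distance at most
    \<open>(card B + 1) * norm h\<close> from \<open>x\<close>, whence the radius
    \<open>\<delta>2 / ?c\<close> below.\<close>
  have P: "\<exists>\<delta>>0. \<forall>h. norm h < \<delta> \<longrightarrow> \<bar>f (x + k B h) - f x - (\<Sum>e\<in>B. (h \<bullet> e) * g e x)\<bar> \<le> \<epsilon> * norm h"
    if "finite B" "B \<subseteq> Basis" "\<epsilon> > 0" for B \<epsilon>
    using that
  proof (induction B arbitrary: \<epsilon> rule: finite_induct)
    case empty
    then show ?case by (intro exI[of _ 1]) (auto simp: k_def)
  next
    case (insert b B)
    then have b: "b \<in> Basis" by auto
    from insert obtain \<delta>1 where \<delta>1: "\<delta>1 > 0"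
      "\<And>h. norm h < \<delta>1 \<Longrightarrow> \<bar>f (x + k B h) - f x - (\<Sum>e\<in>B. (h \<bullet> e) * g e x)\<bar> \<le> \<epsilon>/2 * norm h"
      by (metis half_gt_zero insert_subset)
    obtain \<delta>2 where \<delta>2: "\<delta>2 > 0" "\<And>y. dist y x < \<delta>2 \<Longrightarrow> \<bar>g b y - g b x\<bar> < \<epsilon>/2"
      using c[OF b] insert.prems(2) unfolding continuous_on_iff
      by (metis UNIV_I dist_real_def half_gt_zero)
    let ?c = "real (card B) + 1"
    show ?case
    proof (intro exI[of _ "min \<delta>1 (\<delta>2 / ?c)"] conjI allI impI)
      show "0 < min \<delta>1 (\<delta>2 / ?c)" using \<delta>1 \<delta>2 by simp
      fix h :: 'e assume h: "norm h < min \<delta>1 (\<delta>2 / ?c)"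
      have kn: "norm (k B h) \<le> card B * norm h"
        unfolding k_def using insert.prems(1) insert.hyps(1)
        by (intro sum_norm_bound) (auto intro!: Basis_le_norm simp: subset_iff)
      have kb: "x + k (insert b B) h = (x + k B h) + (h \<bullet> b) *\<^sub>R b"
        using insert.hyps by (simp add: k_def algebra_simps)
      obtain z where z: "\<bar>z\<bar> \<le> \<bar>h \<bullet> b\<bar>"
        "f ((x + k B h) + (h \<bullet> b) *\<^sub>R b) - f ((x + k B h) + 0 *\<^sub>R b) = (h \<bullet> b) * g b ((x + k B h) + z *\<^sub>R b)"
        by (rule mvt_real[OF d'[OF b, of "x + k B h"]])
      have z2: "f ((x + k B h) + (h \<bullet> b) *\<^sub>R b) - f (x + k B h) = (h \<bullet> b) * g b ((x + k B h) + z *\<^sub>R b)"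
        using z(2) by simp
      have "dist ((x + k B h) + z *\<^sub>R b) x \<le> norm (k B h) + norm (z *\<^sub>R b)"
        using norm_triangle_ineq[of "k B h" "z *\<^sub>R b"] by (simp add: dist_norm add.assoc)
      also have "norm (z *\<^sub>R b) \<le> norm h" using z(1) Basis_le_norm[OF b, of h] b by simp
      finally have "dist ((x + k B h) + z *\<^sub>R b) x \<le> ?c * norm h" using kn by (simp add: algebra_simps)
      also have "\<dots> < \<delta>2" using h by (simp add: field_simps)
      finally have "\<bar>g b ((x + k B h) + z *\<^sub>R b) - g b x\<bar> \<le> \<epsilon>/2" using \<delta>2(2) by (simp add: less_imp_le)
      then have "\<bar>h \<bullet> b\<bar> * \<bar>g b ((x + k B h) + z *\<^sub>R b) - g b x\<bar> \<le> norm h * (\<epsilon>/2)"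
        using Basis_le_norm[OF b, of h] by (intro mult_mono) auto
      then have "\<bar>(h \<bullet> b) * g b ((x + k B h) + z *\<^sub>R b) - (h \<bullet> b) * g b x\<bar> \<le> \<epsilon>/2 * norm h"
        by (simp add: abs_mult[symmetric] right_diff_distrib mult.commute)
      moreover have "\<bar>f (x + k B h) - f x - (\<Sum>e\<in>B. (h \<bullet> e) * g e x)\<bar> \<le> \<epsilon>/2 * norm h"
        using \<delta>1(2) h by simp
      moreover have "(\<Sum>e\<in>insert b B. (h \<bullet> e) * g e x) = (h \<bullet> b) * g b x + (\<Sum>e\<in>B. (h \<bullet> e) * g e x)"
        using insert.hyps by simp
      ultimately show "\<bar>f (x + k (insert b B) h) - f x - (\<Sum>e\<in>insert b B. (h \<bullet> e) * g e x)\<bar> \<le> \<epsilon> * norm h"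
        using z2 unfolding kb by argo
    qed
  qed
  show ?thesis
    unfolding gderiv_def has_derivative_at_alt
  proof (intro conjI allI impI)
    fix \<epsilon> :: real assume "0 < \<epsilon>"
    from P[OF finite_Basis subset_refl this] obtain \<delta> where \<delta>: "\<delta> > 0"
      "\<And>h. norm h < \<delta> \<Longrightarrow> \<bar>f (x + k Basis h) - f x - (\<Sum>e\<in>Basis. (h \<bullet> e) * g e x)\<bar> \<le> \<epsilon> * norm h"
      by blast
    have kk: "k Basis h = h" for h unfolding k_def by (rule euclidean_representation)
    show "\<exists>d>0. \<forall>y. norm (y - x) < d \<longrightarrow>
      norm (f y - f x - (y - x) \<bullet> (\<Sum>e\<in>Basis. g e x *\<^sub>R e)) \<le> \<epsilon> * norm (y - x)"
      using \<delta>(2)[of "_ - x"] unfolding kk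
      by (intro exI[of _ \<delta>] conjI \<delta>(1)) (simp add: inner_sum_right mult.commute)
  qed (rule bounded_linear_inner_left)
qed

lemma grad_eq: "GDERIV f x :> D \<Longrightarrow> grad f x = D"
  unfolding grad_def
proof (rule the_equality)
  fix E assume D: "GDERIV f x :> D" and E: "GDERIV f x :> E"
  have "(\<lambda>h. h \<bullet> E) = (\<lambda>h. h \<bullet> D)"
    using has_derivative_unique D E unfolding gderiv_def by blast
  then have "\<forall>h. h \<bullet> E = h \<bullet> D" by (simp add: fun_eq_iff)
  then show "E = D" by (simp add: vector_eq_ldot)
qed

text \<open>Summing over coordinates costs the factor \<open>DIM('e)\<close>. The bound holds only
  on a ball, which is enough because a ball is convex.\<close>

lemma partials_Lipschitz:
  fixes f :: "'e::euclidean_space \<Rightarrow> real" and C :: real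
  assumes d: "\<And>e x. e \<in> Basis \<Longrightarrow> ((\<lambda>s. f (x + s *\<^sub>R e)) has_real_derivative g e x) (at 0)"
    and c: "\<And>e. e \<in> Basis \<Longrightarrow> continuous_on UNIV (g e)"
    and le: "\<And>e x. e \<in> Basis \<Longrightarrow> norm x \<le> R \<Longrightarrow> \<bar>g e x\<bar> \<le> C"
    and p: "norm p \<le> R" "norm q \<le> R"
  shows "\<bar>f p - f q\<bar> \<le> DIM('e) * C * norm (p - q)" "norm (grad f p) \<le> DIM('e) * C"
proof -
  let ?D = "\<lambda>x. \<Sum>e\<in>Basis. g e x *\<^sub>R e"
  have D: "GDERIV f x :> ?D x" for x by (rule GDERIV_partials[OF d c])
  have n: "norm (?D x) \<le> DIM('e) * C" if "norm x \<le> R" for x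
    using le[OF _ that] by (intro sum_norm_bound) auto
  show "norm (grad f p) \<le> DIM('e) * C" using grad_eq[OF D] n[OF p(1)] by simp
  have "norm (f p - f q) \<le> DIM('e) * C * norm (p - q)"
  proof (rule differentiable_bound[of "cball 0 R" f "\<lambda>x h. h \<bullet> ?D x"])
    fix x :: 'e assume x: "x \<in> cball 0 R"
    show "(f has_derivative (\<lambda>h. h \<bullet> ?D x)) (at x within cball 0 R)"
      using D[of x] unfolding gderiv_def by (rule has_derivative_at_withinI)
    show "onorm (\<lambda>h. h \<bullet> ?D x) \<le> DIM('e) * C"
    proof (rule onorm_le)
      fix h
      have "norm (h \<bullet> ?D x) \<le> norm h * norm (?D x)" by (simp add: Cauchy_Schwarz_ineq2)
      also have "\<dots> \<le> norm h * (DIM('e) * C)" using n[of x] x by (intro mult_left_mono) auto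
      finally show "norm (h \<bullet> ?D x) \<le> DIM('e) * C * norm h" by (simp add: mult.commute)
    qed
  qed (use p in auto)
  then show "\<bar>f p - f q\<bar> \<le> DIM('e) * C * norm (p - q)" by simp
qed

section \<open>From the multi-index norms to local bounds on the Hamiltonians\<close>

lemma bounded_multi_normD:
  fixes V :: "'b::euclidean_space measure \<Rightarrow> 'e::euclidean_space \<Rightarrow> real"
  assumes V: "bounded_multi_norm S Bs ns V" and fin: "\<And>B. B \<in> set Bs \<Longrightarrow> finite B"
  obtains C where "0 \<le> C" "\<And>m ls vs z. m \<in> P2 \<Longrightarrow> ls \<in> multi_indices ns \<Longrightarrow> vs \<in> directions Bs ls \<Longrightarrow>
    z \<in> S \<Longrightarrow> \<bar>iter_deriv vs (V m) z\<bar> \<le> C"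
proof -
  obtain C where C: "\<And>m. m \<in> P2 \<Longrightarrow> multi_norm S Bs ns (V m) \<le> ennreal C"
    using V unfolding bounded_multi_norm_def by blast
  show thesis
  \<comment> \<open>\<open>ennreal\<close> sends a negative \<open>C\<close> to 0, so
    \<open>max C 0\<close> is the real bound that is actually available.\<close>
  proof (rule that[of "max C 0"])
    fix m :: "'b measure" and ls vs z assume a: "m \<in> P2" "ls \<in> multi_indices ns" "vs \<in> directions Bs ls" "z \<in> S"
    have "\<bar>iter_deriv vs (V m) z\<bar> = sqrt ((iter_deriv vs (V m) z)\<^sup>2)" by simp
    \<comment> \<open>Finiteness of the blocks enters here: a sum over an infinite set of directions
      would be 0 and bound nothing.\<close>
    also have "\<dots> \<le> tensor_norm Bs ls (V m) z"
      unfolding tensor_norm_def using a(3) finite_directions[OF fin]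
      by (intro real_sqrt_le_mono member_le_sum) auto
    finally have 1: "\<bar>iter_deriv vs (V m) z\<bar> \<le> tensor_norm Bs ls (V m) z" .
    have "ennreal (tensor_norm Bs ls (V m) z) \<le> (SUP z\<in>S. ennreal (tensor_norm Bs ls (V m) z))"
      using a(4) by (rule SUP_upper)
    also have "\<dots> \<le> multi_norm S Bs ns (V m)"
      unfolding multi_norm_def using a(2) finite_multi_indices
      by (intro member_le_sum) auto
    also have "\<dots> \<le> ennreal (max C 0)" using C[OF a(1)] by (rule order_trans) (simp add: ennreal_leI)
    finally have "tensor_norm Bs ls (V m) z \<le> max C 0" by (subst (asm) ennreal_le_iff) auto
    with 1 show "\<bar>iter_deriv vs (V m) z\<bar> \<le> max C 0" by linarith
  qed simp
qed

text \<open>Only derivatives in the momentum are used, and the momentum is the last block both for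
  \<open>H\<close> and for \<open>H0\<close>; the other entries of the index list are 0.\<close>

lemma directions_last:
  assumes "set vs \<subseteq> B"
  shows "vs \<in> directions [A, B] [0, length vs]" "vs \<in> directions [A', A, B] [0, 0, length vs]"
proof -
  show "vs \<in> directions [A, B] [0, length vs]"
    unfolding directions_def using assms
    by (intro CollectI exI[of _ "[[], vs]"]) (auto simp: less_Suc_eq)
  show "vs \<in> directions [A', A, B] [0, 0, length vs]"
    unfolding directions_def using assms
    by (intro CollectI exI[of _ "[[], [], vs]"]) (auto simp: less_Suc_eq)
qed

text \<open>The argument common to \<open>H\<close> and \<open>H0\<close>: \<open>P\<close> inserts
  the momentum into the tuple of variables while the others stay frozen, and \<open>J\<close> is its
  linear part on basis vectors. Two orders of momentum derivatives give Lipschitz bounds for the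
  function and for its gradient.\<close>

lemma block_C2:
  fixes F :: "'w::euclidean_space \<Rightarrow> real" and J :: "'e::euclidean_space \<Rightarrow> 'w" and P :: "'e \<Rightarrow> 'w"
    and C :: real
  assumes P: "\<And>p s e. P (p + s *\<^sub>R e) = P p + s *\<^sub>R J e" "continuous_on UNIV P"
    and d1: "\<And>e z. e \<in> Basis \<Longrightarrow> (\<lambda>s. F (z + s *\<^sub>R J e)) field_differentiable at 0"
    and d2: "\<And>e e' z. e \<in> Basis \<Longrightarrow> e' \<in> Basis \<Longrightarrow>
        (\<lambda>s. iter_deriv [J e] F (z + s *\<^sub>R J e')) field_differentiable at 0"
    and c1: "\<And>e. e \<in> Basis \<Longrightarrow> continuous_on UNIV (iter_deriv [J e] F)"
    and c2: "\<And>e e'. e \<in> Basis \<Longrightarrow> e' \<in> Basis \<Longrightarrow> continuous_on UNIV (iter_deriv [J e', J e] F)"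
    and b1: "\<And>e p. e \<in> Basis \<Longrightarrow> norm p \<le> R \<Longrightarrow> \<bar>iter_deriv [J e] F (P p)\<bar> \<le> C"
    and b2: "\<And>e e' p. e \<in> Basis \<Longrightarrow> e' \<in> Basis \<Longrightarrow> norm p \<le> R \<Longrightarrow> \<bar>iter_deriv [J e', J e] F (P p)\<bar> \<le> C"
  shows "grad (\<lambda>p. F (P p)) p = (\<Sum>e\<in>Basis. iter_deriv [J e] F (P p) *\<^sub>R e)"
    and "norm p \<le> R \<Longrightarrow> norm (grad (\<lambda>p. F (P p)) p) \<le> DIM('e) * C"
    and "norm p \<le> R \<Longrightarrow> norm q \<le> R \<Longrightarrow> \<bar>F (P p) - F (P q)\<bar> \<le> DIM('e) * C * norm (p - q)"
    and "norm p \<le> R \<Longrightarrow> norm q \<le> R \<Longrightarrow>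
      norm (grad (\<lambda>p. F (P p)) p - grad (\<lambda>p. F (P p)) q) \<le> DIM('e) * (DIM('e) * C * norm (p - q))"
proof -
  have D1: "((\<lambda>s. F (P (p + s *\<^sub>R e))) has_real_derivative iter_deriv [J e] F (P p)) (at 0)" if "e \<in> Basis" for e p
    unfolding P(1) using d1[OF that, of "P p"]
    by (simp add: dir_deriv_def field_differentiable_derivI)
  have D2: "((\<lambda>s. iter_deriv [J e] F (P (p + s *\<^sub>R e'))) has_real_derivative iter_deriv [J e', J e] F (P p)) (at 0)"
    if "e \<in> Basis" "e' \<in> Basis" for e e' p
    unfolding P(1) using field_differentiable_derivI[OF d2[OF that, of "P p"]]
    by (simp add: dir_deriv_def[of "J e'"])
  have C1: "continuous_on UNIV (\<lambda>p. iter_deriv [J e] F (P p))" if "e \<in> Basis" for e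
    using continuous_on_compose2[OF c1[OF that] P(2)] by auto
  have C2: "continuous_on UNIV (\<lambda>p. iter_deriv [J e', J e] F (P p))" if "e \<in> Basis" "e' \<in> Basis" for e e'
    using continuous_on_compose2[OF c2[OF that] P(2)] by auto
  show g: "grad (\<lambda>p. F (P p)) p = (\<Sum>e\<in>Basis. iter_deriv [J e] F (P p) *\<^sub>R e)" for p
    by (rule grad_eq, rule GDERIV_partials[OF D1 C1])
  show "norm p \<le> R \<Longrightarrow> norm (grad (\<lambda>p. F (P p)) p) \<le> DIM('e) * C"
    by (rule partials_Lipschitz(2)[OF D1 C1 b1])
  show "norm p \<le> R \<Longrightarrow> norm q \<le> R \<Longrightarrow> \<bar>F (P p) - F (P q)\<bar> \<le> DIM('e) * C * norm (p - q)"
    by (rule partials_Lipschitz(1)[OF D1 C1 b1])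
  assume pq: "norm p \<le> R" "norm q \<le> R"
  have "grad (\<lambda>p. F (P p)) p - grad (\<lambda>p. F (P p)) q =
     (\<Sum>e\<in>Basis. (iter_deriv [J e] F (P p) - iter_deriv [J e] F (P q)) *\<^sub>R e)"
    unfolding g by (simp add: sum_subtractf scaleR_left_diff_distrib)
  also have "norm \<dots> \<le> DIM('e) * (DIM('e) * C * norm (p - q))"
  proof (rule sum_norm_bound)
    fix e :: 'e assume e: "e \<in> Basis"
    have "\<bar>iter_deriv [J e] F (P p) - iter_deriv [J e] F (P q)\<bar> \<le> DIM('e) * C * norm (p - q)"
      by (rule partials_Lipschitz(1)[OF D2[OF e] C2[OF e] b2[OF e] pq])
    then show "norm ((iter_deriv [J e] F (P p) - iter_deriv [J e] F (P q)) *\<^sub>R e) \<le> DIM('e) * C * norm (p - q)"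
      using e by simp
  qed
  finally show "norm (grad (\<lambda>p. F (P p)) p - grad (\<lambda>p. F (P p)) q) \<le> DIM('e) * (DIM('e) * C * norm (p - q))" .
qed

lemma finite_blocks: "B \<in> set blocks2 \<Longrightarrow> finite B" "B' \<in> set blocks3 \<Longrightarrow> finite B'"
  by (auto simp: blocks2_def blocks3_def blocks1_def add_block_def)

text \<open>Exactly what the difference of two master equations asks of a Hamiltonian, on a ball
  that contains the gradients of both solutions.\<close>

definition Hamiltonian_bound :: "real \<Rightarrow> real \<Rightarrow> ('e::euclidean_space \<Rightarrow> real) \<Rightarrow> bool" where
  "Hamiltonian_bound R C h \<longleftrightarrow> (\<forall>p q. norm p \<le> R \<longrightarrow> norm q \<le> R \<longrightarrow>
     norm (grad h p) \<le> C \<and> \<bar>h p - h q\<bar> \<le> C * norm (p - q) \<and> norm (grad h p - grad h q) \<le> C * norm (p - q))"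

text \<open>The assumptions are local in the momentum, so \<open>C\<close> depends on
  \<open>R\<close>. Joint continuity of the gradient is recorded because \<open>H_p\<close> is later
  evaluated along a measurable field of momenta and has to be measurable in
  \<open>y\<close>.\<close>

lemma assumption_H_facts:
  fixes H :: "'a::euclidean_space \<Rightarrow> 'b::euclidean_space \<Rightarrow> 'b \<Rightarrow> 'b measure \<Rightarrow> real"
  assumes H: "assumption_H n C0 \<gamma> H" and n: "n \<ge> 4" and R: "R > 0"
  obtains C where "0 \<le> C" "\<And>x0 x m. m \<in> P2 \<Longrightarrow> Hamiltonian_bound R C (\<lambda>p. H x0 x p m)"
    "\<And>m. m \<in> P2 \<Longrightarrow> continuous_on UNIV (\<lambda>(x0, x, p). grad (\<lambda>p. H x0 x p m) p)"
proof -
  let ?S = "{(x0::'a, x::'b, p::'b). norm p \<le> R}"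
  let ?V = "\<lambda>m (x0, x, p). H x0 x p m"
  let ?J = "\<lambda>e::'b. (0::'a, 0::'b, e)"
  have V: "bounded_multi_norm ?S blocks3 [3, n, n + 1] ?V" using H R unfolding assumption_H_def by blast
  obtain C where C: "0 \<le> C" "\<And>m ls vs z. m \<in> P2 \<Longrightarrow> ls \<in> multi_indices [3, n, n + 1] \<Longrightarrow> vs \<in> directions blocks3 ls \<Longrightarrow>
    z \<in> ?S \<Longrightarrow> \<bar>iter_deriv vs (?V m) z\<bar> \<le> C"
    by (rule bounded_multi_normD[OF V finite_blocks(2)], assumption, rule that)
  have CM: "C_multi blocks3 [3, n, n + 1] (?V m)" if "m \<in> P2" for m
    using V that unfolding bounded_multi_norm_def by blast
  have dir: "vs \<in> directions blocks3 [0, 0, length vs]" if "set vs \<subseteq> ?J ` Basis" for vs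
    unfolding blocks3_def blocks2_def blocks1_def add_block_def
    using directions_last(2)[of vs] that by (simp add: image_image)
  have mi: "[0, 0, k] \<in> multi_indices [3, n, n + 1]" if "k \<le> 2" for k
    using that n by (simp add: multi_indices_def)
  define D where "D = real DIM('b)"
  have D: "1 \<le> D" using DIM_positive[where 'a='b] unfolding D_def by linarith
  have cont: "continuous_on UNIV (iter_deriv vs (?V m))" if "m \<in> P2" "set vs \<subseteq> ?J ` Basis" "length vs \<le> 2" for m vs
    using CM[OF that(1)] dir[OF that(2)] mi[OF that(3)] unfolding C_multi_def by blast
  have diff: "(\<lambda>s. iter_deriv vs (?V m) (z + s *\<^sub>R v)) field_differentiable (at 0)"
    if "m \<in> P2" "set (v # vs) \<subseteq> ?J ` Basis" "length (v # vs) \<le> 2" for m v vs z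
    using CM[OF that(1)] dir[OF that(2)] mi[OF that(3)] unfolding C_multi_def by blast
  have bd: "\<bar>iter_deriv vs (?V m) (x0, x, p)\<bar> \<le> C"
    if "m \<in> P2" "set vs \<subseteq> ?J ` Basis" "length vs \<le> 2" "norm p \<le> R" for m vs x0 x p
    using C(2)[OF that(1) mi[OF that(3)] dir[OF that(2)]] that(4) by simp
  show thesis
  \<comment> \<open>One constant for all three estimates: \<open>D * C\<close> bounds the gradient
    and the increments of \<open>H\<close>, and \<open>D * (D * C)\<close> the increments of the
    gradient.\<close>
  proof (rule that[of "D * C + D * (D * C)"])
    show "0 \<le> D * C + D * (D * C)" using C(1) D by simp
    fix m :: "'b measure" assume m: "m \<in> P2"
    have P: "(x0::'a, x::'b, p + s *\<^sub>R e) = (x0, x, p) + s *\<^sub>R ?J e" for x0 x p s and e :: 'b by simp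
    have Pc: "continuous_on UNIV (\<lambda>p. (x0::'a, x::'b, p::'b))" for x0 x by (intro continuous_intros)
    have d1: "(\<lambda>s. ?V m (z + s *\<^sub>R ?J e)) field_differentiable at 0" if "e \<in> Basis" for e z
      using diff[OF m, of "?J e" "[]"] that by simp
    have d2: "(\<lambda>s. iter_deriv [?J e] (?V m) (z + s *\<^sub>R ?J e')) field_differentiable at 0"
      if "e \<in> Basis" "e' \<in> Basis" for e e' z
      using diff[OF m, of "?J e'" "[?J e]"] that by simp
    have c1: "continuous_on UNIV (iter_deriv [?J e] (?V m))" if "e \<in> Basis" for e
      using cont[OF m, of "[?J e]"] that by simp
    have c2: "continuous_on UNIV (iter_deriv [?J e', ?J e] (?V m))" if "e \<in> Basis" "e' \<in> Basis" for e e'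
      using cont[OF m, of "[?J e', ?J e]"] that by simp
    have b1: "\<bar>iter_deriv [?J e] (?V m) (x0, x, p)\<bar> \<le> C" if "e \<in> Basis" "norm p \<le> R" for e x0 x p
      using bd[OF m, of "[?J e]" p x0 x] that by simp
    have b2: "\<bar>iter_deriv [?J e', ?J e] (?V m) (x0, x, p)\<bar> \<le> C"
      if "e \<in> Basis" "e' \<in> Basis" "norm p \<le> R" for e e' x0 x p
      using bd[OF m, of "[?J e', ?J e]" p x0 x] that by simp
    note B' = block_C2[where F="?V m" and J="?J" and R=R and C=C, OF P Pc d1 d2 c1 c2 b1 b2, unfolded prod.case]
    have B1: "grad (\<lambda>p. H x0 x p m) p = (\<Sum>e\<in>Basis. iter_deriv [?J e] (?V m) (x0, x, p) *\<^sub>R e)" for x0 x p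
      by (rule B'(1))
    have "(\<lambda>(x0, x, p). grad (\<lambda>p. H x0 x p m) p) = (\<lambda>z. \<Sum>e\<in>Basis. iter_deriv [?J e] (?V m) z *\<^sub>R e)"
      by (auto simp: fun_eq_iff B1)
    then show "continuous_on UNIV (\<lambda>(x0, x, p). grad (\<lambda>p. H x0 x p m) p)"
      using c1 by (auto intro!: continuous_intros simp del: iter_deriv.simps)
    show "Hamiltonian_bound R (D * C + D * (D * C)) (\<lambda>p. H x0 x p m)" for x0 x
      unfolding Hamiltonian_bound_def
    proof (intro allI impI conjI)
      fix p q :: 'b assume pq: "norm p \<le> R" "norm q \<le> R"
      have B2: "norm (grad (\<lambda>p. H x0 x p m) p) \<le> D * C" unfolding D_def by (rule B'(2)) (assumption | rule pq)+
      have B3: "\<bar>H x0 x p m - H x0 x q m\<bar> \<le> D * C * norm (p - q)"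
        unfolding D_def by (rule B'(3)) (assumption | rule pq)+
      have B4: "norm (grad (\<lambda>p. H x0 x p m) p - grad (\<lambda>p. H x0 x p m) q) \<le> D * (D * C * norm (p - q))"
        unfolding D_def by (rule B'(4)) (assumption | rule pq)+
      have 0: "0 \<le> D * C" "0 \<le> D * (D * C)" using C(1) D by auto
      show "norm (grad (\<lambda>p. H x0 x p m) p) \<le> D * C + D * (D * C)"
        using B2 0 by linarith
      have "\<bar>H x0 x p m - H x0 x q m\<bar> \<le> D * C * norm (p - q)" by (rule B3)
      also have "\<dots> \<le> (D * C + D * (D * C)) * norm (p - q)" using 0 by (intro mult_right_mono) auto
      finally show "\<bar>H x0 x p m - H x0 x q m\<bar> \<le> (D * C + D * (D * C)) * norm (p - q)" .
      have "norm (grad (\<lambda>p. H x0 x p m) p - grad (\<lambda>p. H x0 x p m) q) \<le> D * (D * C) * norm (p - q)"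
        using B4 by (simp add: mult.assoc)
      also have "\<dots> \<le> (D * C + D * (D * C)) * norm (p - q)" using 0 by (intro mult_right_mono) auto
      finally show "norm (grad (\<lambda>p. H x0 x p m) p - grad (\<lambda>p. H x0 x p m) q) \<le> (D * C + D * (D * C)) * norm (p - q)" .
    qed
  qed
qed

text \<open>As for \<open>H\<close>, but without a continuity clause: the gradient of
  \<open>H0\<close> is evaluated at a single momentum and never integrated.\<close>

lemma assumption_H0_facts:
  fixes H0 :: "'a::euclidean_space \<Rightarrow> 'a \<Rightarrow> 'b::euclidean_space measure \<Rightarrow> real"
  assumes H: "assumption_H0 n C0 \<gamma> H0" and R: "R > 0"
  obtains C where "0 \<le> C" "\<And>x0 m. m \<in> P2 \<Longrightarrow> Hamiltonian_bound R C (\<lambda>p. H0 x0 p m)"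
proof -
  let ?S = "{(x0::'a, p::'a). norm p \<le> R}"
  let ?V = "\<lambda>m (x0, p). H0 x0 p m"
  let ?J = "\<lambda>e::'a. (0::'a, e)"
  have V: "bounded_multi_norm ?S blocks2 [3, 4] ?V" using H R unfolding assumption_H0_def by blast
  obtain C where C: "0 \<le> C" "\<And>m ls vs z. m \<in> P2 \<Longrightarrow> ls \<in> multi_indices [3, 4] \<Longrightarrow> vs \<in> directions blocks2 ls \<Longrightarrow>
    z \<in> ?S \<Longrightarrow> \<bar>iter_deriv vs (?V m) z\<bar> \<le> C"
    by (rule bounded_multi_normD[OF V finite_blocks(1)], assumption, rule that)
  have CM: "C_multi blocks2 [3, 4] (?V m)" if "m \<in> P2" for m
    using V that unfolding bounded_multi_norm_def by blast
  have dir: "vs \<in> directions blocks2 [0, length vs]" if "set vs \<subseteq> ?J ` Basis" for vs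
    unfolding blocks2_def blocks1_def add_block_def
    using directions_last(1)[of vs] that by simp
  have mi: "[0, k] \<in> multi_indices [3, 4]" if "k \<le> 2" for k
    using that by (simp add: multi_indices_def)
  define D where "D = real DIM('a)"
  have D: "1 \<le> D" using DIM_positive[where 'a='a] unfolding D_def by linarith
  have cont: "continuous_on UNIV (iter_deriv vs (?V m))" if "m \<in> P2" "set vs \<subseteq> ?J ` Basis" "length vs \<le> 2" for m vs
    using CM[OF that(1)] dir[OF that(2)] mi[OF that(3)] unfolding C_multi_def by blast
  have diff: "(\<lambda>s. iter_deriv vs (?V m) (z + s *\<^sub>R v)) field_differentiable (at 0)"
    if "m \<in> P2" "set (v # vs) \<subseteq> ?J ` Basis" "length (v # vs) \<le> 2" for m v vs z
    using CM[OF that(1)] dir[OF that(2)] mi[OF that(3)] unfolding C_multi_def by blast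
  have bd: "\<bar>iter_deriv vs (?V m) (x0, p)\<bar> \<le> C"
    if "m \<in> P2" "set vs \<subseteq> ?J ` Basis" "length vs \<le> 2" "norm p \<le> R" for m vs x0 p
    using C(2)[OF that(1) mi[OF that(3)] dir[OF that(2)]] that(4) by simp
  show thesis
  proof (rule that[of "D * C + D * (D * C)"])
    show "0 \<le> D * C + D * (D * C)" using C(1) D by simp
    fix m :: "'b measure" and x0 :: 'a assume m: "m \<in> P2"
    have P: "(x0::'a, p + s *\<^sub>R e) = (x0, p) + s *\<^sub>R ?J e" for x0 p s and e :: 'a by simp
    have Pc: "continuous_on UNIV (\<lambda>p. (x0::'a, p::'a))" for x0 by (intro continuous_intros)
    have d1: "(\<lambda>s. ?V m (z + s *\<^sub>R ?J e)) field_differentiable at 0" if "e \<in> Basis" for e z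
      using diff[OF m, of "?J e" "[]"] that by simp
    have d2: "(\<lambda>s. iter_deriv [?J e] (?V m) (z + s *\<^sub>R ?J e')) field_differentiable at 0"
      if "e \<in> Basis" "e' \<in> Basis" for e e' z
      using diff[OF m, of "?J e'" "[?J e]"] that by simp
    have c1: "continuous_on UNIV (iter_deriv [?J e] (?V m))" if "e \<in> Basis" for e
      using cont[OF m, of "[?J e]"] that by simp
    have c2: "continuous_on UNIV (iter_deriv [?J e', ?J e] (?V m))" if "e \<in> Basis" "e' \<in> Basis" for e e'
      using cont[OF m, of "[?J e', ?J e]"] that by simp
    have b1: "\<bar>iter_deriv [?J e] (?V m) (x0, p)\<bar> \<le> C" if "e \<in> Basis" "norm p \<le> R" for e x0 p
      using bd[OF m, of "[?J e]" p x0] that by simp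
    have b2: "\<bar>iter_deriv [?J e', ?J e] (?V m) (x0, p)\<bar> \<le> C"
      if "e \<in> Basis" "e' \<in> Basis" "norm p \<le> R" for e e' x0 p
      using bd[OF m, of "[?J e', ?J e]" p x0] that by simp
    note B' = block_C2[where F="?V m" and J="?J" and R=R and C=C, OF P Pc d1 d2 c1 c2 b1 b2, unfolded prod.case]
    show "Hamiltonian_bound R (D * C + D * (D * C)) (\<lambda>p. H0 x0 p m)"
      unfolding Hamiltonian_bound_def
    proof (intro allI impI conjI)
      fix p q :: 'a assume pq: "norm p \<le> R" "norm q \<le> R"
      have B2: "norm (grad (\<lambda>p. H0 x0 p m) p) \<le> D * C" unfolding D_def by (rule B'(2)) (assumption | rule pq)+
      have B3: "\<bar>H0 x0 p m - H0 x0 q m\<bar> \<le> D * C * norm (p - q)"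
        unfolding D_def by (rule B'(3)) (assumption | rule pq)+
      have B4: "norm (grad (\<lambda>p. H0 x0 p m) p - grad (\<lambda>p. H0 x0 p m) q) \<le> D * (D * C * norm (p - q))"
        unfolding D_def by (rule B'(4)) (assumption | rule pq)+
      have 0: "0 \<le> D * C" "0 \<le> D * (D * C)" using C(1) D by auto
      show "norm (grad (\<lambda>p. H0 x0 p m) p) \<le> D * C + D * (D * C)"
        using B2 0 by linarith
      have "\<bar>H0 x0 p m - H0 x0 q m\<bar> \<le> D * C * norm (p - q)" by (rule B3)
      also have "\<dots> \<le> (D * C + D * (D * C)) * norm (p - q)" using 0 by (intro mult_right_mono) auto
      finally show "\<bar>H0 x0 p m - H0 x0 q m\<bar> \<le> (D * C + D * (D * C)) * norm (p - q)" .
      have "norm (grad (\<lambda>p. H0 x0 p m) p - grad (\<lambda>p. H0 x0 p m) q) \<le> D * (D * C) * norm (p - q)"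
        using B4 by (simp add: mult.assoc)
      also have "\<dots> \<le> (D * C + D * (D * C)) * norm (p - q)" using 0 by (intro mult_right_mono) auto
      finally show "norm (grad (\<lambda>p. H0 x0 p m) p - grad (\<lambda>p. H0 x0 p m) q) \<le> (D * C + D * (D * C)) * norm (p - q)" .
    qed
  qed
qed

section \<open>Difference quotients\<close>

lemma bounded_convergence_integrable:
  fixes f :: "nat \<Rightarrow> 'c \<Rightarrow> real"
  assumes M: "prob_space M" and f: "\<And>n. f n \<in> borel_measurable M"
    and lim: "\<And>x. x \<in> space M \<Longrightarrow> (\<lambda>n. f n x) \<longlonglongrightarrow> g x"
    and le: "\<And>n x. x \<in> space M \<Longrightarrow> \<bar>f n x\<bar> \<le> C"
  shows "integrable M g"
proof (rule bounded_integrable[OF M, of _ C])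
  show "g \<in> borel_measurable M" by (rule borel_measurable_LIMSEQ_real[OF lim f])
  fix x assume x: "x \<in> space M"
  show "norm (g x) \<le> C"
    using tendsto_upperbound[OF tendsto_rabs[OF lim[OF x]]] le[OF x] by simp
qed

lemma gderiv_line:
  assumes "\<And>y. GDERIV f y :> g y"
  shows "((\<lambda>s. f (y + s *\<^sub>R v)) has_real_derivative g (y + s *\<^sub>R v) \<bullet> v) (at s)"
proof -
  have "((\<lambda>s. f (y + s *\<^sub>R v)) has_derivative (\<lambda>r. (r *\<^sub>R v) \<bullet> g (y + s *\<^sub>R v))) (at s)"
    by (rule has_derivative_compose[where f="\<lambda>s. y + s *\<^sub>R v" and g=f, OF _ assms[unfolded gderiv_def]])
      (auto intro!: derivative_eq_intros)
  then show ?thesis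
    unfolding has_field_derivative_def by (rule has_derivative_eq_rhs) (auto simp: inner_commute fun_eq_iff)
qed

lemma jac_line:
  fixes g :: "'e::euclidean_space \<Rightarrow> 'e"
  assumes "\<And>y. (g has_derivative blinfun_apply (J y)) (at y)"
  shows "((\<lambda>s. g (y + s *\<^sub>R v) \<bullet> v) has_real_derivative J (y + s *\<^sub>R v) v \<bullet> v) (at s)"
proof -
  have "((\<lambda>s. g (y + s *\<^sub>R v)) has_derivative (\<lambda>r. J (y + s *\<^sub>R v) (r *\<^sub>R v))) (at s)"
    by (rule has_derivative_compose[where f="\<lambda>s. y + s *\<^sub>R v" and g=g, OF _ assms])
      (auto intro!: derivative_eq_intros)
  then have "((\<lambda>s. g (y + s *\<^sub>R v) \<bullet> v) has_derivative (\<lambda>r. J (y + s *\<^sub>R v) (r *\<^sub>R v) \<bullet> v)) (at s)"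
    by (rule has_derivative_inner_left)
  then show ?thesis
    unfolding has_field_derivative_def
    by (rule has_derivative_eq_rhs) (auto simp: fun_eq_iff blinfun.scaleR_right)
qed

lemma first_difference:
  assumes g: "\<And>y. GDERIV f y :> g y"
  obtains \<theta> where "\<bar>\<theta>\<bar> \<le> \<bar>h\<bar>" "f (y + h *\<^sub>R v) - f y = h * (g (y + \<theta> *\<^sub>R v) \<bullet> v)"
  by (rule mvt_real[where t=h, OF gderiv_line[OF g, of y v]]) (auto intro: that)

text \<open>The sum of \<open>f\<close> over the two opposite points is an even function of the
  step, so its Maclaurin expansion has no linear term.\<close>

lemma second_difference:
  fixes f :: "'e::euclidean_space \<Rightarrow> real"
  assumes g: "\<And>y. GDERIV f y :> g y" and J: "\<And>y. (g has_derivative blinfun_apply (J y)) (at y)" and h: "h > 0"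
  obtains \<theta> where "\<bar>\<theta>\<bar> \<le> h"
    "f (y + h *\<^sub>R v) + f (y - h *\<^sub>R v) - 2 * f y =
      h\<^sup>2 / 2 * (J (y + \<theta> *\<^sub>R v) v \<bullet> v + J (y - \<theta> *\<^sub>R v) v \<bullet> v)"
proof -
  let ?p = "\<lambda>s. f (y + s *\<^sub>R v) + f (y + s *\<^sub>R (- v))"
  let ?p1 = "\<lambda>s. g (y + s *\<^sub>R v) \<bullet> v + g (y + s *\<^sub>R (- v)) \<bullet> (- v)"
  let ?p2 = "\<lambda>s. J (y + s *\<^sub>R v) v \<bullet> v + J (y + s *\<^sub>R (- v)) (- v) \<bullet> (- v)"
  let ?d = "\<lambda>k. if k = 0 then ?p else if k = Suc 0 then ?p1 else ?p2"
  have d: "(?d k has_real_derivative ?d (Suc k) s) (at s)" if "k < 2" for k s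
  proof -
    have "(?p has_real_derivative ?p1 s) (at s)" by (intro DERIV_add gderiv_line[OF g])
    moreover have "(?p1 has_real_derivative ?p2 s) (at s)" by (intro DERIV_add jac_line[OF J])
    ultimately show ?thesis using that by (cases k) (auto simp: less_Suc_eq)
  qed
  have "\<exists>t>0. t < h \<and> ?p h = (\<Sum>m<2. ?d m 0 / fact m * h ^ m) + ?d 2 t / fact 2 * h ^ 2"
    by (rule Maclaurin[OF h]) (use d in auto)
  then obtain t where t: "0 < t" "t < h"
    "?p h = (\<Sum>m<2. ?d m 0 / fact m * h ^ m) + ?d 2 t / fact 2 * h ^ 2" by blast
  show thesis
    by (rule that[of t]) (use t in \<open>simp_all add: numeral_2_eq_2 blinfun.minus_right field_simps\<close>)
qed

text \<open>A fixed null sequence of steps. Sequences fit dominated convergence and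
  \<open>continuous_P2_seq\<close>, and the bound 1 allows higher powers of a step to be absorbed
  into lower ones.\<close>

definition hs :: "nat \<Rightarrow> real" where "hs n = 1 / real (Suc n)"

lemma hs: "0 < hs n" "hs n \<le> 1" "hs \<longlonglongrightarrow> 0"
proof -
  show "0 < hs n" "hs n \<le> 1" by (simp_all add: hs_def)
  show "hs \<longlonglongrightarrow> 0" using LIMSEQ_inverse_real_of_nat by (simp add: hs_def[abs_def] inverse_eq_divide)
qed

text \<open>The shift by \<open>N\<close> keeps \<open>t + hs (n + N)\<close> inside an open time
  interval when the lemma is applied in time.\<close>

lemma DERIV_hs:
  assumes "(f has_real_derivative D) (at t)"
  shows "(\<lambda>n. (f (t + hs (n + N)) - f t) / hs (n + N)) \<longlonglongrightarrow> D"
proof -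
  have hl: "(\<lambda>n. hs (n + N)) \<longlonglongrightarrow> 0" using hs(3) by (rule LIMSEQ_ignore_initial_segment)
  have "filterlim (\<lambda>n. hs (n + N)) (at 0) sequentially"
    by (rule filterlim_atI[OF hl]) (use hs(1) in \<open>auto intro!: always_eventually simp: less_imp_neq[symmetric]\<close>)
  moreover have "((\<lambda>h. (f (t + h) - f t) / h) \<longlongrightarrow> D) (at 0)" using assms by (simp add: DERIV_def)
  ultimately show ?thesis by (rule filterlim_compose[rotated])
qed

text \<open>The measure may move together with the step, and the intermediate point of the mean
  value theorem depends on both; this is where joint continuity of the gradient in point and measure
  enters. The uniform bound is the domination needed later.\<close>

lemma quot1:
  fixes F :: "'e::euclidean_space \<Rightarrow> 'b::euclidean_space measure \<Rightarrow> real"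
  assumes g: "\<And>\<nu> y. \<nu> \<in> P2 \<Longrightarrow> GDERIV (\<lambda>y. F y \<nu>) y :> g y \<nu>"
    and c: "continuous_P2 UNIV g" and C: "\<And>\<nu> y. \<nu> \<in> P2 \<Longrightarrow> norm (g y \<nu>) \<le> C"
  shows "(\<And>n. \<nu> n \<in> P2) \<Longrightarrow> m \<in> P2 \<Longrightarrow> (\<lambda>n. d2 (\<nu> n) m) \<longlonglongrightarrow> 0 \<Longrightarrow>
      (\<lambda>n. (F (y + hs n *\<^sub>R v) (\<nu> n) - F y (\<nu> n)) / hs n) \<longlonglongrightarrow> g y m \<bullet> v"
    and "m \<in> P2 \<Longrightarrow> \<bar>(F (y + hs n *\<^sub>R v) m - F y m) / hs n\<bar> \<le> C * norm v"
proof -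
  have ex: "\<exists>\<theta>. \<bar>\<theta>\<bar> \<le> \<bar>hs n\<bar> \<and> (F (y + hs n *\<^sub>R v) \<mu> - F y \<mu>) / hs n = g (y + \<theta> *\<^sub>R v) \<mu> \<bullet> v"
    if "\<mu> \<in> P2" for n \<mu>
    by (rule first_difference[where h="hs n" and v=v and y=y, OF g[OF that]]) (use hs(1)[of n] in auto)
  show "\<bar>(F (y + hs n *\<^sub>R v) m - F y m) / hs n\<bar> \<le> C * norm v" if m: "m \<in> P2"
  proof -
    from ex[OF m] obtain \<theta> where "(F (y + hs n *\<^sub>R v) m - F y m) / hs n = g (y + \<theta> *\<^sub>R v) m \<bullet> v" by blast
    then have "\<bar>(F (y + hs n *\<^sub>R v) m - F y m) / hs n\<bar> \<le> norm (g (y + \<theta> *\<^sub>R v) m) * norm v"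
      by (simp add: Cauchy_Schwarz_ineq2)
    also have "\<dots> \<le> C * norm v" using C[OF m] by (intro mult_right_mono) auto
    finally show ?thesis .
  qed
  assume \<nu>: "\<And>n. \<nu> n \<in> P2" "m \<in> P2" "(\<lambda>n. d2 (\<nu> n) m) \<longlonglongrightarrow> 0"
  from ex[OF \<nu>(1)] have "\<forall>n. \<exists>\<theta>. \<bar>\<theta>\<bar> \<le> \<bar>hs n\<bar> \<and>
      (F (y + hs n *\<^sub>R v) (\<nu> n) - F y (\<nu> n)) / hs n = g (y + \<theta> *\<^sub>R v) (\<nu> n) \<bullet> v" by blast
  from choice[OF this] obtain \<theta> where \<theta>: "\<And>n. \<bar>\<theta> n\<bar> \<le> \<bar>hs n\<bar>"
    "\<And>n. (F (y + hs n *\<^sub>R v) (\<nu> n) - F y (\<nu> n)) / hs n = g (y + \<theta> n *\<^sub>R v) (\<nu> n) \<bullet> v" by blast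
  have "\<theta> \<longlonglongrightarrow> 0"
    by (rule Lim_null_comparison[OF _ hs(3)]) (use \<theta>(1) hs(1) in \<open>auto simp: abs_of_pos\<close>)
  then have "(\<lambda>n. y + \<theta> n *\<^sub>R v) \<longlonglongrightarrow> y + 0 *\<^sub>R v" by (intro tendsto_intros)
  then have "(\<lambda>n. g (y + \<theta> n *\<^sub>R v) (\<nu> n)) \<longlonglongrightarrow> g y m"
    by (intro continuous_P2_seq[OF c _ _ _ \<nu>]) auto
  then show "(\<lambda>n. (F (y + hs n *\<^sub>R v) (\<nu> n) - F y (\<nu> n)) / hs n) \<longlonglongrightarrow> g y m \<bullet> v"
    unfolding \<theta>(2) by (intro tendsto_intros)
qed

lemma quot2:
  fixes F :: "'e::euclidean_space \<Rightarrow> 'b::euclidean_space measure \<Rightarrow> real"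
  assumes g: "\<And>\<nu> y. \<nu> \<in> P2 \<Longrightarrow> GDERIV (\<lambda>y. F y \<nu>) y :> g y \<nu>"
    and J: "\<And>\<nu> y. \<nu> \<in> P2 \<Longrightarrow> ((\<lambda>y. g y \<nu>) has_derivative blinfun_apply (J y \<nu>)) (at y)"
    and c: "continuous_P2 UNIV J" and C: "\<And>\<nu> y. \<nu> \<in> P2 \<Longrightarrow> norm (J y \<nu>) \<le> C"
  shows "(\<And>n. \<nu> n \<in> P2) \<Longrightarrow> m \<in> P2 \<Longrightarrow> (\<lambda>n. d2 (\<nu> n) m) \<longlonglongrightarrow> 0 \<Longrightarrow>
      (\<lambda>n. (F (y + hs n *\<^sub>R v) (\<nu> n) + F (y - hs n *\<^sub>R v) (\<nu> n) - 2 * F y (\<nu> n)) / (hs n)\<^sup>2) \<longlonglongrightarrow> J y m v \<bullet> v"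
    and "m \<in> P2 \<Longrightarrow> \<bar>(F (y + hs n *\<^sub>R v) m + F (y - hs n *\<^sub>R v) m - 2 * F y m) / (hs n)\<^sup>2\<bar> \<le> C * (norm v)\<^sup>2"
proof -
  have ex: "\<exists>\<theta>. \<bar>\<theta>\<bar> \<le> hs n \<and> (F (y + hs n *\<^sub>R v) \<mu> + F (y - hs n *\<^sub>R v) \<mu> - 2 * F y \<mu>) / (hs n)\<^sup>2 =
      1 / 2 * (J (y + \<theta> *\<^sub>R v) \<mu> v \<bullet> v + J (y - \<theta> *\<^sub>R v) \<mu> v \<bullet> v)"
    if "\<mu> \<in> P2" for n \<mu>
    by (rule second_difference[where h="hs n" and v=v and y=y, OF g[OF that] J[OF that]])
      (use hs(1)[of n] in \<open>auto simp: power2_eq_square\<close>)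
  have J1: "\<bar>J z \<mu> v \<bullet> v\<bar> \<le> C * (norm v)\<^sup>2" if "\<mu> \<in> P2" for z \<mu>
  proof -
    have "\<bar>J z \<mu> v \<bullet> v\<bar> \<le> norm (J z \<mu> v) * norm v" by (rule Cauchy_Schwarz_ineq2)
    also have "\<dots> \<le> (norm (J z \<mu>) * norm v) * norm v" by (intro mult_right_mono norm_blinfun) auto
    also have "\<dots> \<le> (C * norm v) * norm v" using C[OF that] by (intro mult_right_mono) auto
    finally show ?thesis by (simp add: power2_eq_square mult.assoc)
  qed
  show "\<bar>(F (y + hs n *\<^sub>R v) m + F (y - hs n *\<^sub>R v) m - 2 * F y m) / (hs n)\<^sup>2\<bar> \<le> C * (norm v)\<^sup>2" if m: "m \<in> P2"
  proof -
    from ex[OF m] obtain \<theta> where e: "(F (y + hs n *\<^sub>R v) m + F (y - hs n *\<^sub>R v) m - 2 * F y m) / (hs n)\<^sup>2 =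
      1 / 2 * (J (y + \<theta> *\<^sub>R v) m v \<bullet> v + J (y - \<theta> *\<^sub>R v) m v \<bullet> v)" by blast
    have "\<bar>1 / 2 * (a + b)\<bar> \<le> K" if "\<bar>a\<bar> \<le> K" "\<bar>b\<bar> \<le> K" for a b K :: real
      using that by (simp add: abs_le_iff)
    then show ?thesis unfolding e using J1[OF m] by blast
  qed
  assume \<nu>: "\<And>n. \<nu> n \<in> P2" "m \<in> P2" "(\<lambda>n. d2 (\<nu> n) m) \<longlonglongrightarrow> 0"
  from ex[OF \<nu>(1)] have "\<forall>n. \<exists>\<theta>. \<bar>\<theta>\<bar> \<le> hs n \<and>
      (F (y + hs n *\<^sub>R v) (\<nu> n) + F (y - hs n *\<^sub>R v) (\<nu> n) - 2 * F y (\<nu> n)) / (hs n)\<^sup>2 =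
      1 / 2 * (J (y + \<theta> *\<^sub>R v) (\<nu> n) v \<bullet> v + J (y - \<theta> *\<^sub>R v) (\<nu> n) v \<bullet> v)" by blast
  from choice[OF this] obtain \<theta> where \<theta>: "\<And>n. \<bar>\<theta> n\<bar> \<le> hs n"
    "\<And>n. (F (y + hs n *\<^sub>R v) (\<nu> n) + F (y - hs n *\<^sub>R v) (\<nu> n) - 2 * F y (\<nu> n)) / (hs n)\<^sup>2 =
      1 / 2 * (J (y + \<theta> n *\<^sub>R v) (\<nu> n) v \<bullet> v + J (y - \<theta> n *\<^sub>R v) (\<nu> n) v \<bullet> v)" by blast
  have t0: "\<theta> \<longlonglongrightarrow> 0"
    by (rule Lim_null_comparison[OF _ hs(3)]) (use \<theta>(1) in auto)
  have "(\<lambda>n. y + \<theta> n *\<^sub>R v) \<longlonglongrightarrow> y + 0 *\<^sub>R v" "(\<lambda>n. y - \<theta> n *\<^sub>R v) \<longlonglongrightarrow> y - 0 *\<^sub>R v"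
    by (intro tendsto_intros t0)+
  then have "(\<lambda>n. J (y + \<theta> n *\<^sub>R v) (\<nu> n)) \<longlonglongrightarrow> J y m" "(\<lambda>n. J (y - \<theta> n *\<^sub>R v) (\<nu> n)) \<longlonglongrightarrow> J y m"
    by (auto intro!: continuous_P2_seq[OF c _ _ _ \<nu>])
  then have "(\<lambda>n. 1 / 2 * (J (y + \<theta> n *\<^sub>R v) (\<nu> n) v \<bullet> v + J (y - \<theta> n *\<^sub>R v) (\<nu> n) v \<bullet> v)) \<longlonglongrightarrow>
      1 / 2 * (J y m v \<bullet> v + J y m v \<bullet> v)"
    by (intro tendsto_intros blinfun.tendsto)
  then show "(\<lambda>n. (F (y + hs n *\<^sub>R v) (\<nu> n) + F (y - hs n *\<^sub>R v) (\<nu> n) - 2 * F y (\<nu> n)) / (hs n)\<^sup>2) \<longlonglongrightarrow> J y m v \<bullet> v"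
    unfolding \<theta>(2) by simp
qed

text \<open>The squares of the two first differences survive in the limit. They are the origin of
  the squared gradients on which all later absorption rests.\<close>

lemma square_quot2:
  assumes "(\<lambda>n. (p n + q n - 2 * r n) / (hs n)\<^sup>2) \<longlonglongrightarrow> L"
    and "(\<lambda>n. (p n - r n) / hs n) \<longlonglongrightarrow> G" "(\<lambda>n. (q n - r n) / hs n) \<longlonglongrightarrow> - G" "r \<longlonglongrightarrow> r0"
  shows "(\<lambda>n. ((p n)\<^sup>2 + (q n)\<^sup>2 - 2 * (r n)\<^sup>2) / (hs n)\<^sup>2) \<longlonglongrightarrow> 2 * r0 * L + 2 * G\<^sup>2"
proof -
  have e: "((p n)\<^sup>2 + (q n)\<^sup>2 - 2 * (r n)\<^sup>2) / (hs n)\<^sup>2 =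
    2 * r n * ((p n + q n - 2 * r n) / (hs n)\<^sup>2) + ((p n - r n) / hs n)\<^sup>2 + ((q n - r n) / hs n)\<^sup>2" for n
    using hs(1)[of n] by (simp add: field_simps power2_eq_square)
  have l: "(\<lambda>n. 2 * r n * ((p n + q n - 2 * r n) / (hs n)\<^sup>2) + ((p n - r n) / hs n)\<^sup>2 + ((q n - r n) / hs n)\<^sup>2)
    \<longlonglongrightarrow> 2 * r0 * L + G\<^sup>2 + (- G)\<^sup>2"
    by (intro tendsto_intros assms)
  have "2 * r0 * L + G\<^sup>2 + (- G)\<^sup>2 = 2 * r0 * L + 2 * G\<^sup>2" by simp
  from l[unfolded this] show ?thesis unfolding e .
qed

lemma square_quot2_bound:
  assumes "\<bar>(p + q - 2 * r) / h\<^sup>2\<bar> \<le> C" "\<bar>(p - r) / h\<bar> \<le> C" "\<bar>(q - r) / h\<bar> \<le> C" "\<bar>r\<bar> \<le> (C::real)" "h > 0"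
  shows "\<bar>(p\<^sup>2 + q\<^sup>2 - 2 * r\<^sup>2) / h\<^sup>2\<bar> \<le> 4 * C\<^sup>2"
proof -
  have C: "0 \<le> C" using assms(4) by linarith
  have "(p\<^sup>2 + q\<^sup>2 - 2 * r\<^sup>2) / h\<^sup>2 = 2 * (r * ((p + q - 2 * r) / h\<^sup>2)) + ((p - r) / h)\<^sup>2 + ((q - r) / h)\<^sup>2"
    using assms(5) by (simp add: field_simps power2_eq_square)
  moreover have "\<bar>r * ((p + q - 2 * r) / h\<^sup>2)\<bar> \<le> C\<^sup>2"
    unfolding abs_mult power2_eq_square[of C] by (rule mult_mono[OF assms(4,1) C]) simp
  moreover have "((p - r) / h)\<^sup>2 \<le> C\<^sup>2" "((q - r) / h)\<^sup>2 \<le> C\<^sup>2"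
    using assms(2,3) C by (metis abs_le_square_iff abs_of_nonneg)+
  moreover have "0 \<le> ((p - r) / h)\<^sup>2" "0 \<le> ((q - r) / h)\<^sup>2" by simp_all
  ultimately show ?thesis by argo
qed

text \<open>The scale \<open>a\<close> is left free: it is a step for shifts and drifts and a
  squared step for the effect of the random walk on the measure argument, where squaring produces no
  gradient term.\<close>

lemma square_quot1:
  assumes "(\<lambda>n. (p n - r n) / a n) \<longlonglongrightarrow> G" "r \<longlonglongrightarrow> r0" "p \<longlonglongrightarrow> r0"
  shows "(\<lambda>n. ((p n)\<^sup>2 - (r n)\<^sup>2) / a n) \<longlonglongrightarrow> 2 * r0 * (G::real)"
proof -
  have e: "((p n)\<^sup>2 - (r n)\<^sup>2) / a n = (p n + r n) * ((p n - r n) / a n)" for n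
    by (simp add: field_simps power2_eq_square)
  have l: "(\<lambda>n. (p n + r n) * ((p n - r n) / a n)) \<longlonglongrightarrow> (r0 + r0) * G"
    by (intro tendsto_intros assms)
  have "(r0 + r0) * G = 2 * r0 * G" by simp
  from l[unfolded this] show ?thesis unfolding e .
qed

lemma square_quot1_bound:
  assumes "\<bar>(p - r) / a\<bar> \<le> C" "\<bar>r\<bar> \<le> C" "\<bar>p\<bar> \<le> (C::real)"
  shows "\<bar>(p\<^sup>2 - r\<^sup>2) / a\<bar> \<le> 2 * C\<^sup>2"
proof -
  have C: "0 \<le> C" using assms(2) by linarith
  have "(p\<^sup>2 - r\<^sup>2) / a = (p + r) * ((p - r) / a)" by (simp add: field_simps power2_eq_square)
  then have "\<bar>(p\<^sup>2 - r\<^sup>2) / a\<bar> = \<bar>p + r\<bar> * \<bar>(p - r) / a\<bar>" by (simp only: abs_mult)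
  also have "\<dots> \<le> (2 * C) * C" using assms C by (intro mult_mono) auto
  finally show ?thesis by (simp add: power2_eq_square)
qed

section \<open>Transport and random walk of a measure\<close>

text \<open>A uniform bound on the displacement controls the second moments, the distance to the
  perturbed law, and the distance to every mixture on the way. Drift and random walk are both of
  this form.\<close>

lemma perturbation_d2:
  fixes X :: "'c \<Rightarrow> 'b::euclidean_space" and Y :: "nat \<Rightarrow> 'c \<Rightarrow> 'b"
  assumes M: "prob_space M" and X: "X \<in> borel_measurable M" and Y: "\<And>n. Y n \<in> borel_measurable M"
    and PX: "distr M borel X \<in> P2" and le: "\<And>n w. dist (X w) (Y n w) \<le> hs n * B" and B: "0 \<le> B"
  shows "distr M borel (Y n) \<in> P2"
    and "s \<in> {0..1} \<Longrightarrow> (\<lambda>n. d2 (mix s (distr M borel X) (distr M borel (Y n))) (distr M borel X)) \<longlonglongrightarrow> 0"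
    and "(\<lambda>n. d2 (distr M borel (Y n)) (distr M borel X)) \<longlonglongrightarrow> 0"
proof -
  interpret prob_space M by fact
  have iX: "integrable M (\<lambda>w. (norm (X w))\<^sup>2)"
    using P2_D(4)[OF PX] X by (simp add: integrable_distr_eq)
  have iY: "integrable M (\<lambda>w. (norm (Y n w))\<^sup>2)" for n
  proof (rule Bochner_Integration.integrable_bound)
    show "integrable M (\<lambda>w. 2 * (norm (X w))\<^sup>2 + 2 * B\<^sup>2)" using iX by simp
    show "(\<lambda>w. (norm (Y n w))\<^sup>2) \<in> borel_measurable M" using Y by measurable
    show "AE w in M. norm ((norm (Y n w))\<^sup>2) \<le> norm (2 * (norm (X w))\<^sup>2 + 2 * B\<^sup>2)"
    proof (rule AE_I2)
      fix w
      have "norm (Y n w) \<le> norm (X w) + dist (X w) (Y n w)"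
        using norm_triangle_ineq[of "X w" "Y n w - X w"] by (simp add: dist_norm norm_minus_commute)
      also have "dist (X w) (Y n w) \<le> 1 * B"
        using le[of w n] hs(2)[of n] B by (meson mult_right_mono order_trans)
      finally have "(norm (Y n w))\<^sup>2 \<le> (norm (X w) + B)\<^sup>2" by (intro power_mono) auto
      also have "\<dots> \<le> 2 * (norm (X w))\<^sup>2 + 2 * B\<^sup>2"
        using sum_squares_bound[of "norm (X w)" B] by (simp add: power2_sum)
      finally show "norm ((norm (Y n w))\<^sup>2) \<le> norm (2 * (norm (X w))\<^sup>2 + 2 * B\<^sup>2)" by simp
    qed
  qed
  show PY: "distr M borel (Y n) \<in> P2" for n by (rule P2_distr[OF M Y iY])
  have J: "(\<integral>\<^sup>+ w. ennreal ((dist (X w) (Y n w))\<^sup>2) \<partial>M) \<le> ennreal ((hs n * B)\<^sup>2)" for n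
  proof -
    have "(\<integral>\<^sup>+ w. ennreal ((dist (X w) (Y n w))\<^sup>2) \<partial>M) \<le> (\<integral>\<^sup>+ w. ennreal ((hs n * B)\<^sup>2) \<partial>M)"
      using le by (intro nn_integral_mono ennreal_leI power_mono) auto
    then show ?thesis by (simp add: emeasure_space_1)
  qed
  have lim: "(\<lambda>n. hs n * B) \<longlonglongrightarrow> 0" using tendsto_mult_left_zero[OF hs(3)] .
  have sq: "sqrt ((hs n * B)\<^sup>2) = hs n * B" for n using hs(1)[of n] B by (simp add: less_imp_le)
  show "(\<lambda>n. d2 (mix s (distr M borel X) (distr M borel (Y n))) (distr M borel X)) \<longlonglongrightarrow> 0"
    if s: "s \<in> {0..1}" for s
  proof (rule tendsto_sandwich[OF _ _ tendsto_const lim])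
    have "d2 (mix s (distr M borel X) (distr M borel (Y n))) (distr M borel X) \<le> hs n * B" for n
    proof -
      \<comment> \<open>The unperturbed law is read as the mixture with weight 0, so that the coin
        coupling applies.\<close>
      have "d2 (mix s (distr M borel X) (distr M borel (Y n))) (mix 0 (distr M borel X) (distr M borel (Y n)))
        \<le> sqrt (\<bar>s - 0\<bar> * (hs n * B)\<^sup>2)"
        by (rule d2_mix_distr_le[OF M X Y PX PY s _ _ J]) auto
      also have "\<dots> \<le> sqrt ((hs n * B)\<^sup>2)" using s by (intro real_sqrt_le_mono mult_left_le_one_le) auto
      finally show ?thesis unfolding mix_0[OF PX PY] sq .
    qed
    then show "\<forall>\<^sub>F n in sequentially. d2 (mix s (distr M borel X) (distr M borel (Y n))) (distr M borel X) \<le> hs n * B"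
      by simp
    have "0 \<le> d2 (mix s (distr M borel X) (distr M borel (Y n))) (distr M borel X)" for n
    proof -
      obtain c where "\<And>s s'. s \<in> {0..1} \<Longrightarrow> s' \<in> {0..1} \<Longrightarrow>
        0 \<le> d2 (mix s (distr M borel X) (distr M borel (Y n))) (mix s' (distr M borel X) (distr M borel (Y n)))"
        by (rule d2_mix_le[OF PX PY], rule that)
      from this[of s 0] s show ?thesis unfolding mix_0[OF PX PY] by simp
    qed
    then show "\<forall>\<^sub>F n in sequentially. 0 \<le> d2 (mix s (distr M borel X) (distr M borel (Y n))) (distr M borel X)"
      by simp
  qed
  show "(\<lambda>n. d2 (distr M borel (Y n)) (distr M borel X)) \<longlonglongrightarrow> 0"
  proof (rule tendsto_sandwich[OF _ _ tendsto_const lim])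
    have "d2 (distr M borel (Y n)) (distr M borel X) \<le> sqrt ((hs n * B)\<^sup>2)" for n
      by (rule d2_distr_le[OF M Y X]) (use J in \<open>simp_all add: dist_commute\<close>)
    then show "\<forall>\<^sub>F n in sequentially. d2 (distr M borel (Y n)) (distr M borel X) \<le> hs n * B"
      unfolding sq by simp
    show "\<forall>\<^sub>F n in sequentially. 0 \<le> d2 (distr M borel (Y n)) (distr M borel X)"
      using d2_distr_nonneg[OF M Y X] by simp
  qed
qed

text \<open>One explicit Euler step along \<open>b\<close>. A single step suffices to read off a
  derivative at \<open>m\<close>, so no flow has to be constructed.\<close>

definition drift :: "('b \<Rightarrow> 'b) \<Rightarrow> 'b::euclidean_space measure \<Rightarrow> nat \<Rightarrow> 'b measure" where
  "drift b m n = distr m borel (\<lambda>y. y + hs n *\<^sub>R b y)"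

text \<open>One step of a symmetric random walk in the direction \<open>e\<close>. Relative to
  \<open>(hs n)\<^sup>2\<close> it acts on a smooth function as half of the second derivative along
  \<open>e\<close>.\<close>

definition heat :: "'b \<Rightarrow> 'b::euclidean_space measure \<Rightarrow> nat \<Rightarrow> 'b measure" where
  "heat e m n = mix (1/2) (distr m borel (\<lambda>y. y + hs n *\<^sub>R e)) (distr m borel (\<lambda>y. y - hs n *\<^sub>R e))"

lemma
  fixes m :: "'b::euclidean_space measure"
  assumes m: "m \<in> P2" and b: "b \<in> borel_measurable borel" "\<And>y. norm (b y) \<le> B"
  shows drift_P2: "drift b m n \<in> P2"
    and drift_mix: "s \<in> {0..1} \<Longrightarrow> (\<lambda>n. d2 (mix s m (drift b m n)) m) \<longlonglongrightarrow> 0"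
    and drift_d2: "(\<lambda>n. d2 (drift b m n) m) \<longlonglongrightarrow> 0"
    and drift_integral: "\<And>f::'b \<Rightarrow> real. f \<in> borel_measurable borel \<Longrightarrow>
        (\<integral>y. f y \<partial>drift b m n) = (\<integral>y. f (y + hs n *\<^sub>R b y) \<partial>m)"
    and drift_integrable: "\<And>f::'b \<Rightarrow> real. f \<in> borel_measurable borel \<Longrightarrow>
        integrable m (\<lambda>y. f (y + hs n *\<^sub>R b y)) \<Longrightarrow> integrable (drift b m n) f"
proof -
  have B: "0 \<le> B" using norm_ge_zero b(2) order_trans by blast
  have X: "(\<lambda>y. y) \<in> borel_measurable m" and Y: "(\<lambda>y. y + hs n *\<^sub>R b y) \<in> borel_measurable m" for n
    by (rule measurable_P2[OF m], use b(1) in measurable)+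
  have le: "dist y (y + hs n *\<^sub>R b y) \<le> hs n * B" for y n
    using hs(1)[of n] b(2)[of y] by (simp add: dist_norm)
  note p = perturbation_d2[OF P2_D(1)[OF m] X Y _ le B, unfolded P2_distr_id[OF m], OF m]
  show "drift b m n \<in> P2" "(\<lambda>n. d2 (drift b m n) m) \<longlonglongrightarrow> 0"
    "s \<in> {0..1} \<Longrightarrow> (\<lambda>n. d2 (mix s m (drift b m n)) m) \<longlonglongrightarrow> 0"
    unfolding drift_def by (rule p | assumption)+
  show "(\<integral>y. f y \<partial>drift b m n) = (\<integral>y. f (y + hs n *\<^sub>R b y) \<partial>m)"
    if "f \<in> borel_measurable borel" for f :: "'b \<Rightarrow> real"
    unfolding drift_def by (rule integral_distr[OF Y that])
  show "integrable (drift b m n) f"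
    if "f \<in> borel_measurable borel" "integrable m (\<lambda>y. f (y + hs n *\<^sub>R b y))" for f :: "'b \<Rightarrow> real"
    unfolding drift_def using that by (simp add: integrable_distr_eq[OF Y])
qed

text \<open>\<open>heat e m n\<close> is a mixture of two push-forwards. On the product of
  \<open>m\<close> with a coin it becomes the law of a point displaced by at most
  \<open>hs n * norm e\<close>, and \<open>perturbation_d2\<close> applies with \<open>fst\<close>
  as the unperturbed variable.\<close>

lemma
  fixes m :: "'b::euclidean_space measure"
  assumes m: "m \<in> P2"
  shows heat_P2: "heat e m n \<in> P2"
    and heat_mix: "s \<in> {0..1} \<Longrightarrow> (\<lambda>n. d2 (mix s m (heat e m n)) m) \<longlonglongrightarrow> 0"
    and heat_d2: "(\<lambda>n. d2 (heat e m n) m) \<longlonglongrightarrow> 0"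
    and heat_integral: "\<And>f::'b \<Rightarrow> real. f \<in> borel_measurable borel \<Longrightarrow>
        integrable m (\<lambda>y. f (y + hs n *\<^sub>R e)) \<Longrightarrow> integrable m (\<lambda>y. f (y - hs n *\<^sub>R e)) \<Longrightarrow>
        (\<integral>y. f y \<partial>heat e m n) = (\<integral>y. (f (y + hs n *\<^sub>R e) + f (y - hs n *\<^sub>R e)) / 2 \<partial>m)"
    and heat_integrable: "\<And>f::'b \<Rightarrow> real. f \<in> borel_measurable borel \<Longrightarrow>
        integrable m (\<lambda>y. f (y + hs n *\<^sub>R e)) \<Longrightarrow> integrable m (\<lambda>y. f (y - hs n *\<^sub>R e)) \<Longrightarrow>
        integrable (heat e m n) f"
proof -
  interpret m: prob_space m by (rule P2_D(1)[OF m])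
  let ?u = "uniform_measure lborel {0..1::real}"
  interpret u: prob_space ?u by (rule prob_space_uniform_measure) auto
  interpret N: pair_prob_space m ?u ..
  let ?N = "m \<Otimes>\<^sub>M ?u"
  note [measurable_cong] = P2_D(2)[OF m]
  have pm: "(\<lambda>y. y + hs n *\<^sub>R e) \<in> borel_measurable m" "(\<lambda>y. y - hs n *\<^sub>R e) \<in> borel_measurable m" for n
    by measurable
  have P: "distr m borel (\<lambda>y. y + hs n *\<^sub>R e) \<in> P2" "distr m borel (\<lambda>y. y - hs n *\<^sub>R e) \<in> P2" for n
    using drift_P2[OF m, of "\<lambda>_. e" "norm e" n] drift_P2[OF m, of "\<lambda>_. - e" "norm e" n]
    by (simp_all add: drift_def)
  have half: "(1/2::real) \<in> {0..1}" by simp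
  let ?Y = "\<lambda>n z. if snd z \<le> (1/2::real) then fst z - hs n *\<^sub>R e else fst z + hs n *\<^sub>R e"
  have Y: "?Y n \<in> borel_measurable ?N" for n by measurable
  have X: "fst \<in> borel_measurable ?N" by measurable
  have dX: "distr ?N borel fst = m"
    using u.distr_pair_fst[of m] by (simp add: P2_D(2)[OF m] cong: distr_cong)
  have dY: "distr ?N borel (?Y n) = heat e m n" for n
    unfolding heat_def by (rule distr_mix_coin[OF m.prob_space_axioms pm P half])
  have le: "dist (fst z) (?Y n z) \<le> hs n * norm e" for z n
    using hs(1)[of n] by (simp add: dist_norm)
  have dXP: "distr ?N borel fst \<in> P2" using m unfolding dX .
  note p = perturbation_d2[OF N.prob_space_axioms X Y dXP le norm_ge_zero, unfolded dX dY]
  show "heat e m n \<in> P2" "(\<lambda>n. d2 (heat e m n) m) \<longlonglongrightarrow> 0"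
    "s \<in> {0..1} \<Longrightarrow> (\<lambda>n. d2 (mix s m (heat e m n)) m) \<longlonglongrightarrow> 0"
    by (rule p | assumption)+
  fix f :: "'b \<Rightarrow> real" assume f: "f \<in> borel_measurable borel"
    and i: "integrable m (\<lambda>y. f (y + hs n *\<^sub>R e))" "integrable m (\<lambda>y. f (y - hs n *\<^sub>R e))"
  have i': "integrable (distr m borel (\<lambda>y. y + hs n *\<^sub>R e)) f" "integrable (distr m borel (\<lambda>y. y - hs n *\<^sub>R e)) f"
    using i by (simp_all add: integrable_distr_eq[OF pm(1) f] integrable_distr_eq[OF pm(2) f])
  note im = integral_mix[OF P half i']
  show "integrable (heat e m n) f" unfolding heat_def by (rule im(1))
  show "(\<integral>y. f y \<partial>heat e m n) = (\<integral>y. (f (y + hs n *\<^sub>R e) + f (y - hs n *\<^sub>R e)) / 2 \<partial>m)"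
    unfolding heat_def im(2) integral_distr[OF pm(1) f] integral_distr[OF pm(2) f] using i by simp
qed

section \<open>Smooth fields on the Wasserstein space\<close>

text \<open>Insertions and projections of coordinates are non-expansive, so the radius found for
  \<open>f\<close> can be reused unchanged.\<close>

lemma continuous_P2_compose:
  fixes f :: "'c::metric_space \<Rightarrow> 'b::euclidean_space measure \<Rightarrow> 'd::metric_space"
    and i :: "'e::metric_space \<Rightarrow> 'c"
  assumes f: "continuous_P2 A f" and i: "\<And>z. z \<in> B \<Longrightarrow> i z \<in> A" "\<And>z z'. dist (i z') (i z) \<le> dist z' z"
  shows "continuous_P2 B (\<lambda>z. f (i z))"
  unfolding continuous_P2_def
proof (intro ballI allI impI)
  fix z and m :: "'b measure" and e :: real assume "z \<in> B" "m \<in> P2" "0 < e"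
  then obtain d where d: "d > 0" "\<And>z' m'. z' \<in> A \<Longrightarrow> m' \<in> P2 \<Longrightarrow> dist z' (i z) < d \<Longrightarrow> d2 m' m < d \<Longrightarrow>
     dist (f z' m') (f (i z) m) < e"
    using f i(1) unfolding continuous_P2_def by blast
  show "\<exists>d>0. \<forall>z'\<in>B. \<forall>m'\<in>P2. dist z' z < d \<and> d2 m' m < d \<longrightarrow> dist (f (i z') m') (f (i z) m) < e"
    by (intro exI[of _ d] conjI d(1) ballI impI, elim conjE)
      (rule d(2)[OF i(1) _ le_less_trans[OF i(2)]])
qed

lemma continuous_P2_slice:
  fixes f :: "'c::metric_space \<Rightarrow> 'b::euclidean_space measure \<Rightarrow> 'd::metric_space"
    and i :: "'e::metric_space \<Rightarrow> 'c"
  assumes f: "continuous_P2 A f" and i: "\<And>z. i z \<in> A" "\<And>z z'. dist (i z') (i z) \<le> dist z' z"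
  shows "continuous_P2 UNIV (\<lambda>z. f (i z))"
  by (rule continuous_P2_compose[OF f]) (rule i)+

text \<open>\<open>ut\<close> is the time derivative; \<open>gx\<close>, \<open>hx\<close> and \<open>gz\<close>, \<open>hz\<close> are gradients and Hessians in \<open>x\<close> and
  \<open>z\<close>; \<open>gm\<close>, \<open>hm\<close> are the first two \<open>y\<close>-derivatives of the linear derivative \<open>D\<close>. The value function
  \<open>U0\<close> is treated as a field that is constant in \<open>z\<close>.\<close>

locale smooth_field =
  fixes T C :: real
    and u ut :: "real \<Rightarrow> 'a::euclidean_space \<Rightarrow> 'b::euclidean_space \<Rightarrow> 'b measure \<Rightarrow> real"
    and gx :: "real \<Rightarrow> 'a \<Rightarrow> 'b \<Rightarrow> 'b measure \<Rightarrow> 'a"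
    and hx :: "real \<Rightarrow> 'a \<Rightarrow> 'b \<Rightarrow> 'b measure \<Rightarrow> ('a \<Rightarrow>\<^sub>L 'a)"
    and gz :: "real \<Rightarrow> 'a \<Rightarrow> 'b \<Rightarrow> 'b measure \<Rightarrow> 'b"
    and hz :: "real \<Rightarrow> 'a \<Rightarrow> 'b \<Rightarrow> 'b measure \<Rightarrow> ('b \<Rightarrow>\<^sub>L 'b)"
    and D :: "real \<Rightarrow> 'a \<Rightarrow> 'b \<Rightarrow> 'b measure \<Rightarrow> 'b \<Rightarrow> real"
    and gm :: "real \<Rightarrow> 'a \<Rightarrow> 'b \<Rightarrow> 'b measure \<Rightarrow> 'b \<Rightarrow> 'b"
    and hm :: "real \<Rightarrow> 'a \<Rightarrow> 'b \<Rightarrow> 'b measure \<Rightarrow> 'b \<Rightarrow> ('b \<Rightarrow>\<^sub>L 'b)"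
  assumes dt: "\<And>t x z m. t \<in> {0<..<T} \<Longrightarrow> m \<in> P2 \<Longrightarrow>
        ((\<lambda>s. u s x z m) has_real_derivative ut t x z m) (at t)"
    and dx: "\<And>t x z m. t \<in> {0<..<T} \<Longrightarrow> m \<in> P2 \<Longrightarrow> GDERIV (\<lambda>x. u t x z m) x :> gx t x z m"
    and dx2: "\<And>t x z m. t \<in> {0<..<T} \<Longrightarrow> m \<in> P2 \<Longrightarrow>
        ((\<lambda>x. gx t x z m) has_derivative blinfun_apply (hx t x z m)) (at x)"
    and dz: "\<And>t x z m. t \<in> {0<..<T} \<Longrightarrow> m \<in> P2 \<Longrightarrow> GDERIV (\<lambda>z. u t x z m) z :> gz t x z m"
    and dz2: "\<And>t x z m. t \<in> {0<..<T} \<Longrightarrow> m \<in> P2 \<Longrightarrow>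
        ((\<lambda>z. gz t x z m) has_derivative blinfun_apply (hz t x z m)) (at z)"
    and dm: "\<And>t x z. t \<in> {0<..<T} \<Longrightarrow> has_lin_deriv (u t x z) (D t x z)"
    and dm1: "\<And>t x z m y. t \<in> {0<..<T} \<Longrightarrow> m \<in> P2 \<Longrightarrow> GDERIV (D t x z m) y :> gm t x z m y"
    and dm2: "\<And>t x z m y. t \<in> {0<..<T} \<Longrightarrow> m \<in> P2 \<Longrightarrow>
        (gm t x z m has_derivative blinfun_apply (hm t x z m y)) (at y)"
    and cont: "continuous_P2 ({0<..<T} \<times> UNIV \<times> UNIV) (\<lambda>(t, x, z) m. u t x z m)"
      "continuous_P2 ({0<..<T} \<times> UNIV \<times> UNIV) (\<lambda>(t, x, z) m. ut t x z m)"
      "continuous_P2 ({0<..<T} \<times> UNIV \<times> UNIV) (\<lambda>(t, x, z) m. gx t x z m)"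
      "continuous_P2 ({0<..<T} \<times> UNIV \<times> UNIV) (\<lambda>(t, x, z) m. hx t x z m)"
      "continuous_P2 ({0<..<T} \<times> UNIV \<times> UNIV) (\<lambda>(t, x, z) m. gz t x z m)"
      "continuous_P2 ({0<..<T} \<times> UNIV \<times> UNIV) (\<lambda>(t, x, z) m. hz t x z m)"
    and contm: "continuous_P2 ({0<..<T} \<times> UNIV \<times> UNIV \<times> UNIV) (\<lambda>(t, x, z, y) m. gm t x z m y)"
      "continuous_P2 ({0<..<T} \<times> UNIV \<times> UNIV \<times> UNIV) (\<lambda>(t, x, z, y) m. hm t x z m y)"
    and bounded: "\<And>t x z m. t \<in> {0<..<T} \<Longrightarrow> m \<in> P2 \<Longrightarrow> \<bar>u t x z m\<bar> \<le> C"
      "\<And>t x z m. t \<in> {0<..<T} \<Longrightarrow> m \<in> P2 \<Longrightarrow> \<bar>ut t x z m\<bar> \<le> C"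
      "\<And>t x z m. t \<in> {0<..<T} \<Longrightarrow> m \<in> P2 \<Longrightarrow> norm (gx t x z m) \<le> C"
      "\<And>t x z m. t \<in> {0<..<T} \<Longrightarrow> m \<in> P2 \<Longrightarrow> norm (hx t x z m) \<le> C"
      "\<And>t x z m. t \<in> {0<..<T} \<Longrightarrow> m \<in> P2 \<Longrightarrow> norm (gz t x z m) \<le> C"
      "\<And>t x z m. t \<in> {0<..<T} \<Longrightarrow> m \<in> P2 \<Longrightarrow> norm (hz t x z m) \<le> C"
      "\<And>t x z m y. t \<in> {0<..<T} \<Longrightarrow> m \<in> P2 \<Longrightarrow> norm (gm t x z m y) \<le> C"
      "\<And>t x z m y. t \<in> {0<..<T} \<Longrightarrow> m \<in> P2 \<Longrightarrow> norm (hm t x z m y) \<le> C"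
begin

text \<open>\<open>m\<close> occurs twice, as integrating measure and as argument of
  \<open>u\<close>, so a perturbation of \<open>m\<close> acts on \<open>Q\<close> in two ways. For
  \<open>u\<close> constant in \<open>z\<close> this is simply the square of
  \<open>u\<close>.\<close>

definition Q :: "real \<Rightarrow> 'a \<Rightarrow> 'b measure \<Rightarrow> real" where
  "Q t x m = (\<integral>z. (u t x z m)\<^sup>2 \<partial>m)"

lemma slice_z:
  assumes t: "t \<in> {0<..<T}"
  shows "continuous_P2 UNIV (\<lambda>z m. u t x z m)" "continuous_P2 UNIV (\<lambda>z m. ut t x z m)"
    "continuous_P2 UNIV (\<lambda>z m. gx t x z m)" "continuous_P2 UNIV (\<lambda>z m. hx t x z m)"
    "continuous_P2 UNIV (\<lambda>z m. gz t x z m)" "continuous_P2 UNIV (\<lambda>z m. hz t x z m)"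
  using cont[THEN continuous_P2_slice, of "\<lambda>z. (t, x, z)"] t by (simp_all add: dist_Pair_Pair)

lemma slice_x:
  assumes t: "t \<in> {0<..<T}"
  shows "continuous_P2 UNIV (\<lambda>x m. u t x z m)" "continuous_P2 UNIV (\<lambda>x m. gx t x z m)"
    "continuous_P2 UNIV (\<lambda>x m. hx t x z m)"
  using cont(1,3,4)[THEN continuous_P2_slice, of "\<lambda>x. (t, x, z)"] t by (simp_all add: dist_Pair_Pair)

lemma slice_y:
  assumes t: "t \<in> {0<..<T}"
  shows "continuous_P2 UNIV (\<lambda>y m. gm t x z m y)" "continuous_P2 UNIV (\<lambda>y m. hm t x z m y)"
  using contm[THEN continuous_P2_slice, of "\<lambda>y. (t, x, z, y)"] t by (simp_all add: dist_Pair_Pair)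

lemma measurable_z:
  assumes t: "t \<in> {0<..<T}" and m: "m \<in> P2"
  shows "(\<lambda>z. u t x z m) \<in> borel_measurable borel" "(\<lambda>z. ut t x z m) \<in> borel_measurable borel"
    "(\<lambda>z. gx t x z m) \<in> borel_measurable borel" "(\<lambda>z. hx t x z m) \<in> borel_measurable borel"
    "(\<lambda>z. gz t x z m) \<in> borel_measurable borel" "(\<lambda>z. hz t x z m) \<in> borel_measurable borel"
  using slice_z[OF t, THEN continuous_P2_continuous_on, OF m]
  by (auto intro: borel_measurable_continuous_onI)

lemma C_nonneg: fixes m :: "'b measure" shows "t \<in> {0<..<T} \<Longrightarrow> m \<in> P2 \<Longrightarrow> 0 \<le> C"
  using bounded(1)[of t m] abs_ge_zero order_trans by blast

lemma D_measurable:
  assumes t: "t \<in> {0<..<T}" and m: "m \<in> P2"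
  shows "D t x z m \<in> borel_measurable borel" "\<And>\<nu>. prob_space \<nu> \<Longrightarrow> sets \<nu> = sets borel \<Longrightarrow> integrable \<nu> (D t x z m)"
proof -
  have cD: "continuous_P2 UNIV (\<lambda>y m. D t x z m y)" and bD: "bounded_P2 UNIV (\<lambda>y m. D t x z m y)"
    using dm[OF t] unfolding has_lin_deriv_def by auto
  show b: "D t x z m \<in> borel_measurable borel"
    using continuous_P2_continuous_on[OF cD m] by (intro borel_measurable_continuous_onI) simp
  obtain K where K: "\<And>y. \<bar>D t x z m y\<bar> \<le> K" using bD m unfolding bounded_P2_def by auto
  fix \<nu> :: "'b measure" assume \<nu>: "prob_space \<nu>" "sets \<nu> = sets borel"
  show "integrable \<nu> (D t x z m)"
    by (rule bounded_integrable[OF \<nu>(1), of _ K]) (use b K \<nu>(2) in \<open>simp_all cong: measurable_cong_sets\<close>)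
qed

text \<open>Domination comes from the mean value theorem in time, so all steps must stay in the open
  interval; \<open>N\<close> ensures this because \<open>hs\<close> decreases. Integrability of the
  limit is recorded, here and in the lemmas that follow, for the regrouping in
  \<open>energy_split\<close>.\<close>

lemma Q_time:
  assumes t: "t \<in> {0<..<T}" and m: "m \<in> P2" and N: "hs N < T - t"
  shows "(\<lambda>n. (Q (t + hs (n + N)) x m - Q t x m) / hs (n + N)) \<longlonglongrightarrow> (\<integral>z. 2 * u t x z m * ut t x z m \<partial>m)"
    and "integrable m (\<lambda>z. 2 * u t x z m * ut t x z m)"
proof -
  let ?h = "\<lambda>n. hs (n + N)"
  have hN: "?h n \<le> hs N" for n by (simp add: hs_def divide_simps)
  have tn: "t + ?h n \<in> {0<..<T}" "t + s \<in> {0<..<T}" if "0 \<le> s" "s \<le> ?h n" for n s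
    using t N hN[of n] hs(1)[of "n + N"] that by auto
  have tn': "t + ?h n \<in> {0<..<T}" for n using tn(1)[of 0 n] hs(1)[of "n+N"] by simp
  have hl: "?h \<longlonglongrightarrow> 0" using hs(3) by (rule LIMSEQ_ignore_initial_segment)
  let ?q = "\<lambda>n z. ((u (t + ?h n) x z m)\<^sup>2 - (u t x z m)\<^sup>2) / ?h n"
  have qe: "(Q (t + ?h n) x m - Q t x m) / ?h n = (\<integral>z. ?q n z \<partial>m)" for n
  proof -
    have i: "integrable m (\<lambda>z. (u s x z m)\<^sup>2)" if "s \<in> {0<..<T}" for s
    proof (rule bounded_integrable[OF P2_D(1)[OF m], of _ "C\<^sup>2"])
      show "(\<lambda>z. (u s x z m)\<^sup>2) \<in> borel_measurable m"
        by (rule measurable_P2[OF m]) (use measurable_z(1)[OF that m] in measurable)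
      show "norm ((u s x z m)\<^sup>2) \<le> C\<^sup>2" for z
        using bounded(1)[OF that m, of x z] by (simp add: abs_le_square_iff[symmetric])
    qed
    show ?thesis unfolding Q_def using i[OF tn'] i[OF t] by simp
  qed
  have bd: "\<bar>(u (t + ?h n) x z m - u t x z m) / ?h n\<bar> \<le> C" for n z
  proof -
    obtain s where s: "t < s" "s < t + ?h n" "u (t + ?h n) x z m - u t x z m = (t + ?h n - t) * ut s x z m"
    proof -
      have "\<exists>s>t. s < t + ?h n \<and> u (t + ?h n) x z m - u t x z m = (t + ?h n - t) * ut s x z m"
      proof (rule MVT2)
        fix s assume "t \<le> s" "s \<le> t + ?h n"
        then show "((\<lambda>s. u s x z m) has_real_derivative ut s x z m) (at s)"
          using dt[OF _ m, of s x z] tn(2)[of "s - t" n] by simp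
      qed (simp add: hs)
      then show thesis using that by blast
    qed
    have "s \<in> {0<..<T}" using tn(2)[of "s - t" n] s by simp
    with s(3) bounded(2)[OF this m, of x z] hs(1)[of "n + N"] show ?thesis by simp
  qed
  have lim: "(\<lambda>n. (u (t + ?h n) x z m - u t x z m) / ?h n) \<longlonglongrightarrow> ut t x z m" for z
    by (rule DERIV_hs[OF dt[OF t m]])
  have ul: "(\<lambda>n. u (t + ?h n) x z m) \<longlonglongrightarrow> u t x z m" for z
  proof -
    have "(\<lambda>n. u t x z m + ?h n * ((u (t + ?h n) x z m - u t x z m) / ?h n)) \<longlonglongrightarrow> u t x z m + 0 * ut t x z m"
      by (intro tendsto_intros hl lim)
    moreover have "u t x z m + ?h n * ((u (t + ?h n) x z m - u t x z m) / ?h n) = u (t + ?h n) x z m" for n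
      using hs(1)[of "n + N"] by simp
    ultimately show ?thesis by simp
  qed
  have ql: "(\<lambda>n. ?q n z) \<longlonglongrightarrow> 2 * u t x z m * ut t x z m" for z
    by (rule square_quot1[OF lim tendsto_const ul])
  have qb: "\<bar>?q n z\<bar> \<le> 2 * C\<^sup>2" for n z
    by (rule square_quot1_bound[OF bd bounded(1)[OF t m] bounded(1)[OF tn' m]])
  have qm: "?q n \<in> borel_measurable m" for n
    by (rule measurable_P2[OF m]) (use measurable_z(1)[OF t m] measurable_z(1)[OF tn' m] in measurable)
  show "(\<lambda>n. (Q (t + ?h n) x m - Q t x m) / ?h n) \<longlonglongrightarrow> (\<integral>z. 2 * u t x z m * ut t x z m \<partial>m)"
    unfolding qe by (rule bounded_convergence[OF P2_D(1)[OF m] qm ql qb])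
  show "integrable m (\<lambda>z. 2 * u t x z m * ut t x z m)"
    by (rule bounded_convergence_integrable[OF P2_D(1)[OF m] qm ql qb])
qed

lemma square_integrable:
  assumes t: "t \<in> {0<..<T}" and m: "m \<in> P2" and m': "m' \<in> P2" and f: "f \<in> borel_measurable borel"
  shows "integrable m' (\<lambda>z. (u t x' (f z) m)\<^sup>2)"
proof (rule bounded_integrable[OF P2_D(1)[OF m'], of _ "C\<^sup>2"])
  show "(\<lambda>z. (u t x' (f z) m)\<^sup>2) \<in> borel_measurable m'"
    by (rule measurable_P2[OF m']) (intro borel_measurable_power measurable_compose[OF f measurable_z(1)[OF t m]])
  show "norm ((u t x' (f z) m)\<^sup>2) \<le> C\<^sup>2" for z
    using bounded(1)[OF t m, of x' "f z"] by (simp add: abs_le_square_iff[symmetric])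
qed

lemma Q_x1:
  assumes t: "t \<in> {0<..<T}" and m: "m \<in> P2"
  shows "(\<lambda>n. (Q t (x + hs n *\<^sub>R \<beta>) m - Q t x m) / hs n) \<longlonglongrightarrow> (\<integral>z. 2 * u t x z m * (gx t x z m \<bullet> \<beta>) \<partial>m)"
    and "integrable m (\<lambda>z. 2 * u t x z m * (gx t x z m \<bullet> \<beta>))"
proof -
  let ?q = "\<lambda>n z. ((u t (x + hs n *\<^sub>R \<beta>) z m)\<^sup>2 - (u t x z m)\<^sup>2) / hs n"
  have qe: "(Q t (x + hs n *\<^sub>R \<beta>) m - Q t x m) / hs n = (\<integral>z. ?q n z \<partial>m)" for n
    unfolding Q_def using square_integrable[OF t m m, of "\<lambda>z. z"] by simp
  note q1 = quot1[where F="\<lambda>x m. u t x z m" and g="\<lambda>x m. gx t x z m" and C=C for z,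
      OF dx[OF t] slice_x(2)[OF t] bounded(3)[OF t]]
  have lim: "(\<lambda>n. (u t (x + hs n *\<^sub>R v) z m - u t x z m) / hs n) \<longlonglongrightarrow> gx t x z m \<bullet> v" for z v
    by (rule q1(1)) (simp_all add: m d2_self[OF m])
  have b1: "\<bar>(u t (x + hs n *\<^sub>R v) z m - u t x z m) / hs n\<bar> \<le> C * norm v" for n v z
    by (rule q1(2)) (simp_all add: m)
  have ul: "(\<lambda>n. u t (x + hs n *\<^sub>R \<beta>) z m) \<longlonglongrightarrow> u t x z m" for z
  proof -
    have "(\<lambda>n. x + hs n *\<^sub>R \<beta>) \<longlonglongrightarrow> x + 0 *\<^sub>R \<beta>" by (intro tendsto_intros hs)
    then show ?thesis
      by (intro continuous_P2_seq[OF slice_x(1)[OF t]]) (use m d2_self[OF m] in auto)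
  qed
  have ql: "(\<lambda>n. ?q n z) \<longlonglongrightarrow> 2 * u t x z m * (gx t x z m \<bullet> \<beta>)" for z
    by (rule square_quot1[OF lim tendsto_const ul])
  let ?K = "C + C * norm \<beta>"
  have C: "0 \<le> C" "0 \<le> C * norm \<beta>" using C_nonneg[OF t m] by auto
  have "\<bar>(u t (x + hs n *\<^sub>R \<beta>) z m - u t x z m) / hs n\<bar> \<le> ?K" "\<bar>u t x' z m\<bar> \<le> ?K" for n z x'
    using b1[of n \<beta> z] bounded(1)[OF t m, of x' z] C by linarith+
  then have qb: "\<bar>?q n z\<bar> \<le> 2 * ?K\<^sup>2" for n z by (intro square_quot1_bound)
  have qm: "?q n \<in> borel_measurable m" for n
    by (rule measurable_P2[OF m]) (use measurable_z(1)[OF t m] in measurable)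
  show "(\<lambda>n. (Q t (x + hs n *\<^sub>R \<beta>) m - Q t x m) / hs n) \<longlonglongrightarrow> (\<integral>z. 2 * u t x z m * (gx t x z m \<bullet> \<beta>) \<partial>m)"
    unfolding qe by (rule bounded_convergence[OF P2_D(1)[OF m] qm ql qb])
  show "integrable m (\<lambda>z. 2 * u t x z m * (gx t x z m \<bullet> \<beta>))"
    by (rule bounded_convergence_integrable[OF P2_D(1)[OF m] qm ql qb])
qed

lemma Q_x2:
  assumes t: "t \<in> {0<..<T}" and m: "m \<in> P2"
  shows "(\<lambda>n. (Q t (x + hs n *\<^sub>R e) m + Q t (x - hs n *\<^sub>R e) m - 2 * Q t x m) / (hs n)\<^sup>2)
      \<longlonglongrightarrow> (\<integral>z. 2 * u t x z m * (hx t x z m e \<bullet> e) + 2 * (gx t x z m \<bullet> e)\<^sup>2 \<partial>m)"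
    and "integrable m (\<lambda>z. 2 * u t x z m * (hx t x z m e \<bullet> e) + 2 * (gx t x z m \<bullet> e)\<^sup>2)"
proof -
  let ?q = "\<lambda>n z. ((u t (x + hs n *\<^sub>R e) z m)\<^sup>2 + (u t (x - hs n *\<^sub>R e) z m)\<^sup>2 - 2 * (u t x z m)\<^sup>2) / (hs n)\<^sup>2"
  have qe: "(Q t (x + hs n *\<^sub>R e) m + Q t (x - hs n *\<^sub>R e) m - 2 * Q t x m) / (hs n)\<^sup>2 = (\<integral>z. ?q n z \<partial>m)" for n
    unfolding Q_def using square_integrable[OF t m m, of "\<lambda>z. z"] by simp
  note q1 = quot1[where F="\<lambda>x m. u t x z m" and g="\<lambda>x m. gx t x z m" and C=C for z,
      OF dx[OF t] slice_x(2)[OF t] bounded(3)[OF t]]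
  note q2 = quot2[where F="\<lambda>x m. u t x z m" and g="\<lambda>x m. gx t x z m" and J="\<lambda>x m. hx t x z m" and C=C for z,
      OF dx[OF t] dx2[OF t] slice_x(3)[OF t] bounded(4)[OF t]]
  have lim: "(\<lambda>n. (u t (x + hs n *\<^sub>R v) z m - u t x z m) / hs n) \<longlonglongrightarrow> gx t x z m \<bullet> v" for z v
    by (rule q1(1)) (simp_all add: m d2_self[OF m])
  have b1: "\<bar>(u t (x + hs n *\<^sub>R v) z m - u t x z m) / hs n\<bar> \<le> C * norm v" for n v z
    by (rule q1(2)) (simp_all add: m)
  have b2: "\<bar>(u t (x + hs n *\<^sub>R e) z m + u t (x - hs n *\<^sub>R e) z m - 2 * u t x z m) / (hs n)\<^sup>2\<bar> \<le> C * (norm e)\<^sup>2" for n z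
    by (rule q2(2)) (simp_all add: m)
  have lim': "(\<lambda>n. (u t (x - hs n *\<^sub>R e) z m - u t x z m) / hs n) \<longlonglongrightarrow> - (gx t x z m \<bullet> e)" for z
    using lim[of "- e" z] by simp
  have lim2: "(\<lambda>n. (u t (x + hs n *\<^sub>R e) z m + u t (x - hs n *\<^sub>R e) z m - 2 * u t x z m) / (hs n)\<^sup>2) \<longlonglongrightarrow> hx t x z m e \<bullet> e" for z
    by (rule q2(1)) (simp_all add: m d2_self[OF m])
  have ql: "(\<lambda>n. ?q n z) \<longlonglongrightarrow> 2 * u t x z m * (hx t x z m e \<bullet> e) + 2 * (gx t x z m \<bullet> e)\<^sup>2" for z
    by (rule square_quot2[OF lim2 lim lim' tendsto_const])
  \<comment> \<open>The sum majorises the bounds for the value, the first and the second quotient,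
    since \<open>square_quot2_bound\<close> takes a single constant.\<close>
  let ?K = "C + C * norm e + C * (norm e)\<^sup>2"
  have C: "0 \<le> C" "0 \<le> C * norm e" "0 \<le> C * (norm e)\<^sup>2" using C_nonneg[OF t m] by auto
  have "\<bar>(u t (x + hs n *\<^sub>R e) z m - u t x z m) / hs n\<bar> \<le> ?K" "\<bar>(u t (x - hs n *\<^sub>R e) z m - u t x z m) / hs n\<bar> \<le> ?K"
    "\<bar>u t x z m\<bar> \<le> ?K" "\<bar>(u t (x + hs n *\<^sub>R e) z m + u t (x - hs n *\<^sub>R e) z m - 2 * u t x z m) / (hs n)\<^sup>2\<bar> \<le> ?K" for n z
    using b1[of n e z] b1[of n "- e" z, unfolded scaleR_minus_right norm_minus_cancel add_uminus_conv_diff]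
      b2[of n z] bounded(1)[OF t m, of x z] C by linarith+
  then have qb: "\<bar>?q n z\<bar> \<le> 4 * ?K\<^sup>2" for n z by (intro square_quot2_bound hs)
  have qm: "?q n \<in> borel_measurable m" for n
    by (rule measurable_P2[OF m]) (use measurable_z(1)[OF t m] in measurable)
  show "(\<lambda>n. (Q t (x + hs n *\<^sub>R e) m + Q t (x - hs n *\<^sub>R e) m - 2 * Q t x m) / (hs n)\<^sup>2)
      \<longlonglongrightarrow> (\<integral>z. 2 * u t x z m * (hx t x z m e \<bullet> e) + 2 * (gx t x z m \<bullet> e)\<^sup>2 \<partial>m)"
    unfolding qe by (rule bounded_convergence[OF P2_D(1)[OF m] qm ql qb])
  show "integrable m (\<lambda>z. 2 * u t x z m * (hx t x z m e \<bullet> e) + 2 * (gx t x z m \<bullet> e)\<^sup>2)"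
    by (rule bounded_convergence_integrable[OF P2_D(1)[OF m] qm ql qb])
qed

end

section \<open>Perturbations of the measure\<close>

context smooth_field
begin

text \<open>A change of variables writes the integral of \<open>D\<close> against the transported
  measure as an integral against \<open>m\<close>; the kernel \<open>?R\<close> required by
  \<open>lin_deriv_quotient\<close> is then a difference quotient of \<open>D\<close> along
  \<open>b\<close>.\<close>

lemma drift_quotient:
  assumes t: "t \<in> {0<..<T}" and m: "m \<in> P2" and b: "b \<in> borel_measurable borel" "\<And>y. norm (b y) \<le> B"
  shows "(\<lambda>n. (u t x z (drift b m n) - u t x z m) / hs n) \<longlonglongrightarrow> (\<integral>y. gm t x z m y \<bullet> b y \<partial>m)"
    and "\<bar>(u t x z (drift b m n) - u t x z m) / hs n\<bar> \<le> C * B"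
proof -
  let ?R = "\<lambda>n \<nu> y. (D t x z \<nu> (y + hs n *\<^sub>R b y) - D t x z \<nu> y) / hs n"
  note q1 = quot1[where F="\<lambda>y \<nu>. D t x z \<nu> y" and g="\<lambda>y \<nu>. gm t x z \<nu> y" and C=C,
      OF dm1[OF t] slice_y(1)[OF t] bounded(7)[OF t]]
  have C: "0 \<le> C" by (rule C_nonneg[OF t m])
  have R: "(\<integral>y. D t x z \<nu> y \<partial>drift b m n) - (\<integral>y. D t x z \<nu> y \<partial>m) = hs n * (\<integral>y. ?R n \<nu> y \<partial>m)"
    if \<nu>: "\<nu> \<in> P2" for \<nu> n
  proof -
    note P = drift_P2[OF m b, of n]
    have i: "integrable m (\<lambda>y. D t x z \<nu> (y + hs n *\<^sub>R b y))"
    proof -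
      have "integrable (drift b m n) (D t x z \<nu>)" by (rule D_measurable(2)[OF t \<nu> P2_D(1,2)[OF P]])
      moreover have "(\<lambda>y. y + hs n *\<^sub>R b y) \<in> borel_measurable m"
        by (rule measurable_P2[OF m]) (use b(1) in measurable)
      ultimately show ?thesis
        unfolding drift_def using D_measurable(1)[OF t \<nu>] by (subst (asm) integrable_distr_eq)
    qed
    show ?thesis
      unfolding drift_integral[OF m b D_measurable(1)[OF t \<nu>]]
      using i D_measurable(2)[OF t \<nu> P2_D(1,2)[OF m]] hs(1)[of n] by simp
  qed
  have Rm: "?R n \<nu> \<in> borel_measurable borel" if "\<nu> \<in> P2" for n \<nu>
    using D_measurable(1)[OF t that, of x z] b(1) by measurable
  have RC: "\<bar>?R n \<nu> y\<bar> \<le> C * B" if "\<nu> \<in> P2" for n \<nu> y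
  proof -
    have "\<bar>?R n \<nu> y\<bar> \<le> C * norm (b y)" by (rule q1(2)) (simp_all add: that)
    also have "\<dots> \<le> C * B" using C b(2) by (intro mult_left_mono)
    finally show ?thesis .
  qed
  have lim: "(\<lambda>n. ?R n (\<nu> n) y) \<longlonglongrightarrow> gm t x z m y \<bullet> b y"
    if "\<And>n. \<nu> n \<in> P2" "(\<lambda>n. d2 (\<nu> n) m) \<longlonglongrightarrow> 0" for \<nu> y
    by (rule q1(1)) (simp_all add: that m)
  note L = lin_deriv_quotient[where D="D t x z" and U="u t x z" and \<mu>="drift b m" and a=hs and R="?R",
     OF dm[OF t] m drift_P2[OF m b] hs(1) drift_mix[OF m b] R Rm RC lim]
  show "(\<lambda>n. (u t x z (drift b m n) - u t x z m) / hs n) \<longlonglongrightarrow> (\<integral>y. gm t x z m y \<bullet> b y \<partial>m)"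
    by (rule L(1))
  show "\<bar>(u t x z (drift b m n) - u t x z m) / hs n\<bar> \<le> C * B" by (rule L(2))
qed

text \<open>The same scheme at scale \<open>(hs n)\<^sup>2\<close>, with second differences of
  \<open>D\<close> in \<open>y\<close> as kernel. Averaging the two shifts accounts for the factor
  1/2.\<close>

lemma heat_quotient:
  assumes t: "t \<in> {0<..<T}" and m: "m \<in> P2"
  shows "(\<lambda>n. (u t x z (heat e m n) - u t x z m) / (hs n)\<^sup>2) \<longlonglongrightarrow> (\<integral>y. (hm t x z m y e \<bullet> e) / 2 \<partial>m)"
    and "\<bar>(u t x z (heat e m n) - u t x z m) / (hs n)\<^sup>2\<bar> \<le> C * (norm e)\<^sup>2"
proof -
  let ?R = "\<lambda>n \<nu> y. ((D t x z \<nu> (y + hs n *\<^sub>R e) + D t x z \<nu> (y - hs n *\<^sub>R e) - 2 * D t x z \<nu> y) / (hs n)\<^sup>2) / 2"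
  note q2 = quot2[where F="\<lambda>y \<nu>. D t x z \<nu> y" and g="\<lambda>y \<nu>. gm t x z \<nu> y" and J="\<lambda>y \<nu>. hm t x z \<nu> y" and C=C,
      OF dm1[OF t] dm2[OF t, simplified] slice_y(2)[OF t] bounded(8)[OF t]]
  have C: "0 \<le> C" by (rule C_nonneg[OF t m])
  have i: "integrable m (\<lambda>y. D t x z \<nu> (y + c))" if \<nu>: "\<nu> \<in> P2" for \<nu> c
  proof -
    have X: "(\<lambda>y. y + c) \<in> borel_measurable m" by (rule measurable_P2[OF m]) measurable
    have "integrable (distr m borel (\<lambda>y. y + c)) (D t x z \<nu>)"
      by (rule D_measurable(2)[OF t \<nu>]) (simp_all add: prob_space.prob_space_distr[OF P2_D(1)[OF m] X])
    then show ?thesis using D_measurable(1)[OF t \<nu>] X by (subst (asm) integrable_distr_eq)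
  qed
  have i': "integrable m (\<lambda>y. D t x z \<nu> (y - c))" if \<nu>: "\<nu> \<in> P2" for \<nu> c
    using i[OF \<nu>, of "- c"] by simp
  have R: "(\<integral>y. D t x z \<nu> y \<partial>heat e m n) - (\<integral>y. D t x z \<nu> y \<partial>m) = (hs n)\<^sup>2 * (\<integral>y. ?R n \<nu> y \<partial>m)"
    if \<nu>: "\<nu> \<in> P2" for \<nu> n
  proof -
    note j = i[OF \<nu>] i'[OF \<nu>] D_measurable(2)[OF t \<nu> P2_D(1,2)[OF m]]
    have "(\<integral>y. ?R n \<nu> y \<partial>m) = ((\<integral>y. D t x z \<nu> (y + hs n *\<^sub>R e) \<partial>m) + (\<integral>y. D t x z \<nu> (y - hs n *\<^sub>R e) \<partial>m)
       - 2 * (\<integral>y. D t x z \<nu> y \<partial>m)) / (hs n)\<^sup>2 / 2"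
      using j by simp
    moreover have "(\<integral>y. D t x z \<nu> y \<partial>heat e m n) =
      ((\<integral>y. D t x z \<nu> (y + hs n *\<^sub>R e) \<partial>m) + (\<integral>y. D t x z \<nu> (y - hs n *\<^sub>R e) \<partial>m)) / 2"
      unfolding heat_integral[OF m D_measurable(1)[OF t \<nu>] i[OF \<nu>] i'[OF \<nu>]] using j by simp
    ultimately show ?thesis using hs(1)[of n] by (simp add: field_simps)
  qed
  have Rm: "?R n \<nu> \<in> borel_measurable borel" if "\<nu> \<in> P2" for n \<nu>
    using D_measurable(1)[OF t that, of x z] by measurable
  have RC: "\<bar>?R n \<nu> y\<bar> \<le> C * (norm e)\<^sup>2" if "\<nu> \<in> P2" for n \<nu> y
  proof -
    have "\<bar>(D t x z \<nu> (y + hs n *\<^sub>R e) + D t x z \<nu> (y - hs n *\<^sub>R e) - 2 * D t x z \<nu> y) / (hs n)\<^sup>2\<bar> \<le> C * (norm e)\<^sup>2"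
      by (rule q2(2)) (simp_all add: that)
    moreover have "\<bar>a / 2\<bar> \<le> K" if "\<bar>a\<bar> \<le> K" for a K :: real using that by simp
    ultimately show ?thesis by blast
  qed
  have lim: "(\<lambda>n. ?R n (\<nu> n) y) \<longlonglongrightarrow> (hm t x z m y e \<bullet> e) / 2"
    if "\<And>n. \<nu> n \<in> P2" "(\<lambda>n. d2 (\<nu> n) m) \<longlonglongrightarrow> 0" for \<nu> y
    by (rule tendsto_divide[OF q2(1) tendsto_const]) (simp_all add: that m)
  have h2: "0 < (hs n)\<^sup>2" for n using hs(1)[of n] by simp
  note L = lin_deriv_quotient[where D="D t x z" and U="u t x z" and \<mu>="heat e m" and a="\<lambda>n. (hs n)\<^sup>2" and R="?R",
     OF dm[OF t] m heat_P2[OF m] h2 heat_mix[OF m] R Rm RC lim]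
  show "(\<lambda>n. (u t x z (heat e m n) - u t x z m) / (hs n)\<^sup>2) \<longlonglongrightarrow> (\<integral>y. (hm t x z m y e \<bullet> e) / 2 \<partial>m)"
    by (rule L(1))
  show "\<bar>(u t x z (heat e m n) - u t x z m) / (hs n)\<^sup>2\<bar> \<le> C * (norm e)\<^sup>2" by (rule L(2))
qed

text \<open>The increment of \<open>u\<close> is split at \<open>u t x z (drift b m n)\<close>: one
  part moves the point along \<open>b\<close> under the perturbed measure, the other moves only the
  measure.\<close>

lemma Q_drift:
  assumes t: "t \<in> {0<..<T}" and m: "m \<in> P2" and b: "b \<in> borel_measurable borel" "\<And>y. norm (b y) \<le> B"
  shows "(\<lambda>n. (Q t x (drift b m n) - Q t x m) / hs n) \<longlonglongrightarrow>
      (\<integral>z. 2 * u t x z m * (gz t x z m \<bullet> b z + (\<integral>y. gm t x z m y \<bullet> b y \<partial>m)) \<partial>m)"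
    and "integrable m (\<lambda>z. 2 * u t x z m * (gz t x z m \<bullet> b z + (\<integral>y. gm t x z m y \<bullet> b y \<partial>m)))"
proof -
  let ?q = "\<lambda>n z. ((u t x (z + hs n *\<^sub>R b z) (drift b m n))\<^sup>2 - (u t x z m)\<^sup>2) / hs n"
  note P = drift_P2[OF m b]
  have fb: "(\<lambda>z. z + hs n *\<^sub>R b z) \<in> borel_measurable borel" for n using b(1) by measurable
  have qe: "(Q t x (drift b m n) - Q t x m) / hs n = (\<integral>z. ?q n z \<partial>m)" for n
  proof -
    have "Q t x (drift b m n) = (\<integral>z. (u t x (z + hs n *\<^sub>R b z) (drift b m n))\<^sup>2 \<partial>m)"
      unfolding Q_def by (rule drift_integral[OF m b]) (use measurable_z(1)[OF t P] in measurable)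
    then show ?thesis
      using square_integrable[OF t P m fb] square_integrable[OF t m m, of "\<lambda>z. z"] by (simp add: Q_def)
  qed
  note q1 = quot1[where F="\<lambda>z \<nu>. u t x z \<nu>" and g="\<lambda>z \<nu>. gz t x z \<nu>" and C=C,
      OF dz[OF t] slice_z(5)[OF t] bounded(5)[OF t]]
  have C: "0 \<le> C" by (rule C_nonneg[OF t m])
  have B: "0 \<le> B" using norm_ge_zero b(2) order_trans by blast
  have lim1: "(\<lambda>n. (u t x (z + hs n *\<^sub>R b z) (drift b m n) - u t x z (drift b m n)) / hs n) \<longlonglongrightarrow> gz t x z m \<bullet> b z" for z
    by (rule q1(1)) (simp_all add: P m drift_d2[OF m b])
  have split: "(u t x (z + hs n *\<^sub>R b z) (drift b m n) - u t x z m) / hs n =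
     (u t x (z + hs n *\<^sub>R b z) (drift b m n) - u t x z (drift b m n)) / hs n + (u t x z (drift b m n) - u t x z m) / hs n" for n z
    by (simp add: diff_divide_distrib)
  have lim: "(\<lambda>n. (u t x (z + hs n *\<^sub>R b z) (drift b m n) - u t x z m) / hs n) \<longlonglongrightarrow>
     gz t x z m \<bullet> b z + (\<integral>y. gm t x z m y \<bullet> b y \<partial>m)" for z
    unfolding split by (intro tendsto_add lim1 drift_quotient(1)[OF t m b])
  have ul: "(\<lambda>n. u t x (z + hs n *\<^sub>R b z) (drift b m n)) \<longlonglongrightarrow> u t x z m" for z
  proof -
    have "(\<lambda>n. z + hs n *\<^sub>R b z) \<longlonglongrightarrow> z + 0 *\<^sub>R b z" by (intro tendsto_intros hs)
    then show ?thesis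
      by (intro continuous_P2_seq[OF slice_z(1)[OF t]]) (use m P drift_d2[OF m b] in auto)
  qed
  have ql: "(\<lambda>n. ?q n z) \<longlonglongrightarrow> 2 * u t x z m * (gz t x z m \<bullet> b z + (\<integral>y. gm t x z m y \<bullet> b y \<partial>m))" for z
    by (rule square_quot1[OF lim tendsto_const ul])
  let ?K = "C + 2 * (C * B)"
  have CB: "0 \<le> C * B" using C B by simp
  have bq: "\<bar>(u t x (z + hs n *\<^sub>R b z) (drift b m n) - u t x z m) / hs n\<bar> \<le> ?K" for n z
  proof -
    have "\<bar>(u t x (z + hs n *\<^sub>R b z) (drift b m n) - u t x z (drift b m n)) / hs n\<bar> \<le> C * norm (b z)"
      by (rule q1(2)) (simp_all add: P)
    also have "\<dots> \<le> C * B" using C b(2) by (intro mult_left_mono)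
    finally show ?thesis
      unfolding split using drift_quotient(2)[OF t m b, of x z n] C by argo
  qed
  have bu: "\<bar>u t x z' \<nu>\<bar> \<le> ?K" if "\<nu> \<in> P2" for z' \<nu>
    using bounded(1)[OF t that, of x z'] CB by linarith
  have qb: "\<bar>?q n z\<bar> \<le> 2 * ?K\<^sup>2" for n z by (rule square_quot1_bound[OF bq bu[OF m] bu[OF P]])
  have qm: "?q n \<in> borel_measurable m" for n
  proof (rule measurable_P2[OF m])
    have "(\<lambda>z. u t x (z + hs n *\<^sub>R b z) (drift b m n)) \<in> borel_measurable borel"
      by (rule measurable_compose[OF fb measurable_z(1)[OF t P]])
    then show "?q n \<in> borel_measurable borel" using measurable_z(1)[OF t m, of x] by measurable
  qed
  show "(\<lambda>n. (Q t x (drift b m n) - Q t x m) / hs n) \<longlonglongrightarrow>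
      (\<integral>z. 2 * u t x z m * (gz t x z m \<bullet> b z + (\<integral>y. gm t x z m y \<bullet> b y \<partial>m)) \<partial>m)"
    unfolding qe by (rule bounded_convergence[OF P2_D(1)[OF m] qm ql qb])
  show "integrable m (\<lambda>z. 2 * u t x z m * (gz t x z m \<bullet> b z + (\<integral>y. gm t x z m y \<bullet> b y \<partial>m)))"
    by (rule bounded_convergence_integrable[OF P2_D(1)[OF m] qm ql qb])
qed

text \<open>The two occurrences of \<open>m\<close> are separated. In the integrating measure the
  step becomes a second difference in \<open>z\<close> (\<open>?q1\<close>), whose squares leave the
  squared gradient; in the argument of \<open>u\<close> it is an increment of second order
  (\<open>?q2\<close>), which contributes linearly. As that increment has no first order part, no
  cross term arises.\<close>

lemma Q_heat:
  assumes t: "t \<in> {0<..<T}" and m: "m \<in> P2"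
  shows "(\<lambda>n. (Q t x (heat e m n) - Q t x m) / (hs n)\<^sup>2) \<longlonglongrightarrow>
      (\<integral>z. u t x z m * (hz t x z m e \<bullet> e) + (gz t x z m \<bullet> e)\<^sup>2 + u t x z m * (\<integral>y. hm t x z m y e \<bullet> e \<partial>m) \<partial>m)"
    and "integrable m (\<lambda>z. u t x z m * (hz t x z m e \<bullet> e) + (gz t x z m \<bullet> e)\<^sup>2 + u t x z m * (\<integral>y. hm t x z m y e \<bullet> e \<partial>m))"
proof -
  let ?v = "\<lambda>n. heat e m n"
  let ?q1 = "\<lambda>n z. ((u t x (z + hs n *\<^sub>R e) (?v n))\<^sup>2 + (u t x (z - hs n *\<^sub>R e) (?v n))\<^sup>2 - 2 * (u t x z (?v n))\<^sup>2) / (hs n)\<^sup>2"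
  let ?q2 = "\<lambda>n z. ((u t x z (?v n))\<^sup>2 - (u t x z m)\<^sup>2) / (hs n)\<^sup>2"
  \<comment> \<open>The random walk averages its two shifts, hence the half.\<close>
  let ?q = "\<lambda>n z. ?q1 n z / 2 + ?q2 n z"
  note P = heat_P2[OF m, of e]
  have qe: "(Q t x (?v n) - Q t x m) / (hs n)\<^sup>2 = (\<integral>z. ?q n z \<partial>m)" for n
  proof -
    have i: "integrable m (\<lambda>z. (u t x (z + hs n *\<^sub>R e) (?v n))\<^sup>2)" "integrable m (\<lambda>z. (u t x (z - hs n *\<^sub>R e) (?v n))\<^sup>2)"
      "integrable m (\<lambda>z. (u t x z (?v n))\<^sup>2)" "integrable m (\<lambda>z. (u t x z m)\<^sup>2)"
      by (rule square_integrable[OF t P m] square_integrable[OF t m m], measurable)+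
    have "Q t x (?v n) = (\<integral>z. ((u t x (z + hs n *\<^sub>R e) (?v n))\<^sup>2 + (u t x (z - hs n *\<^sub>R e) (?v n))\<^sup>2) / 2 \<partial>m)"
      unfolding Q_def by (rule heat_integral[OF m _ i(1,2)]) (use measurable_z(1)[OF t P] in measurable)
    then have "(Q t x (?v n) - Q t x m) / (hs n)\<^sup>2 =
      (\<integral>z. (((u t x (z + hs n *\<^sub>R e) (?v n))\<^sup>2 + (u t x (z - hs n *\<^sub>R e) (?v n))\<^sup>2) / 2 - (u t x z m)\<^sup>2) / (hs n)\<^sup>2 \<partial>m)"
      using i by (simp add: Q_def)
    also have "\<dots> = (\<integral>z. ?q n z \<partial>m)"
      using hs(1)[of n] by (intro Bochner_Integration.integral_cong) (simp_all add: field_simps)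
    finally show ?thesis .
  qed
  note q1 = quot1[where F="\<lambda>z \<nu>. u t x z \<nu>" and g="\<lambda>z \<nu>. gz t x z \<nu>" and C=C,
      OF dz[OF t] slice_z(5)[OF t] bounded(5)[OF t]]
  note q2 = quot2[where F="\<lambda>z \<nu>. u t x z \<nu>" and g="\<lambda>z \<nu>. gz t x z \<nu>" and J="\<lambda>z \<nu>. hz t x z \<nu>" and C=C,
      OF dz[OF t] dz2[OF t] slice_z(6)[OF t] bounded(6)[OF t]]
  have C: "0 \<le> C" by (rule C_nonneg[OF t m])
  have lim1: "(\<lambda>n. (u t x (z + hs n *\<^sub>R v) (?v n) - u t x z (?v n)) / hs n) \<longlonglongrightarrow> gz t x z m \<bullet> v" for z v
    by (rule q1(1)) (simp_all add: P m heat_d2[OF m])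
  have lim1': "(\<lambda>n. (u t x (z - hs n *\<^sub>R e) (?v n) - u t x z (?v n)) / hs n) \<longlonglongrightarrow> - (gz t x z m \<bullet> e)" for z
    using lim1[of z "- e"] by simp
  have lim2: "(\<lambda>n. (u t x (z + hs n *\<^sub>R e) (?v n) + u t x (z - hs n *\<^sub>R e) (?v n) - 2 * u t x z (?v n)) / (hs n)\<^sup>2) \<longlonglongrightarrow> hz t x z m e \<bullet> e" for z
    by (rule q2(1)) (simp_all add: P m heat_d2[OF m])
  have b1: "\<bar>(u t x (z + hs n *\<^sub>R v) (?v n) - u t x z (?v n)) / hs n\<bar> \<le> C * norm v" for n v z
    by (rule q1(2)) (simp_all add: P)
  have b2: "\<bar>(u t x (z + hs n *\<^sub>R e) (?v n) + u t x (z - hs n *\<^sub>R e) (?v n) - 2 * u t x z (?v n)) / (hs n)\<^sup>2\<bar> \<le> C * (norm e)\<^sup>2" for n z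
    by (rule q2(2)) (simp_all add: P)
  have ul: "(\<lambda>n. u t x z (?v n)) \<longlonglongrightarrow> u t x z m" for z
    by (intro continuous_P2_seq[OF slice_z(1)[OF t]]) (use m P heat_d2[OF m] in auto)
  have ql1: "(\<lambda>n. ?q1 n z) \<longlonglongrightarrow> 2 * u t x z m * (hz t x z m e \<bullet> e) + 2 * (gz t x z m \<bullet> e)\<^sup>2" for z
    by (rule square_quot2[OF lim2 lim1 lim1' ul])
  have ql2: "(\<lambda>n. ?q2 n z) \<longlonglongrightarrow> 2 * u t x z m * (\<integral>y. (hm t x z m y e \<bullet> e) / 2 \<partial>m)" for z
    by (rule square_quot1[OF heat_quotient(1)[OF t m] tendsto_const ul])
  have ql: "(\<lambda>n. ?q n z) \<longlonglongrightarrow>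
     u t x z m * (hz t x z m e \<bullet> e) + (gz t x z m \<bullet> e)\<^sup>2 + u t x z m * (\<integral>y. hm t x z m y e \<bullet> e \<partial>m)" for z
  proof -
    have eq: "(2 * u t x z m * (hz t x z m e \<bullet> e) + 2 * (gz t x z m \<bullet> e)\<^sup>2) / 2 + 2 * u t x z m * (\<integral>y. (hm t x z m y e \<bullet> e) / 2 \<partial>m)
      = u t x z m * (hz t x z m e \<bullet> e) + (gz t x z m \<bullet> e)\<^sup>2 + u t x z m * (\<integral>y. hm t x z m y e \<bullet> e \<partial>m)"
      by (simp add: field_simps)
    have "(\<lambda>n. ?q n z) \<longlonglongrightarrow> (2 * u t x z m * (hz t x z m e \<bullet> e) + 2 * (gz t x z m \<bullet> e)\<^sup>2) / 2
       + 2 * u t x z m * (\<integral>y. (hm t x z m y e \<bullet> e) / 2 \<partial>m)"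
      by (intro tendsto_add tendsto_divide ql1 ql2 tendsto_const) simp
    then show ?thesis unfolding eq .
  qed
  let ?K = "C + C * norm e + C * (norm e)\<^sup>2"
  have K: "0 \<le> C * norm e" "0 \<le> C * (norm e)\<^sup>2" using C by auto
  have bk: "\<bar>(u t x (z + hs n *\<^sub>R e) (?v n) - u t x z (?v n)) / hs n\<bar> \<le> ?K"
     "\<bar>(u t x (z - hs n *\<^sub>R e) (?v n) - u t x z (?v n)) / hs n\<bar> \<le> ?K"
     "\<bar>(u t x (z + hs n *\<^sub>R e) (?v n) + u t x (z - hs n *\<^sub>R e) (?v n) - 2 * u t x z (?v n)) / (hs n)\<^sup>2\<bar> \<le> ?K"
     "\<bar>u t x z (?v n)\<bar> \<le> ?K" "\<bar>u t x z m\<bar> \<le> ?K" "\<bar>(u t x z (?v n) - u t x z m) / (hs n)\<^sup>2\<bar> \<le> ?K" for n z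
    using b1[where n=n and z=z and v=e] b1[where n=n and z=z and v="- e", unfolded scaleR_minus_right norm_minus_cancel add_uminus_conv_diff]
      b2[of z n] bounded(1)[OF t P[of n], of x z] bounded(1)[OF t m, of x z] heat_quotient(2)[OF t m, of x z e n] C K by linarith+
  have qb: "\<bar>?q n z\<bar> \<le> 4 * ?K\<^sup>2" for n z
    using square_quot2_bound[OF bk(3,1,2,4) hs(1), of z n] square_quot1_bound[OF bk(6,5,4), of z n] by argo
  have qm: "?q n \<in> borel_measurable m" for n
    by (rule measurable_P2[OF m]) (use measurable_z(1)[OF t m] measurable_z(1)[OF t P] in measurable)
  show "(\<lambda>n. (Q t x (?v n) - Q t x m) / (hs n)\<^sup>2) \<longlonglongrightarrow>
      (\<integral>z. u t x z m * (hz t x z m e \<bullet> e) + (gz t x z m \<bullet> e)\<^sup>2 + u t x z m * (\<integral>y. hm t x z m y e \<bullet> e \<partial>m) \<partial>m)"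
    unfolding qe by (rule bounded_convergence[OF P2_D(1)[OF m] qm ql qb])
  show "integrable m (\<lambda>z. u t x z m * (hz t x z m e \<bullet> e) + (gz t x z m \<bullet> e)\<^sup>2 + u t x z m * (\<integral>y. hm t x z m y e \<bullet> e \<partial>m))"
    by (rule bounded_convergence_integrable[OF P2_D(1)[OF m] qm ql qb])
qed

end

section \<open>Classical solutions and their differences as smooth fields\<close>

lemma GDERIV_grad:
  fixes f :: "'e::euclidean_space \<Rightarrow> real"
  assumes "f differentiable (at x)" shows "GDERIV f x :> grad f x"
proof -
  obtain f' where f': "(f has_derivative f') (at x)" using assms unfolding differentiable_def by blast
  let ?D = "\<Sum>e\<in>Basis. f' e *\<^sub>R e"
  have l: "linear f'" using has_derivative_linear[OF f'] .
  have "f' h = h \<bullet> ?D" for h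
  proof -
    have "f' h = f' (\<Sum>e\<in>Basis. (h \<bullet> e) *\<^sub>R e)" by (simp only: euclidean_representation)
    also have "\<dots> = (\<Sum>e\<in>Basis. (h \<bullet> e) * f' e)" using l by (simp add: linear_sum linear_cmul)
    finally show ?thesis by (simp add: inner_sum_right mult.commute)
  qed
  then have "f' = (\<lambda>h. h \<bullet> ?D)" by (rule ext)
  with f' have "GDERIV f x :> ?D" unfolding gderiv_def by simp
  with grad_eq[OF this] show ?thesis by simp
qed

lemma has_derivative_jac:
  assumes "F differentiable (at x)" shows "(F has_derivative blinfun_apply (jac F x)) (at x)"
proof -
  have d: "(F has_derivative frechet_derivative F (at x)) (at x)"
    using assms by (simp add: frechet_derivative_works)
  then have "bounded_linear (frechet_derivative F (at x))" by (rule has_derivative_bounded_linear)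
  then have "blinfun_apply (jac F x) = frechet_derivative F (at x)"
    unfolding jac_def by (rule bounded_linear_Blinfun_apply)
  with d show ?thesis by simp
qed

lemma continuous_P2_const: "continuous_P2 A (\<lambda>z m. c)"
  unfolding continuous_P2_def by (auto intro: exI[of _ 1])

lemma continuous_P2_diff:
  fixes f g :: "'e::metric_space \<Rightarrow> 'b::euclidean_space measure \<Rightarrow> 'g::real_normed_vector"
  assumes f: "continuous_P2 A f" and g: "continuous_P2 A g"
  shows "continuous_P2 A (\<lambda>z m. f z m - g z m)"
  unfolding continuous_P2_def
proof (intro ballI allI impI)
  fix z and m :: "'b measure" and e :: real assume zm: "z \<in> A" "m \<in> P2" and "0 < e"
  then have e: "0 < e/2" by simp
  obtain d1 where d1: "d1 > 0" "\<And>z' m'. z' \<in> A \<Longrightarrow> m' \<in> P2 \<Longrightarrow> dist z' z < d1 \<Longrightarrow> d2 m' m < d1 \<Longrightarrow>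
     dist (f z' m') (f z m) < e/2"
    using f zm e unfolding continuous_P2_def by blast
  obtain d2' where d2': "d2' > 0" "\<And>z' m'. z' \<in> A \<Longrightarrow> m' \<in> P2 \<Longrightarrow> dist z' z < d2' \<Longrightarrow> d2 m' m < d2' \<Longrightarrow>
     dist (g z' m') (g z m) < e/2"
    using g zm e unfolding continuous_P2_def by blast
  show "\<exists>d>0. \<forall>z'\<in>A. \<forall>m'\<in>P2. dist z' z < d \<and> d2 m' m < d \<longrightarrow>
     dist (f z' m' - g z' m') (f z m - g z m) < e"
  proof (intro exI[of _ "min d1 d2'"] conjI ballI impI)
    fix z' m' assume a: "z' \<in> A" "m' \<in> P2" "dist z' z < min d1 d2' \<and> d2 m' m < min d1 d2'"
    have "norm ((f z' m' - g z' m') - (f z m - g z m)) = norm ((f z' m' - f z m) - (g z' m' - g z m))"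
      by (simp add: algebra_simps)
    also have "\<dots> \<le> norm (f z' m' - f z m) + norm (g z' m' - g z m)" by (rule norm_triangle_ineq4)
    also have "\<dots> < e/2 + e/2"
      using d1(2)[of z' m'] d2'(2)[of z' m'] a unfolding dist_norm by (intro add_strict_mono) auto
    finally show "dist (f z' m' - g z' m') (f z m - g z m) < e" by (simp add: dist_norm)
  qed (use d1 d2' in simp)
qed

text \<open>The two integral formulas may be subtracted under both integrals because
  \<open>D\<close> and \<open>E\<close> are bounded and their averages are continuous along the
  segment.\<close>

lemma has_lin_deriv_diff:
  assumes D: "has_lin_deriv U D" and E: "has_lin_deriv V E"
  shows "has_lin_deriv (\<lambda>m. U m - V m) (\<lambda>m y. D m y - E m y)"
  unfolding has_lin_deriv_def
proof (intro conjI ballI)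
  show "continuous_P2 UNIV (\<lambda>y m. D m y - E m y)"
    using D E unfolding has_lin_deriv_def by (intro continuous_P2_diff) auto
  obtain K where K: "\<And>m y. m \<in> P2 \<Longrightarrow> \<bar>D m y\<bar> \<le> K"
    using D unfolding has_lin_deriv_def bounded_P2_def by auto
  obtain L where L: "\<And>m y. m \<in> P2 \<Longrightarrow> \<bar>E m y\<bar> \<le> L"
    using E unfolding has_lin_deriv_def bounded_P2_def by auto
  have "\<bar>D m y - E m y\<bar> \<le> K + L" if "m \<in> P2" for m y
    using K[OF that, of y] L[OF that, of y] by linarith
  then show "bounded_P2 UNIV (\<lambda>y m. D m y - E m y)" unfolding bounded_P2_def by auto
next
  fix m :: "'a measure" assume m: "m \<in> P2"
  show "(\<integral>y. D m y - E m y \<partial>m) = 0"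
    using D E m lin_deriv_integrable(1)[OF D m m] lin_deriv_integrable(1)[OF E m m]
    unfolding has_lin_deriv_def by simp
  fix m' :: "'a measure" assume m': "m' \<in> P2"
  let ?f = "\<lambda>D s. (\<integral>y. D (mix s m m') y \<partial>m') - (\<integral>y. D (mix s m m') y \<partial>m)"
  have i: "set_integrable lborel {0..1} (?f D)" if "has_lin_deriv U D" for U D
    by (intro borel_integrable_atLeastAtMost' continuous_on_diff
      lin_deriv_integrable(2)[OF that m' m m'] lin_deriv_integrable(2)[OF that m m m'])
  have "(U m' - V m') - (U m - V m) = (LINT s:{0..1}|lborel. ?f D s) - (LINT s:{0..1}|lborel. ?f E s)"
  proof -
    have "U m' - U m = (LINT s:{0..1}|lborel. ?f D s)" "V m' - V m = (LINT s:{0..1}|lborel. ?f E s)"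
      using D E m m' unfolding has_lin_deriv_def by blast+
    then show ?thesis by argo
  qed
  also have "\<dots> = (LINT s:{0..1}|lborel. ?f D s - ?f E s)" using i[OF D] i[OF E] by simp
  also have "\<dots> = (LINT s:{0..1}|lborel. ?f (\<lambda>m y. D m y - E m y) s)"
  proof (rule set_lebesgue_integral_cong)
    show "\<forall>s. s \<in> {0..1} \<longrightarrow> ?f D s - ?f E s = ?f (\<lambda>m y. D m y - E m y) s"
    proof (intro allI impI)
      fix s :: real assume s: "s \<in> {0..1}"
      note P = mix_P2[OF m m' s]
      show "?f D s - ?f E s = ?f (\<lambda>m y. D m y - E m y) s"
        using lin_deriv_integrable(1)[OF D m P] lin_deriv_integrable(1)[OF D m' P]
          lin_deriv_integrable(1)[OF E m P] lin_deriv_integrable(1)[OF E m' P] by simp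
    qed
  qed simp
  finally show "(U m' - V m') - (U m - V m) = (LINT s:{0..1}|lborel. ?f (\<lambda>m y. D m y - E m y) s)" .
qed

lemma lin_deriv_works: "m_C1 U \<Longrightarrow> has_lin_deriv U (lin_deriv U)"
  using someI_ex[of "has_lin_deriv U"] unfolding m_C1_def lin_deriv_def by blast

lemma bounded_P2_obtain:
  assumes "bounded_P2 A f"
  obtains K where "0 \<le> K" "\<And>z m. z \<in> A \<Longrightarrow> m \<in> P2 \<Longrightarrow> norm (f z m) \<le> K"
proof -
  obtain K where K: "\<forall>z\<in>A. \<forall>m\<in>P2. norm (f z m) \<le> K" using assms unfolding bounded_P2_def by blast
  show thesis by (rule that[of "\<bar>K\<bar>"]) (use K in \<open>auto intro: order_trans[OF _ abs_ge_self]\<close>)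
qed

text \<open>The difference carries the differences of the derivatives already chosen for the two
  fields. Its linear derivative is thus explicit in terms of the two solutions, which is what the
  subtraction of the equations needs.\<close>

lemma smooth_field_diff:
  assumes "smooth_field T C u ut gx hx gz hz D gm hm" "smooth_field T C' u' ut' gx' hx' gz' hz' D' gm' hm'"
  shows "smooth_field T (C + C') (\<lambda>t x z m. u t x z m - u' t x z m) (\<lambda>t x z m. ut t x z m - ut' t x z m)
    (\<lambda>t x z m. gx t x z m - gx' t x z m) (\<lambda>t x z m. hx t x z m - hx' t x z m)
    (\<lambda>t x z m. gz t x z m - gz' t x z m) (\<lambda>t x z m. hz t x z m - hz' t x z m)
    (\<lambda>t x z m y. D t x z m y - D' t x z m y)
    (\<lambda>t x z m y. gm t x z m y - gm' t x z m y) (\<lambda>t x z m y. hm t x z m y - hm' t x z m y)"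
proof -
  interpret a: smooth_field T C u ut gx hx gz hz D gm hm by fact
  interpret b: smooth_field T C' u' ut' gx' hx' gz' hz' D' gm' hm' by fact
  have n: "norm (p - q) \<le> C + C'" if "norm p \<le> C" "norm q \<le> C'" for p q :: "'x::real_normed_vector"
    using norm_triangle_ineq4[of p q] that by linarith
  have nr: "\<bar>p - q\<bar> \<le> C + C'" if "\<bar>p\<bar> \<le> C" "\<bar>q\<bar> \<le> C'" for p q :: real
    using n[of p q] that by simp
  have G: "GDERIV (\<lambda>x. f x - f' x) x :> d - d'" if "GDERIV f x :> d" "GDERIV f' x :> d'"
    for f f' :: "'x::euclidean_space \<Rightarrow> real" and x d d'
    using that by (rule GDERIV_diff)
  have H: "((\<lambda>x. f x - f' x) has_derivative blinfun_apply (d - d')) (at x)"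
    if "(f has_derivative blinfun_apply d) (at x)" "(f' has_derivative blinfun_apply d') (at x)"
    for f f' :: "'x::euclidean_space \<Rightarrow> 'x" and x d d'
    using has_derivative_diff[OF that] by (simp add: minus_blinfun.rep_eq)
  have c3: "continuous_P2 A (\<lambda>(t, x, z) m. f t x z m - g t x z m)"
    if "continuous_P2 A (\<lambda>(t, x, z) m. f t x z m)" "continuous_P2 A (\<lambda>(t, x, z) m. g t x z m)"
    for A and f g :: "real \<Rightarrow> 'a \<Rightarrow> 'b \<Rightarrow> 'b measure \<Rightarrow> 'x::real_normed_vector"
    using continuous_P2_diff[OF that] by (simp add: case_prod_unfold)
  have c4: "continuous_P2 A (\<lambda>(t, x, z, y) m. f t x z m y - g t x z m y)"
    if "continuous_P2 A (\<lambda>(t, x, z, y) m. f t x z m y)" "continuous_P2 A (\<lambda>(t, x, z, y) m. g t x z m y)"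
    for A and f g :: "real \<Rightarrow> 'a \<Rightarrow> 'b \<Rightarrow> 'b measure \<Rightarrow> 'b \<Rightarrow> 'x::real_normed_vector"
    using continuous_P2_diff[OF that] by (simp add: case_prod_unfold)
  show ?thesis
  proof (unfold_locales, goal_cases)
    case 1 then show ?case by (intro DERIV_diff a.dt b.dt)
  next
    case 2 then show ?case by (intro G a.dx b.dx)
  next
    case 3 then show ?case by (intro H a.dx2 b.dx2)
  next
    case 4 then show ?case by (intro G a.dz b.dz)
  next
    case 5 then show ?case by (intro H a.dz2 b.dz2)
  next
    case 6 then show ?case by (intro has_lin_deriv_diff a.dm b.dm)
  next
    case 7 then show ?case by (intro G a.dm1 b.dm1)
  next
    case 8 then show ?case by (intro H a.dm2 b.dm2)
  qed ((rule c3, rule a.cont, rule b.cont) | (rule c4, rule a.contm, rule b.contm) |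
      (rule n nr, (rule a.bounded; assumption), (rule b.bounded; assumption)))+
qed

lemma regular_U_smooth:
  fixes U :: "real \<Rightarrow> 'a::euclidean_space \<Rightarrow> 'b::euclidean_space \<Rightarrow> 'b measure \<Rightarrow> real"
  assumes "regular_U T U"
  obtains C where "smooth_field T C U (\<lambda>t x z m. deriv (\<lambda>s. U s x z m) t)
    (\<lambda>t x z m. grad (\<lambda>x. U t x z m) x) (\<lambda>t x z m. jac (grad (\<lambda>x. U t x z m)) x)
    (\<lambda>t x z m. grad (\<lambda>z. U t x z m) z) (\<lambda>t x z m. jac (grad (\<lambda>z. U t x z m)) z)
    (\<lambda>t x z. lin_deriv (U t x z)) (\<lambda>t x z. Dm (U t x z)) (\<lambda>t x z m. jac (Dm (U t x z) m))"
proof -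
  note r = assms[unfolded regular_U_def Let_def]
  let ?A = "{0<..<T} \<times> (UNIV :: 'a set) \<times> (UNIV :: 'b set)"
  have c0: "continuous_P2 ?A (\<lambda>(t, x0, x) m. U t x0 x m)"
    by (rule continuous_P2_compose[where i="\<lambda>z. z" and A="{0..T} \<times> UNIV \<times> UNIV"]) (use r in auto)
  obtain C1 where C1: "0 \<le> C1" "\<And>z m. z \<in> {0..T} \<times> UNIV \<times> UNIV \<Longrightarrow> m \<in> P2 \<Longrightarrow> norm ((case z of (t, x0, x) \<Rightarrow> \<lambda>m. U t x0 x m) m) \<le> C1"
    by (rule bounded_P2_obtain[where f="\<lambda>(t, x0, x) m. U t x0 x m" and A="{0..T} \<times> UNIV \<times> UNIV"]) (use r in auto)
  obtain C2 where C2: "0 \<le> C2" "\<And>z m. z \<in> ?A \<Longrightarrow> m \<in> P2 \<Longrightarrow> norm ((case z of (t, x0, x) \<Rightarrow> \<lambda>m. deriv (\<lambda>s. U s x0 x m) t) m) \<le> C2"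
    by (rule bounded_P2_obtain[where f="\<lambda>(t, x0, x) m. deriv (\<lambda>s. U s x0 x m) t" and A="?A"]) (use r in auto)
  obtain C3 where C3: "0 \<le> C3" "\<And>z m. z \<in> ?A \<Longrightarrow> m \<in> P2 \<Longrightarrow> norm ((case z of (t, x0, x) \<Rightarrow> \<lambda>m. grad (\<lambda>x0. U t x0 x m) x0) m) \<le> C3"
    by (rule bounded_P2_obtain[where f="\<lambda>(t, x0, x) m. grad (\<lambda>x0. U t x0 x m) x0" and A="?A"]) (use r in auto)
  obtain C4 where C4: "0 \<le> C4" "\<And>z m. z \<in> ?A \<Longrightarrow> m \<in> P2 \<Longrightarrow> norm ((case z of (t, x0, x) \<Rightarrow> \<lambda>m. jac (grad (\<lambda>x0. U t x0 x m)) x0) m) \<le> C4"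
    by (rule bounded_P2_obtain[where f="\<lambda>(t, x0, x) m. jac (grad (\<lambda>x0. U t x0 x m)) x0" and A="?A"]) (use r in auto)
  obtain C5 where C5: "0 \<le> C5" "\<And>z m. z \<in> ?A \<Longrightarrow> m \<in> P2 \<Longrightarrow> norm ((case z of (t, x0, x) \<Rightarrow> \<lambda>m. grad (\<lambda>x. U t x0 x m) x) m) \<le> C5"
    by (rule bounded_P2_obtain[where f="\<lambda>(t, x0, x) m. grad (\<lambda>x. U t x0 x m) x" and A="?A"]) (use r in auto)
  obtain C6 where C6: "0 \<le> C6" "\<And>z m. z \<in> ?A \<Longrightarrow> m \<in> P2 \<Longrightarrow> norm ((case z of (t, x0, x) \<Rightarrow> \<lambda>m. jac (grad (\<lambda>x. U t x0 x m)) x) m) \<le> C6"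
    by (rule bounded_P2_obtain[where f="\<lambda>(t, x0, x) m. jac (grad (\<lambda>x. U t x0 x m)) x" and A="?A"]) (use r in auto)
  obtain C7 where C7: "0 \<le> C7" "\<And>z m. z \<in> {0<..<T} \<times> UNIV \<times> UNIV \<times> UNIV \<Longrightarrow> m \<in> P2 \<Longrightarrow> norm ((case z of (t, x0, x, y) \<Rightarrow> \<lambda>m. Dm (U t x0 x) m y) m) \<le> C7"
    by (rule bounded_P2_obtain[where f="\<lambda>(t, x0, x, y) m. Dm (U t x0 x) m y" and A="{0<..<T} \<times> UNIV \<times> UNIV \<times> UNIV"]) (use r in auto)
  obtain C8 where C8: "0 \<le> C8" "\<And>z m. z \<in> {0<..<T} \<times> UNIV \<times> UNIV \<times> UNIV \<Longrightarrow> m \<in> P2 \<Longrightarrow> norm ((case z of (t, x0, x, y) \<Rightarrow> \<lambda>m. jac (Dm (U t x0 x) m) y) m) \<le> C8"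
    by (rule bounded_P2_obtain[where f="\<lambda>(t, x0, x, y) m. jac (Dm (U t x0 x) m) y" and A="{0<..<T} \<times> UNIV \<times> UNIV \<times> UNIV"]) (use r in auto)
  define C where "C = C1 + C2 + C3 + C4 + C5 + C6 + C7 + C8"
  have le: "C1 \<le> C" "C2 \<le> C" "C3 \<le> C" "C4 \<le> C" "C5 \<le> C" "C6 \<le> C" "C7 \<le> C" "C8 \<le> C"
    unfolding C_def using C1(1) C2(1) C3(1) C4(1) C5(1) C6(1) C7(1) C8(1) by linarith+
  have d: "(\<lambda>s. U s x z m) field_differentiable (at t)" "(\<lambda>x0. U t x0 z m) differentiable (at x)"
    "grad (\<lambda>x0. U t x0 z m) differentiable (at x)" "(\<lambda>z. U t x z m) differentiable (at z)"
    "grad (\<lambda>z. U t x z m) differentiable (at z)" "lin_deriv (U t x z) m differentiable (at y)"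
    "Dm (U t x z) m differentiable (at y)" "m_C1 (U t x z)"
    if "t \<in> {0<..<T}" "m \<in> P2" for t x z m y
    using r that by blast+
  show thesis
  proof (rule that[of C], unfold_locales, goal_cases)
    case 1 then show ?case using d(1) by (simp add: DERIV_deriv_iff_field_differentiable)
  next
    case 2 then show ?case by (intro GDERIV_grad d(2))
  next
    case 3 then show ?case by (intro has_derivative_jac d(3))
  next
    case 4 then show ?case by (intro GDERIV_grad d(4))
  next
    case 5 then show ?case by (intro has_derivative_jac d(5))
  next
    case (6 t x z)
    then show ?case using r by (intro lin_deriv_works) blast
  next
    case (7 t x z m y) then show ?case unfolding Dm_def[abs_def] by (intro GDERIV_grad d(6))
  next
    case 8 then show ?case by (intro has_derivative_jac d(7))
  next
    case 9 show ?case by (rule c0)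
  next
    case (17 t x z m) then show ?case using C1(2)[of "(t, x, z)" m] le by simp
  next
    case (18 t x z m) then show ?case using C2(2)[of "(t, x, z)" m] le by simp
  next
    case (19 t x z m) then show ?case using C3(2)[of "(t, x, z)" m] le by simp
  next
    case (20 t x z m) then show ?case using C4(2)[of "(t, x, z)" m] le by simp
  next
    case (21 t x z m) then show ?case using C5(2)[of "(t, x, z)" m] le by simp
  next
    case (22 t x z m) then show ?case using C6(2)[of "(t, x, z)" m] le by simp
  next
    case (23 t x z m y) then show ?case using C7(2)[of "(t, x, z, y)" m] le by simp
  next
    case (24 t x z m y) then show ?case using C8(2)[of "(t, x, z, y)" m] le by simp
  qed (use r in blast)+
qed

lemma regular_U0_smooth:
  fixes U0 :: "real \<Rightarrow> 'a::euclidean_space \<Rightarrow> 'b::euclidean_space measure \<Rightarrow> real"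
  assumes "regular_U0 T U0"
  obtains C where "smooth_field T C (\<lambda>t x (z::'b) m. U0 t x m) (\<lambda>t x z m. deriv (\<lambda>s. U0 s x m) t)
    (\<lambda>t x z m. grad (\<lambda>x. U0 t x m) x) (\<lambda>t x z m. jac (grad (\<lambda>x. U0 t x m)) x)
    (\<lambda>t x z m. 0) (\<lambda>t x z m. 0)
    (\<lambda>t x z. lin_deriv (U0 t x)) (\<lambda>t x z. Dm (U0 t x)) (\<lambda>t x z m. jac (Dm (U0 t x) m))"
proof -
  note r = assms[unfolded regular_U0_def Let_def]
  let ?A = "{0<..<T} \<times> (UNIV :: 'a set)"
  let ?B = "{0<..<T} \<times> (UNIV :: 'a set) \<times> (UNIV :: 'b set)"
  \<comment> \<open>Forgetting the dummy variable \<open>z\<close> is non-expansive.\<close>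
  have lift: "continuous_P2 ?B (\<lambda>(t, x, z) m. f t x m)" if "continuous_P2 A (\<lambda>(t, x) m. f t x m)" "?A \<subseteq> A"
    for f :: "real \<Rightarrow> 'a \<Rightarrow> 'b measure \<Rightarrow> 'x::real_normed_vector" and A
  proof -
    have d: "dist (fst p, fst (snd p)) (fst q, fst (snd q)) \<le> dist p q" for p q :: "real \<times> 'a \<times> 'b"
      by (cases p; cases q) (auto simp: dist_Pair_Pair)
    have "continuous_P2 ?B (\<lambda>p. (\<lambda>(t, x) m. f t x m) (fst p, fst (snd p)))"
      by (rule continuous_P2_compose[OF that(1)]) (use that(2) d in auto)
    then show ?thesis by (simp add: case_prod_unfold)
  qed
  have lift4: "continuous_P2 ({0<..<T} \<times> UNIV \<times> UNIV \<times> UNIV) (\<lambda>(t, x, z::'b, y) m. f t x m y)"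
    if "continuous_P2 ?B (\<lambda>(t, x, y) m. f t x m y)"
    for f :: "real \<Rightarrow> 'a \<Rightarrow> 'b measure \<Rightarrow> 'b \<Rightarrow> 'x::real_normed_vector"
  proof -
    have d: "dist (fst p, fst (snd p), snd (snd (snd p))) (fst q, fst (snd q), snd (snd (snd q))) \<le> dist p q"
      for p q :: "real \<times> 'a \<times> 'b \<times> 'b"
      by (cases p; cases q) (auto simp: dist_Pair_Pair)
    have "continuous_P2 ({0<..<T} \<times> UNIV \<times> UNIV \<times> UNIV)
      (\<lambda>p. (\<lambda>(t, x, y) m. f t x m y) (fst p, fst (snd p), snd (snd (snd (p :: real \<times> 'a \<times> 'b \<times> 'b)))))"
      by (rule continuous_P2_compose[OF that]) (use d in auto)
    then show ?thesis by (simp add: case_prod_unfold)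
  qed
  obtain C1 where C1: "0 \<le> C1" "\<And>z m. z \<in> {0..T} \<times> UNIV \<Longrightarrow> m \<in> P2 \<Longrightarrow> norm ((case z of (t, x) \<Rightarrow> \<lambda>m. U0 t x m) m) \<le> C1"
    by (rule bounded_P2_obtain[where f="\<lambda>(t, x) m. U0 t x m" and A="{0..T} \<times> UNIV"]) (use r in auto)
  obtain C2 where C2: "0 \<le> C2" "\<And>z m. z \<in> ?A \<Longrightarrow> m \<in> P2 \<Longrightarrow> norm ((case z of (t, x) \<Rightarrow> \<lambda>m. deriv (\<lambda>s. U0 s x m) t) m) \<le> C2"
    by (rule bounded_P2_obtain[where f="\<lambda>(t, x) m. deriv (\<lambda>s. U0 s x m) t" and A="?A"]) (use r in auto)
  obtain C3 where C3: "0 \<le> C3" "\<And>z m. z \<in> ?A \<Longrightarrow> m \<in> P2 \<Longrightarrow> norm ((case z of (t, x) \<Rightarrow> \<lambda>m. grad (\<lambda>x. U0 t x m) x) m) \<le> C3"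
    by (rule bounded_P2_obtain[where f="\<lambda>(t, x) m. grad (\<lambda>x. U0 t x m) x" and A="?A"]) (use r in auto)
  obtain C4 where C4: "0 \<le> C4" "\<And>z m. z \<in> ?A \<Longrightarrow> m \<in> P2 \<Longrightarrow> norm ((case z of (t, x) \<Rightarrow> \<lambda>m. jac (grad (\<lambda>x. U0 t x m)) x) m) \<le> C4"
    by (rule bounded_P2_obtain[where f="\<lambda>(t, x) m. jac (grad (\<lambda>x. U0 t x m)) x" and A="?A"]) (use r in auto)
  obtain C5 where C5: "0 \<le> C5" "\<And>z m. z \<in> ?B \<Longrightarrow> m \<in> P2 \<Longrightarrow> norm ((case z of (t, x, y) \<Rightarrow> \<lambda>m. Dm (U0 t x) m y) m) \<le> C5"
    by (rule bounded_P2_obtain[where f="\<lambda>(t, x, y) m. Dm (U0 t x) m y" and A="?B"]) (use r in auto)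
  obtain C6 where C6: "0 \<le> C6" "\<And>z m. z \<in> ?B \<Longrightarrow> m \<in> P2 \<Longrightarrow> norm ((case z of (t, x, y) \<Rightarrow> \<lambda>m. jac (Dm (U0 t x) m) y) m) \<le> C6"
    by (rule bounded_P2_obtain[where f="\<lambda>(t, x, y) m. jac (Dm (U0 t x) m) y" and A="?B"]) (use r in auto)
  define C where "C = C1 + C2 + C3 + C4 + C5 + C6"
  have le: "C1 \<le> C" "C2 \<le> C" "C3 \<le> C" "C4 \<le> C" "C5 \<le> C" "C6 \<le> C" "0 \<le> C"
    unfolding C_def using C1(1) C2(1) C3(1) C4(1) C5(1) C6(1) by linarith+
  have d: "(\<lambda>s. U0 s x m) field_differentiable (at t)" "(\<lambda>x0. U0 t x0 m) differentiable (at x)"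
    "grad (\<lambda>x0. U0 t x0 m) differentiable (at x)" "lin_deriv (U0 t x) m differentiable (at y)"
    "Dm (U0 t x) m differentiable (at y)"
    if "t \<in> {0<..<T}" "m \<in> P2" for t x m y
    using r that by blast+
  show thesis
  proof (rule that[of C], unfold_locales, goal_cases)
    case 1 then show ?case using d(1) by (simp add: DERIV_deriv_iff_field_differentiable)
  next
    case 2 then show ?case by (intro GDERIV_grad d(2))
  next
    case 3 then show ?case by (intro has_derivative_jac d(3))
  next
    case 4 then show ?case by (simp add: gderiv_def)
  next
    case 5 show ?case using has_derivative_const[of 0] by (simp add: zero_blinfun.rep_eq)
  next
    case (6 t x z)
    then show ?case using r by (intro lin_deriv_works) blast
  next
    case (7 t x z m y) then show ?case unfolding Dm_def[abs_def] by (intro GDERIV_grad d(4))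
  next
    case 8 then show ?case by (intro has_derivative_jac d(5))
  next
    case 9 show ?case by (rule lift[of "{0..T} \<times> UNIV"]) (use r in auto)
  next
    case 10 show ?case by (rule lift[of "?A"]) (use r in auto)
  next
    case 11 show ?case by (rule lift[of "?A"]) (use r in auto)
  next
    case 12 show ?case by (rule lift[of "?A"]) (use r in auto)
  next
    case 13 show ?case using continuous_P2_const[of ?B 0] by (simp add: case_prod_unfold)
  next
    case 14 show ?case using continuous_P2_const[of ?B 0] by (simp add: case_prod_unfold)
  next
    case 15 show ?case by (rule lift4) (use r in auto)
  next
    case 16 show ?case by (rule lift4) (use r in auto)
  next
    case (17 t x z m) then show ?case using C1(2)[of "(t, x)" m] le by simp
  next
    case (18 t x z m) then show ?case using C2(2)[of "(t, x)" m] le by simp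
  next
    case (19 t x z m) then show ?case using C3(2)[of "(t, x)" m] le by simp
  next
    case (20 t x z m) then show ?case using C4(2)[of "(t, x)" m] le by simp
  next
    case (23 t x z m y) then show ?case using C5(2)[of "(t, x, y)" m] le by simp
  next
    case (24 t x z m y) then show ?case using C6(2)[of "(t, x, y)" m] le by simp
  qed (use le in simp_all)
qed

section \<open>The maximum principle\<close>

text \<open>Integrand and integrating measure vary at the same time. The Skorohod variables move
  everything to the fixed space \<open>\<Omega>\<close>, where dominated convergence
  applies.\<close>

lemma square_integral_limit:
  fixes v :: "real \<Rightarrow> 'a::euclidean_space \<Rightarrow> 'b::euclidean_space \<Rightarrow> 'b measure \<Rightarrow> real"
  assumes v: "continuous_P2 ({0..T} \<times> UNIV \<times> UNIV) (\<lambda>(t, x, z) m. v t x z m)"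
    and K: "\<And>t x z m. t \<in> {0..T} \<Longrightarrow> m \<in> P2 \<Longrightarrow> \<bar>v t x z m\<bar> \<le> K"
    and t: "\<And>n. t n \<in> {0..T}" "t0 \<in> {0..T}" "t \<longlonglongrightarrow> t0" and x: "x \<longlonglongrightarrow> x0"
    and Om: "prob_space \<Omega>" and X: "\<And>n. X n \<in> borel_measurable \<Omega>" "X0 \<in> borel_measurable \<Omega>"
    and lim: "AE w in \<Omega>. (\<lambda>n. X n w) \<longlonglongrightarrow> X0 w"
    and m: "\<And>n. distr \<Omega> borel (X n) = m n" "\<And>n. m n \<in> P2" "distr \<Omega> borel X0 = m0" "m0 \<in> P2"
      "(\<lambda>n. d2 (m n) m0) \<longlonglongrightarrow> 0"
  shows "(\<lambda>n. \<integral>z. (v (t n) (x n) z (m n))\<^sup>2 \<partial>m n) \<longlonglongrightarrow> (\<integral>z. (v t0 x0 z m0)\<^sup>2 \<partial>m0)"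
proof -
  interpret prob_space \<Omega> by fact
  have vm: "(\<lambda>z. v s y z \<mu>) \<in> borel_measurable borel" if "s \<in> {0..T}" "\<mu> \<in> P2" for s y \<mu>
  proof (rule borel_measurable_continuous_onI)
    have c: "continuous_on UNIV (\<lambda>z::'b. (s, y, z))" by (intro continuous_intros)
    have r: "range (\<lambda>z::'b. (s, y, z)) \<subseteq> {0..T} \<times> UNIV \<times> UNIV" using that by auto
    from continuous_on_compose2[OF continuous_P2_continuous_on[OF v that(2)] c r]
    show "continuous_on UNIV (\<lambda>z. v s y z \<mu>)" by simp
  qed
  have e: "(\<integral>z. (v (t n) (x n) z (m n))\<^sup>2 \<partial>m n) = (\<integral>w. (v (t n) (x n) (X n w) (m n))\<^sup>2 \<partial>\<Omega>)" for n
    using integral_distr[OF X(1)[of n], of "\<lambda>z. (v (t n) (x n) z (m n))\<^sup>2"] vm[OF t(1) m(2)] unfolding m(1) by simp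
  have e0: "(\<integral>z. (v t0 x0 z m0)\<^sup>2 \<partial>m0) = (\<integral>w. (v t0 x0 (X0 w) m0)\<^sup>2 \<partial>\<Omega>)"
    using integral_distr[OF X(2), of "\<lambda>z. (v t0 x0 z m0)\<^sup>2"] vm[OF t(2) m(4)] unfolding m(3) by simp
  show ?thesis
    unfolding e e0
  proof (rule integral_dominated_convergence[where w="\<lambda>_. K\<^sup>2"])
    show "(\<lambda>w. (v t0 x0 (X0 w) m0)\<^sup>2) \<in> borel_measurable \<Omega>"
      using measurable_compose[OF X(2) vm[OF t(2) m(4)]] by measurable
    show "(\<lambda>w. (v (t n) (x n) (X n w) (m n))\<^sup>2) \<in> borel_measurable \<Omega>" for n
      using measurable_compose[OF X(1) vm[OF t(1) m(2)]] by measurable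
    show "AE w in \<Omega>. (\<lambda>n. (v (t n) (x n) (X n w) (m n))\<^sup>2) \<longlonglongrightarrow> (v t0 x0 (X0 w) m0)\<^sup>2"
      using lim
    proof eventually_elim
      fix w assume "(\<lambda>n. X n w) \<longlonglongrightarrow> X0 w"
      then have "(\<lambda>n. (t n, x n, X n w)) \<longlonglongrightarrow> (t0, x0, X0 w)" by (intro tendsto_Pair t x)
      from continuous_P2_seq[OF v _ _ this m(2,4,5)] t(1,2)
      have "(\<lambda>n. v (t n) (x n) (X n w) (m n)) \<longlonglongrightarrow> v t0 x0 (X0 w) m0" by simp
      then show "(\<lambda>n. (v (t n) (x n) (X n w) (m n))\<^sup>2) \<longlonglongrightarrow> (v t0 x0 (X0 w) m0)\<^sup>2" by (intro tendsto_intros)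
    qed
    show "AE w in \<Omega>. norm ((v (t n) (x n) (X n w) (m n))\<^sup>2) \<le> K\<^sup>2" for n
      using K[OF t(1) m(2)] by (auto simp: abs_le_square_iff[symmetric] intro!: AE_I2 order_trans[OF K abs_ge_self] t m)
  qed simp
qed

text \<open>The direct method. Along a maximizing sequence the penalty bounds \<open>x\<close> and
  the integral of \<open>psi\<close>, and \<open>\<epsilon> / t\<close> keeps the times away from 0.
  In the limit the squares converge, while the integral of \<open>psi\<close> can only drop, which
  increases \<open>F\<close>.\<close>

lemma penalized_max:
  fixes v v' :: "real \<Rightarrow> 'a::euclidean_space \<Rightarrow> 'b::euclidean_space \<Rightarrow> 'b measure \<Rightarrow> real"
    and ms :: "'b measure"
  assumes v: "continuous_P2 ({0..T} \<times> UNIV \<times> UNIV) (\<lambda>(t, x, z) m. v t x z m)"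
    "\<And>t x z m. t \<in> {0..T} \<Longrightarrow> m \<in> P2 \<Longrightarrow> \<bar>v t x z m\<bar> \<le> K"
    and v': "continuous_P2 ({0..T} \<times> UNIV \<times> UNIV) (\<lambda>(t, x, z) m. v' t x z m)"
    "\<And>t x z m. t \<in> {0..T} \<Longrightarrow> m \<in> P2 \<Longrightarrow> \<bar>v' t x z m\<bar> \<le> K"
    and eps: "\<epsilon> > 0" and lk: "0 \<le> \<theta>" "0 \<le> \<kappa>"
    and F: "\<And>t x m. F t x m = exp (\<theta> * t) * ((\<integral>z. (v t x z m)\<^sup>2 \<partial>m) + (\<integral>z. (v' t x z m)\<^sup>2 \<partial>m))
      - \<epsilon> * exp (\<kappa> * (T - t)) * (1 + (norm x)\<^sup>2 + (\<integral>y. psi y \<partial>m)) - \<epsilon> / t"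
    and ts: "ts \<in> {0<..T}" "ms \<in> P2" "integrable ms psi"
  obtains t x m where "t \<in> {0<..T}" "m \<in> P2" "integrable m psi"
    "\<And>t' x' m'. t' \<in> {0<..T} \<Longrightarrow> m' \<in> P2 \<Longrightarrow> integrable m' psi \<Longrightarrow> F t' x' m' \<le> F t x m"
proof -
  define W where "W t x m = (\<integral>z. (v t x z m)\<^sup>2 \<partial>m) + (\<integral>z. (v' t x z m)\<^sup>2 \<partial>m)" for t x and m :: "'b measure"
  define P where "P x m = 1 + (norm x)\<^sup>2 + (\<integral>y. psi y \<partial>m)" for x :: 'a and m :: "'b measure"
  have F': "F t x m = exp (\<theta> * t) * W t x m - \<epsilon> * exp (\<kappa> * (T - t)) * P x m - \<epsilon> / t" for t x m
    unfolding F W_def P_def ..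
  have K: "0 \<le> K"
  proof -
    have "\<bar>v ts 0 0 ms\<bar> \<le> K" using ts(1,2) by (intro v(2)) auto
    then show ?thesis by linarith
  qed
  have W: "W t x m \<le> 2 * K\<^sup>2" if "t \<in> {0..T}" "m \<in> P2" for t x m
  proof -
    have B: "(\<integral>z. (g z)\<^sup>2 \<partial>m) \<le> K\<^sup>2" if g: "\<And>z. \<bar>g z\<bar> \<le> K" for g :: "'b \<Rightarrow> real"
    proof -
      have "\<bar>(g z)\<^sup>2\<bar> \<le> K\<^sup>2" for z using power_mono[OF g[of z] abs_ge_zero, of 2] by simp
      then have "\<bar>\<integral>z. (g z)\<^sup>2 \<partial>m\<bar> \<le> K\<^sup>2" by (rule integral_abs_le[OF P2_D(1)[OF \<open>m \<in> P2\<close>]])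
      then show ?thesis by linarith
    qed
    have "(\<integral>z. (v t x z m)\<^sup>2 \<partial>m) \<le> K\<^sup>2" by (rule B) (rule v(2)[OF that])
    moreover have "(\<integral>z. (v' t x z m)\<^sup>2 \<partial>m) \<le> K\<^sup>2" by (rule B) (rule v'(2)[OF that])
    ultimately show ?thesis unfolding W_def by linarith
  qed
  define M where "M = exp (\<theta> * T) * (2 * K\<^sup>2)"
  have WM: "exp (\<theta> * t) * W t x m \<le> M" if "t \<in> {0<..T}" "m \<in> P2" for t x m
  proof -
    have "exp (\<theta> * t) * W t x m \<le> exp (\<theta> * t) * (2 * K\<^sup>2)" using W[of t m x] that by (intro mult_left_mono) auto
    also have "\<dots> \<le> M" unfolding M_def using that lk by (intro mult_right_mono) (auto intro!: mult_left_mono)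
    finally show ?thesis .
  qed
  have psi0: "0 \<le> (\<integral>y. psi y \<partial>m)" for m :: "'b measure" by (rule Bochner_Integration.integral_nonneg) (simp add: psi_ge)
  have pen: "\<epsilon> * (1 + (norm x)\<^sup>2 + (\<integral>y. psi y \<partial>m)) + \<epsilon> / t \<le> M - F t x m"
    if "t \<in> {0<..T}" "m \<in> P2" for t x m
  proof -
    have "1 \<le> exp (\<kappa> * (T - t))" using lk that by simp
    moreover have "0 \<le> P x m" unfolding P_def using psi0[of m] by simp
    ultimately have "P x m \<le> exp (\<kappa> * (T - t)) * P x m" by (simp add: mult_le_cancel_right1)
    then have "\<epsilon> * P x m \<le> \<epsilon> * (exp (\<kappa> * (T - t)) * P x m)" using eps by simp
    then show ?thesis using WM[OF that, of x] unfolding F' P_def by (simp add: mult.assoc)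
  qed
  define S where "S = {F t x m | t x m. t \<in> {0<..T} \<and> m \<in> P2 \<and> integrable m psi}"
  have Sne: "S \<noteq> {}" unfolding S_def using ts by blast
  have FM: "F t x m \<le> M" if "t \<in> {0<..T}" "m \<in> P2" for t x m
  proof -
    have "0 \<le> \<epsilon> * (1 + (norm x)\<^sup>2 + (\<integral>y. psi y \<partial>m)) + \<epsilon> / t"
      using eps that psi0[of m] by (intro add_nonneg_nonneg mult_nonneg_nonneg) auto
    then show ?thesis using pen[OF that, of x] by linarith
  qed
  have Sbd: "bdd_above S" by (rule bdd_aboveI[of _ M]) (use FM in \<open>auto simp: S_def\<close>)
  have inS: "F t x m \<in> S" if "t \<in> {0<..T}" "m \<in> P2" "integrable m psi" for t x m
    unfolding S_def using that by blast
  define s where "s = Sup S"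
  have "\<exists>t x m. t \<in> {0<..T} \<and> m \<in> P2 \<and> integrable m psi \<and> s - hs n < F t x m" for n
  proof -
    have "s - hs n < Sup S" using hs(1)[of n] by (simp add: s_def)
    from less_cSupE[OF this Sne] show ?thesis unfolding S_def by blast
  qed
  then obtain t x m where txm: "\<And>n. t n \<in> {0<..T}" "\<And>n. m n \<in> P2" "\<And>n. integrable (m n) psi"
    "\<And>n. s - hs n < F (t n) (x n) (m n)" by metis
  have Fs: "F (t n) (x n) (m n) \<le> s" for n
    unfolding s_def by (rule cSup_upper[OF inS[OF txm(1,2,3)] Sbd])
  \<comment> \<open>Along the sequence \<open>F\<close> exceeds \<open>s - 1\<close>, because steps
    are at most 1, so the penalty never exceeds \<open>R\<close>.\<close>
  define R where "R = M - s + 1"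
  have pR: "\<epsilon> * (1 + (norm (x n))\<^sup>2 + (\<integral>y. psi y \<partial>m n)) + \<epsilon> / t n \<le> R" for n
    using pen[OF txm(1)[of n] txm(2)[of n], of "x n"] txm(4)[of n] hs(2)[of n] unfolding R_def by linarith
  have tpos: "0 < \<epsilon> / t n" for n using eps txm(1)[of n] by simp
  have epos: "0 \<le> \<epsilon> * (norm (x n))\<^sup>2" "0 \<le> \<epsilon> * (\<integral>y. psi y \<partial>m n)" for n using eps psi0[of "m n"] by simp_all
  have pR': "\<epsilon> + \<epsilon> * (norm (x n))\<^sup>2 + \<epsilon> * (\<integral>y. psi y \<partial>m n) + \<epsilon> / t n \<le> R" for n
    using pR[of n] by (simp add: distrib_left)
  have R: "0 < R" using pR'[of 0] tpos[of 0] epos[of 0] eps by linarith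
  have tR: "\<epsilon> / R \<le> t n" for n
  proof -
    have "\<epsilon> / t n \<le> R" using pR'[of n] epos[of n] eps by linarith
    then show ?thesis using txm(1)[of n] R by (simp add: field_simps)
  qed
  have xR: "norm (x n) \<le> 1 + R / \<epsilon>" for n
  proof -
    have "\<epsilon> * (norm (x n))\<^sup>2 \<le> R" using pR'[of n] epos[of n] tpos[of n] eps by linarith
    then have "(norm (x n))\<^sup>2 \<le> R / \<epsilon>" using eps by (simp add: field_simps)
    moreover have "2 * norm (x n) \<le> 1 + (norm (x n))\<^sup>2" using sum_squares_bound[of "norm (x n)" 1] by simp
    moreover have "0 \<le> R / \<epsilon>" using R eps by simp
    ultimately show ?thesis using norm_ge_zero[of "x n"] by linarith
  qed
  have mR: "(\<integral>y. psi y \<partial>m n) \<le> R / \<epsilon>" for n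
  proof -
    have "\<epsilon> * (\<integral>y. psi y \<partial>m n) \<le> R" using pR'[of n] epos[of n] tpos[of n] eps by linarith
    then show ?thesis using eps by (simp add: field_simps)
  qed
  have nn: "(\<integral>\<^sup>+y. ennreal (psi y) \<partial>m n) = ennreal (\<integral>y. psi y \<partial>m n)" for n
    by (rule nn_integral_eq_integral[OF txm(3)]) (simp add: psi_ge)
  have "bounded (range (\<lambda>n. (t n, x n)))"
  proof -
    have "range (\<lambda>n. (t n, x n)) \<subseteq> {0..T} \<times> cball 0 (1 + R / \<epsilon>)" using xR txm(1) by (auto simp: less_imp_le)
    then show ?thesis by (rule bounded_subset[rotated]) (intro bounded_Times bounded_closed_interval bounded_cball)
  qed
  from bounded_imp_convergent_subsequence[OF this] obtain l r0 where r0: "strict_mono r0" "((\<lambda>n. (t n, x n)) \<circ> r0) \<longlonglongrightarrow> l"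
    by blast
  have mC: "(\<integral>\<^sup>+y. ennreal (psi y) \<partial>m (r0 n)) \<le> ennreal (R / \<epsilon>)" for n
    unfolding nn using mR by (rule ennreal_leI)
  have R0: "0 \<le> R / \<epsilon>" using R eps by simp
  obtain r \<Omega> X X0 where r: "strict_mono r" and Om: "prob_space (\<Omega> :: real measure)"
    and X: "\<And>n. X n \<in> borel_measurable \<Omega>" "\<And>n. distr \<Omega> borel (X n) = m (r0 (r n))"
    and X0: "X0 \<in> borel_measurable \<Omega>" "AE w in \<Omega>. (\<lambda>n. X n w) \<longlonglongrightarrow> X0 w" "distr \<Omega> borel X0 \<in> P2"
    and d: "(\<lambda>n. d2 (m (r0 (r n))) (distr \<Omega> borel X0)) \<longlonglongrightarrow> 0"
    and Fatou: "(\<integral>\<^sup>+y. ennreal (psi y) \<partial>distr \<Omega> borel X0) \<le> liminf (\<lambda>n. \<integral>\<^sup>+y. ennreal (psi y) \<partial>m (r0 (r n)))"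
    by (rule P2_compact[OF txm(2) mC R0], rule that)
  define \<rho> where "\<rho> n = r0 (r n)" for n
  define mh where "mh = distr \<Omega> borel X0"
  have lim: "(\<lambda>n. (t (\<rho> n), x (\<rho> n))) \<longlonglongrightarrow> l"
    using LIMSEQ_subseq_LIMSEQ[OF r0(2) r] by (simp add: comp_def \<rho>_def)
  define th xh where "th = fst l" and "xh = snd l"
  have tl: "(\<lambda>n. t (\<rho> n)) \<longlonglongrightarrow> th" and xl: "(\<lambda>n. x (\<rho> n)) \<longlonglongrightarrow> xh"
    using tendsto_fst[OF lim] tendsto_snd[OF lim] by (simp_all add: th_def xh_def)
  have th: "\<epsilon> / R \<le> th" "th \<le> T"
    by (rule LIMSEQ_le_const[OF tl], use tR in blast) (rule LIMSEQ_le_const2[OF tl], use txm(1) in auto)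
  have th0: "0 < th" using th(1) eps R by (meson divide_pos_pos less_le_trans)
  have thI: "th \<in> {0..T}" "th \<in> {0<..T}" using th th0 by auto
  have tI: "t (\<rho> n) \<in> {0..T}" for n using txm(1)[of "\<rho> n"] by auto
  have mh: "mh \<in> P2" using X0(3) by (simp add: mh_def)
  have Xd: "distr \<Omega> borel (X n) = m (\<rho> n)" for n using X(2) by (simp add: \<rho>_def)
  have dl: "(\<lambda>n. d2 (m (\<rho> n)) mh) \<longlonglongrightarrow> 0" using d by (simp add: \<rho>_def mh_def)
  have Wl: "(\<lambda>n. W (t (\<rho> n)) (x (\<rho> n)) (m (\<rho> n))) \<longlonglongrightarrow> W th xh mh"
    unfolding W_def
    by (intro tendsto_add square_integral_limit[OF v tI thI(1) tl xl Om X(1) X0(1,2) Xd txm(2) mh_def[symmetric] mh dl]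
      square_integral_limit[OF v' tI thI(1) tl xl Om X(1) X0(1,2) Xd txm(2) mh_def[symmetric] mh dl])
  have Fl: "(\<lambda>n. F (t (\<rho> n)) (x (\<rho> n)) (m (\<rho> n))) \<longlonglongrightarrow> s"
  proof (rule tendsto_sandwich[OF _ _ _ tendsto_const])
    have "strict_mono \<rho>" using strict_mono_o[OF r0(1) r] by (simp add: comp_def \<rho>_def[abs_def])
    then have "(\<lambda>n. hs (\<rho> n)) \<longlonglongrightarrow> 0" using LIMSEQ_subseq_LIMSEQ[OF hs(3)] by (simp add: comp_def)
    then have "(\<lambda>n. s - hs (\<rho> n)) \<longlonglongrightarrow> s - 0" by (intro tendsto_intros)
    then show "(\<lambda>n. s - hs (\<rho> n)) \<longlonglongrightarrow> s" by simp
  qed (use txm(4) Fs in \<open>auto intro!: always_eventually less_imp_le\<close>)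
  \<comment> \<open>The limit of the \<open>psi\<close>-integrals, found by solving the formula for
    \<open>F\<close> for that integral: \<open>F\<close> itself converges to the supremum
    \<open>s\<close> and all other terms converge. The liminf in Fatou's lemma is therefore this
    number.\<close>
  define ell where "ell = (exp (\<theta> * th) * W th xh mh - \<epsilon> / th - s) / (\<epsilon> * exp (\<kappa> * (T - th))) - 1 - (norm xh)\<^sup>2"
  have Pn: "(\<integral>y. psi y \<partial>m n) = (exp (\<theta> * t n) * W (t n) (x n) (m n) - \<epsilon> / t n - F (t n) (x n) (m n)) / (\<epsilon> * exp (\<kappa> * (T - t n))) - 1 - (norm (x n))\<^sup>2" for n
    unfolding F' P_def using eps by simp
  have Pl: "(\<lambda>n. \<integral>y. psi y \<partial>m (\<rho> n)) \<longlonglongrightarrow> ell"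
    unfolding Pn ell_def using th0 eps by (intro tendsto_intros tl xl Wl Fl) auto
  have "liminf (\<lambda>n. \<integral>\<^sup>+y. ennreal (psi y) \<partial>m (r0 (r n))) = ennreal ell"
    unfolding nn using tendsto_ennrealI[OF Pl] by (intro lim_imp_Liminf) (simp_all add: \<rho>_def)
  with Fatou have Fa: "(\<integral>\<^sup>+y. ennreal (psi y) \<partial>mh) \<le> ennreal ell" by (simp add: mh_def)
  have imh: "integrable mh psi"
    by (rule P2_psi(2)[OF P2_D(1,2)[OF mh]]) (use Fa in \<open>auto intro: le_less_trans\<close>)
  have ell0: "0 \<le> ell" by (rule LIMSEQ_le_const[OF Pl]) (simp add: psi0)
  have "ennreal (\<integral>y. psi y \<partial>mh) = (\<integral>\<^sup>+y. ennreal (psi y) \<partial>mh)"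
    using nn_integral_eq_integral[OF imh] by (simp add: psi_ge)
  with Fa ell0 have le: "(\<integral>y. psi y \<partial>mh) \<le> ell" by (metis ennreal_le_iff)
  have "s \<le> F th xh mh"
  proof -
    let ?c = "\<epsilon> * exp (\<kappa> * (T - th))"
    have c: "0 < ?c" using eps by simp
    have "P xh mh \<le> 1 + (norm xh)\<^sup>2 + ell" unfolding P_def using le by simp
    then have "?c * P xh mh \<le> ?c * (1 + (norm xh)\<^sup>2 + ell)" using c by (intro mult_left_mono) auto
    also have "\<dots> = exp (\<theta> * th) * W th xh mh - \<epsilon> / th - s" unfolding ell_def using eps by simp
    finally show ?thesis unfolding F' by linarith
  qed
  then have "F t' x' m' \<le> F th xh mh" if "t' \<in> {0<..T}" "m' \<in> P2" "integrable m' psi" for t' x' m'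
  proof -
    have "F t' x' m' \<le> s" unfolding s_def by (rule cSup_upper[OF inS[OF that] Sbd])
    with \<open>s \<le> F th xh mh\<close> show ?thesis by simp
  qed
  with thI(2) mh imh show thesis by (rule that)
qed

text \<open>The increase is a multiple of \<open>psi\<close> itself, so that an exponential factor
  in time can outweigh it. The estimate is first made for \<open>1 + (norm y)\<^sup>2\<close>, which
  grows at rate at most \<open>B + B\<^sup>2\<close>, and then squared, using that the step is at
  most 1.\<close>

lemma psi_drift_le:
  fixes y v :: "'b::euclidean_space"
  assumes "norm v \<le> B" "0 < h" "h \<le> 1"
  shows "psi (y + h *\<^sub>R v) \<le> psi y + h * ((2 * (B + B\<^sup>2) + (B + B\<^sup>2)\<^sup>2) * psi y)"
proof -
  let ?s = "1 + (norm y)\<^sup>2" and ?K = "B + B\<^sup>2"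
  have B: "0 \<le> B" using assms(1) norm_ge_zero order_trans by blast
  have "norm (y + h *\<^sub>R v) \<le> norm y + h * B"
    using norm_triangle_ineq[of y "h *\<^sub>R v"] assms by (simp add: mult_left_mono order_trans[OF _ add_left_mono])
  then have "(norm (y + h *\<^sub>R v))\<^sup>2 \<le> (norm y + h * B)\<^sup>2" by (rule power_mono) simp
  also have "\<dots> = (norm y)\<^sup>2 + h * (B * (2 * norm y)) + h * (h * B\<^sup>2)"
    by (simp add: power2_sum power_mult_distrib) (simp add: power2_eq_square algebra_simps)
  also have "\<dots> \<le> (norm y)\<^sup>2 + h * (B * ?s) + h * (B\<^sup>2 * ?s)"
  proof -
    have "2 * norm y \<le> ?s" using sum_squares_bound[of "norm y" 1] by simp
    then have "B * (2 * norm y) \<le> B * ?s" using B by (rule mult_left_mono)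
    moreover have "h * B\<^sup>2 \<le> B\<^sup>2 * ?s"
    proof -
      have "h * B\<^sup>2 \<le> 1 * B\<^sup>2" using assms by (intro mult_right_mono) auto
      also have "\<dots> \<le> B\<^sup>2 * ?s" by (simp add: distrib_left)
      finally show ?thesis .
    qed
    ultimately have "h * (B * (2 * norm y)) \<le> h * (B * ?s)" "h * (h * B\<^sup>2) \<le> h * (B\<^sup>2 * ?s)"
      using assms(2) mult_left_mono[of _ _ h] by auto
    then show ?thesis by linarith
  qed
  finally have "1 + (norm (y + h *\<^sub>R v))\<^sup>2 \<le> ?s * (1 + h * ?K)" by (simp add: algebra_simps)
  then have "psi (y + h *\<^sub>R v) \<le> (?s * (1 + h * ?K))\<^sup>2"
    unfolding psi_def by (rule power_mono) (simp add: add_nonneg_nonneg)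
  also have "\<dots> = psi y * (1 + h * (2 * ?K + h * ?K\<^sup>2))"
    unfolding psi_def power_mult_distrib by (simp add: power2_sum power_mult_distrib) (simp add: power2_eq_square algebra_simps)
  also have "\<dots> \<le> psi y * (1 + h * (2 * ?K + ?K\<^sup>2))"
  proof -
    have "h * ?K\<^sup>2 \<le> 1 * ?K\<^sup>2" using assms by (intro mult_right_mono) auto
    then have "h * (2 * ?K + h * ?K\<^sup>2) \<le> h * (2 * ?K + ?K\<^sup>2)" using assms by (intro mult_left_mono) auto
    then show ?thesis by (intro mult_left_mono) (auto simp: psi_ge)
  qed
  finally show ?thesis by (simp add: algebra_simps)
qed

text \<open>In the sum over opposite shifts the terms linear in the step cancel, and
  \<open>2 * a\<^sup>2 + 2 * d\<^sup>2\<close> remains with \<open>a\<close> the common part and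
  \<open>d\<close> the odd one. Their excesses \<open>3 * psi y\<close> and \<open>4 * psi y\<close>
  make up the constant 7.\<close>

lemma psi_heat_le:
  fixes y e :: "'b::euclidean_space"
  assumes "norm e = 1" "0 < h" "h \<le> 1"
  shows "psi (y + h *\<^sub>R e) + psi (y - h *\<^sub>R e) \<le> 2 * (psi y + h\<^sup>2 * (7 * psi y))"
proof -
  let ?s = "1 + (norm y)\<^sup>2" and ?d = "2 * h * (y \<bullet> e)"
  have ee: "e \<bullet> e = 1" using assms(1) by (simp add: power2_norm_eq_inner[symmetric])
  have p: "1 + (norm (y + h *\<^sub>R e))\<^sup>2 = (?s + h\<^sup>2) + ?d" "1 + (norm (y - h *\<^sub>R e))\<^sup>2 = (?s + h\<^sup>2) - ?d"
    unfolding power2_norm_eq_inner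
    by (simp_all add: inner_add_left inner_add_right inner_diff_left inner_diff_right ee inner_commute power2_eq_square)
  have "psi (y + h *\<^sub>R e) + psi (y - h *\<^sub>R e) = 2 * (?s + h\<^sup>2)\<^sup>2 + 2 * ?d\<^sup>2"
    unfolding psi_def p by (simp add: power2_sum power2_diff)
  moreover have "(?s + h\<^sup>2)\<^sup>2 \<le> psi y + h\<^sup>2 * (3 * psi y)"
  proof -
    have "(?s + h\<^sup>2)\<^sup>2 = psi y + h\<^sup>2 * (2 * ?s + h\<^sup>2)" unfolding psi_def by (simp add: power2_eq_square algebra_simps)
    moreover have "h\<^sup>2 \<le> 1" using assms by (simp add: power_le_one)
    moreover have "2 * ?s \<le> 2 * psi y" "1 \<le> psi y" using psi_ge(4)[of y] psi_ge(1)[of y] by auto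
    ultimately show ?thesis using mult_left_mono[of "2 * ?s + h\<^sup>2" "3 * psi y" "h\<^sup>2"] by simp
  qed
  moreover have "?d\<^sup>2 \<le> h\<^sup>2 * (4 * psi y)"
  proof -
    have "(y \<bullet> e)\<^sup>2 \<le> (norm y)\<^sup>2" using Cauchy_Schwarz_ineq[of y e] ee by (simp add: power2_norm_eq_inner)
    also have "\<dots> \<le> psi y" by (rule psi_ge)
    finally have "h\<^sup>2 * (4 * (y \<bullet> e)\<^sup>2) \<le> h\<^sup>2 * (4 * psi y)" by (intro mult_left_mono) auto
    moreover have "?d\<^sup>2 = h\<^sup>2 * (4 * (y \<bullet> e)\<^sup>2)" by (simp add: power_mult_distrib)
    ultimately show ?thesis by simp
  qed
  ultimately show ?thesis by (simp add: algebra_simps)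
qed

lemma drift_psi:
  fixes m :: "'b::euclidean_space measure"
  assumes m: "m \<in> P2" "integrable m psi" and b: "b \<in> borel_measurable borel" "\<And>y. norm (b y) \<le> B"
  shows "integrable (drift b m n) psi"
    "(\<integral>y. psi y \<partial>drift b m n) \<le> (\<integral>y. psi y \<partial>m) + hs n * ((2 * (B + B\<^sup>2) + (B + B\<^sup>2)\<^sup>2) * (\<integral>y. psi y \<partial>m))"
proof -
  let ?c = "2 * (B + B\<^sup>2) + (B + B\<^sup>2)\<^sup>2"
  have le: "psi (y + hs n *\<^sub>R b y) \<le> psi y + hs n * (?c * psi y)" for y
    by (rule psi_drift_le[OF b(2) hs(1,2)])
  have i0: "integrable m (\<lambda>y. psi y + hs n * (?c * psi y))" using m(2) by simp
  have i: "integrable m (\<lambda>y. psi (y + hs n *\<^sub>R b y))"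
  proof (rule Bochner_Integration.integrable_bound[OF i0])
    show "(\<lambda>y. psi (y + hs n *\<^sub>R b y)) \<in> borel_measurable m"
      by (rule measurable_P2[OF m(1)]) (use b(1) in measurable)
    show "AE y in m. norm (psi (y + hs n *\<^sub>R b y)) \<le> norm (psi y + hs n * (?c * psi y))"
    proof (rule AE_I2)
      fix y
      show "norm (psi (y + hs n *\<^sub>R b y)) \<le> norm (psi y + hs n * (?c * psi y))"
        unfolding real_norm_def abs_of_nonneg[OF psi_ge(5)] by (rule order_trans[OF le abs_ge_self])
    qed
  qed
  show "integrable (drift b m n) psi" by (rule drift_integrable[OF m(1) b psi_measurable i])
  have "(\<integral>y. psi y \<partial>drift b m n) = (\<integral>y. psi (y + hs n *\<^sub>R b y) \<partial>m)"
    by (rule drift_integral[OF m(1) b psi_measurable])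
  also have "\<dots> \<le> (\<integral>y. psi y + hs n * (?c * psi y) \<partial>m)" by (rule integral_mono[OF i i0 le])
  also have "\<dots> = (\<integral>y. psi y \<partial>m) + hs n * (?c * (\<integral>y. psi y \<partial>m))" using m(2) by simp
  finally show "(\<integral>y. psi y \<partial>drift b m n) \<le> (\<integral>y. psi y \<partial>m) + hs n * (?c * (\<integral>y. psi y \<partial>m))" .
qed

lemma heat_psi:
  fixes m :: "'b::euclidean_space measure"
  assumes m: "m \<in> P2" "integrable m psi" and e: "norm e = 1"
  shows "integrable (heat e m n) psi"
    "(\<integral>y. psi y \<partial>heat e m n) \<le> (\<integral>y. psi y \<partial>m) + (hs n)\<^sup>2 * (7 * (\<integral>y. psi y \<partial>m))"
proof -
  note le = psi_heat_le[OF e hs(1,2), of _ n]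
  have i0: "integrable m (\<lambda>y. 2 * (psi y + (hs n)\<^sup>2 * (7 * psi y)))" using m(2) by simp
  have bd: "integrable m (\<lambda>y. psi (y + c))" if "\<And>y. psi (y + c) \<le> 2 * (psi y + (hs n)\<^sup>2 * (7 * psi y))" for c
  proof (rule Bochner_Integration.integrable_bound[OF i0])
    show "(\<lambda>y. psi (y + c)) \<in> borel_measurable m" by (rule measurable_P2[OF m(1)]) measurable
    show "AE y in m. norm (psi (y + c)) \<le> norm (2 * (psi y + (hs n)\<^sup>2 * (7 * psi y)))"
    proof (rule AE_I2)
      fix y
      show "norm (psi (y + c)) \<le> norm (2 * (psi y + (hs n)\<^sup>2 * (7 * psi y)))"
        unfolding real_norm_def abs_of_nonneg[OF psi_ge(5)] by (rule order_trans[OF that abs_ge_self])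
    qed
  qed
  have i: "integrable m (\<lambda>y. psi (y + hs n *\<^sub>R e))"
  proof (rule bd)
    show "psi (y + hs n *\<^sub>R e) \<le> 2 * (psi y + (hs n)\<^sup>2 * (7 * psi y))" for y
      using le[of y] psi_ge(5)[of "y - hs n *\<^sub>R e"] by linarith
  qed
  have i': "integrable m (\<lambda>y. psi (y - hs n *\<^sub>R e))"
  proof -
    have "integrable m (\<lambda>y. psi (y + (- (hs n *\<^sub>R e))))"
    proof (rule bd)
      show "psi (y + (- (hs n *\<^sub>R e))) \<le> 2 * (psi y + (hs n)\<^sup>2 * (7 * psi y))" for y
        using le[of y] psi_ge(5)[of "y + hs n *\<^sub>R e"] by simp
    qed
    then show ?thesis by simp
  qed
  show "integrable (heat e m n) psi" by (rule heat_integrable[OF m(1) psi_measurable i i'])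
  have "(\<integral>y. psi y \<partial>heat e m n) = (\<integral>y. (psi (y + hs n *\<^sub>R e) + psi (y - hs n *\<^sub>R e)) / 2 \<partial>m)"
    by (rule heat_integral[OF m(1) psi_measurable i i'])
  also have "\<dots> \<le> (\<integral>y. (2 * (psi y + (hs n)\<^sup>2 * (7 * psi y))) / 2 \<partial>m)"
    using i i' i0 le by (intro integral_mono divide_right_mono) auto
  also have "\<dots> = (\<integral>y. psi y \<partial>m) + (hs n)\<^sup>2 * (7 * (\<integral>y. psi y \<partial>m))" using m(2) by simp
  finally show "(\<integral>y. psi y \<partial>heat e m n) \<le> (\<integral>y. psi y \<partial>m) + (hs n)\<^sup>2 * (7 * (\<integral>y. psi y \<partial>m))" .
qed

section \<open>The generator, the energy density and the inequality at a maximum\<close>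

context smooth_field
begin

text \<open>The backward operator of a system in which \<open>x\<close> drifts along
  \<open>\<beta>\<close> while the tagged point \<open>z\<close> and the particles of
  \<open>m\<close> drift along \<open>b\<close>, all with noise. The sums over \<open>Basis\<close>
  are traces, that is the Laplacians in \<open>x\<close> and \<open>z\<close> and the divergence of
  the measure derivative.\<close>

definition gen :: "('b \<Rightarrow> 'b) \<Rightarrow> 'a \<Rightarrow> real \<Rightarrow> 'a \<Rightarrow> 'b measure \<Rightarrow> 'b \<Rightarrow> real" where
  "gen b \<beta> t x m z = ut t x z m + (\<Sum>i\<in>Basis. hx t x z m i \<bullet> i) + gx t x z m \<bullet> \<beta>
     + (\<Sum>i\<in>Basis. hz t x z m i \<bullet> i) + gz t x z m \<bullet> b z
     + (\<Sum>i\<in>Basis. \<integral>y. hm t x z m y i \<bullet> i \<partial>m) + (\<integral>y. gm t x z m y \<bullet> b y \<partial>m)"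

text \<open>By \<open>energy_split\<close> the \<open>m\<close>-integral of this density is the same
  operator applied to \<open>Q\<close>; the squared norms are the carre du champ terms of a
  square.\<close>

definition energy :: "('b \<Rightarrow> 'b) \<Rightarrow> 'a \<Rightarrow> real \<Rightarrow> 'a \<Rightarrow> 'b measure \<Rightarrow> 'b \<Rightarrow> real" where
  "energy b \<beta> t x m z = 2 * u t x z m * gen b \<beta> t x m z + 2 * (norm (gx t x z m))\<^sup>2 + 2 * (norm (gz t x z m))\<^sup>2"

text \<open>A regrouping of the limits found for the five kinds of perturbation. The factor 2 before
  the random walk terms undoes the half produced by \<open>heat\<close>.\<close>

lemma energy_split:
  assumes t: "t \<in> {0<..<T}" and m: "m \<in> P2" and b: "b \<in> borel_measurable borel" "\<And>y. norm (b y) \<le> B"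
  shows "integrable m (energy b \<beta> t x m)"
    and "(\<integral>z. energy b \<beta> t x m z \<partial>m) = (\<integral>z. 2 * u t x z m * ut t x z m \<partial>m)
      + (\<Sum>i\<in>Basis. \<integral>z. 2 * u t x z m * (hx t x z m i \<bullet> i) + 2 * (gx t x z m \<bullet> i)\<^sup>2 \<partial>m)
      + (\<integral>z. 2 * u t x z m * (gx t x z m \<bullet> \<beta>) \<partial>m)
      + 2 * (\<Sum>i\<in>Basis. \<integral>z. u t x z m * (hz t x z m i \<bullet> i) + (gz t x z m \<bullet> i)\<^sup>2 + u t x z m * (\<integral>y. hm t x z m y i \<bullet> i \<partial>m) \<partial>m)
      + (\<integral>z. 2 * u t x z m * (gz t x z m \<bullet> b z + (\<integral>y. gm t x z m y \<bullet> b y \<partial>m)) \<partial>m)"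
proof -
  have n2: "(norm v)\<^sup>2 = (\<Sum>i\<in>Basis. (v \<bullet> i)\<^sup>2)" for v :: "'e::euclidean_space"
  proof -
    have "(norm v)\<^sup>2 = v \<bullet> v" by (rule power2_norm_eq_inner)
    also have "\<dots> = (\<Sum>i\<in>Basis. (v \<bullet> i) * (v \<bullet> i))" by (rule euclidean_inner)
    finally show ?thesis by (simp add: power2_eq_square)
  qed
  let ?X = "\<lambda>i z. 2 * u t x z m * (hx t x z m i \<bullet> i) + 2 * (gx t x z m \<bullet> i)\<^sup>2"
  let ?Z = "\<lambda>i z. u t x z m * (hz t x z m i \<bullet> i) + (gz t x z m \<bullet> i)\<^sup>2 + u t x z m * (\<integral>y. hm t x z m y i \<bullet> i \<partial>m)"
  have e: "energy b \<beta> t x m = (\<lambda>z. 2 * u t x z m * ut t x z m + (\<Sum>i\<in>Basis. ?X i z)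
    + 2 * u t x z m * (gx t x z m \<bullet> \<beta>) + 2 * (\<Sum>i\<in>Basis. ?Z i z)
    + 2 * u t x z m * (gz t x z m \<bullet> b z + (\<integral>y. gm t x z m y \<bullet> b y \<partial>m)))"
  proof (rule ext)
    fix z
    have X: "(\<Sum>i\<in>Basis. ?X i z) = 2 * u t x z m * (\<Sum>i\<in>Basis. hx t x z m i \<bullet> i) + 2 * (norm (gx t x z m))\<^sup>2"
      unfolding n2 sum.distrib sum_distrib_left ..
    have Z: "(\<Sum>i\<in>Basis. ?Z i z) = u t x z m * (\<Sum>i\<in>Basis. hz t x z m i \<bullet> i) + (norm (gz t x z m))\<^sup>2
       + u t x z m * (\<Sum>i\<in>Basis. \<integral>y. hm t x z m y i \<bullet> i \<partial>m)"
      unfolding n2 sum.distrib sum_distrib_left ..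
    show "energy b \<beta> t x m z = 2 * u t x z m * ut t x z m + (\<Sum>i\<in>Basis. ?X i z)
      + 2 * u t x z m * (gx t x z m \<bullet> \<beta>) + 2 * (\<Sum>i\<in>Basis. ?Z i z)
      + 2 * u t x z m * (gz t x z m \<bullet> b z + (\<integral>y. gm t x z m y \<bullet> b y \<partial>m))"
      unfolding X Z energy_def gen_def by (simp add: algebra_simps)
  qed
  obtain N where "hs N < T - t"
    using order_tendstoD(2)[OF hs(3), of "T - t"] t unfolding eventually_sequentially by auto
  note i = Q_time(2)[OF t m this, of x] Q_x1(2)[OF t m, of x \<beta>] Q_drift(2)[OF t m b, of x]
  have iX: "integrable m (\<lambda>z. \<Sum>i\<in>Basis. ?X i z)" by (rule Bochner_Integration.integrable_sum) (rule Q_x2(2)[OF t m])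
  have iZ: "integrable m (\<lambda>z. \<Sum>i\<in>Basis. ?Z i z)" by (rule Bochner_Integration.integrable_sum) (rule Q_heat(2)[OF t m])
  have sX: "(\<integral>z. (\<Sum>i\<in>Basis. ?X i z) \<partial>m) = (\<Sum>i\<in>Basis. \<integral>z. ?X i z \<partial>m)"
    by (rule Bochner_Integration.integral_sum) (rule Q_x2(2)[OF t m])
  have sZ: "(\<integral>z. (\<Sum>i\<in>Basis. ?Z i z) \<partial>m) = (\<Sum>i\<in>Basis. \<integral>z. ?Z i z \<partial>m)"
    by (rule Bochner_Integration.integral_sum) (rule Q_heat(2)[OF t m])
  note a = Bochner_Integration.integrable_add and a' = Bochner_Integration.integral_add
  have j1: "integrable m (\<lambda>z. 2 * u t x z m * ut t x z m + (\<Sum>i\<in>Basis. ?X i z))" by (rule a[OF i(1) iX])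
  have j2: "integrable m (\<lambda>z. 2 * u t x z m * ut t x z m + (\<Sum>i\<in>Basis. ?X i z) + 2 * u t x z m * (gx t x z m \<bullet> \<beta>))"
    by (rule a[OF j1 i(2)])
  have j3': "integrable m (\<lambda>z. 2 * (\<Sum>i\<in>Basis. ?Z i z))" by (rule integrable_mult_right) (rule iZ)
  have j3: "integrable m (\<lambda>z. 2 * u t x z m * ut t x z m + (\<Sum>i\<in>Basis. ?X i z) + 2 * u t x z m * (gx t x z m \<bullet> \<beta>)
     + 2 * (\<Sum>i\<in>Basis. ?Z i z))"
    by (rule a[OF j2 j3'])
  show "integrable m (energy b \<beta> t x m)" unfolding e by (rule a[OF j3 i(3)])
  show "(\<integral>z. energy b \<beta> t x m z \<partial>m) = (\<integral>z. 2 * u t x z m * ut t x z m \<partial>m)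
      + (\<Sum>i\<in>Basis. \<integral>z. ?X i z \<partial>m) + (\<integral>z. 2 * u t x z m * (gx t x z m \<bullet> \<beta>) \<partial>m)
      + 2 * (\<Sum>i\<in>Basis. \<integral>z. ?Z i z \<partial>m)
      + (\<integral>z. 2 * u t x z m * (gz t x z m \<bullet> b z + (\<integral>y. gm t x z m y \<bullet> b y \<partial>m)) \<partial>m)"
    unfolding e a'[OF j3 i(3)] a'[OF j2 j3'] a'[OF j1 i(2)] a'[OF i(1) iX] sX integral_mult_right_zero sZ ..
qed

end

text \<open>\<open>E * W\<close> minus a penalty is maximal at the unperturbed point, so per unit of
  step the gain in \<open>E * W\<close> cannot exceed the growth of the penalty.\<close>

lemma quotient_limit_le:
  fixes W W0 :: real
  assumes "(\<lambda>n. (W' n - W0) / a n) \<longlonglongrightarrow> L" and a: "\<And>n. 0 < a n" and E: "0 < E"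
    and le: "\<And>n. E * W' n - q' n \<le> E * W0 - q" and q: "\<And>n. q' n \<le> q + a n * c"
  shows "E * L \<le> c"
proof (rule LIMSEQ_le_const2)
  show "(\<lambda>n. E * ((W' n - W0) / a n)) \<longlonglongrightarrow> E * L" by (intro tendsto_intros assms(1))
  have "E * ((W' n - W0) / a n) \<le> c" for n
  proof -
    have "E * (W' n - W0) \<le> a n * c" using le[of n] q[of n] by (simp add: right_diff_distrib)
    then show ?thesis using a[of n] by (simp add: pos_divide_le_eq mult.commute)
  qed
  then show "\<exists>N. \<forall>n\<ge>N. E * ((W' n - W0) / a n) \<le> c" by blast
qed

text \<open>Five separate tests of one maximum, added up. Each right-hand side is a growth rate of
  the penalty: 2 for each direction of \<open>x\<close>, \<open>B + B\<^sup>2\<close> for the shift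
  along \<open>\<beta>\<close>, twice 7 for each direction of the random walk, and the constant of
  \<open>psi_drift_le\<close> for the transport. \<open>\<kappa>\<close> exceeds their sum, which
  makes the conclusion strict.\<close>

lemma max_inequality:
  fixes F :: "real \<Rightarrow> 'a::euclidean_space \<Rightarrow> 'b::euclidean_space measure \<Rightarrow> real"
  assumes s0: "smooth_field T C0 u0 ut0 gx0 hx0 gz0 hz0 D0 gm0 hm0"
    and s1: "smooth_field T C1 u1 ut1 gx1 hx1 gz1 hz1 D1 gm1 hm1"
    and W: "\<And>t x m. W t x m = (\<integral>z. (u0 t x z m)\<^sup>2 \<partial>m) + (\<integral>z. (u1 t x z m)\<^sup>2 \<partial>m)"
    and F: "\<And>t x m. F t x m = exp (\<theta> * t) * W t x m
      - \<epsilon> * exp (\<kappa> * (T - t)) * (1 + (norm x)\<^sup>2 + (\<integral>y. psi y \<partial>m)) - \<epsilon> / t"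
    and eps: "\<epsilon> > 0"
    and t: "t \<in> {0<..<T}" and m: "m \<in> P2" "integrable m psi"
    and max: "\<And>t' x' m'. t' \<in> {0<..<T} \<Longrightarrow> m' \<in> P2 \<Longrightarrow> integrable m' psi \<Longrightarrow> F t' x' m' \<le> F t x m"
    and b: "b \<in> borel_measurable borel" "\<And>y. norm (b y) \<le> B" and \<beta>: "norm \<beta> \<le> B"
    and \<kappa>: "2 * real DIM('a) + (B + B\<^sup>2) + 14 * real DIM('b) + (2 * (B + B\<^sup>2) + (B + B\<^sup>2)\<^sup>2) < \<kappa>"
  shows "\<theta> * W t x m + (\<integral>z. smooth_field.energy u0 ut0 gx0 hx0 gz0 hz0 gm0 hm0 b \<beta> t x m z \<partial>m)
      + (\<integral>z. smooth_field.energy u1 ut1 gx1 hx1 gz1 hz1 gm1 hm1 b \<beta> t x m z \<partial>m) < 0"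
proof -
  interpret s0: smooth_field T C0 u0 ut0 gx0 hx0 gz0 hz0 D0 gm0 hm0 by (rule s0)
  interpret s1: smooth_field T C1 u1 ut1 gx1 hx1 gz1 hz1 D1 gm1 hm1 by (rule s1)
  have WQ: "W t x m = s0.Q t x m + s1.Q t x m" for t x m by (simp add: W s0.Q_def s1.Q_def)
  have B: "0 \<le> B" using \<beta> norm_ge_zero order_trans by blast
  define E where "E = exp (\<theta> * t)"
  define k where "k = \<epsilon> * exp (\<kappa> * (T - t))"
  define J where "J = (\<integral>y. psi y \<partial>m)"
  define P where "P = 1 + (norm x)\<^sup>2 + J"
  have E: "0 < E" and k: "0 < k" using eps by (simp_all add: E_def k_def)
  have J: "0 \<le> J" unfolding J_def by (rule Bochner_Integration.integral_nonneg) (simp add: psi_ge)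
  have P: "1 \<le> P" "J \<le> P" "1 + (norm x)\<^sup>2 \<le> P" using J by (simp_all add: P_def)
  have Fx: "E * W t x' m - k * (1 + (norm x')\<^sup>2 + J) \<le> E * W t x m - k * (1 + (norm x)\<^sup>2 + J)" for x'
    using max[OF t m, of x'] unfolding F E_def k_def J_def by simp
  have Fm: "E * W t x m' - k * (1 + (norm x)\<^sup>2 + (\<integral>y. psi y \<partial>m')) \<le> E * W t x m - k * (1 + (norm x)\<^sup>2 + J)"
    if "m' \<in> P2" "integrable m' psi" for m'
    using max[OF t that, of x] unfolding F E_def k_def J_def by simp
  have quot_add: "(W t' x' m' - W t x m) / a = (s0.Q t' x' m' - s0.Q t x m) / a + (s1.Q t' x' m' - s1.Q t x m) / a"
    for t' x' m' and a :: real
    by (simp add: WQ add_divide_distrib diff_divide_distrib)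

  let ?T = "(\<integral>z. 2 * u0 t x z m * ut0 t x z m \<partial>m) + (\<integral>z. 2 * u1 t x z m * ut1 t x z m \<partial>m)"
  \<comment> \<open>Forward steps only, available since \<open>t < T\<close>. The penalty decays in
    time at rate \<open>\<kappa>\<close>, the one negative contribution, and it pays for all the
    others.\<close>
  have time: "E * (\<theta> * W t x m + ?T) \<le> - \<kappa> * (k * P)"
  proof -
    obtain N where N: "hs N < T - t"
      using order_tendstoD(2)[OF hs(3), of "T - t"] t unfolding eventually_sequentially by auto
    let ?h = "\<lambda>n. hs (n + N)"
    have hl: "?h \<longlonglongrightarrow> 0" using hs(3) by (rule LIMSEQ_ignore_initial_segment)
    have tn: "t + ?h n \<in> {0<..<T}" for n
    proof -
      have "?h n \<le> hs N" by (simp add: hs_def divide_simps)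
      then show ?thesis using t N hs(1)[of "n + N"] by auto
    qed
    have lW: "(\<lambda>n. (W (t + ?h n) x m - W t x m) / ?h n) \<longlonglongrightarrow> ?T"
      unfolding quot_add by (intro tendsto_add s0.Q_time(1)[OF t m(1) N] s1.Q_time(1)[OF t m(1) N])
    have lE: "(\<lambda>n. (exp (\<theta> * (t + ?h n)) - exp (\<theta> * t)) / ?h n) \<longlonglongrightarrow> \<theta> * E"
      by (rule DERIV_hs[where f="\<lambda>t. exp (\<theta> * t)"]) (auto intro!: derivative_eq_intros simp: E_def)
    have lq: "(\<lambda>n. (\<epsilon> * exp (\<kappa> * (T - (t + ?h n))) * P - \<epsilon> * exp (\<kappa> * (T - t)) * P) / ?h n) \<longlonglongrightarrow> - \<kappa> * (k * P)"
      by (rule DERIV_hs[where f="\<lambda>t. \<epsilon> * exp (\<kappa> * (T - t)) * P"]) (auto intro!: derivative_eq_intros simp: k_def)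
    have lX: "(\<lambda>n. exp (\<theta> * (t + ?h n))) \<longlonglongrightarrow> exp (\<theta> * (t + 0))" by (intro tendsto_intros hl)
    have "(\<lambda>n. exp (\<theta> * (t + ?h n)) * ((W (t + ?h n) x m - W t x m) / ?h n)
       + W t x m * ((exp (\<theta> * (t + ?h n)) - exp (\<theta> * t)) / ?h n)) \<longlonglongrightarrow> exp (\<theta> * (t + 0)) * ?T + W t x m * (\<theta> * E)"
      by (intro tendsto_add tendsto_mult lX lW lE tendsto_const)
    moreover have "exp (\<theta> * (t + ?h n)) * ((W (t + ?h n) x m - W t x m) / ?h n)
       + W t x m * ((exp (\<theta> * (t + ?h n)) - exp (\<theta> * t)) / ?h n)
       \<le> (\<epsilon> * exp (\<kappa> * (T - (t + ?h n))) * P - \<epsilon> * exp (\<kappa> * (T - t)) * P) / ?h n" for n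
    proof -
      have h: "0 < ?h n" by (rule hs)
      \<comment> \<open>This term decreases as time advances; its change has the favourable sign and
        is dropped.\<close>
      have "\<epsilon> / (t + ?h n) \<le> \<epsilon> / t" using eps t h by (intro divide_left_mono) auto
      moreover have "F (t + ?h n) x m \<le> F t x m" by (rule max[OF tn m])
      ultimately have "exp (\<theta> * (t + ?h n)) * W (t + ?h n) x m - exp (\<theta> * t) * W t x m
         \<le> \<epsilon> * exp (\<kappa> * (T - (t + ?h n))) * P - \<epsilon> * exp (\<kappa> * (T - t)) * P"
        unfolding F P_def J_def by linarith
      then have "(exp (\<theta> * (t + ?h n)) * W (t + ?h n) x m - exp (\<theta> * t) * W t x m) / ?h n
         \<le> (\<epsilon> * exp (\<kappa> * (T - (t + ?h n))) * P - \<epsilon> * exp (\<kappa> * (T - t)) * P) / ?h n"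
        using h by (intro divide_right_mono) auto
      moreover have "exp (\<theta> * (t + ?h n)) * ((W (t + ?h n) x m - W t x m) / ?h n)
         + W t x m * ((exp (\<theta> * (t + ?h n)) - exp (\<theta> * t)) / ?h n)
        = (exp (\<theta> * (t + ?h n)) * W (t + ?h n) x m - exp (\<theta> * t) * W t x m) / ?h n"
        using h by (simp add: field_simps)
      ultimately show ?thesis by linarith
    qed
    ultimately have "exp (\<theta> * (t + 0)) * ?T + W t x m * (\<theta> * E) \<le> - \<kappa> * (k * P)"
      by (intro LIMSEQ_le[OF _ lq]) blast+
    then show ?thesis by (simp add: E_def algebra_simps)
  qed

  let ?X1 = "(\<integral>z. 2 * u0 t x z m * (gx0 t x z m \<bullet> \<beta>) \<partial>m) + (\<integral>z. 2 * u1 t x z m * (gx1 t x z m \<bullet> \<beta>) \<partial>m)"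
  have x1: "E * ?X1 \<le> k * ((B + B\<^sup>2) * P)"
  proof (rule quotient_limit_le[OF _ hs(1) E Fx])
    show "(\<lambda>n. (W t (x + hs n *\<^sub>R \<beta>) m - W t x m) / hs n) \<longlonglongrightarrow> ?X1"
      unfolding quot_add by (intro tendsto_add s0.Q_x1(1)[OF t m(1)] s1.Q_x1(1)[OF t m(1)])
    fix n
    have h: "0 < hs n" "hs n \<le> 1" by (rule hs)+
    have "(norm (x + hs n *\<^sub>R \<beta>))\<^sup>2 \<le> (norm x + hs n * B)\<^sup>2"
    proof (rule power_mono)
      have "hs n * norm \<beta> \<le> hs n * B" using h \<beta> by (intro mult_left_mono) auto
      moreover have "norm (hs n *\<^sub>R \<beta>) = hs n * norm \<beta>" using h by simp
      ultimately show "norm (x + hs n *\<^sub>R \<beta>) \<le> norm x + hs n * B"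
        using norm_triangle_ineq[of x "hs n *\<^sub>R \<beta>"] by linarith
    qed simp
    also have "\<dots> = (norm x)\<^sup>2 + hs n * (B * (2 * norm x)) + hs n * (hs n * B\<^sup>2)"
      by (simp add: power2_sum power_mult_distrib) (simp add: power2_eq_square algebra_simps)
    also have "\<dots> \<le> (norm x)\<^sup>2 + hs n * (B * P) + hs n * (B\<^sup>2 * P)"
    proof -
      have "2 * norm x \<le> P" using sum_squares_bound[of "norm x" 1] P(3) by simp
      then have "B * (2 * norm x) \<le> B * P" using B by (rule mult_left_mono)
      moreover have "hs n * B\<^sup>2 \<le> B\<^sup>2 * P"
      proof -
        have "hs n * B\<^sup>2 \<le> 1 * B\<^sup>2" using h by (intro mult_right_mono) auto
        also have "\<dots> \<le> B\<^sup>2 * P" using P(1) mult_left_mono[of 1 P "B\<^sup>2"] by simp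
        finally show ?thesis .
      qed
      ultimately have "hs n * (B * (2 * norm x)) \<le> hs n * (B * P)" "hs n * (hs n * B\<^sup>2) \<le> hs n * (B\<^sup>2 * P)"
        using h mult_left_mono[of _ _ "hs n"] by auto
      then show ?thesis by linarith
    qed
    finally have "1 + (norm (x + hs n *\<^sub>R \<beta>))\<^sup>2 + J \<le> (1 + (norm x)\<^sup>2 + J) + hs n * ((B + B\<^sup>2) * P)"
      by (simp add: algebra_simps)
    from mult_left_mono[OF this, of k] k
    show "k * (1 + (norm (x + hs n *\<^sub>R \<beta>))\<^sup>2 + J) \<le> k * (1 + (norm x)\<^sup>2 + J) + hs n * (k * ((B + B\<^sup>2) * P))"
      by (simp add: distrib_left mult.left_commute)
  qed

  let ?X2 = "\<lambda>i. (\<integral>z. 2 * u0 t x z m * (hx0 t x z m i \<bullet> i) + 2 * (gx0 t x z m \<bullet> i)\<^sup>2 \<partial>m)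
     + (\<integral>z. 2 * u1 t x z m * (hx1 t x z m i \<bullet> i) + 2 * (gx1 t x z m \<bullet> i)\<^sup>2 \<partial>m)"
  \<comment> \<open>The inequalities for two opposite shifts are added: first order terms cancel,
    and the parallelogram identity gives the increment of the penalty exactly.\<close>
  have x2: "E * ?X2 i \<le> k * 2 * P" if i: "i \<in> Basis" for i
  proof -
    have "E * ?X2 i \<le> k * 2"
    proof (rule LIMSEQ_le_const2)
      have e: "(W t (x + hs n *\<^sub>R i) m + W t (x - hs n *\<^sub>R i) m - 2 * W t x m) / (hs n)\<^sup>2 =
        (s0.Q t (x + hs n *\<^sub>R i) m + s0.Q t (x - hs n *\<^sub>R i) m - 2 * s0.Q t x m) / (hs n)\<^sup>2
        + (s1.Q t (x + hs n *\<^sub>R i) m + s1.Q t (x - hs n *\<^sub>R i) m - 2 * s1.Q t x m) / (hs n)\<^sup>2" for n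
        unfolding WQ add_divide_distrib[symmetric] by (simp add: algebra_simps)
      have "(\<lambda>n. (W t (x + hs n *\<^sub>R i) m + W t (x - hs n *\<^sub>R i) m - 2 * W t x m) / (hs n)\<^sup>2) \<longlonglongrightarrow> ?X2 i"
        unfolding e by (intro tendsto_add s0.Q_x2(1)[OF t m(1)] s1.Q_x2(1)[OF t m(1)])
      then show "(\<lambda>n. E * ((W t (x + hs n *\<^sub>R i) m + W t (x - hs n *\<^sub>R i) m - 2 * W t x m) / (hs n)\<^sup>2)) \<longlonglongrightarrow> E * ?X2 i"
        by (rule tendsto_mult_left)
      have "E * ((W t (x + hs n *\<^sub>R i) m + W t (x - hs n *\<^sub>R i) m - 2 * W t x m) / (hs n)\<^sup>2) \<le> k * 2" for n
      proof -
        have "(norm (x + hs n *\<^sub>R i))\<^sup>2 + (norm (x - hs n *\<^sub>R i))\<^sup>2 = 2 * (norm x)\<^sup>2 + 2 * (hs n)\<^sup>2"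
          unfolding power2_norm_eq_inner using i
          by (simp add: inner_add_left inner_add_right inner_diff_left inner_diff_right inner_commute power2_eq_square)
        then have "k * (1 + (norm (x + hs n *\<^sub>R i))\<^sup>2 + J) + k * (1 + (norm (x - hs n *\<^sub>R i))\<^sup>2 + J)
          = 2 * (k * (1 + (norm x)\<^sup>2 + J)) + 2 * k * (hs n)\<^sup>2"
          by (simp only: distrib_left[symmetric]) (simp add: algebra_simps)
        then have "E * (W t (x + hs n *\<^sub>R i) m + W t (x - hs n *\<^sub>R i) m - 2 * W t x m) \<le> 2 * k * (hs n)\<^sup>2"
          using Fx[of "x + hs n *\<^sub>R i"] Fx[of "x - hs n *\<^sub>R i"] by (simp add: distrib_left right_diff_distrib)
        then show ?thesis using hs(1)[of n] by (simp add: pos_divide_le_eq mult.commute)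
      qed
      then show "\<exists>N. \<forall>n\<ge>N. E * ((W t (x + hs n *\<^sub>R i) m + W t (x - hs n *\<^sub>R i) m - 2 * W t x m) / (hs n)\<^sup>2) \<le> k * 2"
        by blast
    qed
    also have "\<dots> \<le> k * 2 * P" using k P(1) by simp
    finally show ?thesis .
  qed

  let ?M1 = "(\<integral>z. 2 * u0 t x z m * (gz0 t x z m \<bullet> b z + (\<integral>y. gm0 t x z m y \<bullet> b y \<partial>m)) \<partial>m)
     + (\<integral>z. 2 * u1 t x z m * (gz1 t x z m \<bullet> b z + (\<integral>y. gm1 t x z m y \<bullet> b y \<partial>m)) \<partial>m)"
  let ?c = "2 * (B + B\<^sup>2) + (B + B\<^sup>2)\<^sup>2"
  have c0: "0 \<le> ?c" using B by simp
  have "E * ?M1 \<le> k * (?c * J)"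
  proof (rule quotient_limit_le[OF _ hs(1) E Fm])
    show "(\<lambda>n. (W t x (drift b m n) - W t x m) / hs n) \<longlonglongrightarrow> ?M1"
      unfolding quot_add by (intro tendsto_add s0.Q_drift(1)[OF t m(1) b] s1.Q_drift(1)[OF t m(1) b])
    show "drift b m n \<in> P2" "integrable (drift b m n) psi" for n
      by (rule drift_P2[OF m(1) b] drift_psi(1)[OF m b])+
    fix n
    have "1 + (norm x)\<^sup>2 + (\<integral>y. psi y \<partial>drift b m n) \<le> (1 + (norm x)\<^sup>2 + J) + hs n * (?c * J)"
      using drift_psi(2)[OF m b, of n] unfolding J_def by linarith
    from mult_left_mono[OF this, of k] k
    show "k * (1 + (norm x)\<^sup>2 + (\<integral>y. psi y \<partial>drift b m n)) \<le> k * (1 + (norm x)\<^sup>2 + J) + hs n * (k * (?c * J))"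
      by (simp add: distrib_left mult.left_commute)
  qed
  also have "k * (?c * J) \<le> k * (?c * P)" using k c0 P(2) by (intro mult_left_mono) auto
  finally have m1: "E * ?M1 \<le> k * (?c * P)" .

  let ?M2 = "\<lambda>i. (\<integral>z. u0 t x z m * (hz0 t x z m i \<bullet> i) + (gz0 t x z m \<bullet> i)\<^sup>2 + u0 t x z m * (\<integral>y. hm0 t x z m y i \<bullet> i \<partial>m) \<partial>m)
    + (\<integral>z. u1 t x z m * (hz1 t x z m i \<bullet> i) + (gz1 t x z m \<bullet> i)\<^sup>2 + u1 t x z m * (\<integral>y. hm1 t x z m y i \<bullet> i \<partial>m) \<partial>m)"
  have m2: "E * ?M2 i \<le> k * 7 * P" if i: "i \<in> Basis" for i
  proof -
    have h2: "0 < (hs n)\<^sup>2" for n using hs(1)[of n] by simp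
    have ni: "norm i = 1" using i by simp
    have "E * ?M2 i \<le> k * (7 * J)"
    proof (rule quotient_limit_le[OF _ h2 E Fm])
      show "(\<lambda>n. (W t x (heat i m n) - W t x m) / (hs n)\<^sup>2) \<longlonglongrightarrow> ?M2 i"
        unfolding quot_add by (intro tendsto_add s0.Q_heat(1)[OF t m(1)] s1.Q_heat(1)[OF t m(1)])
      show "heat i m n \<in> P2" "integrable (heat i m n) psi" for n
        by (rule heat_P2[OF m(1)] heat_psi(1)[OF m ni])+
      fix n
      have "1 + (norm x)\<^sup>2 + (\<integral>y. psi y \<partial>heat i m n) \<le> (1 + (norm x)\<^sup>2 + J) + (hs n)\<^sup>2 * (7 * J)"
        using heat_psi(2)[OF m ni, of n] unfolding J_def by linarith
      from mult_left_mono[OF this, of k] k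
      show "k * (1 + (norm x)\<^sup>2 + (\<integral>y. psi y \<partial>heat i m n)) \<le> k * (1 + (norm x)\<^sup>2 + J) + (hs n)\<^sup>2 * (k * (7 * J))"
        by (simp add: distrib_left mult.left_commute)
    qed
    also have "\<dots> \<le> k * 7 * P" using k P(2) by simp
    finally show ?thesis .
  qed

  let ?S = "\<theta> * W t x m + ?T + (\<Sum>i\<in>Basis. ?X2 i) + ?X1 + 2 * (\<Sum>i\<in>Basis. ?M2 i) + ?M1"
  have SX: "E * (\<Sum>i\<in>Basis. ?X2 i) \<le> real DIM('a) * (k * 2 * P)"
    unfolding sum_distrib_left by (rule sum_bounded_above) (rule x2)
  have SM: "E * (\<Sum>i\<in>Basis. ?M2 i) \<le> real DIM('b) * (k * 7 * P)"
    unfolding sum_distrib_left by (rule sum_bounded_above) (rule m2)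
  have "E * ?S = E * (\<theta> * W t x m + ?T) + E * (\<Sum>i\<in>Basis. ?X2 i) + E * ?X1 + 2 * (E * (\<Sum>i\<in>Basis. ?M2 i)) + E * ?M1"
    by (simp only: distrib_left mult.left_commute)
  also have "\<dots> \<le> - \<kappa> * (k * P) + real DIM('a) * (k * 2 * P) + k * ((B + B\<^sup>2) * P) + 2 * (real DIM('b) * (k * 7 * P)) + k * (?c * P)"
    using time x1 SX SM m1 by linarith
  \<comment> \<open>Every rate has been bounded by a multiple of the same \<open>k * P\<close>, so
    the bracket is precisely the hypothesis on \<open>\<kappa>\<close>.\<close>
  also have "\<dots> = (k * P) * ((2 * real DIM('a) + (B + B\<^sup>2) + 14 * real DIM('b) + ?c) - \<kappa>)"
    by (simp add: algebra_simps)
  also have "\<dots> < 0" using k P(1) \<kappa> by (intro mult_pos_neg mult_pos_pos) auto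
  finally have "?S < 0" using E by (simp add: mult_less_0_iff)
  moreover have "?S = \<theta> * W t x m + (\<integral>z. s0.energy b \<beta> t x m z \<partial>m) + (\<integral>z. s1.energy b \<beta> t x m z \<partial>m)"
    unfolding s0.energy_split(2)[OF t m(1) b] s1.energy_split(2)[OF t m(1) b]
    by (simp add: sum.distrib)
  ultimately show ?thesis by simp
qed

section \<open>Density arguments\<close>

text \<open>Mass outside a large ball is moved to the origin. The cost is the tail of the second
  moment, and the truncated measure has bounded support, hence a finite integral of
  \<open>psi\<close>.\<close>

lemma P2_truncation:
  fixes m :: "'b::euclidean_space measure"
  assumes m: "m \<in> P2"
  obtains \<mu> where "\<And>n. \<mu> n \<in> P2" "\<And>n. integrable (\<mu> n) psi" "(\<lambda>n::nat. d2 (\<mu> n) m) \<longlonglongrightarrow> 0"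
proof -
  interpret m: prob_space m by (rule P2_D(1)[OF m])
  define Y where "Y n y = (if norm y \<le> real n then y else 0)" for n and y :: 'b
  have Yb: "Y n \<in> borel_measurable borel" for n unfolding Y_def by measurable
  have Y: "Y n \<in> borel_measurable m" for n by (rule measurable_P2[OF m Yb])
  have id: "(\<lambda>y. y) \<in> borel_measurable m" by (rule measurable_P2[OF m]) simp
  have Yle: "norm (Y n y) \<le> norm y" "norm (Y n y) \<le> real n" for n y by (auto simp: Y_def)
  have iY: "integrable m (\<lambda>y. (norm (Y n y))\<^sup>2)" for n
    by (rule bounded_integrable[OF m.prob_space_axioms, of _ "(real n)\<^sup>2"])
      (use Y Yle(2) in \<open>auto intro!: power_mono\<close>)
  have P: "distr m borel (Y n) \<in> P2" for n by (rule P2_distr[OF m.prob_space_axioms Y iY])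
  have ipsi: "integrable (distr m borel (Y n)) psi" for n
  proof -
    have "integrable m (\<lambda>y. psi (Y n y))"
    proof (rule bounded_integrable[OF m.prob_space_axioms, of _ "(1 + (real n)\<^sup>2)\<^sup>2"])
      show "(\<lambda>y. psi (Y n y)) \<in> borel_measurable m" using Y by measurable
      show "norm (psi (Y n y)) \<le> (1 + (real n)\<^sup>2)\<^sup>2" for y
        unfolding real_norm_def abs_of_nonneg[OF psi_ge(5)] unfolding psi_def
        using Yle(2)[of n y] by (intro power_mono add_left_mono) auto
    qed
    then show ?thesis using Y by (simp add: integrable_distr_eq)
  qed
  define c where "c n = (\<integral>y. (dist (Y n y) y)\<^sup>2 \<partial>m)" for n
  have dle: "(dist (Y n y) y)\<^sup>2 \<le> (norm y)\<^sup>2" for n y by (auto simp: Y_def)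
  have ic: "integrable m (\<lambda>y. (dist (Y n y) y)\<^sup>2)" for n
    by (rule Bochner_Integration.integrable_bound[OF P2_D(4)[OF m]]) (use Y id dle in auto)
  have cl: "c \<longlonglongrightarrow> 0"
  proof -
    have "c \<longlonglongrightarrow> (\<integral>y. 0 \<partial>m)"
      unfolding c_def
    proof (rule integral_dominated_convergence[OF _ _ P2_D(4)[OF m]])
      show "(\<lambda>y. (dist (Y n y) y)\<^sup>2) \<in> borel_measurable m" for n using ic by blast
      show "AE y in m. (\<lambda>n. (dist (Y n y) y)\<^sup>2) \<longlonglongrightarrow> 0"
      proof (rule AE_I2)
        fix y :: 'b
        obtain N where N: "norm y \<le> real N" using real_arch_simple by blast
        have "\<forall>\<^sub>F n in sequentially. (dist (Y n y) y)\<^sup>2 = 0"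
          unfolding eventually_sequentially
          by (rule exI[of _ N]) (use N in \<open>auto simp: Y_def\<close>)
        then show "(\<lambda>n. (dist (Y n y) y)\<^sup>2) \<longlonglongrightarrow> 0" by (rule tendsto_eventually)
      qed
      show "AE y in m. norm ((dist (Y n y) y)\<^sup>2) \<le> (norm y)\<^sup>2" for n using dle by simp
    qed simp
    then show ?thesis by simp
  qed
  have c0: "0 \<le> c n" for n unfolding c_def by (rule Bochner_Integration.integral_nonneg) simp
  have U: "d2 (distr m borel (Y n)) m \<le> sqrt (c n)" for n
  proof -
    have "(\<integral>\<^sup>+ y. ennreal ((dist (Y n y) y)\<^sup>2) \<partial>m) \<le> ennreal (c n)"
      unfolding c_def by (subst nn_integral_eq_integral[OF ic]) auto
    from d2_distr_le[OF m.prob_space_axioms Y id c0 this] show ?thesis unfolding P2_distr_id[OF m] .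
  qed
  have L: "0 \<le> d2 (distr m borel (Y n)) m" for n
    using d2_distr_nonneg[OF m.prob_space_axioms Y id] unfolding P2_distr_id[OF m] .
  have S: "(\<lambda>n. sqrt (c n)) \<longlonglongrightarrow> 0" using tendsto_real_sqrt[OF cl] by simp
  have "(\<lambda>n. d2 (distr m borel (Y n)) m) \<longlonglongrightarrow> 0"
    by (rule tendsto_sandwich[OF _ _ tendsto_const S]) (use L U in auto)
  with P ipsi show thesis by (rule that)
qed

text \<open>The information that \<open>f\<close> vanishes almost everywhere is upgraded by giving \<open>z\<close> some mass.\<close>

lemma zero_everywhere:
  fixes f :: "'b::euclidean_space \<Rightarrow> 'b measure \<Rightarrow> real"
  assumes f: "continuous_P2 UNIV f" and K: "\<And>z m. m \<in> P2 \<Longrightarrow> \<bar>f z m\<bar> \<le> K"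
    and zero: "\<And>m. m \<in> P2 \<Longrightarrow> integrable m psi \<Longrightarrow> (\<integral>z. (f z m)\<^sup>2 \<partial>m) = 0"
    and m: "m \<in> P2"
  shows "f z m = 0"
proof -
  let ?\<delta> = "return borel z"
  have \<delta>: "?\<delta> \<in> P2" "integrable ?\<delta> psi"
  proof -
    have "(\<integral>\<^sup>+y. ennreal (psi y) \<partial>?\<delta>) < \<infinity>" by (subst nn_integral_return) auto
    from P2_psi[OF prob_space_return _ this] show "?\<delta> \<in> P2" "integrable ?\<delta> psi" by auto
  qed
  have psi_case: "f z m = 0" if m: "m \<in> P2" "integrable m psi" for m
  proof -
    have h: "hs n \<in> {0..1}" for n using hs(1,2)[of n] by simp
    note P = mix_P2[OF m(1) \<delta>(1) h]
    have 0: "f z (mix (hs n) m ?\<delta>) = 0" for n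
    proof -
      let ?g = "\<lambda>y. (f y (mix (hs n) m ?\<delta>))\<^sup>2"
      have gb: "?g \<in> borel_measurable borel"
        using continuous_P2_continuous_on[OF f P] by (intro borel_measurable_power borel_measurable_continuous_onI)
      have i: "integrable \<nu> ?g" if "\<nu> \<in> P2" for \<nu>
      proof (rule bounded_integrable[OF P2_D(1)[OF that] measurable_P2[OF that gb], of "K\<^sup>2"])
        fix y
        have "\<bar>f y (mix (hs n) m ?\<delta>)\<bar> \<le> K" by (rule K[OF P])
        then show "norm (?g y) \<le> K\<^sup>2" using power_mono[of "\<bar>f y (mix (hs n) m ?\<delta>)\<bar>" K 2] by simp
      qed
      have "0 = (\<integral>y. ?g y \<partial>mix (hs n) m ?\<delta>)"
        by (rule zero[OF P, symmetric]) (rule integral_mix(1)[OF m(1) \<delta>(1) h m(2) \<delta>(2)])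
      also have "\<dots> = (1 - hs n) * (\<integral>y. ?g y \<partial>m) + hs n * (\<integral>y. ?g y \<partial>?\<delta>)"
        by (rule integral_mix(2)[OF m(1) \<delta>(1) h i[OF m(1)] i[OF \<delta>(1)]])
      also have "(\<integral>y. ?g y \<partial>?\<delta>) = ?g z" by (rule integral_return) (use gb in auto)
      finally have "(1 - hs n) * (\<integral>y. ?g y \<partial>m) + hs n * ?g z = 0" by simp
      moreover have "0 \<le> (1 - hs n) * (\<integral>y. ?g y \<partial>m)" using h[of n] by (intro mult_nonneg_nonneg) auto
      moreover have "0 \<le> hs n * ?g z" using h[of n] by simp
      ultimately have "hs n * ?g z = 0" by linarith
      then show ?thesis using hs(1)[of n] by simp
    qed
    have "(\<lambda>n. d2 (mix (hs n) m ?\<delta>) (mix 0 m ?\<delta>)) \<longlonglongrightarrow> 0"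
      by (rule mix_seq[OF m(1) \<delta>(1) h _ hs(3)]) simp
    then have "(\<lambda>n. d2 (mix (hs n) m ?\<delta>) m) \<longlonglongrightarrow> 0" unfolding mix_0[OF m(1) \<delta>(1)] .
    from continuous_P2_seq[OF f _ _ tendsto_const P m(1) this, of z]
    have "(\<lambda>n. 0) \<longlonglongrightarrow> f z m" unfolding 0 by simp
    then show ?thesis using LIMSEQ_unique tendsto_const by blast
  qed
  \<comment> \<open>A general \<open>m\<close> is reached through its truncations, by continuity in
    the measure.\<close>
  obtain \<mu> where \<mu>: "\<And>n. \<mu> n \<in> P2" "\<And>n. integrable (\<mu> n) psi" "(\<lambda>n::nat. d2 (\<mu> n) m) \<longlonglongrightarrow> 0"
    by (rule P2_truncation[OF m], rule that)
  from continuous_P2_seq[OF f _ _ tendsto_const \<mu>(1) m \<mu>(3), of z]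
  have "(\<lambda>n. 0) \<longlonglongrightarrow> f z m" unfolding psi_case[OF \<mu>(1,2)] by simp
  then show ?thesis using LIMSEQ_unique tendsto_const by blast
qed

text \<open>For the nonlocal term: \<open>q\<close> will be a measure derivative, \<open>h\<close>
  the difference of \<open>H_p\<close> at two momenta, and \<open>p\<close> the difference of these
  momenta.\<close>

lemma coupling_bound:
  fixes q h p :: "'b::euclidean_space \<Rightarrow> 'b"
  assumes m: "m \<in> P2" and q: "q \<in> borel_measurable borel" "\<And>y. norm (q y) \<le> K"
    and h: "h \<in> borel_measurable borel" "\<And>y. norm (h y) \<le> C * norm (p y)"
    and p: "integrable m (\<lambda>y. norm (p y))"
  shows "\<bar>\<integral>y. q y \<bullet> h y \<partial>m\<bar> \<le> K * C * (\<integral>y. norm (p y) \<partial>m)"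
proof -
  have K: "0 \<le> K" using q(2) norm_ge_zero order_trans by blast
  have le: "\<bar>q y \<bullet> h y\<bar> \<le> K * C * norm (p y)" for y
  proof -
    have "\<bar>q y \<bullet> h y\<bar> \<le> norm (q y) * norm (h y)" by (rule Cauchy_Schwarz_ineq2)
    also have "\<dots> \<le> K * (C * norm (p y))" using q(2) h(2) K by (intro mult_mono) auto
    finally show ?thesis by (simp add: mult.assoc)
  qed
  have i0: "integrable m (\<lambda>y. K * C * norm (p y))" using p by simp
  have i: "integrable m (\<lambda>y. q y \<bullet> h y)"
  proof (rule Bochner_Integration.integrable_bound[OF i0])
    show "(\<lambda>y. q y \<bullet> h y) \<in> borel_measurable m" by (rule measurable_P2[OF m]) (use q(1) h(1) in measurable)
    show "AE y in m. norm (q y \<bullet> h y) \<le> norm (K * C * norm (p y))"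
      using order_trans[OF le abs_ge_self] by (intro AE_I2) (simp only: real_norm_def)
  qed
  have "\<bar>\<integral>y. q y \<bullet> h y \<partial>m\<bar> \<le> (\<integral>y. \<bar>q y \<bullet> h y\<bar> \<partial>m)" by (rule integral_abs_bound)
  also have "\<dots> \<le> (\<integral>y. K * C * norm (p y) \<partial>m)" using i i0 le by (intro integral_mono integrable_abs)
  finally show ?thesis by simp
qed

section \<open>Measurability and traces, to read the master equations in terms of
  \<open>gen\<close>\<close>

context smooth_field
begin

lemma measurable_y:
  assumes t: "t \<in> {0<..<T}" and m: "m \<in> P2"
  shows "gm t x z m \<in> borel_measurable borel" "(\<lambda>y. hm t x z m y v \<bullet> v) \<in> borel_measurable borel"
proof -
  show "gm t x z m \<in> borel_measurable borel"
    using continuous_P2_continuous_on[OF slice_y(1)[OF t] m] by (intro borel_measurable_continuous_onI) simp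
  have "continuous_on UNIV (\<lambda>y. hm t x z m y v \<bullet> v)"
    using continuous_P2_continuous_on[OF slice_y(2)[OF t] m] by (intro continuous_intros) simp
  then show "(\<lambda>y. hm t x z m y v \<bullet> v) \<in> borel_measurable borel" by (rule borel_measurable_continuous_onI)
qed

lemma integrable_y:
  assumes t: "t \<in> {0<..<T}" and m: "m \<in> P2"
  shows "i \<in> Basis \<Longrightarrow> integrable m (\<lambda>y. hm t x z m y i \<bullet> i)"
    and "b \<in> borel_measurable borel \<Longrightarrow> (\<And>y. norm (b y) \<le> B) \<Longrightarrow> integrable m (\<lambda>y. gm t x z m y \<bullet> b y)"
proof -
  show "integrable m (\<lambda>y. hm t x z m y i \<bullet> i)" if i: "i \<in> Basis"
  proof (rule bounded_integrable[OF P2_D(1)[OF m] measurable_P2[OF m measurable_y(2)[OF t m]], where C=C])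
    fix y
    have "\<bar>hm t x z m y i \<bullet> i\<bar> \<le> norm (hm t x z m y i)" using i by (rule Basis_le_norm)
    also have "\<dots> \<le> norm (hm t x z m y) * norm i" by (rule norm_blinfun)
    also have "\<dots> \<le> C" using bounded(8)[OF t m] i by simp
    finally show "norm (hm t x z m y i \<bullet> i) \<le> C" by simp
  qed
  assume b: "b \<in> borel_measurable borel" "\<And>y. norm (b y) \<le> B"
  show "integrable m (\<lambda>y. gm t x z m y \<bullet> b y)"
  proof (rule bounded_integrable[OF P2_D(1)[OF m], of _ "C * B"])
    show "(\<lambda>y. gm t x z m y \<bullet> b y) \<in> borel_measurable m"
      by (rule measurable_P2[OF m]) (use b(1) measurable_y(1)[OF t m] in measurable)
    fix y
    have "\<bar>gm t x z m y \<bullet> b y\<bar> \<le> norm (gm t x z m y) * norm (b y)" by (rule Cauchy_Schwarz_ineq2)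
    also have "\<dots> \<le> C * B" using bounded(7)[OF t m] b(2) C_nonneg[OF t m] by (intro mult_mono) auto
    finally show "norm (gm t x z m y \<bullet> b y) \<le> C * B" by simp
  qed
qed

text \<open>\<open>laplacian\<close> goes through \<open>grad\<close> and
  \<open>frechet_derivative\<close>; in a smooth field these are \<open>gx\<close> and
  \<open>hx\<close>, so the Laplacian is the trace that occurs in \<open>gen\<close>.\<close>

lemma laplacian_x: "t \<in> {0<..<T} \<Longrightarrow> m \<in> P2 \<Longrightarrow>
    laplacian (\<lambda>x. u t x z m) x = (\<Sum>i\<in>Basis. hx t x z m i \<bullet> i)"
proof -
  assume t: "t \<in> {0<..<T}" "m \<in> P2"
  have "grad (\<lambda>x. u t x z m) = (\<lambda>x. gx t x z m)" using grad_eq[OF dx[OF t]] by (rule ext)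
  then show ?thesis
    unfolding laplacian_def divergence_def by (simp add: frechet_derivative_at[OF dx2[OF t], symmetric])
qed

lemma laplacian_z: "t \<in> {0<..<T} \<Longrightarrow> m \<in> P2 \<Longrightarrow>
    laplacian (\<lambda>z. u t x z m) z = (\<Sum>i\<in>Basis. hz t x z m i \<bullet> i)"
proof -
  assume t: "t \<in> {0<..<T}" "m \<in> P2"
  have "grad (\<lambda>z. u t x z m) = (\<lambda>z. gz t x z m)" using grad_eq[OF dz[OF t]] by (rule ext)
  then show ?thesis
    unfolding laplacian_def divergence_def by (simp add: frechet_derivative_at[OF dz2[OF t], symmetric])
qed

lemma divergence_y: "t \<in> {0<..<T} \<Longrightarrow> m \<in> P2 \<Longrightarrow>
    (\<integral>y. divergence (gm t x z m) y \<partial>m) = (\<Sum>i\<in>Basis. \<integral>y. hm t x z m y i \<bullet> i \<partial>m)"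
proof -
  assume t: "t \<in> {0<..<T}" "m \<in> P2"
  have "divergence (gm t x z m) y = (\<Sum>i\<in>Basis. hm t x z m y i \<bullet> i)" for y
    unfolding divergence_def by (simp add: frechet_derivative_at[OF dm2[OF t], symmetric])
  then show ?thesis by (simp add: Bochner_Integration.integral_sum integrable_y(1)[OF t])
qed

end

section \<open>Uniqueness\<close>

text \<open>Young's inequality: the squared gradients absorb the products of \<open>u0\<close>, \<open>u1\<close> with the gradient
  terms \<open>g\<close>, \<open>p\<close> and with the nonlocal term \<open>G\<close>.\<close>

lemma energy_lower_bound:
  fixes e0 e1 u1 p :: "'b::euclidean_space \<Rightarrow> real" and u0 g A G :: real
  assumes m: "m \<in> P2" and A: "0 \<le> A" and g: "0 \<le> g"
    and i: "integrable m e0" "integrable m e1" "integrable m (\<lambda>z. (u1 z)\<^sup>2)"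
    and p: "integrable m p" "integrable m (\<lambda>z. (p z)\<^sup>2)" and p0: "\<And>z. 0 \<le> p z"
    and G: "G = (\<integral>z. p z \<partial>m)"
    and e0: "\<And>z. e0 z \<ge> 2 * u0 * l0 z + 2 * g\<^sup>2" "\<And>z. \<bar>l0 z\<bar> \<le> A * (g + G)"
    and e1: "\<And>z. e1 z \<ge> 2 * u1 z * l1 z + 2 * (p z)\<^sup>2" "\<And>z. \<bar>l1 z\<bar> \<le> A * (g + p z + G)"
  shows "0 \<le> 5 * A\<^sup>2 * (u0\<^sup>2 + (\<integral>z. (u1 z)\<^sup>2 \<partial>m)) + (\<integral>z. e0 z \<partial>m) + (\<integral>z. e1 z \<partial>m)"
proof -
  interpret m: prob_space m by (rule P2_D(1)[OF m])
  have G0: "0 \<le> G" unfolding G by (rule Bochner_Integration.integral_nonneg) (rule p0)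
  \<comment> \<open>Jensen's inequality, as nonnegativity of a variance.\<close>
  have G2: "G\<^sup>2 \<le> (\<integral>z. (p z)\<^sup>2 \<partial>m)"
  proof -
    have "0 \<le> (\<integral>z. (p z - G)\<^sup>2 \<partial>m)" by (rule Bochner_Integration.integral_nonneg) simp
    also have "\<dots> = (\<integral>z. (p z)\<^sup>2 - 2 * G * p z + G\<^sup>2 \<partial>m)"
      by (intro Bochner_Integration.integral_cong) (simp_all add: power2_diff algebra_simps)
    also have "\<dots> = (\<integral>z. (p z)\<^sup>2 \<partial>m) - 2 * G * G + G\<^sup>2" using p by (simp add: G m.prob_space)
    finally show ?thesis by (simp add: power2_eq_square)
  qed
  \<comment> \<open>The weights are chosen so that \<open>g\<^sup>2\<close> is left over from
    \<open>e0\<close> and exactly used up in \<open>e1\<close>, while each nonlocal product costs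
    only \<open>G\<^sup>2 / 2\<close>. The price is 3 times \<open>A\<^sup>2\<close> for
    \<open>u0\<close> and 5 = 1 + 2 + 2 times \<open>A\<^sup>2\<close> for
    \<open>u1\<close>.\<close>
  have young: "2 * x * y \<le> x\<^sup>2 + y\<^sup>2" "2 * x * y \<le> 2 * x\<^sup>2 + y\<^sup>2 / 2" for x y :: real
  proof -
    show "2 * x * y \<le> x\<^sup>2 + y\<^sup>2" by (rule sum_squares_bound)
    have "0 \<le> (2 * x - y)\<^sup>2" by simp
    then show "2 * x * y \<le> 2 * x\<^sup>2 + y\<^sup>2 / 2" by (simp add: power2_diff power_mult_distrib)
  qed
  have prod: "- (2 * (A * \<bar>u\<bar>) * a) \<le> 2 * u * l" if "\<bar>l\<bar> \<le> A * a" for u l a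
  proof -
    have "\<bar>u * l\<bar> \<le> \<bar>u\<bar> * (A * a)" unfolding abs_mult using that by (intro mult_left_mono) auto
    then have "- (\<bar>u\<bar> * (A * a)) \<le> u * l" by linarith
    then show ?thesis by (simp add: ac_simps)
  qed
  have b0: "- 3 * A\<^sup>2 * u0\<^sup>2 + g\<^sup>2 - G\<^sup>2 / 2 \<le> e0 z" for z
  proof -
    have "- (2 * (A * \<bar>u0\<bar>) * g) - 2 * (A * \<bar>u0\<bar>) * G \<le> 2 * u0 * l0 z"
      using prod[OF e0(2)[of z], of u0] by (simp add: distrib_left)
    moreover have "(A * \<bar>u0\<bar>)\<^sup>2 = A\<^sup>2 * u0\<^sup>2" by (simp add: power_mult_distrib)
    ultimately show ?thesis using young(1)[of "A * \<bar>u0\<bar>" g] young(2)[of "A * \<bar>u0\<bar>" G] e0(1)[of z] by linarith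
  qed
  have b1: "- 5 * A\<^sup>2 * (u1 z)\<^sup>2 - g\<^sup>2 + 3 / 2 * (p z)\<^sup>2 - G\<^sup>2 / 2 \<le> e1 z" for z
  proof -
    have "- (2 * (A * \<bar>u1 z\<bar>) * g) - 2 * (A * \<bar>u1 z\<bar>) * p z - 2 * (A * \<bar>u1 z\<bar>) * G \<le> 2 * u1 z * l1 z"
      using prod[OF e1(2)[of z], of "u1 z"] by (simp add: distrib_left)
    moreover have "(A * \<bar>u1 z\<bar>)\<^sup>2 = A\<^sup>2 * (u1 z)\<^sup>2" by (simp add: power_mult_distrib)
    ultimately show ?thesis using young(1)[of "A * \<bar>u1 z\<bar>" g] young(2)[of "A * \<bar>u1 z\<bar>" G]
      young(2)[of "A * \<bar>u1 z\<bar>" "p z"] e1(1)[of z] by linarith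
  qed
  have "- 3 * A\<^sup>2 * u0\<^sup>2 + g\<^sup>2 - G\<^sup>2 / 2 = (\<integral>z. - 3 * A\<^sup>2 * u0\<^sup>2 + g\<^sup>2 - G\<^sup>2 / 2 \<partial>m)" by (simp add: m.prob_space)
  also have "\<dots> \<le> (\<integral>z. e0 z \<partial>m)" by (rule integral_mono[OF _ i(1) b0]) simp
  finally have I0: "- 3 * A\<^sup>2 * u0\<^sup>2 + g\<^sup>2 - G\<^sup>2 / 2 \<le> (\<integral>z. e0 z \<partial>m)" .
  have j: "integrable m (\<lambda>z. - 5 * A\<^sup>2 * (u1 z)\<^sup>2 - g\<^sup>2 + 3 / 2 * (p z)\<^sup>2 - G\<^sup>2 / 2)" using i p by simp
  have "- 5 * A\<^sup>2 * (\<integral>z. (u1 z)\<^sup>2 \<partial>m) - g\<^sup>2 + 3 / 2 * (\<integral>z. (p z)\<^sup>2 \<partial>m) - G\<^sup>2 / 2 =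
    (\<integral>z. - 5 * A\<^sup>2 * (u1 z)\<^sup>2 - g\<^sup>2 + 3 / 2 * (p z)\<^sup>2 - G\<^sup>2 / 2 \<partial>m)" using i p by (simp add: m.prob_space)
  also have "\<dots> \<le> (\<integral>z. e1 z \<partial>m)" by (rule integral_mono[OF j i(2) b1])
  finally have I1: "- 5 * A\<^sup>2 * (\<integral>z. (u1 z)\<^sup>2 \<partial>m) - g\<^sup>2 + 3 / 2 * (\<integral>z. (p z)\<^sup>2 \<partial>m) - G\<^sup>2 / 2 \<le> (\<integral>z. e1 z \<partial>m)" .
  \<comment> \<open>After addition \<open>3 / 2\<close> times the integral of
    \<open>p\<^sup>2\<close> stands against \<open>G\<^sup>2\<close>, and Jensen decides in favour
    of the former.\<close>
  have "0 \<le> A\<^sup>2 * u0\<^sup>2" "0 \<le> G\<^sup>2" by simp_all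
  with I0 I1 G2 show ?thesis unfolding distrib_left by linarith
qed

text \<open>The left sides are the parts of \<open>gen\<close> that do not involve the drifts, the
  right sides everything with a Hamiltonian. Subtracting two such identities evaluates
  \<open>gen\<close> on the difference of the solutions.\<close>

lemma master_equationsD:
  assumes me: "master_equations T H G H0 G0 U0 U" and t: "t \<in> {0<..<T}" and m: "m \<in> P2"
  shows "deriv (\<lambda>s. U0 s x m) t + laplacian (\<lambda>x. U0 t x m) x + (\<integral>y. divergence (Dm (U0 t x) m) y \<partial>m)
      = H0 x (grad (\<lambda>x. U0 t x m) x) m
        + (\<integral>y. Dm (U0 t x) m y \<bullet> grad (\<lambda>p. H x y p m) (grad (\<lambda>z. U t x z m) y) \<partial>m)"
    and "deriv (\<lambda>s. U s x z m) t + laplacian (\<lambda>x. U t x z m) x + laplacian (\<lambda>z. U t x z m) z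
        + (\<integral>y. divergence (Dm (U t x z) m) y \<partial>m)
      = H x z (grad (\<lambda>z. U t x z m) z) m
        + grad (\<lambda>x. U t x z m) x \<bullet> grad (\<lambda>p. H0 x p m) (grad (\<lambda>x. U0 t x m) x)
        + (\<integral>y. Dm (U t x z) m y \<bullet> grad (\<lambda>p. H x y p m) (grad (\<lambda>z. U t x z m) y) \<partial>m)"
proof -
  have "- deriv (\<lambda>s. U0 s x m) t - laplacian (\<lambda>x. U0 t x m) x + H0 x (grad (\<lambda>x. U0 t x m) x) m
      - (\<integral>y. divergence (Dm (U0 t x) m) y \<partial>m)
      + (\<integral>y. Dm (U0 t x) m y \<bullet> grad (\<lambda>p. H x y p m) (grad (\<lambda>z. U t x z m) y) \<partial>m) = 0"
    "- deriv (\<lambda>s. U s x z m) t - laplacian (\<lambda>z. U t x z m) z - laplacian (\<lambda>x. U t x z m) x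
      + H x z (grad (\<lambda>z. U t x z m) z) m - (\<integral>y. divergence (Dm (U t x z) m) y \<partial>m)
      + grad (\<lambda>x. U t x z m) x \<bullet> grad (\<lambda>p. H0 x p m) (grad (\<lambda>x. U0 t x m) x)
      + (\<integral>y. Dm (U t x z) m y \<bullet> grad (\<lambda>p. H x y p m) (grad (\<lambda>z. U t x z m) y) \<partial>m) = 0"
    using me t m unfolding master_equations_def by blast+
  then show "deriv (\<lambda>s. U0 s x m) t + laplacian (\<lambda>x. U0 t x m) x + (\<integral>y. divergence (Dm (U0 t x) m) y \<partial>m)
      = H0 x (grad (\<lambda>x. U0 t x m) x) m
        + (\<integral>y. Dm (U0 t x) m y \<bullet> grad (\<lambda>p. H x y p m) (grad (\<lambda>z. U t x z m) y) \<partial>m)"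
    "deriv (\<lambda>s. U s x z m) t + laplacian (\<lambda>x. U t x z m) x + laplacian (\<lambda>z. U t x z m) z
        + (\<integral>y. divergence (Dm (U t x z) m) y \<partial>m)
      = H x z (grad (\<lambda>z. U t x z m) z) m
        + grad (\<lambda>x. U t x z m) x \<bullet> grad (\<lambda>p. H0 x p m) (grad (\<lambda>x. U0 t x m) x)
        + (\<integral>y. Dm (U t x z) m y \<bullet> grad (\<lambda>p. H x y p m) (grad (\<lambda>z. U t x z m) y) \<partial>m)"
    by linarith+
qed

text \<open>At a positive penalized maximum, \<open>max_inequality\<close> and
  \<open>energy_lower_bound\<close> assert opposite signs for the same expression once
  \<open>\<theta>\<close> is \<open>5 * A\<^sup>2\<close>.\<close>

lemma master_difference_zero:
  fixes T C0 \<gamma> :: real and n :: nat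
    and H :: "'a::euclidean_space \<Rightarrow> 'b::euclidean_space \<Rightarrow> 'b \<Rightarrow> 'b measure \<Rightarrow> real"
    and U01 U02 :: "real \<Rightarrow> 'a \<Rightarrow> 'b measure \<Rightarrow> real"
    and U1 U2 :: "real \<Rightarrow> 'a \<Rightarrow> 'b \<Rightarrow> 'b measure \<Rightarrow> real"
  assumes n: "n \<ge> 4" and H: "assumption_H n C0 \<gamma> H" and H0: "assumption_H0 n C0 \<gamma> H0"
    and sol1: "classical_solution T H G H0 G0 U01 U1" and sol2: "classical_solution T H G H0 G0 U02 U2"
    and ts: "ts \<in> {0<..<T}" and ms: "ms \<in> P2" "integrable ms psi"
  shows "(\<integral>z. (U01 ts xs ms - U02 ts xs ms)\<^sup>2 \<partial>ms) + (\<integral>z. (U1 ts xs z ms - U2 ts xs z ms)\<^sup>2 \<partial>ms) \<le> 0"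
proof (rule ccontr)
  have reg: "regular_U0 T U01" "regular_U T U1" "regular_U0 T U02" "regular_U T U2"
    and me: "master_equations T H G H0 G0 U01 U1" "master_equations T H G H0 G0 U02 U2"
    using sol1 sol2 unfolding classical_solution_def by auto
  obtain K01 where f01: "smooth_field T K01 (\<lambda>t x (z::'b) m. U01 t x m) (\<lambda>t x z m. deriv (\<lambda>s. U01 s x m) t)
    (\<lambda>t x z m. grad (\<lambda>x. U01 t x m) x) (\<lambda>t x z m. jac (grad (\<lambda>x. U01 t x m)) x) (\<lambda>t x z m. 0) (\<lambda>t x z m. 0)
    (\<lambda>t x z. lin_deriv (U01 t x)) (\<lambda>t x z. Dm (U01 t x)) (\<lambda>t x z m. jac (Dm (U01 t x) m))"
    by (rule regular_U0_smooth[OF reg(1)])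
  obtain K02 where f02: "smooth_field T K02 (\<lambda>t x (z::'b) m. U02 t x m) (\<lambda>t x z m. deriv (\<lambda>s. U02 s x m) t)
    (\<lambda>t x z m. grad (\<lambda>x. U02 t x m) x) (\<lambda>t x z m. jac (grad (\<lambda>x. U02 t x m)) x) (\<lambda>t x z m. 0) (\<lambda>t x z m. 0)
    (\<lambda>t x z. lin_deriv (U02 t x)) (\<lambda>t x z. Dm (U02 t x)) (\<lambda>t x z m. jac (Dm (U02 t x) m))"
    by (rule regular_U0_smooth[OF reg(3)])
  obtain K1 where f1: "smooth_field T K1 U1 (\<lambda>t x z m. deriv (\<lambda>s. U1 s x z m) t)
    (\<lambda>t x z m. grad (\<lambda>x. U1 t x z m) x) (\<lambda>t x z m. jac (grad (\<lambda>x. U1 t x z m)) x)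
    (\<lambda>t x z m. grad (\<lambda>z. U1 t x z m) z) (\<lambda>t x z m. jac (grad (\<lambda>z. U1 t x z m)) z)
    (\<lambda>t x z. lin_deriv (U1 t x z)) (\<lambda>t x z. Dm (U1 t x z)) (\<lambda>t x z m. jac (Dm (U1 t x z) m))"
    by (rule regular_U_smooth[OF reg(2)])
  obtain K2 where f2: "smooth_field T K2 U2 (\<lambda>t x z m. deriv (\<lambda>s. U2 s x z m) t)
    (\<lambda>t x z m. grad (\<lambda>x. U2 t x z m) x) (\<lambda>t x z m. jac (grad (\<lambda>x. U2 t x z m)) x)
    (\<lambda>t x z m. grad (\<lambda>z. U2 t x z m) z) (\<lambda>t x z m. jac (grad (\<lambda>z. U2 t x z m)) z)
    (\<lambda>t x z. lin_deriv (U2 t x z)) (\<lambda>t x z. Dm (U2 t x z)) (\<lambda>t x z m. jac (Dm (U2 t x z) m))"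
    by (rule regular_U_smooth[OF reg(4)])
  note d0 = smooth_field_diff[OF f01 f02] and d1 = smooth_field_diff[OF f1 f2]
  define v0 where "v0 t x (z::'b) m = U01 t x m - U02 t x m" for t x z m
  define v1 where "v1 t x z m = U1 t x z m - U2 t x z m" for t x z m
  define W where "W t x m = (\<integral>z. (v0 t x z m)\<^sup>2 \<partial>m) + (\<integral>z. (v1 t x z m)\<^sup>2 \<partial>m)" for t x m
  assume "\<not> (\<integral>z. (U01 ts xs ms - U02 ts xs ms)\<^sup>2 \<partial>ms) + (\<integral>z. (U1 ts xs z ms - U2 ts xs z ms)\<^sup>2 \<partial>ms) \<le> 0"
  then have Wpos: "0 < W ts xs ms" unfolding W_def v0_def v1_def by simp
  have Kpos: "0 \<le> K01" "0 \<le> K02" "0 \<le> K1" "0 \<le> K2"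
    using smooth_field.C_nonneg[OF f01 ts ms(1)] smooth_field.C_nonneg[OF f02 ts ms(1)]
      smooth_field.C_nonneg[OF f1 ts ms(1)] smooth_field.C_nonneg[OF f2 ts ms(1)] by auto
  \<comment> \<open>A common bound for the gradients and measure derivatives of all four functions,
    fixed before the constants of the Hamiltonians, which depend on it. The summand 1 makes it
    positive.\<close>
  define R where "R = K01 + K02 + K1 + K2 + 1"
  have R: "R > 0" "K01 \<le> R" "K02 \<le> R" "K1 \<le> R" "K2 \<le> R" using Kpos by (simp_all add: R_def)
  obtain CH where CH: "0 \<le> CH" "\<And>x0 x m. m \<in> P2 \<Longrightarrow> Hamiltonian_bound R CH (\<lambda>p. H x0 x p m)"
    "\<And>m. m \<in> P2 \<Longrightarrow> continuous_on UNIV (\<lambda>(x0, x, p). grad (\<lambda>p. H x0 x p m) p)"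
    by (rule assumption_H_facts[OF H n R(1)], rule that)
  obtain CH0 where CH0: "0 \<le> CH0" "\<And>x0 m. m \<in> P2 \<Longrightarrow> Hamiltonian_bound R CH0 (\<lambda>p. H0 x0 p m)"
    by (rule assumption_H0_facts[OF H0 R(1)], rule that)
  define B where "B = CH + CH0"
  \<comment> \<open>Majorises every coefficient in the bounds for the two generators: twice a
    Lipschitz constant of a Hamiltonian, and \<open>R\<close> times a Lipschitz constant of its
    gradient.\<close>
  define A where "A = 2 * CH + 2 * CH0 + R * CH + R * CH0"
  have A: "0 \<le> A" using CH(1) CH0(1) R(1) by (simp add: A_def)
  define \<theta> where "\<theta> = 5 * A\<^sup>2"
  define \<kappa> where "\<kappa> = 1 + (2 * real DIM('a) + (B + B\<^sup>2) + 14 * real DIM('b) + (2 * (B + B\<^sup>2) + (B + B\<^sup>2)\<^sup>2))"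
  have B: "0 \<le> B" using CH(1) CH0(1) by (simp add: B_def)
  have \<theta>\<kappa>: "0 \<le> \<theta>" "0 \<le> \<kappa>" using B by (simp_all add: \<theta>_def \<kappa>_def)
  define P where "P x m = 1 + (norm x)\<^sup>2 + (\<integral>y. psi y \<partial>m)" for x :: 'a and m :: "'b measure"
  have P: "1 \<le> P x m" for x m
  proof -
    have "0 \<le> (\<integral>y. psi y \<partial>m)" by (rule Bochner_Integration.integral_nonneg) (rule psi_ge(5))
    then show ?thesis by (simp add: P_def)
  qed
  define c where "c = exp (\<kappa> * (T - ts)) * P xs ms + 1 / ts"
  have c: "0 < c" using ts P[of xs ms] unfolding c_def by (intro add_pos_pos mult_pos_pos) auto
  \<comment> \<open>With this choice the penalty takes away exactly half of
    \<open>exp (\<theta> * ts) * W ts xs ms\<close>, so \<open>F\<close> stays positive at the given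
    point.\<close>
  define \<epsilon> where "\<epsilon> = exp (\<theta> * ts) * W ts xs ms / (2 * c)"
  have eps: "0 < \<epsilon>" using Wpos c by (simp add: \<epsilon>_def)
  define F where "F t x m = exp (\<theta> * t) * W t x m
      - \<epsilon> * exp (\<kappa> * (T - t)) * (1 + (norm x)\<^sup>2 + (\<integral>y. psi y \<partial>m)) - \<epsilon> / t" for t x and m :: "'b measure"
  have Fpos: "0 < F ts xs ms"
  proof -
    have "F ts xs ms = exp (\<theta> * ts) * W ts xs ms - \<epsilon> * c" by (simp add: F_def c_def P_def algebra_simps)
    also have "\<dots> = exp (\<theta> * ts) * W ts xs ms / 2" using c by (simp add: \<epsilon>_def field_simps)
    finally have "F ts xs ms = exp (\<theta> * ts) * W ts xs ms / 2" .
    moreover have "0 < exp (\<theta> * ts) * W ts xs ms / 2" using Wpos by simp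
    ultimately show ?thesis by linarith
  qed
  have v0c: "continuous_P2 ({0..T} \<times> UNIV \<times> UNIV) (\<lambda>(t, x, z) m. v0 t x z m)"
  proof -
    have d: "dist (fst p, fst (snd p)) (fst q, fst (snd q)) \<le> dist p q" for p q :: "real \<times> 'a \<times> 'b"
      by (cases p; cases q) (auto simp: dist_Pair_Pair)
    have "continuous_P2 ({0..T} \<times> UNIV) (\<lambda>(t, x0) m. U01 t x0 m)" "continuous_P2 ({0..T} \<times> UNIV) (\<lambda>(t, x0) m. U02 t x0 m)"
      using reg(1,3) unfolding regular_U0_def Let_def by blast+
    from continuous_P2_diff[OF this] have *: "continuous_P2 ({0..T} \<times> UNIV) (\<lambda>(t, x0) m. U01 t x0 m - U02 t x0 m)"
      by (simp add: case_prod_unfold)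
    have "continuous_P2 ({0..T} \<times> UNIV \<times> (UNIV :: 'b set)) (\<lambda>p. (\<lambda>(t, x0) m. U01 t x0 m - U02 t x0 m) (fst p, fst (snd p)))"
      by (rule continuous_P2_compose[OF *]) (use d in auto)
    then show ?thesis by (simp add: case_prod_unfold v0_def)
  qed
  have v1c: "continuous_P2 ({0..T} \<times> UNIV \<times> UNIV) (\<lambda>(t, x, z) m. v1 t x z m)"
  proof -
    have "continuous_P2 ({0..T} \<times> UNIV \<times> UNIV) (\<lambda>(t, x0, x) m. U1 t x0 x m)"
      "continuous_P2 ({0..T} \<times> UNIV \<times> UNIV) (\<lambda>(t, x0, x) m. U2 t x0 x m)"
      using reg(2,4) unfolding regular_U_def Let_def by blast+
    from continuous_P2_diff[OF this] show ?thesis by (simp add: case_prod_unfold v1_def)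
  qed
  obtain K where K: "\<And>t x z m. t \<in> {0..T} \<Longrightarrow> m \<in> P2 \<Longrightarrow> \<bar>v0 t x z m\<bar> \<le> K"
    "\<And>t x z m. t \<in> {0..T} \<Longrightarrow> m \<in> P2 \<Longrightarrow> \<bar>v1 t x z m\<bar> \<le> K"
  proof -
    have b: "bounded_P2 ({0..T} \<times> UNIV) (\<lambda>(t, x0) m. U01 t x0 m)" "bounded_P2 ({0..T} \<times> UNIV) (\<lambda>(t, x0) m. U02 t x0 m)"
      "bounded_P2 ({0..T} \<times> UNIV \<times> UNIV) (\<lambda>(t, x0, x) m. U1 t x0 x m)"
      "bounded_P2 ({0..T} \<times> UNIV \<times> UNIV) (\<lambda>(t, x0, x) m. U2 t x0 x m)"
      using reg unfolding regular_U_def regular_U0_def Let_def by blast+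
    obtain L1 where L1: "\<And>z m. z \<in> {0..T} \<times> UNIV \<Longrightarrow> m \<in> P2 \<Longrightarrow> norm ((case z of (t, x0) \<Rightarrow> \<lambda>m. U01 t x0 m) m) \<le> L1"
      by (rule bounded_P2_obtain[OF b(1)], rule that)
    obtain L2 where L2: "\<And>z m. z \<in> {0..T} \<times> UNIV \<Longrightarrow> m \<in> P2 \<Longrightarrow> norm ((case z of (t, x0) \<Rightarrow> \<lambda>m. U02 t x0 m) m) \<le> L2"
      by (rule bounded_P2_obtain[OF b(2)], rule that)
    obtain L3 where L3: "\<And>z m. z \<in> {0..T} \<times> UNIV \<times> UNIV \<Longrightarrow> m \<in> P2 \<Longrightarrow> norm ((case z of (t, x0, x) \<Rightarrow> \<lambda>m. U1 t x0 x m) m) \<le> L3"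
      by (rule bounded_P2_obtain[OF b(3)], rule that)
    obtain L4 where L4: "\<And>z m. z \<in> {0..T} \<times> UNIV \<times> UNIV \<Longrightarrow> m \<in> P2 \<Longrightarrow> norm ((case z of (t, x0, x) \<Rightarrow> \<lambda>m. U2 t x0 x m) m) \<le> L4"
      by (rule bounded_P2_obtain[OF b(4)], rule that)
    show thesis
    proof (rule that[of "max (L1 + L2) (L3 + L4)"])
      fix t x z and m :: "'b measure" assume t: "t \<in> {0..T}" "m \<in> P2"
      show "\<bar>v0 t x z m\<bar> \<le> max (L1 + L2) (L3 + L4)"
        using L1[of "(t, x)" m] L2[of "(t, x)" m] t unfolding v0_def by auto
      show "\<bar>v1 t x z m\<bar> \<le> max (L1 + L2) (L3 + L4)"
        using L3[of "(t, x, z)" m] L4[of "(t, x, z)" m] t unfolding v1_def by auto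
    qed
  qed
  have ts': "ts \<in> {0<..T}" using ts by auto
  obtain t x m where tT: "t \<in> {0<..T}" and m: "m \<in> P2" "integrable m psi"
    and max: "\<And>t' x' m'. t' \<in> {0<..T} \<Longrightarrow> m' \<in> P2 \<Longrightarrow> integrable m' psi \<Longrightarrow> F t' x' m' \<le> F t x m"
    by (rule penalized_max[OF v0c K(1) v1c K(2) eps \<theta>\<kappa> _ ts' ms, of F]) (auto simp: F_def W_def)
  \<comment> \<open>At the final time both solutions equal the same data, hence \<open>W\<close>
    vanishes and \<open>F\<close> is at most 0, below its positive value at
    \<open>ts\<close>.\<close>
  have t: "t \<in> {0<..<T}"
  proof -
    have "t \<noteq> T"
    proof
      assume "t = T"
      have "U01 T x m = U02 T x m" "\<And>z. U1 T x z m = U2 T x z m"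
        using me m(1) unfolding master_equations_def by simp_all
      then have "W T x m = 0" by (simp add: W_def v0_def v1_def)
      moreover have "0 \<le> \<epsilon> * P x m" "0 \<le> \<epsilon> / T" using eps P[of x m] tT \<open>t = T\<close> by auto
      ultimately have "F t x m \<le> 0" unfolding \<open>t = T\<close> F_def P_def by simp
      moreover have "F ts xs ms \<le> F t x m" by (rule max[OF ts' ms])
      ultimately show False using Fpos by simp
    qed
    with tT show ?thesis by auto
  qed
  define a1 a2 where "a1 = grad (\<lambda>x. U01 t x m) x" and "a2 = grad (\<lambda>x. U02 t x m) x"
  define p1 p2 where "p1 y = grad (\<lambda>z. U1 t x z m) y" and "p2 y = grad (\<lambda>z. U2 t x z m) y" for y
  define h1 h2 where "h1 y = grad (\<lambda>p. H x y p m) (p1 y)" and "h2 y = grad (\<lambda>p. H x y p m) (p2 y)" for y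
  define h01 h02 where "h01 = grad (\<lambda>p. H0 x p m) a1" and "h02 = grad (\<lambda>p. H0 x p m) a2"
  \<comment> \<open>The drifts of the second solution, with \<open>x\<close> and \<open>m\<close>
    frozen at the maximum. A field that depends on \<open>y\<close> alone is enough, since each test
    takes a single step from \<open>m\<close>.\<close>
  define b where "b y = - h2 y" for y
  define \<beta> where "\<beta> = - h02"
  have aR: "norm a1 \<le> R" "norm a2 \<le> R"
    using smooth_field.bounded(3)[OF f01 t m(1)] smooth_field.bounded(3)[OF f02 t m(1)] R
    unfolding a1_def a2_def by (meson order_trans)+
  have pR: "norm (p1 y) \<le> R" "norm (p2 y) \<le> R" for y
    using smooth_field.bounded(5)[OF f1 t m(1)] smooth_field.bounded(5)[OF f2 t m(1)] R
    unfolding p1_def p2_def by (meson order_trans)+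
  have hC: "norm (h1 y) \<le> CH" "norm (h2 y) \<le> CH" "\<bar>H x y (p1 y) m - H x y (p2 y) m\<bar> \<le> CH * norm (p1 y - p2 y)"
    "norm (h1 y - h2 y) \<le> CH * norm (p1 y - p2 y)" for y
    using CH(2)[OF m(1), of x y] pR[of y] unfolding Hamiltonian_bound_def h1_def h2_def by blast+
  have h0C: "norm h02 \<le> CH0" "\<bar>H0 x a1 m - H0 x a2 m\<bar> \<le> CH0 * norm (a1 - a2)"
    "norm (h01 - h02) \<le> CH0 * norm (a1 - a2)"
    using CH0(2)[OF m(1), of x] aR unfolding Hamiltonian_bound_def h01_def h02_def by blast+
  have pm: "p1 \<in> borel_measurable borel" "p2 \<in> borel_measurable borel"
    unfolding p1_def p2_def
    by (rule smooth_field.measurable_z(5)[OF f1 t m(1)] smooth_field.measurable_z(5)[OF f2 t m(1)])+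
  have hm: "h1 \<in> borel_measurable borel" "h2 \<in> borel_measurable borel"
  proof -
    have "(\<lambda>y. (\<lambda>(x0, x, p). grad (\<lambda>p. H x0 x p m) p) (x, y, q y)) \<in> borel_measurable borel"
      if "q \<in> borel_measurable borel" for q
      \<comment> \<open>Joint continuity of \<open>H_p\<close> in position and momentum turns a
        measurable field of momenta into a measurable field.\<close>
      by (rule measurable_compose[OF _ borel_measurable_continuous_onI[OF CH(3)[OF m(1)]]])
        (intro borel_measurable_Pair that, simp_all)
    from this[OF pm(1)] this[OF pm(2)]
    show "h1 \<in> borel_measurable borel" "h2 \<in> borel_measurable borel" by (simp_all add: h1_def[abs_def] h2_def[abs_def])
  qed
  have bm: "b \<in> borel_measurable borel" unfolding b_def using hm(2) by measurable
  have bB: "norm (b y) \<le> B" for y using hC(2)[of y] CH0(1) unfolding b_def B_def by simp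
  have \<beta>B: "norm \<beta> \<le> B" using h0C(1) CH(1) unfolding \<beta>_def B_def by simp
  have dpm: "(\<lambda>y. p1 y - p2 y) \<in> borel_measurable m" by (rule measurable_P2[OF m(1)]) (use pm in measurable)
  have dpR: "norm (p1 y - p2 y) \<le> 2 * R" for y using norm_triangle_ineq4[of "p1 y" "p2 y"] pR[of y] by linarith
  have dpi: "integrable m (\<lambda>y. norm (p1 y - p2 y))" "integrable m (\<lambda>y. (norm (p1 y - p2 y))\<^sup>2)"
  proof -
    show "integrable m (\<lambda>y. norm (p1 y - p2 y))"
      by (rule bounded_integrable[OF P2_D(1)[OF m(1)], where C="2 * R"]) (use dpm dpR in auto)
    show "integrable m (\<lambda>y. (norm (p1 y - p2 y))\<^sup>2)"
      by (rule bounded_integrable[OF P2_D(1)[OF m(1)], where C="(2 * R)\<^sup>2"])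
        (use dpm power_mono[OF dpR norm_ge_zero, where n=2] in auto)
  qed
  define G' where "G' = (\<integral>y. norm (p1 y - p2 y) \<partial>m)"
  have G'0: "0 \<le> G'" unfolding G'_def by (rule Bochner_Integration.integral_nonneg) simp

  interpret d0: smooth_field T "K01 + K02" "\<lambda>t x z m. U01 t x m - U02 t x m"
    "\<lambda>t x z m. deriv (\<lambda>s. U01 s x m) t - deriv (\<lambda>s. U02 s x m) t"
    "\<lambda>t x z m. grad (\<lambda>x. U01 t x m) x - grad (\<lambda>x. U02 t x m) x"
    "\<lambda>t x z m. jac (grad (\<lambda>x. U01 t x m)) x - jac (grad (\<lambda>x. U02 t x m)) x"
    "\<lambda>t x z m. 0 - 0" "\<lambda>t x z m. 0 - 0"
    "\<lambda>t x z m y. lin_deriv (U01 t x) m y - lin_deriv (U02 t x) m y"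
    "\<lambda>t x z m y. Dm (U01 t x) m y - Dm (U02 t x) m y"
    "\<lambda>t x z m y. jac (Dm (U01 t x) m) y - jac (Dm (U02 t x) m) y"
    by (rule d0)
  interpret d1: smooth_field T "K1 + K2" "\<lambda>t x z m. U1 t x z m - U2 t x z m"
    "\<lambda>t x z m. deriv (\<lambda>s. U1 s x z m) t - deriv (\<lambda>s. U2 s x z m) t"
    "\<lambda>t x z m. grad (\<lambda>x. U1 t x z m) x - grad (\<lambda>x. U2 t x z m) x"
    "\<lambda>t x z m. jac (grad (\<lambda>x. U1 t x z m)) x - jac (grad (\<lambda>x. U2 t x z m)) x"
    "\<lambda>t x z m. grad (\<lambda>z. U1 t x z m) z - grad (\<lambda>z. U2 t x z m) z"
    "\<lambda>t x z m. jac (grad (\<lambda>z. U1 t x z m)) z - jac (grad (\<lambda>z. U2 t x z m)) z"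
    "\<lambda>t x z m y. lin_deriv (U1 t x z) m y - lin_deriv (U2 t x z) m y"
    "\<lambda>t x z m y. Dm (U1 t x z) m y - Dm (U2 t x z) m y"
    "\<lambda>t x z m y. jac (Dm (U1 t x z) m) y - jac (Dm (U2 t x z) m) y"
    by (rule d1)

  have neg: "\<theta> * W t x m + (\<integral>z. d0.energy b \<beta> t x m z \<partial>m) + (\<integral>z. d1.energy b \<beta> t x m z \<partial>m) < 0"
  proof (rule max_inequality[OF d0 d1 _ F_def eps t m _ bm bB \<beta>B])
    show "W t x m = (\<integral>z. (U01 t x m - U02 t x m)\<^sup>2 \<partial>m) + (\<integral>z. (U1 t x z m - U2 t x z m)\<^sup>2 \<partial>m)" for t x m
      by (simp add: W_def v0_def v1_def)
    show "F t' x' m' \<le> F t x m" if "t' \<in> {0<..<T}" "m' \<in> P2" "integrable m' psi" for t' x' m'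
      by (rule max) (use that in auto)
  qed (simp add: \<kappa>_def)

  have int_hm: "(\<Sum>i\<in>Basis. \<integral>y. (J1 y - J2 y) i \<bullet> i \<partial>m) = (\<Sum>i\<in>Basis. \<integral>y. J1 y i \<bullet> i \<partial>m) - (\<Sum>i\<in>Basis. \<integral>y. J2 y i \<bullet> i \<partial>m)"
    if "\<And>i. i \<in> Basis \<Longrightarrow> integrable m (\<lambda>y. J1 y i \<bullet> i)" "\<And>i. i \<in> Basis \<Longrightarrow> integrable m (\<lambda>y. J2 y i \<bullet> i)"
    for J1 J2 :: "'b \<Rightarrow> 'b \<Rightarrow>\<^sub>L 'b"
    unfolding sum_subtractf[symmetric] by (intro sum.cong refl) (simp add: blinfun.diff_left inner_diff_left that)
  \<comment> \<open>The cancellation that fixes \<open>b\<close>: with \<open>b = - h2\<close> the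
    measure derivative \<open>q2\<close> of the second solution disappears. What remains is
    \<open>q1\<close>, which is bounded, against \<open>h1 - h2\<close>, which is Lipschitz in the
    difference of the momenta.\<close>
  have int_gm: "(\<integral>y. (q1 y - q2 y) \<bullet> b y \<partial>m) + (\<integral>y. q1 y \<bullet> h1 y \<partial>m) - (\<integral>y. q2 y \<bullet> h2 y \<partial>m) = (\<integral>y. q1 y \<bullet> (h1 y - h2 y) \<partial>m)"
    if "integrable m (\<lambda>y. q1 y \<bullet> h1 y)" "integrable m (\<lambda>y. q1 y \<bullet> h2 y)" "integrable m (\<lambda>y. q2 y \<bullet> h2 y)" for q1 q2
    using that by (simp add: b_def inner_diff_left inner_diff_right)

  note L0 = smooth_field.laplacian_x[OF f01 t m(1)] smooth_field.laplacian_x[OF f02 t m(1)]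
  note V0 = smooth_field.divergence_y[OF f01 t m(1)] smooth_field.divergence_y[OF f02 t m(1)]
  have eq0: "deriv (\<lambda>s. U01 s x m) t + (\<Sum>i\<in>Basis. jac (grad (\<lambda>x. U01 t x m)) x i \<bullet> i)
      + (\<Sum>i\<in>Basis. \<integral>y. jac (Dm (U01 t x) m) y i \<bullet> i \<partial>m) = H0 x a1 m + (\<integral>y. Dm (U01 t x) m y \<bullet> h1 y \<partial>m)"
    "deriv (\<lambda>s. U02 s x m) t + (\<Sum>i\<in>Basis. jac (grad (\<lambda>x. U02 t x m)) x i \<bullet> i)
      + (\<Sum>i\<in>Basis. \<integral>y. jac (Dm (U02 t x) m) y i \<bullet> i \<partial>m) = H0 x a2 m + (\<integral>y. Dm (U02 t x) m y \<bullet> h2 y \<partial>m)"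
    unfolding L0[symmetric] V0[symmetric] a1_def a2_def h1_def h2_def p1_def p2_def
    by (rule master_equationsD(1)[OF me(1) t m(1)] master_equationsD(1)[OF me(2) t m(1)])+
  \<comment> \<open>The equations eliminate the time derivative, the Laplacian and the divergence
    term; only quantities controlled by differences of first derivatives are left.\<close>
  have gen0: "d0.gen b \<beta> t x m z = H0 x a1 m - H0 x a2 m + (a1 - a2) \<bullet> \<beta> + (\<integral>y. Dm (U01 t x) m y \<bullet> (h1 y - h2 y) \<partial>m)" for z
  proof -
    note i1 = smooth_field.integrable_y[OF f01 t m(1)] and i2 = smooth_field.integrable_y[OF f02 t m(1)]
    have 1: "(\<Sum>i\<in>Basis. (jac (grad (\<lambda>x. U01 t x m)) x - jac (grad (\<lambda>x. U02 t x m)) x) i \<bullet> i) =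
      (\<Sum>i\<in>Basis. jac (grad (\<lambda>x. U01 t x m)) x i \<bullet> i) - (\<Sum>i\<in>Basis. jac (grad (\<lambda>x. U02 t x m)) x i \<bullet> i)"
      by (simp add: blinfun.diff_left inner_diff_left sum_subtractf)
    have 2: "(\<Sum>i\<in>Basis. \<integral>y. (jac (Dm (U01 t x) m) y - jac (Dm (U02 t x) m) y) i \<bullet> i \<partial>m) =
      (\<Sum>i\<in>Basis. \<integral>y. jac (Dm (U01 t x) m) y i \<bullet> i \<partial>m) - (\<Sum>i\<in>Basis. \<integral>y. jac (Dm (U02 t x) m) y i \<bullet> i \<partial>m)"
      by (rule int_hm) (rule i1(1) i2(1), assumption)+
    note 3 = int_gm[OF i1(2)[OF hm(1) hC(1)] i1(2)[OF hm(2) hC(2)] i2(2)[OF hm(2) hC(2)]]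
    show ?thesis
      unfolding d0.gen_def 1 2 using 3[of x x] eq0 by (simp add: a1_def[symmetric] a2_def[symmetric])
  qed

  note L1 = smooth_field.laplacian_x[OF f1 t m(1)] smooth_field.laplacian_x[OF f2 t m(1)]
    smooth_field.laplacian_z[OF f1 t m(1)] smooth_field.laplacian_z[OF f2 t m(1)]
  note V1 = smooth_field.divergence_y[OF f1 t m(1)] smooth_field.divergence_y[OF f2 t m(1)]
  have eq1: "deriv (\<lambda>s. U1 s x z m) t + (\<Sum>i\<in>Basis. jac (grad (\<lambda>x. U1 t x z m)) x i \<bullet> i)
      + (\<Sum>i\<in>Basis. jac (grad (\<lambda>z. U1 t x z m)) z i \<bullet> i) + (\<Sum>i\<in>Basis. \<integral>y. jac (Dm (U1 t x z) m) y i \<bullet> i \<partial>m)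
      = H x z (p1 z) m + grad (\<lambda>x. U1 t x z m) x \<bullet> h01 + (\<integral>y. Dm (U1 t x z) m y \<bullet> h1 y \<partial>m)"
    "deriv (\<lambda>s. U2 s x z m) t + (\<Sum>i\<in>Basis. jac (grad (\<lambda>x. U2 t x z m)) x i \<bullet> i)
      + (\<Sum>i\<in>Basis. jac (grad (\<lambda>z. U2 t x z m)) z i \<bullet> i) + (\<Sum>i\<in>Basis. \<integral>y. jac (Dm (U2 t x z) m) y i \<bullet> i \<partial>m)
      = H x z (p2 z) m + grad (\<lambda>x. U2 t x z m) x \<bullet> h02 + (\<integral>y. Dm (U2 t x z) m y \<bullet> h2 y \<partial>m)" for z
    unfolding L1[symmetric] V1[symmetric] a1_def a2_def h1_def h2_def p1_def p2_def h01_def h02_def a1_def a2_def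
    by (rule master_equationsD(2)[OF me(1) t m(1)] master_equationsD(2)[OF me(2) t m(1)])+
  have gen1: "d1.gen b \<beta> t x m z = H x z (p1 z) m - H x z (p2 z) m + grad (\<lambda>x. U1 t x z m) x \<bullet> (h01 - h02)
     + (p1 z - p2 z) \<bullet> b z + (\<integral>y. Dm (U1 t x z) m y \<bullet> (h1 y - h2 y) \<partial>m)" for z
  proof -
    note i1 = smooth_field.integrable_y[OF f1 t m(1)] and i2 = smooth_field.integrable_y[OF f2 t m(1)]
    have 1: "(\<Sum>i\<in>Basis. (J1 - J2) i \<bullet> i) = (\<Sum>i\<in>Basis. J1 i \<bullet> i) - (\<Sum>i\<in>Basis. J2 i \<bullet> i)"
      for J1 J2 :: "'e::euclidean_space \<Rightarrow>\<^sub>L 'e"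
      by (simp add: blinfun.diff_left inner_diff_left sum_subtractf)
    have 2: "(\<Sum>i\<in>Basis. \<integral>y. (jac (Dm (U1 t x z) m) y - jac (Dm (U2 t x z) m) y) i \<bullet> i \<partial>m) =
      (\<Sum>i\<in>Basis. \<integral>y. jac (Dm (U1 t x z) m) y i \<bullet> i \<partial>m) - (\<Sum>i\<in>Basis. \<integral>y. jac (Dm (U2 t x z) m) y i \<bullet> i \<partial>m)"
      by (rule int_hm) (rule i1(1) i2(1), assumption)+
    note 3 = int_gm[OF i1(2)[OF hm(1) hC(1)] i1(2)[OF hm(2) hC(2)] i2(2)[OF hm(2) hC(2)]]
    \<comment> \<open>The same cancellation for the common noise variable:
      \<open>\<beta> = - h02\<close> leaves the bounded gradient of the first solution against
      \<open>h01 - h02\<close>.\<close>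
    have 4: "grad (\<lambda>x. U1 t x z m) x \<bullet> (h01 - h02) = (grad (\<lambda>x. U1 t x z m) x - grad (\<lambda>x. U2 t x z m) x) \<bullet> \<beta>
       + grad (\<lambda>x. U1 t x z m) x \<bullet> h01 - grad (\<lambda>x. U2 t x z m) x \<bullet> h02"
      by (simp add: \<beta>_def inner_diff_left inner_diff_right)
    show ?thesis
      unfolding d1.gen_def 1 2 4 using 3[of x z x z] eq1[of z]
      by (simp add: p1_def[symmetric] p2_def[symmetric])
  qed

  let ?g = "norm (a1 - a2)"
  have gen0_le: "\<bar>d0.gen b \<beta> t x m z\<bar> \<le> A * (?g + G')" for z
  proof -
    have s1: "\<bar>(a1 - a2) \<bullet> \<beta>\<bar> \<le> ?g * CH0"
      using Cauchy_Schwarz_ineq2[of "a1 - a2" \<beta>] h0C(1) mult_left_mono[of "norm \<beta>" CH0 ?g] by (simp add: \<beta>_def)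
    have s2: "\<bar>\<integral>y. Dm (U01 t x) m y \<bullet> (h1 y - h2 y) \<partial>m\<bar> \<le> R * CH * G'"
      unfolding G'_def
    proof (rule coupling_bound[OF m(1) _ _ _ hC(4) dpi(1)])
      show "Dm (U01 t x) m \<in> borel_measurable borel" by (rule smooth_field.measurable_y(1)[OF f01 t m(1)])
      show "norm (Dm (U01 t x) m y) \<le> R" for y using smooth_field.bounded(7)[OF f01 t m(1)] R(2) by (rule order_trans)
      show "(\<lambda>y. h1 y - h2 y) \<in> borel_measurable borel" using hm by measurable
    qed
    have "\<bar>d0.gen b \<beta> t x m z\<bar> \<le> CH0 * ?g + ?g * CH0 + R * CH * G'"
      unfolding gen0 by (intro order_trans[OF abs_triangle_ineq] add_mono h0C(2) s1 s2)
    also have "\<dots> = 2 * CH0 * ?g + R * CH * G'" by simp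
    also have "\<dots> \<le> A * ?g + A * G'"
      using CH(1) CH0(1) R(1) G'0 unfolding A_def by (intro add_mono mult_right_mono) auto
    finally show ?thesis by (simp add: distrib_left)
  qed
  have gen1_le: "\<bar>d1.gen b \<beta> t x m z\<bar> \<le> A * (?g + norm (p1 z - p2 z) + G')" for z
  proof -
    have s1: "\<bar>(p1 z - p2 z) \<bullet> b z\<bar> \<le> norm (p1 z - p2 z) * CH"
      using Cauchy_Schwarz_ineq2[of "p1 z - p2 z" "b z"] hC(2)[of z] mult_left_mono[of "norm (b z)" CH "norm (p1 z - p2 z)"]
      by (simp add: b_def)
    have s2: "\<bar>\<integral>y. Dm (U1 t x z) m y \<bullet> (h1 y - h2 y) \<partial>m\<bar> \<le> R * CH * G'"
      unfolding G'_def
    proof (rule coupling_bound[OF m(1) _ _ _ hC(4) dpi(1)])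
      show "Dm (U1 t x z) m \<in> borel_measurable borel" by (rule smooth_field.measurable_y(1)[OF f1 t m(1)])
      show "norm (Dm (U1 t x z) m y) \<le> R" for y using smooth_field.bounded(7)[OF f1 t m(1)] R(4) by (rule order_trans)
      show "(\<lambda>y. h1 y - h2 y) \<in> borel_measurable borel" using hm by measurable
    qed
    have s3: "\<bar>grad (\<lambda>x. U1 t x z m) x \<bullet> (h01 - h02)\<bar> \<le> R * (CH0 * ?g)"
    proof (rule order_trans[OF Cauchy_Schwarz_ineq2], rule mult_mono[OF _ h0C(3)])
      show "norm (grad (\<lambda>x. U1 t x z m) x) \<le> R"
        using smooth_field.bounded(3)[OF f1 t m(1)] R(4) by (rule order_trans)
    qed (use R(1) in auto)
    have "\<bar>d1.gen b \<beta> t x m z\<bar> \<le> CH * norm (p1 z - p2 z) + R * (CH0 * ?g) + norm (p1 z - p2 z) * CH + R * CH * G'"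
      unfolding gen1 by (intro order_trans[OF abs_triangle_ineq] add_mono hC(3) s1 s2 s3)
    also have "\<dots> = R * CH0 * ?g + 2 * CH * norm (p1 z - p2 z) + R * CH * G'" by simp
    also have "\<dots> \<le> A * ?g + A * norm (p1 z - p2 z) + A * G'"
      using CH(1) CH0(1) R(1) G'0 unfolding A_def by (intro add_mono mult_right_mono) auto
    finally show ?thesis by (simp add: distrib_left)
  qed

  \<comment> \<open>\<open>e0\<close> keeps only the \<open>x\<close>-gradient of the first
    difference and \<open>e1\<close> only the \<open>z\<close>-gradient of the second. The
    \<open>x\<close>-gradient square in \<open>d1.energy\<close> is nonnegative and is
    discarded.\<close>
  have "0 \<le> 5 * A\<^sup>2 * ((U01 t x m - U02 t x m)\<^sup>2 + (\<integral>z. (U1 t x z m - U2 t x z m)\<^sup>2 \<partial>m))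
     + (\<integral>z. d0.energy b \<beta> t x m z \<partial>m) + (\<integral>z. d1.energy b \<beta> t x m z \<partial>m)"
  proof (rule energy_lower_bound[OF m(1) A norm_ge_zero _ _ _ dpi norm_ge_zero G'_def])
    show "integrable m (d0.energy b \<beta> t x m)" by (rule d0.energy_split(1)[OF t m(1) bm bB])
    show "integrable m (d1.energy b \<beta> t x m)" by (rule d1.energy_split(1)[OF t m(1) bm bB])
    show "integrable m (\<lambda>z. (U1 t x z m - U2 t x z m)\<^sup>2)"
      by (rule d1.square_integrable[OF t m(1) m(1), of "\<lambda>z. z"]) simp
    show "2 * (U01 t x m - U02 t x m) * d0.gen b \<beta> t x m z + 2 * (norm (a1 - a2))\<^sup>2 \<le> d0.energy b \<beta> t x m z" for z
      unfolding d0.energy_def a1_def a2_def by simp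
    show "2 * (U1 t x z m - U2 t x z m) * d1.gen b \<beta> t x m z + 2 * (norm (p1 z - p2 z))\<^sup>2 \<le> d1.energy b \<beta> t x m z" for z
      unfolding d1.energy_def p1_def p2_def by simp
  qed (rule gen0_le gen1_le)+
  moreover have "W t x m = (U01 t x m - U02 t x m)\<^sup>2 + (\<integral>z. (U1 t x z m - U2 t x z m)\<^sup>2 \<partial>m)"
    using prob_space.prob_space[OF P2_D(1)[OF m(1)]] by (simp add: W_def v0_def v1_def)
  ultimately show False using neg unfolding \<theta>_def by simp
qed

text \<open>Both integrals in \<open>master_difference_zero\<close> are nonnegative, so each
  vanishes whenever \<open>psi\<close> is integrable; \<open>zero_everywhere\<close> then removes
  the integral and the moment condition. The first difference is treated as a field constant in
  \<open>z\<close>.\<close>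

lemma solutions_agree_interior:
  fixes H :: "'a::euclidean_space \<Rightarrow> 'b::euclidean_space \<Rightarrow> 'b \<Rightarrow> 'b measure \<Rightarrow> real"
  assumes n: "n \<ge> 4" and H: "assumption_H n C0 \<gamma> H" and H0: "assumption_H0 n C0 \<gamma> H0"
    and sol1: "classical_solution T H G H0 G0 U01 U1" and sol2: "classical_solution T H G H0 G0 U02 U2"
    and t: "t \<in> {0<..<T}" and m: "m \<in> P2"
  shows "U01 t x m = U02 t x m" "U1 t x z m = U2 t x z m"
proof -
  have reg: "regular_U0 T U01" "regular_U T U1" "regular_U0 T U02" "regular_U T U2"
    using sol1 sol2 unfolding classical_solution_def by auto
  have nonneg: "0 \<le> (\<integral>z. (f z)\<^sup>2 \<partial>\<mu>)" for f :: "'b \<Rightarrow> real" and \<mu>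
    by (rule Bochner_Integration.integral_nonneg) simp
  have zero: "(\<integral>z. (U01 t x \<mu> - U02 t x \<mu>)\<^sup>2 \<partial>\<mu>) = 0" "(\<integral>z. (U1 t x z \<mu> - U2 t x z \<mu>)\<^sup>2 \<partial>\<mu>) = 0"
    if "\<mu> \<in> P2" "integrable \<mu> psi" for \<mu>
    using master_difference_zero[OF n H H0 sol1 sol2 t that, of x] nonneg[where f="\<lambda>z. U01 t x \<mu> - U02 t x \<mu>" and \<mu>=\<mu>]
      nonneg[where f="\<lambda>z. U1 t x z \<mu> - U2 t x z \<mu>" and \<mu>=\<mu>] by linarith+
  show "U01 t x m = U02 t x m"
  proof (rule regular_U0_smooth[OF reg(1)], rule regular_U0_smooth[OF reg(3)])
    fix K K'
    assume f: "smooth_field T K (\<lambda>t x (z::'b) m. U01 t x m) (\<lambda>t x z m. deriv (\<lambda>s. U01 s x m) t)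
      (\<lambda>t x z m. grad (\<lambda>x. U01 t x m) x) (\<lambda>t x z m. jac (grad (\<lambda>x. U01 t x m)) x) (\<lambda>t x z m. 0) (\<lambda>t x z m. 0)
      (\<lambda>t x z. lin_deriv (U01 t x)) (\<lambda>t x z. Dm (U01 t x)) (\<lambda>t x z m. jac (Dm (U01 t x) m))"
      "smooth_field T K' (\<lambda>t x (z::'b) m. U02 t x m) (\<lambda>t x z m. deriv (\<lambda>s. U02 s x m) t)
      (\<lambda>t x z m. grad (\<lambda>x. U02 t x m) x) (\<lambda>t x z m. jac (grad (\<lambda>x. U02 t x m)) x) (\<lambda>t x z m. 0) (\<lambda>t x z m. 0)
      (\<lambda>t x z. lin_deriv (U02 t x)) (\<lambda>t x z. Dm (U02 t x)) (\<lambda>t x z m. jac (Dm (U02 t x) m))"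
    note d = smooth_field_diff[OF f]
    have "U01 t x m - U02 t x m = 0"
      by (rule zero_everywhere[OF smooth_field.slice_z(1)[OF d t] smooth_field.bounded(1)[OF d t] zero(1) m])
    then show ?thesis by simp
  qed
  show "U1 t x z m = U2 t x z m"
  proof (rule regular_U_smooth[OF reg(2)], rule regular_U_smooth[OF reg(4)])
    fix K K'
    assume f: "smooth_field T K U1 (\<lambda>t x z m. deriv (\<lambda>s. U1 s x z m) t)
      (\<lambda>t x z m. grad (\<lambda>x. U1 t x z m) x) (\<lambda>t x z m. jac (grad (\<lambda>x. U1 t x z m)) x)
      (\<lambda>t x z m. grad (\<lambda>z. U1 t x z m) z) (\<lambda>t x z m. jac (grad (\<lambda>z. U1 t x z m)) z)
      (\<lambda>t x z. lin_deriv (U1 t x z)) (\<lambda>t x z. Dm (U1 t x z)) (\<lambda>t x z m. jac (Dm (U1 t x z) m))"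
      "smooth_field T K' U2 (\<lambda>t x z m. deriv (\<lambda>s. U2 s x z m) t)
      (\<lambda>t x z m. grad (\<lambda>x. U2 t x z m) x) (\<lambda>t x z m. jac (grad (\<lambda>x. U2 t x z m)) x)
      (\<lambda>t x z m. grad (\<lambda>z. U2 t x z m) z) (\<lambda>t x z m. jac (grad (\<lambda>z. U2 t x z m)) z)
      (\<lambda>t x z. lin_deriv (U2 t x z)) (\<lambda>t x z. Dm (U2 t x z)) (\<lambda>t x z m. jac (Dm (U2 t x z) m))"
    note d = smooth_field_diff[OF f]
    have "U1 t x z m - U2 t x z m = 0"
      by (rule zero_everywhere[OF smooth_field.slice_z(1)[OF d t] smooth_field.bounded(1)[OF d t] zero(2) m])
    then show ?thesis by simp
  qed
qed

theorem theorem4p9: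
  fixes T C0 \<gamma> :: real and n :: nat
    and H :: "'a::euclidean_space \<Rightarrow> 'b::euclidean_space \<Rightarrow> 'b \<Rightarrow> 'b measure \<Rightarrow> real"
    and G :: "'a \<Rightarrow> 'b \<Rightarrow> 'b measure \<Rightarrow> real"
    and H0 :: "'a \<Rightarrow> 'a \<Rightarrow> 'b measure \<Rightarrow> real"
    and G0 :: "'a \<Rightarrow> 'b measure \<Rightarrow> real"
    and U01 U02 :: "real \<Rightarrow> 'a \<Rightarrow> 'b measure \<Rightarrow> real"
    and U1 U2 :: "real \<Rightarrow> 'a \<Rightarrow> 'b \<Rightarrow> 'b measure \<Rightarrow> real"
  assumes "T > 0" and "n \<ge> 4" and "C0 > 0" and "\<gamma> > 1"
    and "assumption_H n C0 \<gamma> H" and "assumption_G n G"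
    and "assumption_H0 n C0 \<gamma> H0" and "assumption_G0 n G0"
    and "classical_solution T H G H0 G0 U01 U1"
    and "classical_solution T H G H0 G0 U02 U2"
    and "lipschitz_space_measure T (\<lambda>t x0 m. grad (\<lambda>x0. U01 t x0 m) x0)"
    and "lipschitz_space_measure T
           (\<lambda>t (x0, x) m. (grad (\<lambda>x0. U1 t x0 x m) x0, grad (\<lambda>x. U1 t x0 x m) x))"
  shows "\<forall>t\<in>{0..T}. \<forall>x0. \<forall>m\<in>P2.
           U01 t x0 m = U02 t x0 m \<and> (\<forall>x. U1 t x0 x m = U2 t x0 x m)"
proof (intro ballI allI conjI)
  fix t x0 and m :: "'b measure" and x
  assume t: "t \<in> {0..T}" and m: "m \<in> P2"
  note interior = solutions_agree_interior[OF assms(2,5,7,9,10) _ m]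
  \<comment> \<open>The equations hold on the open interval only, so agreement at time 0 is a limit
    of interior times. The index \<open>k + 1\<close> avoids \<open>hs 0 = 1\<close>, which would
    give the time \<open>T\<close>.\<close>
  define s where "s k = T * hs (k + 1)" for k
  have s: "s k \<in> {0<..<T}" for k
  proof -
    have "hs (k + 1) < 1" by (simp add: hs_def)
    then have "T * hs (k + 1) < T * 1" using assms(1) by (intro mult_strict_left_mono)
    then show ?thesis using assms(1) hs(1)[of "k + 1"] by (simp add: s_def)
  qed
  have s0: "s \<longlonglongrightarrow> 0"
    using tendsto_mult_right_zero[OF LIMSEQ_ignore_initial_segment[OF hs(3), of 1], of T] by (simp add: s_def[abs_def])
  have sc: "s k \<in> {0..T}" "0 \<in> {0..T}" for k using s[of k] assms(1) by auto
  have d: "(\<lambda>k::nat. d2 m m) \<longlonglongrightarrow> 0" by (simp add: d2_self[OF m])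
  have cont: "(\<lambda>k. U0 (s k) x0 m) \<longlonglongrightarrow> U0 0 x0 m" if "classical_solution T H G H0 G0 U0 U" for U0 U
  proof -
    have "continuous_P2 ({0..T} \<times> UNIV) (\<lambda>(t, x0) m. U0 t x0 m)"
      using that unfolding classical_solution_def regular_U0_def Let_def by blast
    from continuous_P2_seq[OF this _ _ tendsto_Pair[OF s0 tendsto_const[of x0]] m m d] sc
    show ?thesis by simp
  qed
  have cont': "(\<lambda>k. U (s k) x0 x m) \<longlonglongrightarrow> U 0 x0 x m" if "classical_solution T H G H0 G0 U0 U" for U0 U
  proof -
    have "continuous_P2 ({0..T} \<times> UNIV \<times> UNIV) (\<lambda>(t, x0, x) m. U t x0 x m)"
      using that unfolding classical_solution_def regular_U_def Let_def by blast
    from continuous_P2_seq[OF this _ _ tendsto_Pair[OF s0 tendsto_const[of "(x0, x)"]] m m d] sc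
    show ?thesis by simp
  qed
  \<comment> \<open>On the interior times the sequence of the second solution is that of the first,
    so continuity up to time 0 gives equal limits.\<close>
  have initial: "U01 0 x0 m = U02 0 x0 m" "U1 0 x0 x m = U2 0 x0 x m"
  proof -
    show "U01 0 x0 m = U02 0 x0 m"
      using LIMSEQ_unique[OF cont[OF assms(9)] cont[OF assms(10), folded interior(1)[OF s]]] .
    show "U1 0 x0 x m = U2 0 x0 x m"
      using LIMSEQ_unique[OF cont'[OF assms(9)] cont'[OF assms(10), folded interior(2)[OF s]]] .
  qed
  have final: "U01 T x0 m = U02 T x0 m" "U1 T x0 x m = U2 T x0 x m"
    using assms(9,10) m unfolding classical_solution_def master_equations_def by simp_all
  from t consider "t = 0" | "t = T" | "t \<in> {0<..<T}" by fastforce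
  then show "U01 t x0 m = U02 t x0 m" "U1 t x0 x m = U2 t x0 x m"
    by (cases; use initial final interior in simp)+
qed

end
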